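(* Let $j$ be a QS flow on $\mathsf A$. For all $F\in B(\widehat{\mathsf k})\,\overline\otimes\,\mathsf A$ the QS differential equation $$Y_0=I_{\mathfrak h\otimes\mathcal F},\qquad dY_t=\widetilde\jmath_t(F)\widetilde Y_t\,d\Lambda_t$$ has a unique strong solution. This solution is such that $Y_sE_\varepsilon\in\mathsf A\,\overline\otimes\,|\mathcal F\rangle$ for all $s\in\mathbb R_+$ and $\varepsilon\in\mathcal E$, and $$\sup_{0\le r<t\le T}(t-r)^{-1/2}\|(Y_t-Y_r)E_\varepsilon\|<\infty\qquad(\varepsilon\in\mathcal E,\ T>0).$$ If either $Y$ is bounded with locally uniform bounds and $\mathfrak h$ and $\mathsf k$ are separable, or $Y$ is coisometric, it also satisfies the condition $$\sup_{0\le r<t\le T}(t-r)^{-1/2}\|(Y_t^*-Y_r^* )E_\varepsilon\|<\infty\qquad(\varepsilon\in\mathcal E,\ T>0).$$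
   Context: All Hilbert spaces are complex, with inner products linear in the second argument. $\mathsf A$ is a von Neumann algebra acting faithfully on a Hilbert space $\mathfrak h$; $\mathsf k$ is a Hilbert space and $\widehat{\mathsf k}:=\mathbb C\oplus\mathsf k$; $\widehat c:=(1,c)$ for $c\in\mathsf k$, $\widehat f(s):=\widehat{f(s)}$. $\underline\otimes$ and $\overline\otimes$ denote algebraic and ultraweak tensor products. $|\mathcal F\rangle:=B(\mathbb C;\mathcal F)$. $\Delta:=\begin{bmatrix}0&0\\0&I_{\mathsf k}\end{bmatrix}\in B(\widehat{\mathsf k})$, $\Delta^\perp:=I-\Delta$; their ampliations are denoted in the same way. Fock space: for a subinterval $J$ of $\mathbb R_+$, $\mathcal F_J$ is the symmetric Fock space over $L^2(J;\mathsf k)$, $\mathsf N_J:=B(\mathcal F_J)$, $I_J$ is the identity on $\mathcal F_J$; subscripts are omitted for $J=\mathbb R_+$; $\mathcal F=\mathcal F_{[0,t[}\otimes\mathcal F_{[t,\infty[}$. $\mathbb S$ is the space of right-continuous step functions in $L^2(\mathbb R_+;\mathsf k)$; $f_J$ equals $f$ on $J$ and $0$ elsewhere; $\varpi(f):=e^{-\|f\|^2/2}\big((n!)^{-1/2}f^{\otimes n}\big)_{n\ge0}$; $\mathcal E$ is the linear span of $\{\varpi(f):f\in\mathbb S\}$. $E_u$ denotes $|u\rangle$ tensored with identity operators (e.g. for $\varepsilon\in\mathcal E$, $E_\varepsilon:\mathfrak h\to\mathfrak h\otimes\mathcal F$, $v\mapsto v\otimes\varepsilon$) and $E^u:=(E_u)^*$.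 Processes: an (operator) process on $\mathfrak h$ is a family $X=(X_t)_{t\ge0}$ of (possibly unbounded) operators on $\mathfrak h\otimes\mathcal F$ with domain $\mathfrak h\underline\otimes\mathcal E$ that is weakly measurable in $t$ and adapted: $E^{\varpi(f)}X_tE_{\varpi(g)}=\langle\varpi(f_{[t,\infty[}),\varpi(g_{[t,\infty[})\rangle E^{\varpi(f_{[0,t[})}X_tE_{\varpi(g_{[0,t[})}$ for $f,g\in\mathbb S$; it is a process in $\mathsf A$ if $E^{\varpi(f)}X_tE_{\varpi(g)}\in\mathsf A$ for all $f,g,t$, and is bounded if each $X_t$ is bounded (then identified with its extension to $\mathfrak h\otimes\mathcal F$); it has locally uniform bounds if $\sup_{t\le T}\|X_t\|<\infty$ for all $T$, and is coisometric if each $X_t$ is. A (mapping) process on $\mathsf A$ is a family $k=(k_t)_{t\ge0}$ of linear maps on $\mathsf A$ with $(k_t(a))_{t\ge0}$ a process in $\mathsf A$ for each $a$. If $k$ is normal and completely bounded (i.e. each $k_t$ is), then $k_r(a)=k_{r)}(a)\otimes I_{[r,\infty[}$ with $k_{r)}:\mathsf A\to\mathsf A\overline\otimes\mathsf N_{[0,r[}$; put $\widehat k_r:=k_{r)}\overline\otimes\operatorname{id}_{\mathsf N_{[r,\infty[}}$ and $\widetilde k_t:=\operatorname{id}_{B(\widehat{\mathsf k})}\overline\otimes k_t$. Let $T_r:\mathcal F\to\mathcal F_{[r,\infty[}$ be the unitary with $\varpi(f)\mapsto\varpi(f_r)$, $f_r(s)=f(s-r)$, and $\sigma_r:\mathsf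 A\overline\otimes\mathsf N\to\mathsf A\overline\otimes\mathsf N_{[r,\infty[}$ the normal *-isomorphism with $a\otimes z\mapsto a\otimes T_rzT_r^*$. $k$ is a QS cocycle if $k_0(a)=a\otimes I_{\mathcal F}$ and $k_{r+t}=\widehat k_r\circ\sigma_r\circ k_t$ for all $r,t\ge0$; it is a QS flow if moreover it is pointwise ultraweakly continuous in $t$, *-homomorphic and unital. QS integrals: for an operator process $X$, $\widetilde X_t:=I_{\widehat{\mathsf k}}\underline\otimes X_t$. $\widehat\nabla_s$ is the linear operator with domain $\mathfrak h\underline\otimes\mathcal E$, $\widehat\nabla_s(u\varpi(f))=\widehat f(s)u\varpi(f)$. A family $G=(G_t)_{t\ge0}$ of operators on $\widehat{\mathsf k}\otimes\mathfrak h\otimes\mathcal F$ is QS integrable if, for all $\zeta\in\mathfrak h\underline\otimes\mathcal E$: $\widehat\nabla_t\zeta\in\operatorname{Dom}G_t$ for all $t$; $s\mapsto\Delta^\perp G_s\widehat\nabla_s\zeta$ is locally integrable; $s\mapsto\Delta G_s\widehat\nabla_s\zeta$ is locally square-integrable; and $E^{\varpi(f)}G_t\widehat\nabla_tE_{\varpi(g)}=\langle\varpi(f_{[t,\infty[}),\varpi(g_{[t,\infty[})\rangle E^{\widehat f(t)\varpi(f_{[0,t[})}G_tE_{\widehat g(t)\varpi(g_{[0,t[})}$ for $f,g\in\mathbb S$. Its QS integral is the continuous operator process determined by $\langle\zeta',\int_0^tG_s\,d\Lambda_s\,\zeta\rangle=\int_0^t\langle\widehat\nabla_s\zeta',G_s\widehat\nabla_s\zeta\rangle\,ds$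 for $\zeta,\zeta'\in\mathfrak h\underline\otimes\mathcal E$. A strong solution of $Y_0=I$, $dY_t=\widetilde\jmath_t(F)\widetilde Y_t\,d\Lambda_t$ is an operator process $Y$ such that $(\widetilde\jmath_t(F)\widetilde Y_t)_{t\ge0}$ is QS integrable and $Y_t=I+\int_0^t\widetilde\jmath_s(F)\widetilde Y_s\,d\Lambda_s$ for all $t\ge0$. *)

theory Defs
  imports "HOL-Analysis.Analysis" "HOL-Library.Multiset"
begin

section \<open>Complex Hilbert spaces\<close>

class cinner_space = real_vector +
  fixes scaleC :: "complex \<Rightarrow> 'a \<Rightarrow> 'a"  (infixr "*\<^sub>C" 75)
    and cinner :: "'a \<Rightarrow> 'a \<Rightarrow> complex"
  assumes scaleC_add_right: "c *\<^sub>C (x + y) = c *\<^sub>C x + c *\<^sub>C y"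
    and scaleC_add_left: "(b + c) *\<^sub>C x = b *\<^sub>C x + c *\<^sub>C x"
    and scaleC_scaleC: "b *\<^sub>C (c *\<^sub>C x) = (b * c) *\<^sub>C x"
    and scaleR_scaleC: "r *\<^sub>R x = complex_of_real r *\<^sub>C x"
    and cinner_commute: "cinner x y = cnj (cinner y x)"
    and cinner_add_right: "cinner x (y + z) = cinner x y + cinner x z"
    and cinner_scaleC_right: "cinner x (c *\<^sub>C y) = c * cinner x y"
    and cinner_ge_zero: "0 \<le> Re (cinner x x)"
    and cinner_eq_zero: "cinner x x = 0 \<Longrightarrow> x = 0"

class chilbert_space = cinner_space + banach +
  assumes norm_cinner: "norm x = sqrt (Re (cinner x x))"

lemma cinner_add_left: "cinner (x + y) z = cinner x z + cinner y z"
  for x y z :: "'a::cinner_space"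
  by (metis cinner_add_right cinner_commute complex_cnj_add)

lemma cinner_scaleC_left: "cinner (c *\<^sub>C x) y = cnj c * cinner x y"
  for x y :: "'a::cinner_space"
  by (metis cinner_commute cinner_scaleC_right complex_cnj_mult)

lemma scaleC_zero_left [simp]: "0 *\<^sub>C x = 0" for x :: "'a::cinner_space"
  by (metis of_real_0 scaleR_scaleC scaleR_zero_left)

lemma scaleC_one [simp]: "1 *\<^sub>C x = x" for x :: "'a::cinner_space"
  by (metis of_real_1 scaleR_scaleC scaleR_one)

lemma scaleC_minus1: "(-1) *\<^sub>C x = - x" for x :: "'a::cinner_space"
  by (metis of_real_1 of_real_minus scaleR_scaleC scaleR_minus1_left)

lemma scaleC_zero_right [simp]: "c *\<^sub>C 0 = (0::'a::cinner_space)"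
  by (metis add_cancel_right_left scaleC_add_right)

lemma cinner_zero_right [simp]: "cinner x 0 = 0" for x :: "'a::cinner_space"
  by (metis add_cancel_right_left cinner_add_right)

lemma cinner_zero_left [simp]: "cinner 0 x = 0" for x :: "'a::cinner_space"
  by (metis cinner_commute cinner_zero_right complex_cnj_zero)

lemma cinner_minus_right: "cinner x (- y) = - cinner x y" for x :: "'a::cinner_space"
  by (metis cinner_scaleC_right mult_minus1 scaleC_minus1)

lemma cinner_minus_left: "cinner (- x) y = - cinner x y" for x :: "'a::cinner_space"
  by (metis cinner_commute cinner_minus_right complex_cnj_minus)

lemma cinner_diff_right: "cinner x (y - z) = cinner x y - cinner x z" for x :: "'a::cinner_space"
  using cinner_add_right[of x y "-z"] by (simp add: cinner_minus_right)

lemma cinner_diff_left: "cinner (x - y) z = cinner x z - cinner y z" for x :: "'a::cinner_space"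
  using cinner_add_left[of x "-y" z] by (simp add: cinner_minus_left)

lemma cinner_sum_right: "cinner x (\<Sum>i\<in>I. f i) = (\<Sum>i\<in>I. cinner x (f i))" for x :: "'a::cinner_space"
  by (induction I rule: infinite_finite_induct) (auto simp: cinner_add_right)

lemma cinner_sum_left: "cinner (\<Sum>i\<in>I. f i) x = (\<Sum>i\<in>I. cinner (f i) x)" for x :: "'a::cinner_space"
  by (induction I rule: infinite_finite_induct) (auto simp: cinner_add_left)

lemma Im_cinner_self [simp]: "Im (cinner x x) = 0" for x :: "'a::cinner_space"
  by (metis add.inverse_neutral cinner_commute complex_cnj_cancel_iff complex.sel(2) cnj.simps(2) equal_neg_zero)

lemma cinner_self_real: "cinner x x = complex_of_real (Re (cinner x x))" for x :: "'a::cinner_space"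
  by (simp add: complex_eq_iff)

lemma cinner_Cauchy_Schwarz:
  "cmod (cinner x y) \<le> sqrt (Re (cinner x x)) * sqrt (Re (cinner y y))" for x y :: "'a::cinner_space"
proof (cases "cinner y y = 0")
  case True
  then have "y = 0" by (rule cinner_eq_zero)
  then show ?thesis by simp
next
  case False
  define b where "b = Re (cinner y y)"
  have bb: "cinner y y = complex_of_real b" unfolding b_def by (rule cinner_self_real)
  have b: "b > 0" using False bb cinner_ge_zero[of y] by (auto simp: b_def[symmetric])
  define c where "c = cinner y x / b"
  have yx: "cinner y x = cnj (cinner x y)" by (rule cinner_commute)
  have "cinner (x - c *\<^sub>C y) (x - c *\<^sub>C y) =
     cinner x x - c * cinner x y - cnj c * cinner y x + cnj c * c * cinner y y"
    by (simp add: cinner_diff_left cinner_diff_right cinner_scaleC_left cinner_scaleC_right algebra_simps)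
  also have "\<dots> = cinner x x - cinner y x * cinner x y / b"
    using b by (simp add: c_def bb yx field_simps)
  also have "cinner y x * cinner x y = complex_of_real ((cmod (cinner x y))\<^sup>2)"
    by (metis yx complex_norm_square mult.commute)
  finally have "Re (cinner (x - c *\<^sub>C y) (x - c *\<^sub>C y)) = Re (cinner x x) - (cmod (cinner x y))\<^sup>2 / b"
    by (simp flip: of_real_divide)
  then have "(cmod (cinner x y))\<^sup>2 / b \<le> Re (cinner x x)"
    by (metis cinner_ge_zero diff_ge_0_iff_ge)
  then have "(cmod (cinner x y))\<^sup>2 \<le> Re (cinner x x) * b"
    using b by (simp add: field_simps)
  then show ?thesis
    unfolding b_def by (metis norm_ge_zero real_le_rsqrt real_sqrt_mult)
qed

lemma cinner_triangle:
  "sqrt (Re (cinner (x + y) (x + y))) \<le> sqrt (Re (cinner x x)) + sqrt (Re (cinner y y))"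
  for x y :: "'a::cinner_space"
proof (rule real_le_lsqrt)
  let ?a = "sqrt (Re (cinner x x))" and ?b = "sqrt (Re (cinner y y))"
  show "0 \<le> ?a + ?b" by (simp add: cinner_ge_zero)
  have "Re (cinner (x + y) (x + y)) = Re (cinner x x) + 2 * Re (cinner x y) + Re (cinner y y)"
    using cinner_commute[of y x] by (simp add: cinner_add_left cinner_add_right)
  also have "Re (cinner x y) \<le> ?a * ?b"
    using cinner_Cauchy_Schwarz[of x y] complex_Re_le_cmod order_trans by blast
  finally show "Re (cinner (x + y) (x + y)) \<le> (?a + ?b)\<^sup>2"
    by (simp add: power2_sum cinner_ge_zero algebra_simps)
qed

lemma sqrt_cinner_eq_0: "sqrt (Re (cinner x x)) = 0 \<longleftrightarrow> x = 0" for x :: "'a::cinner_space"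
  using cinner_self_real[of x] cinner_eq_zero[of x] by auto

lemma sqrt_cinner_scaleR: "sqrt (Re (cinner (r *\<^sub>R x) (r *\<^sub>R x))) = \<bar>r\<bar> * sqrt (Re (cinner x x))"
  for x :: "'a::cinner_space"
  by (simp add: scaleR_scaleC cinner_scaleC_left cinner_scaleC_right real_sqrt_mult mult.assoc[symmetric])

lemma norm2_cinner: "(norm x)\<^sup>2 = Re (cinner x x)" for x :: "'a::chilbert_space"
  by (simp add: norm_cinner cinner_ge_zero)

lemma cinner_self: "cinner x x = complex_of_real ((norm x)\<^sup>2)" for x :: "'a::chilbert_space"
  unfolding norm2_cinner by (rule cinner_self_real)

lemma norm_cinner_le: "cmod (cinner x y) \<le> norm x * norm y" for x y :: "'a::chilbert_space"
  using cinner_Cauchy_Schwarz[of x y] by (simp add: norm_cinner)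

lemma norm_scaleC: "norm (c *\<^sub>C x) = cmod c * norm x" for x :: "'a::chilbert_space"
proof -
  have "(norm (c *\<^sub>C x))\<^sup>2 = Re ((cnj c * c) * cinner x x)"
    unfolding norm2_cinner by (simp add: cinner_scaleC_left cinner_scaleC_right mult.assoc)
  also have "cnj c * c = complex_of_real ((cmod c)\<^sup>2)"
    by (metis complex_norm_square mult.commute)
  finally have "(norm (c *\<^sub>C x))\<^sup>2 = (cmod c * norm x)\<^sup>2"
    by (simp add: norm2_cinner power_mult_distrib)
  then show ?thesis by (simp add: power2_eq_iff_nonneg)
qed

instantiation complex :: chilbert_space
begin
definition scaleC_complex :: "complex \<Rightarrow> complex \<Rightarrow> complex" where "scaleC_complex c z = c * z"
definition cinner_complex :: "complex \<Rightarrow> complex \<Rightarrow> complex" where "cinner_complex w z = cnj w * z"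
instance
  by standard (auto simp: scaleC_complex_def cinner_complex_def algebra_simps scaleR_conv_of_real
      cmod_def power2_eq_square)
end

instantiation prod :: (chilbert_space, chilbert_space) chilbert_space
begin
definition scaleC_prod :: "complex \<Rightarrow> 'a \<times> 'b \<Rightarrow> 'a \<times> 'b"
  where "scaleC_prod c p = (c *\<^sub>C fst p, c *\<^sub>C snd p)"
definition cinner_prod :: "'a \<times> 'b \<Rightarrow> 'a \<times> 'b \<Rightarrow> complex"
  where "cinner_prod p q = cinner (fst p) (fst q) + cinner (snd p) (snd q)"
instance
proof
  fix x y z :: "'a \<times> 'b" and b c :: complex and r :: real
  show "cinner x y = cnj (cinner y x)"
    unfolding cinner_prod_def by (metis cinner_commute complex_cnj_add)
  show "cinner x x = 0 \<Longrightarrow> x = 0"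
  proof -
    assume "cinner x x = 0"
    then have "(norm (fst x))\<^sup>2 + (norm (snd x))\<^sup>2 = 0"
      unfolding cinner_prod_def norm2_cinner by (metis plus_complex.simps(1) zero_complex.simps(1))
    then show "x = 0" by (simp add: prod_eq_iff)
  qed
  show "norm x = sqrt (Re (cinner x x))"
    by (simp add: cinner_prod_def norm_prod_def norm2_cinner)
qed (auto simp: scaleC_prod_def cinner_prod_def scaleC_add_right scaleC_add_left scaleC_scaleC
      scaleR_scaleC[symmetric] cinner_add_right cinner_scaleC_right algebra_simps cinner_ge_zero
      scaleR_prod_def)
end

definition sq_summable :: "('i \<Rightarrow> 'b::chilbert_space) \<Rightarrow> bool"
  where "sq_summable \<phi> \<longleftrightarrow> (\<lambda>i. (norm (\<phi> i))\<^sup>2) summable_on UNIV"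

definition l2_cinner :: "('i \<Rightarrow> 'b::chilbert_space) \<Rightarrow> ('i \<Rightarrow> 'b) \<Rightarrow> complex"
  where "l2_cinner \<phi> \<psi> = (\<Sum>\<^sub>\<infinity>i. cinner (\<phi> i) (\<psi> i))"

lemma sq_summable_zero: "sq_summable (\<lambda>i. 0)"
  by (simp add: sq_summable_def)

lemma sq_summable_scaleC: "sq_summable \<phi> \<Longrightarrow> sq_summable (\<lambda>i. c *\<^sub>C \<phi> i)"
  by (simp add: sq_summable_def norm_scaleC power_mult_distrib summable_on_cmult_right)

lemma sq_summable_add:
  assumes "sq_summable \<phi>" "sq_summable \<psi>" shows "sq_summable (\<lambda>i. \<phi> i + \<psi> i)"
  unfolding sq_summable_def
proof -
  let ?g = "\<lambda>i. 2 * ((norm (\<phi> i))\<^sup>2 + (norm (\<psi> i))\<^sup>2)"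
  have g: "?g summable_on UNIV"
    using assms unfolding sq_summable_def by (intro summable_on_cmult_right summable_on_add)
  have b: "norm ((norm (\<phi> i + \<psi> i))\<^sup>2) \<le> ?g i" for i
  proof -
    have "(norm (\<phi> i + \<psi> i))\<^sup>2 \<le> (norm (\<phi> i) + norm (\<psi> i))\<^sup>2"
      by (intro power_mono norm_triangle_ineq norm_ge_zero)
    also have "\<dots> \<le> ?g i"
      using sum_squares_bound[of "norm (\<phi> i)" "norm (\<psi> i)"] by (simp add: power2_sum algebra_simps)
    finally show ?thesis by simp
  qed
  have "(\<lambda>i. norm ((norm (\<phi> i + \<psi> i))\<^sup>2)) summable_on UNIV"
    by (rule Infinite_Sum.abs_summable_on_comparison_test'[OF g]) (use b in auto)
  then show "(\<lambda>i. (norm (\<phi> i + \<psi> i))\<^sup>2) summable_on UNIV" by simp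
qed

lemma sq_summable_diff:
  assumes "sq_summable \<phi>" "sq_summable \<psi>" shows "sq_summable (\<lambda>i. \<phi> i - \<psi> i)"
  using sq_summable_add[OF assms(1) sq_summable_scaleC[OF assms(2), of "-1"]] by (simp add: scaleC_minus1)

lemma l2_cinner_summable:
  assumes "sq_summable \<phi>" "sq_summable \<psi>"
  shows "(\<lambda>i. cinner (\<phi> i) (\<psi> i)) summable_on UNIV"
proof -
  let ?g = "\<lambda>i. (norm (\<phi> i))\<^sup>2 + (norm (\<psi> i))\<^sup>2"
  have g: "?g summable_on UNIV"
    using assms unfolding sq_summable_def by (intro summable_on_add)
  have b: "norm (cinner (\<phi> i) (\<psi> i)) \<le> ?g i" for i
  proof -
    have "cmod (cinner (\<phi> i) (\<psi> i)) \<le> norm (\<phi> i) * norm (\<psi> i)" by (rule norm_cinner_le)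
    also have "\<dots> \<le> ?g i"
      using sum_squares_bound[of "norm (\<phi> i)" "norm (\<psi> i)"]
        mult_nonneg_nonneg[OF norm_ge_zero[of "\<phi> i"] norm_ge_zero[of "\<psi> i"]]
      unfolding mult.assoc by linarith
    finally show ?thesis .
  qed
  show ?thesis
    by (rule abs_summable_summable, rule Infinite_Sum.abs_summable_on_comparison_test'[OF g]) (use b in auto)
qed

lemma l2_cinner_commute: "l2_cinner \<phi> \<psi> = cnj (l2_cinner \<psi> \<phi>)"
  unfolding l2_cinner_def infsum_cnj[symmetric] by (rule infsum_cong) (rule cinner_commute)

lemma l2_cinner_add_right:
  assumes "sq_summable \<phi>" "sq_summable \<psi>" "sq_summable \<theta>"
  shows "l2_cinner \<phi> (\<lambda>i. \<psi> i + \<theta> i) = l2_cinner \<phi> \<psi> + l2_cinner \<phi> \<theta>"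
  unfolding l2_cinner_def cinner_add_right
  by (intro infsum_add l2_cinner_summable assms)

lemma l2_cinner_scaleC_right: "l2_cinner \<phi> (\<lambda>i. c *\<^sub>C \<psi> i) = c * l2_cinner \<phi> \<psi>"
  unfolding l2_cinner_def cinner_scaleC_right by (rule infsum_cmult_right')

lemma Re_l2_cinner: "sq_summable \<phi> \<Longrightarrow> Re (l2_cinner \<phi> \<phi>) = (\<Sum>\<^sub>\<infinity>i. (norm (\<phi> i))\<^sup>2)"
  unfolding l2_cinner_def by (simp add: l2_cinner_summable infsum_Re[symmetric] norm2_cinner)

lemma l2_cinner_ge_zero: "sq_summable \<phi> \<Longrightarrow> 0 \<le> Re (l2_cinner \<phi> \<phi>)"
  by (simp add: Re_l2_cinner infsum_nonneg)

lemma l2_norm_component: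
  assumes "sq_summable \<phi>" shows "norm (\<phi> i) \<le> sqrt (Re (l2_cinner \<phi> \<phi>))"
proof -
  have "sum (\<lambda>i. (norm (\<phi> i))\<^sup>2) {i} \<le> (\<Sum>\<^sub>\<infinity>i. (norm (\<phi> i))\<^sup>2)"
    using assms by (intro finite_sum_le_infsum) (auto simp: sq_summable_def)
  then show ?thesis using assms by (simp add: Re_l2_cinner real_le_rsqrt)
qed

lemma l2_cinner_eq_zero: "sq_summable \<phi> \<Longrightarrow> l2_cinner \<phi> \<phi> = 0 \<Longrightarrow> \<phi> = (\<lambda>i. 0)"
  using l2_norm_component[of \<phi>] by auto

lemma l2_complete:
  fixes X :: "nat \<Rightarrow> 'i \<Rightarrow> 'b::chilbert_space"
  assumes sq: "\<And>n. sq_summable (X n)"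
    and C: "\<And>e. e > 0 \<Longrightarrow> \<exists>N. \<forall>m\<ge>N. \<forall>n\<ge>N.
       sqrt (Re (l2_cinner (\<lambda>i. X m i - X n i) (\<lambda>i. X m i - X n i))) < e"
  shows "\<exists>\<phi>. sq_summable \<phi> \<and> (\<forall>i. (\<lambda>n. X n i) \<longlonglongrightarrow> \<phi> i) \<and>
    (\<forall>e>0. \<exists>N. \<forall>n\<ge>N. sqrt (Re (l2_cinner (\<lambda>i. X n i - \<phi> i) (\<lambda>i. X n i - \<phi> i))) \<le> e)"
proof -
  have comp: "norm (X m i - X n i) \<le> sqrt (Re (l2_cinner (\<lambda>i. X m i - X n i) (\<lambda>i. X m i - X n i)))" for m n i
    by (rule l2_norm_component[OF sq_summable_diff[OF sq[of m] sq[of n]], of i])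
  have "Cauchy (\<lambda>n. X n i)" for i
    unfolding Cauchy_def dist_norm using C comp by (meson le_less_trans)
  then have "\<forall>i. \<exists>l. (\<lambda>n. X n i) \<longlonglongrightarrow> l"
    by (simp add: Cauchy_convergent_iff convergent_def)
  then obtain \<phi> where lim: "\<And>i. (\<lambda>n. X n i) \<longlonglongrightarrow> \<phi> i" by metis
  have fin: "\<exists>N. \<forall>n\<ge>N. \<forall>F. finite F \<longrightarrow> (\<Sum>i\<in>F. (norm (X n i - \<phi> i))\<^sup>2) \<le> e\<^sup>2" if e: "e > 0" for e
  proof -
    obtain N where N: "\<And>m n. m \<ge> N \<Longrightarrow> n \<ge> N \<Longrightarrow>
       sqrt (Re (l2_cinner (\<lambda>i. X m i - X n i) (\<lambda>i. X m i - X n i))) < e"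
      using C[OF e] by blast
    have "(\<Sum>i\<in>F. (norm (X n i - \<phi> i))\<^sup>2) \<le> e\<^sup>2" if "n \<ge> N" "finite F" for n F
    proof (rule LIMSEQ_le_const2)
      show "(\<lambda>m. \<Sum>i\<in>F. (norm (X n i - X m i))\<^sup>2) \<longlonglongrightarrow> (\<Sum>i\<in>F. (norm (X n i - \<phi> i))\<^sup>2)"
        by (intro tendsto_intros lim)
      have "(\<Sum>i\<in>F. (norm (X n i - X m i))\<^sup>2) \<le> e\<^sup>2" if "m \<ge> N" for m
      proof -
        have s: "sq_summable (\<lambda>i. X n i - X m i)" by (intro sq_summable_diff sq)
        have "(\<Sum>i\<in>F. (norm (X n i - X m i))\<^sup>2) \<le> (\<Sum>\<^sub>\<infinity>i. (norm (X n i - X m i))\<^sup>2)"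
          using s \<open>finite F\<close> by (intro finite_sum_le_infsum) (auto simp: sq_summable_def)
        also have "\<dots> \<le> e\<^sup>2"
          using N[OF \<open>n \<ge> N\<close> that] Re_l2_cinner[OF s] \<open>e > 0\<close>
          by (metis less_eq_real_def sqrt_le_D)
        finally show ?thesis .
      qed
      then show "\<exists>N. \<forall>m\<ge>N. (\<Sum>i\<in>F. (norm (X n i - X m i))\<^sup>2) \<le> e\<^sup>2" by blast
    qed
    then show ?thesis by blast
  qed
  have sqd: "sq_summable (\<lambda>i. X n i - \<phi> i)" if "\<And>F. finite F \<Longrightarrow> (\<Sum>i\<in>F. (norm (X n i - \<phi> i))\<^sup>2) \<le> e" for n e
    unfolding sq_summable_def
    by (rule nonneg_bdd_above_summable_on) (use that in \<open>auto intro!: bdd_aboveI[where M=e]\<close>)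
  obtain N where N: "\<And>n F. n \<ge> N \<Longrightarrow> finite F \<Longrightarrow> (\<Sum>i\<in>F. (norm (X n i - \<phi> i))\<^sup>2) \<le> 1"
    using fin[of 1] by auto
  have "sq_summable (\<lambda>i. X N i - (X N i - \<phi> i))"
    by (rule sq_summable_diff[OF sq], rule sqd[of N 1], rule N) auto
  then have "sq_summable \<phi>" by simp
  moreover have "\<exists>N. \<forall>n\<ge>N. sqrt (Re (l2_cinner (\<lambda>i. X n i - \<phi> i) (\<lambda>i. X n i - \<phi> i))) \<le> e" if e: "e > 0" for e
  proof -
    obtain N where N: "\<And>n F. n \<ge> N \<Longrightarrow> finite F \<Longrightarrow> (\<Sum>i\<in>F. (norm (X n i - \<phi> i))\<^sup>2) \<le> e\<^sup>2"
      using fin[OF e] by blast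
    have "sqrt (Re (l2_cinner (\<lambda>i. X n i - \<phi> i) (\<lambda>i. X n i - \<phi> i))) \<le> e" if "n \<ge> N" for n
    proof -
      have s: "sq_summable (\<lambda>i. X n i - \<phi> i)" using sqd N that by blast
      have "(\<Sum>\<^sub>\<infinity>i. (norm (X n i - \<phi> i))\<^sup>2) \<le> e\<^sup>2"
        using s N[OF that] by (intro infsum_le_finite_sums) (auto simp: sq_summable_def)
      then show ?thesis using Re_l2_cinner[OF s] e by (simp add: real_le_lsqrt)
    qed
    then show ?thesis by blast
  qed
  ultimately show ?thesis using lim by blast
qed

text \<open>A fixed orthonormal basis (maximal orthonormal set) of each Hilbert space.\<close>

definition orthonormal :: "'a::chilbert_space set \<Rightarrow> bool"
  where "orthonormal B \<longleftrightarrow> (\<forall>e\<in>B. \<forall>e'\<in>B. cinner e e' = (if e = e' then 1 else 0))"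

definition onb :: "'a::chilbert_space set"
  where "onb = (SOME B. orthonormal B \<and> (\<forall>x. (\<forall>e\<in>B. cinner e x = 0) \<longrightarrow> x = 0))"

lemma onb: "orthonormal (onb :: 'a::chilbert_space set)" "(\<And>e. e \<in> onb \<Longrightarrow> cinner e (x::'a) = 0) \<Longrightarrow> x = 0"
proof -
  have "\<exists>M\<in>Collect orthonormal. \<forall>B\<in>Collect (orthonormal :: 'a set \<Rightarrow> bool). M \<subseteq> B \<longrightarrow> B = M"
  proof (rule subset_Zorn_nonempty)
    show "Collect (orthonormal :: 'a set \<Rightarrow> bool) \<noteq> {}"
      by (auto simp: orthonormal_def intro!: exI[of _ "{}"])
    fix \<C> :: "'a set set" assume C: "\<C> \<noteq> {}" "subset.chain (Collect orthonormal) \<C>"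
    have "cinner e e' = (if e = e' then 1 else 0)" if e: "e \<in> \<Union>\<C>" "e' \<in> \<Union>\<C>" for e e'
    proof -
      obtain B where "B \<in> \<C>" "e \<in> B" "e' \<in> B"
        using e C(2) unfolding subset_chain_def by (metis UnionE in_mono)
      then show ?thesis using C(2) unfolding subset_chain_def orthonormal_def by blast
    qed
    then show "\<Union>\<C> \<in> Collect orthonormal" by (simp add: orthonormal_def)
  qed
  then obtain M :: "'a set" where M: "orthonormal M" "\<And>B. orthonormal B \<Longrightarrow> M \<subseteq> B \<Longrightarrow> B = M" by auto
  have "x = 0" if x: "\<forall>e\<in>M. cinner e x = 0" for x
  proof (rule ccontr)
    assume "x \<noteq> 0"
    define y where "y = (1 / norm x) *\<^sub>R x"
    have y: "cinner y y = 1" "\<And>e. e \<in> M \<Longrightarrow> cinner e y = 0"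
      using \<open>x \<noteq> 0\<close> x
      by (auto simp: y_def scaleR_scaleC cinner_scaleC_left cinner_scaleC_right cinner_self[of x] power2_eq_square)
    have "\<And>e. e \<in> M \<Longrightarrow> cinner y e = 0" using y(2) by (metis cinner_commute complex_cnj_zero)
    then have "orthonormal (insert y M)" using M(1) y by (auto simp: orthonormal_def)
    then have "y \<in> M" using M(2) by blast
    then show False using y by auto
  qed
  with M(1) have "\<exists>B::'a set. orthonormal B \<and> (\<forall>x. (\<forall>e\<in>B. cinner e x = 0) \<longrightarrow> x = 0)" by blast
  from someI_ex[OF this] show "orthonormal (onb :: 'a set)" "(\<And>e. e \<in> onb \<Longrightarrow> cinner e (x::'a) = 0) \<Longrightarrow> x = 0"
    unfolding onb_def by blast+
qed

section \<open>Hilbert space tensor product\<close>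

text \<open>A vector of the tensor product is represented by its coordinates
  \<open>\<phi> e = (\<langle>e| \<otimes> I) \<phi>\<close> for \<open>e\<close> in the orthonormal basis of the first factor, so that the space is
  the \<open>\<ell>\<^sup>2\<close>-direct sum of copies of the second factor. Elementary tensors are introduced as
  \<open>tensor\<close> below.\<close>

typedef (overloaded) ('a::chilbert_space, 'b::chilbert_space) htensor =
  "{\<phi> :: 'a \<Rightarrow> 'b. sq_summable \<phi> \<and> (\<forall>e. e \<notin> onb \<longrightarrow> \<phi> e = 0)}"
  by (rule exI[of _ "\<lambda>e. 0"]) (simp add: sq_summable_zero)

setup_lifting type_definition_htensor

lemma htensor_Rep:
  "sq_summable (Rep_htensor x)" "e \<notin> onb \<Longrightarrow> Rep_htensor x e = 0"
  using Rep_htensor[of x] by auto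

instantiation htensor :: (chilbert_space, chilbert_space) cinner_space
begin

lift_definition zero_htensor :: "('a, 'b) htensor" is "\<lambda>i. 0" by (simp add: sq_summable_zero)
lift_definition plus_htensor :: "('a, 'b) htensor \<Rightarrow> ('a, 'b) htensor \<Rightarrow> ('a, 'b) htensor"
  is "\<lambda>\<phi> \<psi> i. \<phi> i + \<psi> i" by (auto simp: sq_summable_add)
lift_definition minus_htensor :: "('a, 'b) htensor \<Rightarrow> ('a, 'b) htensor \<Rightarrow> ('a, 'b) htensor"
  is "\<lambda>\<phi> \<psi> i. \<phi> i - \<psi> i" by (auto simp: sq_summable_diff)
lift_definition scaleC_htensor :: "complex \<Rightarrow> ('a, 'b) htensor \<Rightarrow> ('a, 'b) htensor"
  is "\<lambda>c \<phi> i. c *\<^sub>C \<phi> i" by (auto simp: sq_summable_scaleC)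
lift_definition cinner_htensor :: "('a, 'b) htensor \<Rightarrow> ('a, 'b) htensor \<Rightarrow> complex"
  is l2_cinner .
definition uminus_htensor :: "('a, 'b) htensor \<Rightarrow> ('a, 'b) htensor"
  where "uminus_htensor x = 0 - x"
definition scaleR_htensor :: "real \<Rightarrow> ('a, 'b) htensor \<Rightarrow> ('a, 'b) htensor"
  where "scaleR_htensor r x = complex_of_real r *\<^sub>C x"

instance
proof
  fix x y z :: "('a, 'b) htensor" and b c :: complex and r s :: real
  show "x + y + z = x + (y + z)" by transfer (simp add: add.assoc)
  show "x + y = y + x" by transfer (simp add: add.commute)
  show "0 + x = x" by transfer simp
  show "- x + x = 0" unfolding uminus_htensor_def by transfer simp
  show "x - y = x + - y" unfolding uminus_htensor_def by transfer simp
  show "r *\<^sub>R (x + y) = r *\<^sub>R x + r *\<^sub>R y"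
    unfolding scaleR_htensor_def by transfer (simp add: scaleC_add_right)
  show "(r + s) *\<^sub>R x = r *\<^sub>R x + s *\<^sub>R x"
    unfolding scaleR_htensor_def by transfer (simp add: scaleC_add_left)
  show "r *\<^sub>R s *\<^sub>R x = (r * s) *\<^sub>R x"
    unfolding scaleR_htensor_def by transfer (simp add: scaleC_scaleC)
  show "1 *\<^sub>R x = x" unfolding scaleR_htensor_def by transfer simp
  show "c *\<^sub>C (x + y) = c *\<^sub>C x + c *\<^sub>C y" by transfer (simp add: scaleC_add_right)
  show "(b + c) *\<^sub>C x = b *\<^sub>C x + c *\<^sub>C x" by transfer (simp add: scaleC_add_left)
  show "b *\<^sub>C c *\<^sub>C x = (b * c) *\<^sub>C x" by transfer (simp add: scaleC_scaleC)
  show "r *\<^sub>R x = complex_of_real r *\<^sub>C x" by (rule scaleR_htensor_def)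
  show "cinner x y = cnj (cinner y x)" by transfer (rule l2_cinner_commute)
  show "cinner x (y + z) = cinner x y + cinner x z" by transfer (simp add: l2_cinner_add_right)
  show "cinner x (c *\<^sub>C y) = c * cinner x y" by transfer (rule l2_cinner_scaleC_right)
  show "0 \<le> Re (cinner x x)" by transfer (blast intro: l2_cinner_ge_zero)
  show "cinner x x = 0 \<Longrightarrow> x = 0" by transfer (blast intro: l2_cinner_eq_zero)
qed

end

instantiation htensor :: (chilbert_space, chilbert_space) real_normed_vector
begin

definition norm_htensor :: "('a, 'b) htensor \<Rightarrow> real"
  where "norm_htensor x = sqrt (Re (cinner x x))"
definition dist_htensor :: "('a, 'b) htensor \<Rightarrow> ('a, 'b) htensor \<Rightarrow> real"
  where "dist_htensor x y = norm (x - y)"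
definition sgn_htensor :: "('a, 'b) htensor \<Rightarrow> ('a, 'b) htensor"
  where "sgn_htensor x = inverse (norm x) *\<^sub>R x"
definition uniformity_htensor :: "(('a, 'b) htensor \<times> ('a, 'b) htensor) filter"
  where "uniformity_htensor = (INF e\<in>{0 <..}. principal {(x, y). dist x y < e})"
definition open_htensor :: "('a, 'b) htensor set \<Rightarrow> bool"
  where "open_htensor U \<longleftrightarrow> (\<forall>x\<in>U. eventually (\<lambda>(x', y). x' = x \<longrightarrow> y \<in> U) uniformity)"

instance
proof
  fix x y :: "('a, 'b) htensor" and r :: real and U :: "('a, 'b) htensor set"
  show "dist x y = norm (x - y)" by (rule dist_htensor_def)
  show "sgn x = inverse (norm x) *\<^sub>R x" by (rule sgn_htensor_def)
  show "uniformity = (INF e\<in>{0 <..}. principal {(x, y). dist (x::('a, 'b) htensor) y < e})"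
    by (rule uniformity_htensor_def)
  show "open U \<longleftrightarrow> (\<forall>x\<in>U. eventually (\<lambda>(x', y). x' = x \<longrightarrow> y \<in> U) uniformity)"
    by (rule open_htensor_def)
  show "norm x = 0 \<longleftrightarrow> x = 0" unfolding norm_htensor_def by (rule sqrt_cinner_eq_0)
  show "norm (x + y) \<le> norm x + norm y" unfolding norm_htensor_def by (rule cinner_triangle)
  show "norm (r *\<^sub>R x) = \<bar>r\<bar> * norm x" unfolding norm_htensor_def by (rule sqrt_cinner_scaleR)
qed

end

instance htensor :: (chilbert_space, chilbert_space) banach
proof
  fix X :: "nat \<Rightarrow> ('a, 'b) htensor"
  assume X: "Cauchy X"
  have sq: "sq_summable (Rep_htensor (X n))" for n by (rule htensor_Rep)
  have "\<exists>N. \<forall>m\<ge>N. \<forall>n\<ge>N. sqrt (Re (l2_cinner (\<lambda>i. Rep_htensor (X m) i - Rep_htensor (X n) i)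
      (\<lambda>i. Rep_htensor (X m) i - Rep_htensor (X n) i))) < e" if "e > 0" for e
    by (rule X[unfolded Cauchy_def dist_norm norm_htensor_def cinner_htensor.rep_eq minus_htensor.rep_eq,
          THEN spec, THEN mp, OF that])
  from l2_complete[OF sq this] obtain \<phi> where \<phi>: "sq_summable \<phi>"
      "\<And>i. (\<lambda>n. Rep_htensor (X n) i) \<longlonglongrightarrow> \<phi> i"
      "\<And>e. e > 0 \<Longrightarrow> \<exists>N. \<forall>n\<ge>N. sqrt (Re (l2_cinner (\<lambda>i. Rep_htensor (X n) i - \<phi> i)
        (\<lambda>i. Rep_htensor (X n) i - \<phi> i))) \<le> e"
    by blast
  have "\<phi> e = 0" if "e \<notin> onb" for e
    using \<phi>(2)[of e] that by (simp add: htensor_Rep LIMSEQ_const_iff)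
  then have R: "Rep_htensor (Abs_htensor \<phi>) = \<phi>"
    using \<phi>(1) by (subst Abs_htensor_inverse) auto
  have "X \<longlonglongrightarrow> Abs_htensor \<phi>"
  proof (rule metric_LIMSEQ_I)
    fix e :: real assume "e > 0"
    obtain N where "\<forall>n\<ge>N. norm (X n - Abs_htensor \<phi>) \<le> e/2"
      unfolding norm_htensor_def cinner_htensor.rep_eq minus_htensor.rep_eq R
      using \<phi>(3)[OF half_gt_zero[OF \<open>e > 0\<close>]] ..
    then have "\<forall>n\<ge>N. dist (X n) (Abs_htensor \<phi>) < e"
      using \<open>e > 0\<close> unfolding dist_norm by (smt (verit) field_sum_of_halves)
    then show "\<exists>N. \<forall>n\<ge>N. dist (X n) (Abs_htensor \<phi>) < e" ..
  qed
  then show "convergent X" by (auto simp: convergent_def)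
qed

instance htensor :: (chilbert_space, chilbert_space) chilbert_space
  by standard (rule norm_htensor_def)

section \<open>Symmetric Fock space\<close>

text \<open>The component of \<open>\<phi>\<close> in \<open>'a\<^bsup>\<otimes>n\<^esup>\<close> is given by its coordinates with respect to the
  orthonormal basis \<open>e\<^sub>1 \<otimes> \<dots> \<otimes> e\<^sub>n\<close>, indexed by the lists of length \<open>n\<close> over \<^const>\<open>onb\<close>; it is
  symmetric iff the coordinates are invariant under permutations of the list.\<close>

definition fock_coords :: "('a::chilbert_space list \<Rightarrow> complex) \<Rightarrow> bool"
  where "fock_coords \<phi> \<longleftrightarrow> sq_summable \<phi> \<and> (\<forall>l. \<not> set l \<subseteq> onb \<longrightarrow> \<phi> l = 0) \<and>
    (\<forall>l l'. mset l = mset l' \<longrightarrow> \<phi> l = \<phi> l')"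

typedef (overloaded) 'a::chilbert_space fock = "{\<phi> :: 'a list \<Rightarrow> complex. fock_coords \<phi>}"
  by (rule exI[of _ "\<lambda>l. 0"]) (simp add: sq_summable_zero fock_coords_def)

setup_lifting type_definition_fock

lemma fock_Rep:
  "sq_summable (Rep_fock x)" "\<not> set l \<subseteq> onb \<Longrightarrow> Rep_fock x l = 0"
  "mset l = mset l' \<Longrightarrow> Rep_fock x l = Rep_fock x l'"
  using Rep_fock[of x] unfolding fock_coords_def mem_Collect_eq by blast+

lemma fock_coordsD: "fock_coords \<phi> \<Longrightarrow> sq_summable \<phi>"
  by (simp add: fock_coords_def)

instantiation fock :: (chilbert_space) cinner_space
begin

lift_definition zero_fock :: "'a fock" is "\<lambda>i. 0" by (simp add: sq_summable_zero fock_coords_def)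
lift_definition plus_fock :: "'a fock \<Rightarrow> 'a fock \<Rightarrow> 'a fock"
  is "\<lambda>\<phi> \<psi> i. \<phi> i + \<psi> i" unfolding fock_coords_def by (metis sq_summable_add add_0)
lift_definition minus_fock :: "'a fock \<Rightarrow> 'a fock \<Rightarrow> 'a fock"
  is "\<lambda>\<phi> \<psi> i. \<phi> i - \<psi> i" unfolding fock_coords_def by (metis sq_summable_diff diff_0_right)
lift_definition scaleC_fock :: "complex \<Rightarrow> 'a fock \<Rightarrow> 'a fock"
  is "\<lambda>c \<phi> i. c *\<^sub>C \<phi> i" unfolding fock_coords_def by (metis sq_summable_scaleC scaleC_zero_right)
lift_definition cinner_fock :: "'a fock \<Rightarrow> 'a fock \<Rightarrow> complex"
  is l2_cinner .
definition uminus_fock :: "'a fock \<Rightarrow> 'a fock"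
  where "uminus_fock x = 0 - x"
definition scaleR_fock :: "real \<Rightarrow> 'a fock \<Rightarrow> 'a fock"
  where "scaleR_fock r x = complex_of_real r *\<^sub>C x"

instance
proof
  fix x y z :: "'a fock" and b c :: complex and r s :: real
  show "x + y + z = x + (y + z)" by transfer (simp add: add.assoc)
  show "x + y = y + x" by transfer (simp add: add.commute)
  show "0 + x = x" by transfer simp
  show "- x + x = 0" unfolding uminus_fock_def by transfer simp
  show "x - y = x + - y" unfolding uminus_fock_def by transfer simp
  show "r *\<^sub>R (x + y) = r *\<^sub>R x + r *\<^sub>R y"
    unfolding scaleR_fock_def by transfer (simp add: scaleC_add_right)
  show "(r + s) *\<^sub>R x = r *\<^sub>R x + s *\<^sub>R x"
    unfolding scaleR_fock_def by transfer (simp add: scaleC_add_left)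
  show "r *\<^sub>R s *\<^sub>R x = (r * s) *\<^sub>R x"
    unfolding scaleR_fock_def by transfer (simp add: scaleC_scaleC)
  show "1 *\<^sub>R x = x" unfolding scaleR_fock_def by transfer simp
  show "c *\<^sub>C (x + y) = c *\<^sub>C x + c *\<^sub>C y" by transfer (simp add: scaleC_add_right)
  show "(b + c) *\<^sub>C x = b *\<^sub>C x + c *\<^sub>C x" by transfer (simp add: scaleC_add_left)
  show "b *\<^sub>C c *\<^sub>C x = (b * c) *\<^sub>C x" by transfer (simp add: scaleC_scaleC)
  show "r *\<^sub>R x = complex_of_real r *\<^sub>C x" by (rule scaleR_fock_def)
  show "cinner x y = cnj (cinner y x)" by transfer (rule l2_cinner_commute)
  show "cinner x (y + z) = cinner x y + cinner x z" by transfer (blast intro: l2_cinner_add_right dest: fock_coordsD)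
  show "cinner x (c *\<^sub>C y) = c * cinner x y" by transfer (rule l2_cinner_scaleC_right)
  show "0 \<le> Re (cinner x x)" by transfer (blast intro: l2_cinner_ge_zero dest: fock_coordsD)
  show "cinner x x = 0 \<Longrightarrow> x = 0" by transfer (blast intro: l2_cinner_eq_zero dest: fock_coordsD)
qed

end

instantiation fock :: (chilbert_space) real_normed_vector
begin

definition norm_fock :: "'a fock \<Rightarrow> real"
  where "norm_fock x = sqrt (Re (cinner x x))"
definition dist_fock :: "'a fock \<Rightarrow> 'a fock \<Rightarrow> real"
  where "dist_fock x y = norm (x - y)"
definition sgn_fock :: "'a fock \<Rightarrow> 'a fock"
  where "sgn_fock x = inverse (norm x) *\<^sub>R x"
definition uniformity_fock :: "('a fock \<times> 'a fock) filter"
  where "uniformity_fock = (INF e\<in>{0 <..}. principal {(x, y). dist x y < e})"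
definition open_fock :: "'a fock set \<Rightarrow> bool"
  where "open_fock U \<longleftrightarrow> (\<forall>x\<in>U. eventually (\<lambda>(x', y). x' = x \<longrightarrow> y \<in> U) uniformity)"

instance
proof
  fix x y :: "'a fock" and r :: real and U :: "'a fock set"
  show "dist x y = norm (x - y)" by (rule dist_fock_def)
  show "sgn x = inverse (norm x) *\<^sub>R x" by (rule sgn_fock_def)
  show "uniformity = (INF e\<in>{0 <..}. principal {(x, y). dist (x::'a fock) y < e})"
    by (rule uniformity_fock_def)
  show "open U \<longleftrightarrow> (\<forall>x\<in>U. eventually (\<lambda>(x', y). x' = x \<longrightarrow> y \<in> U) uniformity)"
    by (rule open_fock_def)
  show "norm x = 0 \<longleftrightarrow> x = 0" unfolding norm_fock_def by (rule sqrt_cinner_eq_0)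
  show "norm (x + y) \<le> norm x + norm y" unfolding norm_fock_def by (rule cinner_triangle)
  show "norm (r *\<^sub>R x) = \<bar>r\<bar> * norm x" unfolding norm_fock_def by (rule sqrt_cinner_scaleR)
qed

end

instance fock :: (chilbert_space) banach
proof
  fix X :: "nat \<Rightarrow> 'a fock"
  assume X: "Cauchy X"
  have sq: "sq_summable (Rep_fock (X n))" for n by (rule fock_Rep)
  have "\<exists>N. \<forall>m\<ge>N. \<forall>n\<ge>N. sqrt (Re (l2_cinner (\<lambda>i. Rep_fock (X m) i - Rep_fock (X n) i)
      (\<lambda>i. Rep_fock (X m) i - Rep_fock (X n) i))) < e" if "e > 0" for e
    by (rule X[unfolded Cauchy_def dist_norm norm_fock_def cinner_fock.rep_eq minus_fock.rep_eq,
          THEN spec, THEN mp, OF that])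
  from l2_complete[OF sq this] obtain \<phi> where \<phi>: "sq_summable \<phi>"
      "\<And>i. (\<lambda>n. Rep_fock (X n) i) \<longlonglongrightarrow> \<phi> i"
      "\<And>e. e > 0 \<Longrightarrow> \<exists>N. \<forall>n\<ge>N. sqrt (Re (l2_cinner (\<lambda>i. Rep_fock (X n) i - \<phi> i)
        (\<lambda>i. Rep_fock (X n) i - \<phi> i))) \<le> e"
    by blast
  have "\<phi> l = 0" if "\<not> set l \<subseteq> onb" for l
    using \<phi>(2)[of l] that by (simp add: fock_Rep LIMSEQ_const_iff)
  moreover have "\<phi> l = \<phi> l'" if "mset l = mset l'" for l l'
    using \<phi>(2)[of l] \<phi>(2)[of l'] fock_Rep(3)[OF that] by (simp add: LIMSEQ_unique)
  ultimately have "fock_coords \<phi>" unfolding fock_coords_def using \<phi>(1) by blast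
  then have R: "Rep_fock (Abs_fock \<phi>) = \<phi>"
    by (intro Abs_fock_inverse CollectI)
  have "X \<longlonglongrightarrow> Abs_fock \<phi>"
  proof (rule metric_LIMSEQ_I)
    fix e :: real assume "e > 0"
    obtain N where "\<forall>n\<ge>N. norm (X n - Abs_fock \<phi>) \<le> e/2"
      unfolding norm_fock_def cinner_fock.rep_eq minus_fock.rep_eq R
      using \<phi>(3)[OF half_gt_zero[OF \<open>e > 0\<close>]] ..
    then have "\<forall>n\<ge>N. dist (X n) (Abs_fock \<phi>) < e"
      using \<open>e > 0\<close> unfolding dist_norm by (smt (verit) field_sum_of_halves)
    then show "\<exists>N. \<forall>n\<ge>N. dist (X n) (Abs_fock \<phi>) < e" ..
  qed
  then show "convergent X" by (auto simp: convergent_def)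
qed

instance fock :: (chilbert_space) chilbert_space
  by standard (rule norm_fock_def)

section \<open>Vector-valued square-integrable functions\<close>

definition halfline :: "real measure"
  where "halfline = restrict_space lborel {0..}"

text \<open>Bochner (strong) measurability: Borel measurable with separable range. The spaces are not
  assumed separable, so this does not reduce to Borel measurability.\<close>

definition strongly_measurable :: "'m measure \<Rightarrow> ('m \<Rightarrow> 'a::metric_space) \<Rightarrow> bool"
  where "strongly_measurable M f \<longleftrightarrow>
    f \<in> borel_measurable M \<and> (\<exists>D. countable D \<and> f ` space M \<subseteq> closure D)"

definition sq_integrable :: "'m measure \<Rightarrow> ('m \<Rightarrow> 'a::real_normed_vector) \<Rightarrow> bool"
  where "sq_integrable M f \<longleftrightarrow> strongly_measurable M f \<and> (\<integral>\<^sup>+x. ennreal ((norm (f x))\<^sup>2) \<partial>M) < \<infinity>"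

lemma strongly_measurable_const: "strongly_measurable M (\<lambda>x. c)"
  unfolding strongly_measurable_def by (auto intro!: exI[of _ "{c}"])

lemma strongly_measurable_comp2:
  fixes f :: "'m \<Rightarrow> 'a::metric_space" and g :: "'m \<Rightarrow> 'b::metric_space" and h :: "'a \<times> 'b \<Rightarrow> 'c::metric_space"
  assumes f: "strongly_measurable M f" and g: "strongly_measurable M g" and h: "continuous_on UNIV h"
  shows "strongly_measurable M (\<lambda>x. h (f x, g x))"
proof -
  obtain D1 D2 where D: "countable D1" "f ` space M \<subseteq> closure D1" "countable D2" "g ` space M \<subseteq> closure D2"
    using f g unfolding strongly_measurable_def by blast
  have [measurable]: "f \<in> borel_measurable M" "g \<in> borel_measurable M"
    using f g unfolding strongly_measurable_def by auto
  have "(\<lambda>x. (f x, g x)) \<in> borel_measurable M"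
  proof (rule borel_measurableI)
    fix U :: "('a \<times> 'b) set" assume "open U"
    define J where "J = {(d, e, n::nat). d \<in> D1 \<and> e \<in> D2 \<and> ball d (1 / Suc n) \<times> ball e (1 / Suc n) \<subseteq> U}"
    have "countable (D1 \<times> D2 \<times> (UNIV :: nat set))" using D by blast
    then have J: "countable J" by (rule countable_subset[rotated]) (auto simp: J_def)
    have "(\<lambda>x. (f x, g x)) -` U \<inter> space M =
      (\<Union>(d, e, n)\<in>J. {x \<in> space M. dist d (f x) < 1 / Suc n \<and> dist e (g x) < 1 / Suc n})"
    proof (intro set_eqI iffI)
      fix x assume "x \<in> (\<lambda>x. (f x, g x)) -` U \<inter> space M"
      then have x: "x \<in> space M" "(f x, g x) \<in> U" by auto
      obtain A B where AB: "open A" "open B" "f x \<in> A" "g x \<in> B" "A \<times> B \<subseteq> U"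
        using open_prod_elim[OF \<open>open U\<close> x(2)] by (metis mem_Sigma_iff)
      obtain e1 e2 where e: "e1 > 0" "ball (f x) e1 \<subseteq> A" "e2 > 0" "ball (g x) e2 \<subseteq> B"
        using AB by (meson openE)
      obtain n where n: "1 / real (Suc n) < min e1 e2 / 2"
        using reals_Archimedean[of "min e1 e2 / 2"] e by (auto simp: inverse_eq_divide)
      have pos: "1 / real (Suc n) > 0" by simp
      obtain d where d: "d \<in> D1" "dist d (f x) < 1 / Suc n"
        using D(2) x(1) pos closure_approachable by (metis image_subset_iff)
      obtain d' where d': "d' \<in> D2" "dist d' (g x) < 1 / Suc n"
        using D(4) x(1) pos closure_approachable by (metis image_subset_iff)
      have "ball d (1 / Suc n) \<subseteq> ball (f x) e1"
      proof
        fix y assume "y \<in> ball d (1 / Suc n)"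
        then have "dist (f x) y < 1 / Suc n + 1 / Suc n"
          using d dist_triangle[of "f x" y d] by (simp add: dist_commute)
        then show "y \<in> ball (f x) e1" using n by simp
      qed
      moreover have "ball d' (1 / Suc n) \<subseteq> ball (g x) e2"
      proof
        fix y assume "y \<in> ball d' (1 / Suc n)"
        then have "dist (g x) y < 1 / Suc n + 1 / Suc n"
          using d' dist_triangle[of "g x" y d'] by (simp add: dist_commute)
        then show "y \<in> ball (g x) e2" using n by simp
      qed
      ultimately have "(d, d', n) \<in> J" using d d' e AB unfolding J_def by blast
      with d d' x show "x \<in> (\<Union>(d, e, n)\<in>J. {x \<in> space M. dist d (f x) < 1 / Suc n \<and> dist e (g x) < 1 / Suc n})"
        by blast
    next
      fix x assume "x \<in> (\<Union>(d, e, n)\<in>J. {x \<in> space M. dist d (f x) < 1 / Suc n \<and> dist e (g x) < 1 / Suc n})"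
      then show "x \<in> (\<lambda>x. (f x, g x)) -` U \<inter> space M" unfolding J_def by auto
    qed
    also have "\<dots> \<in> sets M"
    proof (rule sets.countable_UN'[OF J], clarsimp simp del: of_nat_Suc)
      fix d e and n :: nat
      have "{x \<in> space M. dist d (f x) < 1 / Suc n \<and> dist e (g x) < 1 / Suc n} =
        (f -` ball d (1 / Suc n) \<inter> space M) \<inter> (g -` ball e (1 / Suc n) \<inter> space M)"
        by auto
      also have "\<dots> \<in> sets M" by (intro sets.Int measurable_sets[of _ _ borel]) auto
      finally show "{x \<in> space M. dist d (f x) < 1 / Suc n \<and> dist e (g x) < 1 / Suc n} \<in> sets M" .
    qed
    finally show "(\<lambda>x. (f x, g x)) -` U \<inter> space M \<in> sets M" .
  qed
  then have "(\<lambda>x. h (f x, g x)) \<in> borel_measurable M"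
    by (rule measurable_compose) (rule borel_measurable_continuous_onI[OF h])
  moreover have "(\<lambda>x. h (f x, g x)) ` space M \<subseteq> closure (h ` (D1 \<times> D2))"
  proof -
    have "(\<lambda>x. h (f x, g x)) ` space M \<subseteq> h ` closure (D1 \<times> D2)"
      using D unfolding closure_Times by blast
    also have "\<dots> \<subseteq> closure (h ` (D1 \<times> D2))"
      by (rule image_closure_subset) (use continuous_on_subset[OF h] closure_subset[of "h ` (D1 \<times> D2)"] in auto)
    finally show ?thesis .
  qed
  moreover have "countable (h ` (D1 \<times> D2))" using D by blast
  ultimately show ?thesis unfolding strongly_measurable_def by blast
qed

lemma strongly_measurable_comp:
  fixes f :: "'m \<Rightarrow> 'a::metric_space" and h :: "'a \<Rightarrow> 'c::metric_space"
  assumes f: "strongly_measurable M f" and h: "continuous_on UNIV h"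
  shows "strongly_measurable M (\<lambda>x. h (f x))"
proof -
  have "continuous_on UNIV (\<lambda>p::'a \<times> real. h (fst p))"
    by (rule continuous_on_compose2[OF h]) (auto intro: continuous_on_fst continuous_on_id)
  from strongly_measurable_comp2[OF f strongly_measurable_const[of M "0::real"] this]
  show ?thesis by simp
qed

lemma strongly_measurable_LIMSEQ:
  fixes f :: "nat \<Rightarrow> 'm \<Rightarrow> 'a::metric_space"
  assumes f: "\<And>n. strongly_measurable M (f n)" and lim: "\<And>x. x \<in> space M \<Longrightarrow> (\<lambda>n. f n x) \<longlonglongrightarrow> g x"
  shows "strongly_measurable M g"
proof -
  have "\<forall>n. \<exists>D. countable D \<and> f n ` space M \<subseteq> closure D" using f unfolding strongly_measurable_def by blast
  then obtain D where D: "\<And>n. countable (D n)" "\<And>n. f n ` space M \<subseteq> closure (D n)" by metis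
  have "g x \<in> closure (\<Union>n. D n)" if "x \<in> space M" for x
  proof (rule closed_sequentially[OF closed_closure _ lim[OF that]])
    show "f n x \<in> closure (\<Union>n. D n)" for n
      using D(2)[of n] that closure_mono[of "D n" "\<Union>n. D n"] by blast
  qed
  moreover have "g \<in> borel_measurable M"
    by (rule borel_measurable_LIMSEQ_metric[OF _ lim]) (use f in \<open>auto simp: strongly_measurable_def\<close>)
  moreover have "countable (\<Union>n. D n)" using D by blast
  ultimately show ?thesis unfolding strongly_measurable_def by blast
qed

lemma strongly_measurable_D: "strongly_measurable M f \<Longrightarrow> f \<in> borel_measurable M"
  by (simp add: strongly_measurable_def)

lemma continuous_on_scaleC: "continuous_on UNIV (\<lambda>x::'a::chilbert_space. c *\<^sub>C x)"
proof (rule linear_continuous_on, rule bounded_linear_intro)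
  show "norm (c *\<^sub>C x) \<le> norm x * cmod c" for x :: 'a
    by (simp add: norm_scaleC mult.commute)
qed (simp_all add: scaleC_add_right scaleR_scaleC scaleC_scaleC mult.commute)

lemma continuous_on_cinner: "continuous_on UNIV (\<lambda>p::'a::chilbert_space \<times> 'a. cinner (fst p) (snd p))"
proof -
  have "bounded_bilinear (cinner :: 'a \<Rightarrow> 'a \<Rightarrow> complex)"
  proof
    fix x y z :: 'a and r :: real
    show "cinner (x + y) z = cinner x z + cinner y z" by (rule cinner_add_left)
    show "cinner x (y + z) = cinner x y + cinner x z" by (rule cinner_add_right)
    show "cinner (r *\<^sub>R x) y = r *\<^sub>R cinner x y"
      by (simp add: scaleR_scaleC[of r x] cinner_scaleC_left scaleR_conv_of_real)
    show "cinner x (r *\<^sub>R y) = r *\<^sub>R cinner x y"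
      by (simp add: scaleR_scaleC[of r y] cinner_scaleC_right scaleR_conv_of_real)
    show "\<exists>K. \<forall>x y::'a. cmod (cinner x y) \<le> norm x * norm y * K"
      by (intro exI[of _ 1] allI) (simp add: norm_cinner_le)
  qed
  then show ?thesis
    by (rule bounded_bilinear.continuous_on[OF _ continuous_on_fst[OF continuous_on_id]
          continuous_on_snd[OF continuous_on_id]])
qed

lemma sq_integrable_zero: "sq_integrable M (\<lambda>x. 0)"
  by (simp add: sq_integrable_def strongly_measurable_const)

lemma sq_integrable_scaleC:
  fixes f :: "'m \<Rightarrow> 'a::chilbert_space"
  assumes "sq_integrable M f" shows "sq_integrable M (\<lambda>x. c *\<^sub>C f x)"
proof -
  have sm: "strongly_measurable M f" and fin: "(\<integral>\<^sup>+x. ennreal ((norm (f x))\<^sup>2) \<partial>M) < \<infinity>"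
    using assms by (auto simp: sq_integrable_def)
  have [measurable]: "f \<in> borel_measurable M" by (rule strongly_measurable_D[OF sm])
  have "(\<integral>\<^sup>+x. ennreal ((norm (c *\<^sub>C f x))\<^sup>2) \<partial>M) = (\<integral>\<^sup>+x. ennreal ((cmod c)\<^sup>2) * ennreal ((norm (f x))\<^sup>2) \<partial>M)"
    by (simp add: norm_scaleC power_mult_distrib ennreal_mult)
  also have "\<dots> = ennreal ((cmod c)\<^sup>2) * (\<integral>\<^sup>+x. ennreal ((norm (f x))\<^sup>2) \<partial>M)"
    by (rule nn_integral_cmult) simp
  also have "\<dots> < \<infinity>" using fin by (simp add: ennreal_mult_less_top)
  finally show ?thesis
    unfolding sq_integrable_def by (simp add: strongly_measurable_comp[OF sm continuous_on_scaleC])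
qed

lemma strongly_measurable_add:
  fixes f :: "'m \<Rightarrow> 'a::real_normed_vector"
  assumes "strongly_measurable M f" "strongly_measurable M g"
  shows "strongly_measurable M (\<lambda>x. f x + g x)"
  using strongly_measurable_comp2[OF assms, of "\<lambda>p. fst p + snd p"]
  by (simp add: continuous_on_add continuous_on_fst continuous_on_snd)

lemma norm_add_sq_le: "(norm (x + y))\<^sup>2 \<le> 2 * (norm x)\<^sup>2 + 2 * (norm y)\<^sup>2" for x y :: "'a::real_normed_vector"
proof -
  have "(norm (x + y))\<^sup>2 \<le> (norm x + norm y)\<^sup>2"
    by (intro power_mono norm_triangle_ineq norm_ge_zero)
  also have "\<dots> \<le> 2 * (norm x)\<^sup>2 + 2 * (norm y)\<^sup>2"
    using sum_squares_bound[of "norm x" "norm y"] by (simp add: power2_sum algebra_simps)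
  finally show ?thesis .
qed

lemma sq_integrable_add:
  fixes f :: "'m \<Rightarrow> 'a::real_normed_vector"
  assumes "sq_integrable M f" "sq_integrable M g" shows "sq_integrable M (\<lambda>x. f x + g x)"
proof -
  have sm: "strongly_measurable M f" "strongly_measurable M g"
    and fin: "(\<integral>\<^sup>+x. ennreal ((norm (f x))\<^sup>2) \<partial>M) < \<infinity>" "(\<integral>\<^sup>+x. ennreal ((norm (g x))\<^sup>2) \<partial>M) < \<infinity>"
    using assms by (auto simp: sq_integrable_def)
  have [measurable]: "f \<in> borel_measurable M" "g \<in> borel_measurable M"
    using sm by (auto intro: strongly_measurable_D)
  have "(\<integral>\<^sup>+x. ennreal ((norm (f x + g x))\<^sup>2) \<partial>M) \<le>
     (\<integral>\<^sup>+x. 2 * ennreal ((norm (f x))\<^sup>2) + 2 * ennreal ((norm (g x))\<^sup>2) \<partial>M)"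
  proof (rule nn_integral_mono)
    fix x
    have "ennreal ((norm (f x + g x))\<^sup>2) \<le> ennreal (2 * (norm (f x))\<^sup>2 + 2 * (norm (g x))\<^sup>2)"
      by (rule ennreal_leI[OF norm_add_sq_le])
    also have "\<dots> = 2 * ennreal ((norm (f x))\<^sup>2) + 2 * ennreal ((norm (g x))\<^sup>2)"
      by (simp add: ennreal_plus ennreal_mult)
    finally show "ennreal ((norm (f x + g x))\<^sup>2) \<le> 2 * ennreal ((norm (f x))\<^sup>2) + 2 * ennreal ((norm (g x))\<^sup>2)" .
  qed
  also have "\<dots> = 2 * (\<integral>\<^sup>+x. ennreal ((norm (f x))\<^sup>2) \<partial>M) + 2 * (\<integral>\<^sup>+x. ennreal ((norm (g x))\<^sup>2) \<partial>M)"
    by (simp add: nn_integral_add nn_integral_cmult)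
  also have "\<dots> < \<infinity>" using fin by (simp add: ennreal_mult_less_top)
  finally show ?thesis
    unfolding sq_integrable_def by (simp add: strongly_measurable_add[OF sm])
qed

lemma sq_integrable_diff:
  fixes f :: "'m \<Rightarrow> 'a::chilbert_space"
  assumes "sq_integrable M f" "sq_integrable M g" shows "sq_integrable M (\<lambda>x. f x - g x)"
  using sq_integrable_add[OF assms(1) sq_integrable_scaleC[OF assms(2), of "-1"]] by (simp add: scaleC_minus1)

lemma cinner_measurable:
  fixes f :: "'m \<Rightarrow> 'a::chilbert_space"
  assumes "strongly_measurable M f" "strongly_measurable M g"
  shows "(\<lambda>x. cinner (f x) (g x)) \<in> borel_measurable M"
  using strongly_measurable_comp2[OF assms continuous_on_cinner] by (simp add: strongly_measurable_D)

lemma sq_integrable_iff: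
  fixes f :: "'m \<Rightarrow> 'a::real_normed_vector"
  shows "sq_integrable M f \<longleftrightarrow> strongly_measurable M f \<and> integrable M (\<lambda>x. (norm (f x))\<^sup>2)"
proof -
  have "strongly_measurable M f \<Longrightarrow> (\<lambda>x. (norm (f x))\<^sup>2) \<in> borel_measurable M"
    using strongly_measurable_D[of M f] by simp
  then show ?thesis unfolding sq_integrable_def integrable_iff_bounded by auto
qed

lemma cinner_integrable:
  fixes f :: "'m \<Rightarrow> 'a::chilbert_space"
  assumes "sq_integrable M f" "sq_integrable M g"
  shows "integrable M (\<lambda>x. cinner (f x) (g x))"
proof (rule Bochner_Integration.integrable_bound)
  show "integrable M (\<lambda>x. (norm (f x))\<^sup>2 + (norm (g x))\<^sup>2)"
    using assms by (simp add: sq_integrable_iff)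
  show "(\<lambda>x. cinner (f x) (g x)) \<in> borel_measurable M"
    using assms by (simp add: cinner_measurable sq_integrable_def)
  show "AE x in M. norm (cinner (f x) (g x)) \<le> norm ((norm (f x))\<^sup>2 + (norm (g x))\<^sup>2)"
  proof (rule AE_I2)
    fix x
    have "norm (cinner (f x) (g x)) \<le> norm (f x) * norm (g x)" by (rule norm_cinner_le)
    moreover have "2 * (norm (f x) * norm (g x)) \<le> (norm (f x))\<^sup>2 + (norm (g x))\<^sup>2"
      using sum_squares_bound[of "norm (f x)" "norm (g x)"] unfolding mult.assoc .
    moreover have "0 \<le> norm (f x) * norm (g x)" by simp
    ultimately have "norm (cinner (f x) (g x)) \<le> (norm (f x))\<^sup>2 + (norm (g x))\<^sup>2"
      by linarith
    then show "norm (cinner (f x) (g x)) \<le> norm ((norm (f x))\<^sup>2 + (norm (g x))\<^sup>2)"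
      by simp
  qed
qed

lemma Re_integral_cinner:
  fixes f :: "'m \<Rightarrow> 'a::chilbert_space"
  assumes "sq_integrable M f"
  shows "Re (\<integral>x. cinner (f x) (f x) \<partial>M) = (\<integral>x. (norm (f x))\<^sup>2 \<partial>M)"
  using integral_Re[OF cinner_integrable[OF assms assms]] by (simp add: norm2_cinner)

lemma sq_integrable_complete:
  fixes f :: "nat \<Rightarrow> 'm \<Rightarrow> 'a::chilbert_space"
  assumes f: "\<And>n. sq_integrable M (f n)"
    and fast: "\<And>n. (\<integral>\<^sup>+x. ennreal ((norm (f (Suc n) x - f n x))\<^sup>2) \<partial>M) \<le> ennreal ((1/16)^n)"
  shows "\<exists>g C. sq_integrable M g \<and> (\<forall>n. (\<integral>\<^sup>+x. ennreal ((norm (f n x - g x))\<^sup>2) \<partial>M) \<le> ennreal (C * (1/4)^n))"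
proof -
  have sm: "strongly_measurable M (f n)" for n using f by (simp add: sq_integrable_def)
  have [measurable]: "f n \<in> borel_measurable M" for n by (rule strongly_measurable_D[OF sm])
  have sd: "strongly_measurable M (\<lambda>x. f m x - f n x)" for m n
    using sq_integrable_diff[OF f[of m] f[of n]] by (simp add: sq_integrable_def)
  have [measurable]: "(\<lambda>x. f m x - f n x) \<in> borel_measurable M" for m n
    by (rule strongly_measurable_D[OF sd])
  define S where "S x = (\<Sum>n. ennreal (4^n * (norm (f (Suc n) x - f n x))\<^sup>2))" for x
  have [measurable]: "S \<in> borel_measurable M" unfolding S_def by measurable
  have "(\<integral>\<^sup>+x. S x \<partial>M) = (\<Sum>n. \<integral>\<^sup>+x. ennreal (4^n * (norm (f (Suc n) x - f n x))\<^sup>2) \<partial>M)"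
    unfolding S_def by (rule nn_integral_suminf) measurable
  also have "\<dots> \<le> (\<Sum>n. ennreal ((1/4)^n))"
  proof (rule suminf_le)
    fix n
    have "(\<integral>\<^sup>+x. ennreal (4^n * (norm (f (Suc n) x - f n x))\<^sup>2) \<partial>M) =
        ennreal (4^n) * (\<integral>\<^sup>+x. ennreal ((norm (f (Suc n) x - f n x))\<^sup>2) \<partial>M)"
      by (subst nn_integral_cmult[symmetric]) (auto simp: ennreal_mult)
    also have "\<dots> \<le> ennreal (4^n) * ennreal ((1/16)^n)" by (rule mult_left_mono[OF fast]) simp
    also have "\<dots> = ennreal ((1/4)^n)"
      by (simp add: ennreal_mult[symmetric] power_mult_distrib[symmetric])
    finally show "(\<integral>\<^sup>+x. ennreal (4^n * (norm (f (Suc n) x - f n x))\<^sup>2) \<partial>M) \<le> ennreal ((1/4)^n)" .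
  qed auto
  also have "\<dots> = ennreal (\<Sum>n. (1/4)^n)" by (rule suminf_ennreal2) (auto intro: summable_geometric)
  finally have SI: "(\<integral>\<^sup>+x. S x \<partial>M) \<le> ennreal (4/3)" by (simp add: suminf_geometric)
  then have "(\<integral>\<^sup>+x. S x \<partial>M) \<noteq> \<infinity>" by (auto simp: top_unique)
  then have AE: "AE x in M. S x \<noteq> \<infinity>" by (intro nn_integral_PInf_AE) auto
  have step: "norm (f (Suc k) x - f k x) \<le> sqrt (enn2real (S x)) * (1/2)^k" if "S x \<noteq> \<infinity>" for k x
  proof -
    have "(\<Sum>n\<in>{k}. ennreal (4^n * (norm (f (Suc n) x - f n x))\<^sup>2)) \<le> S x"
      unfolding S_def by (rule sum_le_suminf) auto
    then have "ennreal (4^k * (norm (f (Suc k) x - f k x))\<^sup>2) \<le> S x"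
      by (simp only: finite.intros sum.insert sum.empty empty_iff not_False_eq_True add_0_right)
    moreover have "S x = ennreal (enn2real (S x))"
      using that by (simp add: ennreal_enn2real_if)
    ultimately have "4^k * (norm (f (Suc k) x - f k x))\<^sup>2 \<le> enn2real (S x)"
      by (metis ennreal_le_iff enn2real_nonneg)
    moreover have "(2::real)^k * 2^k = 4^k" by (simp flip: power_mult_distrib)
    then have "(2^k * norm (f (Suc k) x - f k x))\<^sup>2 = 4^k * (norm (f (Suc k) x - f k x))\<^sup>2"
      by (simp add: power2_eq_square algebra_simps)
    ultimately have "(2^k * norm (f (Suc k) x - f k x))\<^sup>2 \<le> enn2real (S x)" by (simp only:)
    then have "2^k * norm (f (Suc k) x - f k x) \<le> sqrt (enn2real (S x))" by (rule real_le_rsqrt)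
    then show ?thesis by (simp add: field_simps power_divide)
  qed
  have tele: "norm (f (n + j) x - f n x) \<le> 2 * sqrt (enn2real (S x)) * (1/2)^n" if "S x \<noteq> \<infinity>" for n j x
  proof -
    have "norm (f (n + j) x - f n x) \<le> 2 * sqrt (enn2real (S x)) * ((1/2)^n - (1/2)^(n+j))"
    proof (induction j)
      case (Suc j)
      have "norm (f (n + Suc j) x - f n x) \<le> norm (f (Suc (n + j)) x - f (n + j) x) + norm (f (n + j) x - f n x)"
        using norm_triangle_ineq[of "f (Suc (n + j)) x - f (n + j) x" "f (n + j) x - f n x"] by simp
      also have "\<dots> \<le> sqrt (enn2real (S x)) * (1/2)^(n + j) + 2 * sqrt (enn2real (S x)) * ((1/2)^n - (1/2)^(n+j))"
        by (intro add_mono step that Suc.IH)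
      also have "\<dots> = 2 * sqrt (enn2real (S x)) * ((1/2)^n - (1/2)^(n+Suc j))"
        by (simp add: algebra_simps)
      finally show ?case .
    qed simp
    also have "\<dots> \<le> 2 * sqrt (enn2real (S x)) * (1/2)^n" by (intro mult_left_mono) auto
    finally show ?thesis .
  qed
  have conv: "convergent (\<lambda>n. f n x)" if S: "S x \<noteq> \<infinity>" for x
  proof -
    have "Cauchy (\<lambda>n. f n x)"
    proof (rule CauchyI')
      fix e :: real assume "e > 0"
      have "(\<lambda>n. 2 * sqrt (enn2real (S x)) * (1/2)^n) \<longlonglongrightarrow> 2 * sqrt (enn2real (S x)) * 0"
        by (intro tendsto_mult tendsto_const LIMSEQ_power_zero) simp
      then have "eventually (\<lambda>n. 2 * sqrt (enn2real (S x)) * (1/2)^n < e) sequentially"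
        using \<open>e > 0\<close> by (intro order_tendstoD(2)) auto
      then obtain N where N: "\<And>n. n \<ge> N \<Longrightarrow> 2 * sqrt (enn2real (S x)) * (1/2)^n < e"
        by (auto simp: eventually_sequentially)
      have "dist (f m x) (f n x) < e" if mn: "m \<ge> N" "n > m" for m n
      proof -
        obtain j where j: "n = m + j" using mn(2) less_imp_add_positive by blast
        have "norm (f n x - f m x) < e"
          using tele[OF S, of m j] N[OF mn(1)] unfolding j by linarith
        then show ?thesis by (simp add: dist_norm norm_minus_commute)
      qed
      then show "\<exists>M. \<forall>m\<ge>M. \<forall>n>m. dist (f m x) (f n x) < e" by blast
    qed
    then show ?thesis by (rule Cauchy_convergent)
  qed
  define h where "h n x = (if S x \<noteq> \<infinity> then f n x else 0)" for n x
  define g where "g x = (if S x \<noteq> \<infinity> then lim (\<lambda>n. f n x) else 0)" for x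
  have hg: "(\<lambda>n. h n x) \<longlonglongrightarrow> g x" for x
  proof (cases "S x = \<infinity>")
    case True
    then show ?thesis by (simp add: h_def g_def)
  next
    case False
    then show ?thesis using conv[OF False] unfolding h_def g_def convergent_LIMSEQ_iff
      by (simp only: if_True not_False_eq_True)
  qed
  have smh: "strongly_measurable M (h n)" for n
  proof -
    have "h n \<in> borel_measurable M" unfolding h_def by measurable
    moreover obtain D where D: "countable D" "f n ` space M \<subseteq> closure D"
      using sm[of n] unfolding strongly_measurable_def by blast
    have "h n ` space M \<subseteq> closure (insert 0 D)"
    proof -
      have "closure D \<subseteq> closure (insert 0 D)" by (rule closure_mono) auto
      moreover have "0 \<in> closure (insert 0 D)" by (meson closure_subset insertI1 subsetD)
      ultimately show ?thesis unfolding h_def using D(2) by auto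
    qed
    moreover have "countable (insert 0 D)" using D by simp
    ultimately show ?thesis unfolding strongly_measurable_def by blast
  qed
  have smg: "strongly_measurable M g"
    by (rule strongly_measurable_LIMSEQ[OF smh hg])
  have bound: "norm (f n x - g x) \<le> 2 * sqrt (enn2real (S x)) * (1/2)^n" if S: "S x \<noteq> \<infinity>" for n x
  proof (rule LIMSEQ_le_const2)
    have "(\<lambda>j. f j x) \<longlonglongrightarrow> g x" using hg[of x] S by (simp add: h_def)
    then have "(\<lambda>j. f (n + j) x) \<longlonglongrightarrow> g x" by (subst add.commute) (rule LIMSEQ_ignore_initial_segment)
    then show "(\<lambda>j. norm (f n x - f (n + j) x)) \<longlonglongrightarrow> norm (f n x - g x)"
      by (intro tendsto_intros)
    show "\<exists>N. \<forall>j\<ge>N. norm (f n x - f (n + j) x) \<le> 2 * sqrt (enn2real (S x)) * (1/2)^n"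
      using tele[OF S] by (metis norm_minus_commute)
  qed
  have int: "(\<integral>\<^sup>+x. ennreal ((norm (f n x - g x))\<^sup>2) \<partial>M) \<le> ennreal (16/3 * (1/4)^n)" for n
  proof -
    have "(\<integral>\<^sup>+x. ennreal ((norm (f n x - g x))\<^sup>2) \<partial>M) \<le> (\<integral>\<^sup>+x. ennreal (4 * (1/4)^n) * S x \<partial>M)"
    proof (rule nn_integral_mono_AE, use AE in eventually_elim)
      fix x assume S: "S x \<noteq> \<infinity>"
      have "(norm (f n x - g x))\<^sup>2 \<le> (2 * sqrt (enn2real (S x)) * (1/2)^n)\<^sup>2"
        by (rule power_mono[OF bound[OF S]]) simp
      also have "\<dots> = 4 * (1/4)^n * enn2real (S x)"
      proof -
        have "((1/2::real)^n)\<^sup>2 = (1/4)^n"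
          by (simp add: power2_eq_square flip: power_mult_distrib)
        then show ?thesis by (simp add: power_mult_distrib)
      qed
      finally have "ennreal ((norm (f n x - g x))\<^sup>2) \<le> ennreal (4 * (1/4)^n * enn2real (S x))"
        by (rule ennreal_leI)
      also have "\<dots> = ennreal (4 * (1/4)^n) * S x"
        using S by (simp add: ennreal_mult ennreal_enn2real_if)
      finally show "ennreal ((norm (f n x - g x))\<^sup>2) \<le> ennreal (4 * (1/4)^n) * S x" .
    qed
    also have "\<dots> = ennreal (4 * (1/4)^n) * (\<integral>\<^sup>+x. S x \<partial>M)" by (rule nn_integral_cmult) simp
    also have "\<dots> \<le> ennreal (4 * (1/4)^n) * ennreal (4/3)" by (rule mult_left_mono[OF SI]) simp
    also have "\<dots> = ennreal (16/3 * (1/4)^n)" by (simp add: ennreal_mult[symmetric])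
    finally show ?thesis .
  qed
  have "strongly_measurable M (\<lambda>x. f 0 x + (-1) *\<^sub>C g x)"
    by (intro strongly_measurable_add sm strongly_measurable_comp[OF smg continuous_on_scaleC])
  then have "strongly_measurable M (\<lambda>x. f 0 x - g x)"
    by (simp only: scaleC_minus1 add_uminus_conv_diff)
  moreover have "(\<integral>\<^sup>+x. ennreal ((norm (f 0 x - g x))\<^sup>2) \<partial>M) < \<infinity>"
    using int[of 0] by (rule le_less_trans) simp
  ultimately have "sq_integrable M (\<lambda>x. f 0 x - g x)" unfolding sq_integrable_def ..
  from sq_integrable_diff[OF f[of 0] this] have "sq_integrable M g" by simp
  with int show ?thesis by blast
qed

definition L2_rel :: "(real \<Rightarrow> 'a::chilbert_space) \<Rightarrow> (real \<Rightarrow> 'a) \<Rightarrow> bool"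
  where "L2_rel f g \<longleftrightarrow> sq_integrable halfline f \<and> sq_integrable halfline g \<and> (AE s in halfline. f s = g s)"

quotient_type (overloaded) 'a L2 = "real \<Rightarrow> 'a::chilbert_space" / partial: L2_rel
proof (rule part_equivpI)
  show "\<exists>f::real \<Rightarrow> 'a. L2_rel f f" by (rule exI[of _ "\<lambda>s. 0"]) (simp add: L2_rel_def sq_integrable_zero)
  show "symp (L2_rel :: (real \<Rightarrow> 'a) \<Rightarrow> _)" by (rule sympI) (auto simp: L2_rel_def eq_commute)
  show "transp (L2_rel :: (real \<Rightarrow> 'a) \<Rightarrow> _)" by (rule transpI) (auto simp: L2_rel_def elim: AE_mp)
qed

lemma L2_rel_refl: "L2_rel f f \<longleftrightarrow> sq_integrable halfline f"
  by (simp add: L2_rel_def)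

instantiation L2 :: (chilbert_space) cinner_space
begin

lift_definition zero_L2 :: "'a L2" is "\<lambda>s. 0" by (simp add: L2_rel_def sq_integrable_zero)
lift_definition plus_L2 :: "'a L2 \<Rightarrow> 'a L2 \<Rightarrow> 'a L2" is "\<lambda>f g s. f s + g s"
  unfolding L2_rel_def by (auto simp: sq_integrable_add elim: AE_mp)
lift_definition minus_L2 :: "'a L2 \<Rightarrow> 'a L2 \<Rightarrow> 'a L2" is "\<lambda>f g s. f s - g s"
  unfolding L2_rel_def by (auto simp: sq_integrable_diff elim: AE_mp)
lift_definition scaleC_L2 :: "complex \<Rightarrow> 'a L2 \<Rightarrow> 'a L2" is "\<lambda>c f s. c *\<^sub>C f s"
  unfolding L2_rel_def by (auto simp: sq_integrable_scaleC elim: AE_mp)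
lift_definition cinner_L2 :: "'a L2 \<Rightarrow> 'a L2 \<Rightarrow> complex" is "\<lambda>f g. \<integral>s. cinner (f s) (g s) \<partial>halfline"
proof -
  fix f f' g g' :: "real \<Rightarrow> 'a"
  assume "L2_rel f f'" "L2_rel g g'"
  then show "(\<integral>s. cinner (f s) (g s) \<partial>halfline) = (\<integral>s. cinner (f' s) (g' s) \<partial>halfline)"
    unfolding L2_rel_def by (intro integral_cong_AE cinner_measurable) (auto simp: sq_integrable_def elim: AE_mp)
qed
definition uminus_L2 :: "'a L2 \<Rightarrow> 'a L2"
  where "uminus_L2 x = 0 - x"
definition scaleR_L2 :: "real \<Rightarrow> 'a L2 \<Rightarrow> 'a L2"
  where "scaleR_L2 r x = complex_of_real r *\<^sub>C x"

instance
proof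
  note closed = sq_integrable_zero sq_integrable_add sq_integrable_diff sq_integrable_scaleC
  fix x y z :: "'a L2" and b c :: complex and r s :: real
  show "x + y + z = x + (y + z)" by transfer (simp add: L2_rel_def closed add.assoc)
  show "x + y = y + x" by transfer (simp add: L2_rel_def closed add.commute)
  show "0 + x = x" by transfer (simp add: L2_rel_def closed)
  show "- x + x = 0" unfolding uminus_L2_def by transfer (simp add: L2_rel_def closed)
  show "x - y = x + - y" unfolding uminus_L2_def by transfer (simp add: L2_rel_def closed)
  show "r *\<^sub>R (x + y) = r *\<^sub>R x + r *\<^sub>R y"
    unfolding scaleR_L2_def by transfer (simp add: L2_rel_def closed scaleC_add_right)
  show "(r + s) *\<^sub>R x = r *\<^sub>R x + s *\<^sub>R x"
    unfolding scaleR_L2_def by transfer (simp add: L2_rel_def closed scaleC_add_left)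
  show "r *\<^sub>R s *\<^sub>R x = (r * s) *\<^sub>R x"
    unfolding scaleR_L2_def by transfer (simp add: L2_rel_def closed scaleC_scaleC)
  show "1 *\<^sub>R x = x" unfolding scaleR_L2_def by transfer (simp add: L2_rel_def closed)
  show "c *\<^sub>C (x + y) = c *\<^sub>C x + c *\<^sub>C y"
    by transfer (simp add: L2_rel_def closed scaleC_add_right)
  show "(b + c) *\<^sub>C x = b *\<^sub>C x + c *\<^sub>C x"
    by transfer (simp add: L2_rel_def closed scaleC_add_left)
  show "b *\<^sub>C c *\<^sub>C x = (b * c) *\<^sub>C x"
    by transfer (simp add: L2_rel_def closed scaleC_scaleC)
  show "r *\<^sub>R x = complex_of_real r *\<^sub>C x" by (rule scaleR_L2_def)
  show "cinner x y = cnj (cinner y x)"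
    by transfer (simp only: Bochner_Integration.integral_cnj[symmetric] cinner_commute[symmetric])
  show "cinner x (y + z) = cinner x y + cinner x z"
    by transfer (simp only: L2_rel_def cinner_add_right Bochner_Integration.integral_add cinner_integrable)
  show "cinner x (c *\<^sub>C y) = c * cinner x y"
    by transfer (simp only: cinner_scaleC_right integral_mult_right_zero)
  show "0 \<le> Re (cinner x x)"
    by transfer (simp add: L2_rel_def Re_integral_cinner)
  show "cinner x x = 0 \<Longrightarrow> x = 0"
  proof transfer
    fix f :: "real \<Rightarrow> 'a" assume f: "L2_rel f f" and 0: "(\<integral>s. cinner (f s) (f s) \<partial>halfline) = 0"
    have sq: "sq_integrable halfline f" using f by (simp add: L2_rel_def)
    then have "integrable halfline (\<lambda>s. (norm (f s))\<^sup>2)" by (simp add: sq_integrable_iff)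
    moreover have "(\<integral>s. (norm (f s))\<^sup>2 \<partial>halfline) = 0"
      using Re_integral_cinner[OF sq] 0 by simp
    ultimately have "AE s in halfline. (norm (f s))\<^sup>2 = 0"
      by (subst (asm) integral_nonneg_eq_0_iff_AE) auto
    then show "L2_rel f (\<lambda>s. 0)"
      using sq by (simp add: L2_rel_def sq_integrable_zero)
  qed
qed

end

instantiation L2 :: (chilbert_space) real_normed_vector
begin

definition norm_L2 :: "'a L2 \<Rightarrow> real"
  where "norm_L2 x = sqrt (Re (cinner x x))"
definition dist_L2 :: "'a L2 \<Rightarrow> 'a L2 \<Rightarrow> real"
  where "dist_L2 x y = norm (x - y)"
definition sgn_L2 :: "'a L2 \<Rightarrow> 'a L2"
  where "sgn_L2 x = inverse (norm x) *\<^sub>R x"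
definition uniformity_L2 :: "('a L2 \<times> 'a L2) filter"
  where "uniformity_L2 = (INF e\<in>{0 <..}. principal {(x, y). dist x y < e})"
definition open_L2 :: "'a L2 set \<Rightarrow> bool"
  where "open_L2 U \<longleftrightarrow> (\<forall>x\<in>U. eventually (\<lambda>(x', y). x' = x \<longrightarrow> y \<in> U) uniformity)"

instance
proof
  fix x y :: "'a L2" and r :: real and U :: "'a L2 set"
  show "dist x y = norm (x - y)" by (rule dist_L2_def)
  show "sgn x = inverse (norm x) *\<^sub>R x" by (rule sgn_L2_def)
  show "uniformity = (INF e\<in>{0 <..}. principal {(x, y). dist (x::'a L2) y < e})"
    by (rule uniformity_L2_def)
  show "open U \<longleftrightarrow> (\<forall>x\<in>U. eventually (\<lambda>(x', y). x' = x \<longrightarrow> y \<in> U) uniformity)"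
    by (rule open_L2_def)
  show "norm x = 0 \<longleftrightarrow> x = 0" unfolding norm_L2_def by (rule sqrt_cinner_eq_0)
  show "norm (x + y) \<le> norm x + norm y" unfolding norm_L2_def by (rule cinner_triangle)
  show "norm (r *\<^sub>R x) = \<bar>r\<bar> * norm x" unfolding norm_L2_def by (rule sqrt_cinner_scaleR)
qed

end

instance L2 :: (chilbert_space) banach
proof
  fix X :: "nat \<Rightarrow> 'a L2"
  assume X: "Cauchy X"
  have "\<forall>n. \<exists>M. \<forall>k\<ge>M. \<forall>l\<ge>M. norm (X k - X l) < (1/4)^n"
    using X unfolding Cauchy_def dist_norm by simp
  then obtain N where N: "\<And>n k l. k \<ge> N n \<Longrightarrow> l \<ge> N n \<Longrightarrow> norm (X k - X l) < (1/4)^n" by metis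
  define r where "r n = n + (\<Sum>i\<le>n. N i)" for n
  have r: "strict_mono r" by (rule strict_mono_Suc_iff[THEN iffD2]) (simp add: r_def)
  have rN: "N n \<le> r n" for n
    using member_le_sum[of n "{..n}" N] by (simp add: r_def)
  have fast: "norm (X (r (Suc n)) - X (r n)) < (1/4)^n" for n
    using N[of n "r (Suc n)" "r n"] rN[of n] strict_mono_leD[OF r, of n "Suc n"] by simp
  define f where "f n = rep_L2 (X (r n))" for n
  have f: "sq_integrable halfline (f n)" and X_f: "X (r n) = abs_L2 (f n)" for n
    unfolding f_def L2_rel_refl[symmetric]
    by (simp_all add: Quotient3_rep_reflp[OF Quotient3_L2] Quotient3_abs_rep[OF Quotient3_L2])
  have nrm: "(norm (abs_L2 g - abs_L2 h))\<^sup>2 = (\<integral>s. (norm (g s - h s))\<^sup>2 \<partial>halfline)"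
    if "sq_integrable halfline g" "sq_integrable halfline h" for g h :: "real \<Rightarrow> 'a"
  proof -
    have "(norm (abs_L2 g - abs_L2 h))\<^sup>2 = Re (cinner (abs_L2 g - abs_L2 h) (abs_L2 g - abs_L2 h))"
      unfolding norm_L2_def by (simp add: cinner_ge_zero)
    also have "\<dots> = Re (\<integral>s. cinner (g s - h s) (g s - h s) \<partial>halfline)"
      using that by (simp add: minus_L2.abs_eq cinner_L2.abs_eq L2_rel_refl sq_integrable_diff)
    finally show ?thesis using that by (simp add: Re_integral_cinner sq_integrable_diff)
  qed
  have nn: "(\<integral>\<^sup>+s. ennreal ((norm (g s - h s))\<^sup>2) \<partial>halfline) = ennreal ((norm (abs_L2 g - abs_L2 h))\<^sup>2)"
    if "sq_integrable halfline g" "sq_integrable halfline h" for g h :: "real \<Rightarrow> 'a"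
    unfolding nrm[OF that]
    using sq_integrable_diff[OF that] by (intro nn_integral_eq_integral) (auto simp: sq_integrable_iff)
  have "(\<integral>\<^sup>+s. ennreal ((norm (f (Suc n) s - f n s))\<^sup>2) \<partial>halfline) \<le> ennreal ((1/16)^n)" for n
  proof -
    have "(norm (X (r (Suc n)) - X (r n)))\<^sup>2 \<le> ((1/4)^n)\<^sup>2"
      using fast[of n] by (intro power_mono) auto
    also have "((1/4::real)^n)\<^sup>2 = (1/16)^n" by (simp add: power2_eq_square flip: power_mult_distrib)
    finally show ?thesis unfolding nn[OF f f] X_f[symmetric] by (rule ennreal_leI)
  qed
  from sq_integrable_complete[OF f this] obtain g C where g: "sq_integrable halfline g"
    and C: "\<And>n. (\<integral>\<^sup>+s. ennreal ((norm (f n s - g s))\<^sup>2) \<partial>halfline) \<le> ennreal (C * (1/4)^n)" by blast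
  have "(norm (X (r n) - abs_L2 g))\<^sup>2 \<le> max C 0 * (1/4)^n" for n
  proof -
    have "ennreal ((norm (X (r n) - abs_L2 g))\<^sup>2) \<le> ennreal (C * (1/4)^n)"
      using C[of n] unfolding nn[OF f g] X_f[symmetric] .
    also have "\<dots> \<le> ennreal (max C 0 * (1/4)^n)" by (intro ennreal_leI mult_right_mono) auto
    finally show ?thesis by (subst (asm) ennreal_le_iff) auto
  qed
  note le = this
  have "(\<lambda>n. max C 0 * (1/4)^n) \<longlonglongrightarrow> max C 0 * 0"
    by (intro tendsto_mult tendsto_const LIMSEQ_power_zero) simp
  then have lim0: "(\<lambda>n. max C 0 * (1/4)^n) \<longlonglongrightarrow> 0" by (simp only: mult_zero_right)
  have "(\<lambda>n. (norm (X (r n) - abs_L2 g))\<^sup>2) \<longlonglongrightarrow> 0"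
  proof (rule tendsto_sandwich[OF _ _ tendsto_const lim0])
    show "\<forall>\<^sub>F n in sequentially. 0 \<le> (norm (X (r n) - abs_L2 g))\<^sup>2" by simp
    show "\<forall>\<^sub>F n in sequentially. (norm (X (r n) - abs_L2 g))\<^sup>2 \<le> max C 0 * (1/4)^n"
      by (rule always_eventually) (blast intro: le)
  qed
  then have "(\<lambda>n. sqrt ((norm (X (r n) - abs_L2 g))\<^sup>2)) \<longlonglongrightarrow> sqrt 0" by (rule tendsto_real_sqrt)
  then have "(\<lambda>n. norm (X (r n) - abs_L2 g)) \<longlonglongrightarrow> 0" by simp
  then have "(X \<circ> r) \<longlonglongrightarrow> abs_L2 g"
    unfolding tendsto_norm_zero_iff LIM_zero_iff o_def .
  from Cauchy_converges_subseq[OF X r this] show "convergent X" by (auto simp: convergent_def)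
qed

instance L2 :: (chilbert_space) chilbert_space
  by standard (rule norm_L2_def)

section \<open>Parseval, elementary tensors and exponential vectors\<close>

lemma bessel:
  fixes x :: "'a::chilbert_space"
  assumes F: "finite F" "F \<subseteq> onb"
  shows "(norm (x - (\<Sum>e\<in>F. cinner e x *\<^sub>C e)))\<^sup>2 = (norm x)\<^sup>2 - (\<Sum>e\<in>F. (cmod (cinner e x))\<^sup>2)"
    "(norm (\<Sum>e\<in>F. cinner e x *\<^sub>C e))\<^sup>2 = (\<Sum>e\<in>F. (cmod (cinner e x))\<^sup>2)"
proof -
  let ?p = "\<Sum>e\<in>F. cinner e x *\<^sub>C e"
  have on: "cinner e e' = (if e = e' then 1 else 0)" if "e \<in> F" "e' \<in> F" for e e'
    using onb(1) F that unfolding orthonormal_def by blast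
  have c1: "cinner ?p x = complex_of_real (\<Sum>e\<in>F. (cmod (cinner e x))\<^sup>2)"
    unfolding cinner_sum_left cinner_scaleC_left of_real_sum complex_norm_square
    by (rule sum.cong) (auto simp: mult.commute)
  have c2: "cinner e ?p = cinner e x" if "e \<in> F" for e
  proof -
    have "cinner e ?p = (\<Sum>e'\<in>F. if e' = e then cinner e x else 0)"
      unfolding cinner_sum_right cinner_scaleC_right
      by (rule sum.cong) (use on that in auto)
    then show ?thesis using F(1) that by simp
  qed
  have "cinner ?p ?p = (\<Sum>e\<in>F. cnj (cinner e x) * cinner e ?p)"
    by (subst cinner_sum_left) (simp add: cinner_scaleC_left)
  also have "\<dots> = cinner ?p x"
    unfolding cinner_sum_left[of _ _ x] cinner_scaleC_left by (rule sum.cong) (auto simp: c2)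
  finally have c3: "cinner ?p ?p = cinner ?p x" .
  have c4: "cinner x ?p = cinner ?p x"
    by (subst cinner_commute) (simp add: c1)
  show "(norm ?p)\<^sup>2 = (\<Sum>e\<in>F. (cmod (cinner e x))\<^sup>2)"
    unfolding norm2_cinner c3 c1 by simp
  show "(norm (x - ?p))\<^sup>2 = (norm x)\<^sup>2 - (\<Sum>e\<in>F. (cmod (cinner e x))\<^sup>2)"
    unfolding norm2_cinner cinner_diff_left cinner_diff_right c3 c4 c1 by simp
qed

text \<open>The coordinates of a vector with respect to \<^const>\<open>onb\<close>, extended by 0.\<close>

definition coords :: "'a::chilbert_space \<Rightarrow> 'a \<Rightarrow> complex"
  where "coords x e = (if e \<in> onb then cinner e x else 0)"

lemma coords_sum_le: "finite F \<Longrightarrow> (\<Sum>e\<in>F. (norm (coords x e))\<^sup>2) \<le> (norm x)\<^sup>2"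
proof -
  assume F: "finite F"
  have "(\<Sum>e\<in>F. (norm (coords x e))\<^sup>2) = (\<Sum>e\<in>F \<inter> onb. (cmod (cinner e x))\<^sup>2)"
    by (rule sum.mono_neutral_cong_right) (use F in \<open>auto simp: coords_def\<close>)
  also have "\<dots> \<le> (norm x)\<^sup>2"
    using bessel(1)[of "F \<inter> onb" x] F
      zero_le_power2[of "norm (x - (\<Sum>e\<in>F \<inter> onb. cinner e x *\<^sub>C e))"] by simp
  finally show ?thesis .
qed

lemma sq_summable_coords: "sq_summable (coords x)"
  unfolding sq_summable_def
  by (rule nonneg_bdd_above_summable_on) (auto intro!: bdd_aboveI[where M="(norm x)\<^sup>2"] coords_sum_le)

lemma parseval_norm: "(\<Sum>\<^sub>\<infinity>e. (norm (coords x e))\<^sup>2) = (norm x)\<^sup>2"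
proof (rule antisym)
  let ?s = "\<Sum>\<^sub>\<infinity>e. (norm (coords x e))\<^sup>2"
  have sm: "(\<lambda>e. (norm (coords x e))\<^sup>2) summable_on UNIV"
    using sq_summable_coords[of x] by (simp add: sq_summable_def)
  show "?s \<le> (norm x)\<^sup>2"
    by (rule infsum_le_finite_sums[OF sm]) (simp add: coords_sum_le)
  have "\<exists>F. finite F \<and> ?s - 1 / Suc n < (\<Sum>e\<in>F. (norm (coords x e))\<^sup>2)" for n
  proof (rule ccontr)
    assume "\<nexists>F. finite F \<and> ?s - 1 / Suc n < (\<Sum>e\<in>F. (norm (coords x e))\<^sup>2)"
    then have "?s \<le> ?s - 1 / Suc n" by (intro infsum_le_finite_sums[OF sm]) force
    then show False by (simp add: field_simps)
  qed
  then obtain G where G: "\<And>n. finite (G n)" "\<And>n. ?s - 1 / Suc n < (\<Sum>e\<in>G n. (norm (coords x e))\<^sup>2)" by metis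
  define F where "F n = (\<Union>k\<le>n. G k) \<inter> onb" for n
  have F: "finite (F n)" "F n \<subseteq> onb" for n using G unfolding F_def by auto
  have mono: "F m \<subseteq> F n" if "m \<le> n" for m n using that unfolding F_def by force
  have Fs: "?s - 1 / Suc n < (\<Sum>e\<in>F n. (cmod (cinner e x))\<^sup>2)" for n
  proof -
    have "(\<Sum>e\<in>G n. (norm (coords x e))\<^sup>2) = (\<Sum>e\<in>G n \<inter> onb. (cmod (cinner e x))\<^sup>2)"
      by (rule sum.mono_neutral_cong_right) (use G in \<open>auto simp: coords_def\<close>)
    also have "\<dots> \<le> (\<Sum>e\<in>F n. (cmod (cinner e x))\<^sup>2)"
      by (rule sum_mono2) (use F in \<open>auto simp: F_def\<close>)
    finally show ?thesis using G(2)[of n] by linarith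
  qed
  have fin_le: "(\<Sum>e\<in>H. (cmod (cinner e x))\<^sup>2) \<le> ?s" if "finite H" "H \<subseteq> onb" for H
  proof -
    have "(\<Sum>e\<in>H. (cmod (cinner e x))\<^sup>2) = (\<Sum>e\<in>H. (norm (coords x e))\<^sup>2)"
      by (rule sum.cong) (use that in \<open>auto simp: coords_def\<close>)
    also have "\<dots> \<le> ?s" by (rule finite_sum_le_infsum[OF sm]) (use that in auto)
    finally show ?thesis .
  qed
  define y where "y n = (\<Sum>e\<in>F n. cinner e x *\<^sub>C e)" for n
  have yd: "(norm (y n - y m))\<^sup>2 < 1 / Suc m" if "m \<le> n" for m n
  proof -
    have "y n - y m = (\<Sum>e\<in>F n - F m. cinner e x *\<^sub>C e)"
      unfolding y_def using sum.subset_diff[OF mono[OF that] F(1), of "\<lambda>e. cinner e x *\<^sub>C e"] by simp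
    then have "(norm (y n - y m))\<^sup>2 = (\<Sum>e\<in>F n - F m. (cmod (cinner e x))\<^sup>2)"
      using bessel(2)[of "F n - F m" x] F[of n] by auto
    also have "\<dots> = (\<Sum>e\<in>F n. (cmod (cinner e x))\<^sup>2) - (\<Sum>e\<in>F m. (cmod (cinner e x))\<^sup>2)"
      by (rule sum_diff[OF F(1) mono[OF that]])
    also have "\<dots> < 1 / Suc m" using Fs[of m] fin_le[OF F(1)[of n] F(2)[of n]] by linarith
    finally show ?thesis .
  qed
  have "Cauchy y"
  proof (rule metric_CauchyI)
    fix e :: real assume "e > 0"
    then obtain N where N: "1 / real (Suc N) < (e/2)\<^sup>2"
      using reals_Archimedean[of "(e/2)\<^sup>2"] by (auto simp: inverse_eq_divide)
    have *: "norm (y n - y N) < e/2" if "n \<ge> N" for n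
      using yd[OF that] N \<open>e > 0\<close> by (intro power2_less_imp_less[of _ "e/2"]) auto
    have "dist (y m) (y n) < e" if "m \<ge> N" "n \<ge> N" for m n
      using *[OF that(1)] *[OF that(2)] dist_triangle2[of "y m" "y n" "y N"] by (simp add: dist_norm)
    then show "\<exists>M. \<forall>m\<ge>M. \<forall>n\<ge>M. dist (y m) (y n) < e" by blast
  qed
  then obtain l where l: "y \<longlonglongrightarrow> l" using Cauchy_convergent convergent_def by blast
  have lim_cinner: "(\<lambda>n. cinner e (y n)) \<longlonglongrightarrow> cinner e l" for e
  proof -
    have "continuous_on UNIV (\<lambda>v::'a. cinner (fst (e, v)) (snd (e, v)))"
      by (rule continuous_on_compose2[OF continuous_on_cinner])
        (auto intro: continuous_on_Pair continuous_on_const continuous_on_id)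
    then show ?thesis using l by (simp add: continuous_on_tendsto_compose[of UNIV "cinner e"])
  qed
  have "cinner e (x - l) = 0" if e: "e \<in> onb" for e
  proof -
    have on: "cinner e e' = (if e = e' then 1 else 0)" if "e' \<in> onb" for e'
      using onb(1) e that unfolding orthonormal_def by blast
    have ey: "cinner e (y n) = (if e \<in> F n then cinner e x else 0)" for n
    proof -
      have "cinner e (y n) = (\<Sum>e'\<in>F n. if e' = e then cinner e x else 0)"
        unfolding y_def cinner_sum_right cinner_scaleC_right
        by (rule sum.cong) (use on F(2)[of n] in auto)
      then show ?thesis using F(1)[of n] by simp
    qed
    show ?thesis
    proof (cases "\<exists>N. e \<in> F N")
      case True
      then obtain N where "e \<in> F N" by blast
      then have "\<And>n. n \<ge> N \<Longrightarrow> cinner e (y n) = cinner e x" using mono ey by (metis subsetD)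
      then have "(\<lambda>n. cinner e (y n)) \<longlonglongrightarrow> cinner e x"
        by (intro tendsto_eventually) (auto simp: eventually_sequentially)
      then have "cinner e l = cinner e x" using lim_cinner LIMSEQ_unique by blast
      then show ?thesis by (simp add: cinner_diff_right)
    next
      case False
      then have "(\<lambda>n. cinner e (y n)) = (\<lambda>n. 0)" by (simp add: ey)
      then have l0: "cinner e l = 0" using lim_cinner[of e] by (simp add: LIMSEQ_const_iff)
      have "(cmod (cinner e x))\<^sup>2 \<le> 1 / Suc n" for n
      proof -
        have "(cmod (cinner e x))\<^sup>2 + (\<Sum>e\<in>F n. (cmod (cinner e x))\<^sup>2) \<le> ?s"
          using fin_le[of "insert e (F n)"] F[of n] e False by simp
        then show ?thesis using Fs[of n] by linarith
      qed
      then have "(cmod (cinner e x))\<^sup>2 \<le> 0"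
        by (intro LIMSEQ_le_const[OF LIMSEQ_inverse_real_of_nat]) (auto simp: inverse_eq_divide)
      then show ?thesis using l0 by (simp add: cinner_diff_right)
    qed
  qed
  then have "x - l = 0" by (rule onb(2))
  then have "y \<longlonglongrightarrow> x" using l by simp
  then have "(\<lambda>n. (norm (y n))\<^sup>2) \<longlonglongrightarrow> (norm x)\<^sup>2" by (intro tendsto_intros)
  moreover have "(norm (y n))\<^sup>2 \<le> ?s" for n
    using bessel(2)[OF F(1)[of n] F(2)[of n], of x] fin_le[OF F(1)[of n] F(2)[of n]] unfolding y_def by simp
  ultimately show "(norm x)\<^sup>2 \<le> ?s" by (intro LIMSEQ_le_const2) auto
qed

lemma coords_add: "coords (x + y) = (\<lambda>e. coords x e + coords y e)"
  by (rule ext) (simp add: coords_def cinner_add_right)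

lemma coords_scaleC: "coords (c *\<^sub>C x) = (\<lambda>e. c *\<^sub>C coords x e)"
  by (rule ext) (simp add: coords_def cinner_scaleC_right scaleC_complex_def)

lemma parseval: "l2_cinner (coords x) (coords y) = cinner x y"
proof -
  note sq = sq_summable_coords
  have nr: "Re (l2_cinner (coords z) (coords z)) = Re (cinner z z)" for z :: 'a
    using parseval_norm[of z] Re_l2_cinner[OF sq, of z] by (simp add: norm2_cinner)
  have l2_add_left: "l2_cinner (\<lambda>e. coords u e + coords v e) (coords w) =
      l2_cinner (coords u) (coords w) + l2_cinner (coords v) (coords w)" for u v w :: 'a
    unfolding l2_cinner_commute[of _ "coords w"] l2_cinner_add_right[OF sq sq sq] by simp
  have re: "Re (l2_cinner (coords u) (coords v)) = Re (cinner u v)" for u v :: 'a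
  proof -
    have "Re (l2_cinner (coords (u + v)) (coords (u + v))) = Re (l2_cinner (coords u) (coords u)) +
        2 * Re (l2_cinner (coords u) (coords v)) + Re (l2_cinner (coords v) (coords v))"
      using l2_cinner_add_right[OF sq_summable_coords[of "u + v"] sq sq, of u v]
        l2_add_left[of u v u] l2_add_left[of u v v] l2_cinner_commute[of "coords v" "coords u"]
      by (simp add: coords_add)
    moreover have "Re (cinner (u + v) (u + v)) = Re (cinner u u) + 2 * Re (cinner u v) + Re (cinner v v)"
      using cinner_commute[of v u] by (simp add: cinner_add_left cinner_add_right)
    ultimately show ?thesis using nr[of u] nr[of v] nr[of "u + v"] by simp
  qed
  have "Im (l2_cinner (coords x) (coords y)) = - Re (l2_cinner (coords x) (coords (\<i> *\<^sub>C y)))"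
    unfolding coords_scaleC l2_cinner_scaleC_right by simp
  also have "\<dots> = Im (cinner x y)" unfolding re by (simp add: cinner_scaleC_right)
  finally show ?thesis using re by (simp add: complex_eq_iff)
qed

definition tensor :: "'a::chilbert_space \<Rightarrow> 'b::chilbert_space \<Rightarrow> ('a, 'b) htensor"
  where "tensor u v = Abs_htensor (\<lambda>e. coords u e *\<^sub>C v)"

lemma Rep_tensor: "Rep_htensor (tensor u v) = (\<lambda>e. coords u e *\<^sub>C v)"
proof -
  have "sq_summable (\<lambda>e. coords u e *\<^sub>C v)"
    using sq_summable_coords[of u]
    by (simp add: sq_summable_def norm_scaleC power_mult_distrib summable_on_cmult_left)
  then show ?thesis unfolding tensor_def
    by (intro Abs_htensor_inverse) (auto simp: coords_def)
qed

lemma cinner_tensor: "cinner (tensor u v) (tensor u' v') = cinner u u' * cinner v v'"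
proof -
  have "cinner (tensor u v) (tensor u' v') = (\<Sum>\<^sub>\<infinity>e. cinner (coords u e) (coords u' e) * cinner v v')"
    unfolding cinner_htensor.rep_eq Rep_tensor l2_cinner_def
    by (rule infsum_cong) (simp add: cinner_scaleC_left cinner_scaleC_right cinner_complex_def)
  also have "\<dots> = l2_cinner (coords u) (coords u') * cinner v v'"
    unfolding l2_cinner_def by (rule infsum_cmult_left')
  finally show ?thesis by (simp add: parseval)
qed

lemma has_sum_lists_length:
  fixes p :: "'e \<Rightarrow> 'c::{real_normed_field,banach}"
  assumes p: "(\<lambda>e. norm (p e)) summable_on UNIV"
  shows "((\<lambda>l. prod_list (map p l)) has_sum (\<Sum>\<^sub>\<infinity>e. p e)^n) {l. length l = n} \<and>
    ((\<lambda>l. norm (prod_list (map p l))) has_sum (\<Sum>\<^sub>\<infinity>e. norm (p e))^n) {l. length l = n}"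
proof (induction n)
  case 0
  have "{l::'e list. length l = 0} = {[]}" by auto
  then show ?case by (simp add: has_sum_finite_iff)
next
  case (Suc n)
  let ?L = "{l::'e list. length l = n}" and ?S = "\<Sum>\<^sub>\<infinity>e. norm (p e)"
  have sum_p: "p summable_on UNIV" using p by (rule abs_summable_summable)
  have bij: "bij_betw (\<lambda>(e, l). e # l) (UNIV \<times> ?L) {l. length l = Suc n}"
    by (auto simp: bij_betw_def inj_on_def length_Suc_conv image_iff)
  have n1: "((\<lambda>l. norm (p e) * norm (prod_list (map p l))) has_sum norm (p e) * ?S^n) ?L" for e
    by (rule has_sum_cmult_right) (use Suc.IH in simp)
  have n2: "((\<lambda>e. norm (p e) * ?S^n) has_sum ?S * ?S^n) UNIV"
    using p by (intro has_sum_cmult_left has_sum_infsum)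
  have n3: "(\<lambda>(e, l). norm (p e) * norm (prod_list (map p l))) summable_on UNIV \<times> ?L"
    by (rule summable_on_SigmaI[where g = "\<lambda>e. norm (p e) * ?S^n"])
      (use n1 n2 in \<open>auto simp: summable_on_def\<close>)
  have N: "((\<lambda>(e, l). norm (p e) * norm (prod_list (map p l))) has_sum ?S * ?S^n) (UNIV \<times> ?L)"
    by (rule has_sum_SigmaI[OF _ n2 n3]) (use n1 in simp)
  have c3: "(\<lambda>(e, l). p e * prod_list (map p l)) summable_on UNIV \<times> ?L"
  proof (rule abs_summable_summable)
    have "(\<lambda>x. norm (case x of (e, l) \<Rightarrow> p e * prod_list (map p l))) =
        (\<lambda>(e, l). norm (p e) * norm (prod_list (map p l)))"
      by (auto simp: norm_mult)
    then show "(\<lambda>x. norm (case x of (e, l) \<Rightarrow> p e * prod_list (map p l))) summable_on UNIV \<times> ?L"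
      using n3 by simp
  qed
  have c1: "((\<lambda>l. p e * prod_list (map p l)) has_sum p e * (\<Sum>\<^sub>\<infinity>e. p e)^n) ?L" for e
    by (rule has_sum_cmult_right) (use Suc.IH in simp)
  have c2: "((\<lambda>e. p e * (\<Sum>\<^sub>\<infinity>e. p e)^n) has_sum (\<Sum>\<^sub>\<infinity>e. p e) * (\<Sum>\<^sub>\<infinity>e. p e)^n) UNIV"
    using sum_p by (intro has_sum_cmult_left has_sum_infsum)
  have C: "((\<lambda>(e, l). p e * prod_list (map p l)) has_sum (\<Sum>\<^sub>\<infinity>e. p e) * (\<Sum>\<^sub>\<infinity>e. p e)^n) (UNIV \<times> ?L)"
    by (rule has_sum_SigmaI[OF _ c2 c3]) (use c1 in simp)
  show ?case
    using C N has_sum_reindex_bij_betw[OF bij, of "\<lambda>l. prod_list (map p l)"]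
      has_sum_reindex_bij_betw[OF bij, of "\<lambda>l. norm (prod_list (map p l))"]
    by (simp add: case_prod_unfold norm_mult)
qed

lemma has_sum_lists_exp:
  fixes p :: "'e \<Rightarrow> 'c::{real_normed_field,banach}"
  assumes p: "(\<lambda>e. norm (p e)) summable_on UNIV"
  shows "((\<lambda>l. prod_list (map p l) / fact (length l)) has_sum exp (\<Sum>\<^sub>\<infinity>e. p e)) UNIV"
    "(\<lambda>l. norm (prod_list (map p l) / fact (length l))) summable_on UNIV"
proof -
  let ?A = "Sigma UNIV (\<lambda>n. {l::'e list. length l = n})" and ?S = "\<Sum>\<^sub>\<infinity>e. norm (p e)" and ?s = "\<Sum>\<^sub>\<infinity>e. p e"
  have bij: "bij_betw snd ?A UNIV"
    by (auto simp: bij_betw_def inj_on_def image_iff)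
  have hs: "((\<lambda>n. z^n / fact n) has_sum exp z) UNIV" for z :: "'d::{real_normed_field,banach}"
  proof (rule norm_summable_imp_has_sum)
    show "(\<lambda>n. z^n / fact n) sums exp z"
      using exp_converges[of z] by (simp add: scaleR_conv_of_real divide_inverse mult.commute)
    show "summable (\<lambda>n. norm (z^n / fact n))"
      using summable_norm_exp[of z] by (simp add: scaleR_conv_of_real divide_inverse norm_mult norm_inverse mult.commute)
  qed
  have n1: "((\<lambda>l. norm (prod_list (map p l) / fact (length l))) has_sum ?S^n / fact n) {l. length l = n}" for n
  proof -
    have "((\<lambda>l. norm (prod_list (map p l)) / fact n) has_sum ?S^n / fact n) {l. length l = n}"
      using has_sum_cmult_left[OF conjunct2[OF has_sum_lists_length[OF p, of n]], of "1 / fact n"] by simp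
    then show ?thesis by (rule has_sum_cong[THEN iffD1, rotated]) (simp add: norm_divide)
  qed
  have c1: "((\<lambda>l. prod_list (map p l) / fact (length l)) has_sum ?s^n / fact n) {l. length l = n}" for n
  proof -
    have "((\<lambda>l. prod_list (map p l) / fact n) has_sum ?s^n / fact n) {l. length l = n}"
      using has_sum_cmult_left[OF conjunct1[OF has_sum_lists_length[OF p, of n]], of "1 / fact n"] by simp
    then show ?thesis by (rule has_sum_cong[THEN iffD1, rotated]) simp
  qed
  have n3: "(\<lambda>x. norm (prod_list (map p (snd x)) / fact (length (snd x)))) summable_on ?A"
  proof (rule summable_on_SigmaI[where g = "\<lambda>n. ?S^n / fact n"])
    show "(\<lambda>n. ?S^n / fact n) summable_on UNIV" using hs[of ?S] by (auto simp: summable_on_def)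
  qed (use n1 in simp_all)
  then show "(\<lambda>l. norm (prod_list (map p l) / fact (length l))) summable_on UNIV"
    using summable_on_reindex_bij_betw[OF bij, of "\<lambda>l. norm (prod_list (map p l) / fact (length l))"] by simp
  have "((\<lambda>x. prod_list (map p (snd x)) / fact (length (snd x))) has_sum exp ?s) ?A"
    by (rule has_sum_SigmaI[OF _ hs abs_summable_summable[OF n3]]) (use c1 in simp)
  then show "((\<lambda>l. prod_list (map p l) / fact (length l)) has_sum exp ?s) UNIV"
    using has_sum_reindex_bij_betw[OF bij, of "\<lambda>l. prod_list (map p l) / fact (length l)"] by simp
qed

text \<open>The normalised exponential vector
  \<open>e\<^bsup>-\<parallel>f\<parallel>\<^sup>2/2\<^esup> ((n!)\<^bsup>-1/2\<^esup> f\<^bsup>\<otimes>n\<^esup>)\<^sub>n\<close>; the coordinate of \<open>f\<^bsup>\<otimes>n\<^esup>\<close> at the list \<open>l\<close> is \<open>\<Prod>e\<leftarrow>l. \<langle>e, f\<rangle>\<close>.\<close>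

definition expvec :: "'a::chilbert_space \<Rightarrow> 'a fock"
  where "expvec f = Abs_fock (\<lambda>l. complex_of_real (exp (- (norm f)\<^sup>2 / 2) / sqrt (fact (length l))) *
    prod_list (map (coords f) l))"

lemma Rep_expvec: "Rep_fock (expvec f) =
  (\<lambda>l. complex_of_real (exp (- (norm f)\<^sup>2 / 2) / sqrt (fact (length l))) * prod_list (map (coords f) l))"
  (is "_ = ?r")
proof -
  have z: "prod_list (map (coords f) l) = 0" if "\<not> set l \<subseteq> onb" for l
    using that unfolding prod_list_zero_iff by (force simp: coords_def image_iff)
  let ?q = "\<lambda>e. (norm (coords f e))\<^sup>2"
  have "(\<lambda>e. norm (?q e)) summable_on UNIV" using sq_summable_coords[of f] by (simp add: sq_summable_def)
  from has_sum_lists_exp(2)[OF this]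
  have s: "(\<lambda>l. prod_list (map ?q l) / fact (length l)) summable_on UNIV"
    by (rule summable_on_iff_abs_summable_on_real[THEN iffD2])
  have prodsq: "prod_list (map ?q l) = (norm (prod_list (map (coords f) l)))\<^sup>2" for l
    by (induction l) (auto simp: norm_mult power_mult_distrib)
  have "(\<lambda>l. (norm (?r l))\<^sup>2) = (\<lambda>l. (exp (- (norm f)\<^sup>2 / 2))\<^sup>2 * (prod_list (map ?q l) / fact (length l)))"
    by (rule ext) (simp add: prodsq norm_mult norm_divide power_mult_distrib power_divide del: of_real_divide)
  then have "sq_summable ?r"
    unfolding sq_summable_def using summable_on_cmult_right[OF s] by simp
  moreover have "?r l = ?r l'" if "mset l = mset l'" for l l'
  proof -
    have "prod_list (map (coords f) l) = prod_list (map (coords f) l')"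
      using that by (metis mset_map prod_mset_prod_list)
    moreover have "length l = length l'" using that by (rule mset_eq_length)
    ultimately show ?thesis by simp
  qed
  moreover have "?r l = 0" if "\<not> set l \<subseteq> onb" for l
    unfolding z[OF that] by simp
  ultimately have "fock_coords ?r" unfolding fock_coords_def by blast
  then show ?thesis unfolding expvec_def by (intro Abs_fock_inverse CollectI)
qed

lemma cinner_expvec:
  "cinner (expvec f) (expvec g) = exp (cinner f g - complex_of_real ((norm f)\<^sup>2 / 2 + (norm g)\<^sup>2 / 2))"
proof -
  let ?p = "\<lambda>e. cinner (coords f e) (coords g e)"
  let ?c = "complex_of_real (exp (- (norm f)\<^sup>2 / 2) * exp (- (norm g)\<^sup>2 / 2))"
  have "?p summable_on UNIV" by (intro l2_cinner_summable sq_summable_coords)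
  then have "(\<lambda>e. norm (?p e)) summable_on UNIV" by (rule summable_on_iff_abs_summable_on_complex[THEN iffD1])
  note hs = has_sum_lists_exp(1)[OF this]
  have pr: "prod_list (map ?p l) = cnj (prod_list (map (coords f) l)) * prod_list (map (coords g) l)" for l
    by (induction l) (auto simp: cinner_complex_def)
  have s: "complex_of_real (a / sqrt (fact n)) * complex_of_real (b / sqrt (fact n)) =
      complex_of_real (a * b) / fact n" for a b n
  proof -
    have "a / sqrt (fact n) * (b / sqrt (fact n)) = a * b / fact n" by simp
    then show ?thesis by (metis of_real_mult of_real_divide of_real_fact)
  qed
  have term_eq: "cinner (complex_of_real (a / sqrt (fact n)) * x) (complex_of_real (b / sqrt (fact n)) * y) =
      complex_of_real (a * b) * (cnj x * y / fact n)" for a b n x y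
  proof -
    have "cinner (complex_of_real (a / sqrt (fact n)) * x) (complex_of_real (b / sqrt (fact n)) * y) =
        complex_of_real (a / sqrt (fact n)) * complex_of_real (b / sqrt (fact n)) * (cnj x * y)"
      unfolding cinner_complex_def complex_cnj_mult complex_cnj_complex_of_real by (simp only: mult_ac)
    then show ?thesis unfolding s by simp
  qed
  have "cinner (expvec f) (expvec g) = (\<Sum>\<^sub>\<infinity>l. ?c * (prod_list (map ?p l) / fact (length l)))"
    unfolding cinner_fock.rep_eq l2_cinner_def Rep_expvec term_eq pr ..
  also have "\<dots> = ?c * exp (\<Sum>\<^sub>\<infinity>e. ?p e)"
    by (rule infsumI[OF has_sum_cmult_right[OF hs]])
  also have "(\<Sum>\<^sub>\<infinity>e. ?p e) = cinner f g" using parseval[of f g] unfolding l2_cinner_def .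
  also have "?c = exp (- complex_of_real ((norm f)\<^sup>2 / 2 + (norm g)\<^sup>2 / 2))"
    by (simp only: exp_add[symmetric] exp_of_real of_real_minus[symmetric] minus_add_distrib minus_divide_left)
  also have "exp (- complex_of_real ((norm f)\<^sup>2 / 2 + (norm g)\<^sup>2 / 2)) * exp (cinner f g) =
      exp (cinner f g - complex_of_real ((norm f)\<^sup>2 / 2 + (norm g)\<^sup>2 / 2))"
    unfolding exp_add[symmetric] by (rule arg_cong[where f = exp]) (rule uminus_add_conv_diff)
  finally show ?thesis .
qed

section \<open>Operators\<close>

text \<open>Operators are plain HOL functions; an unbounded operator is a function together with a
  linear subspace \<open>D\<close>, its values outside \<open>D\<close> being irrelevant.\<close>

definition cspan :: "'a::chilbert_space set \<Rightarrow> 'a set"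
  where "cspan S = {\<Sum>i<n. c i *\<^sub>C x i | (n::nat) c x. \<forall>i<n. x i \<in> S}"

definition csubspace :: "'a::chilbert_space set \<Rightarrow> bool"
  where "csubspace D \<longleftrightarrow> 0 \<in> D \<and> (\<forall>x\<in>D. \<forall>y\<in>D. x + y \<in> D) \<and> (\<forall>c. \<forall>x\<in>D. c *\<^sub>C x \<in> D)"

definition clinear_on :: "'a::chilbert_space set \<Rightarrow> ('a \<Rightarrow> 'b::chilbert_space) \<Rightarrow> bool"
  where "clinear_on D T \<longleftrightarrow> csubspace D \<and> (\<forall>x\<in>D. \<forall>y\<in>D. T (x + y) = T x + T y) \<and>
    (\<forall>c. \<forall>x\<in>D. T (c *\<^sub>C x) = c *\<^sub>C T x)"

definition bounded_ops :: "('a::chilbert_space \<Rightarrow> 'b::chilbert_space) set"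
  where "bounded_ops = {T. clinear_on UNIV T \<and> (\<exists>K. \<forall>x. norm (T x) \<le> K * norm x)}"

text \<open>The operator norm of \<open>T\<close> on \<open>D\<close>, infinite if \<open>T\<close> is unbounded.\<close>

definition opnorm_on :: "'a::chilbert_space set \<Rightarrow> ('a \<Rightarrow> 'b::chilbert_space) \<Rightarrow> ennreal"
  where "opnorm_on D T = (SUP x\<in>{x\<in>D. norm x \<le> 1}. ennreal (norm (T x)))"

definition adj :: "('a::chilbert_space \<Rightarrow> 'b::chilbert_space) \<Rightarrow> ('b \<Rightarrow> 'a)"
  where "adj T = (SOME S. \<forall>x y. cinner (S x) y = cinner x (T y))"

definition tensor_op :: "('a::chilbert_space \<Rightarrow> 'c::chilbert_space) \<Rightarrow> ('b::chilbert_space \<Rightarrow> 'd::chilbert_space) \<Rightarrow>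
    ('a, 'b) htensor \<Rightarrow> ('c, 'd) htensor"
  where "tensor_op S T = (SOME R. R \<in> bounded_ops \<and> (\<forall>u v. R (tensor u v) = tensor (S u) (T v)))"

definition op_span :: "('a \<Rightarrow> 'b::chilbert_space) set \<Rightarrow> ('a \<Rightarrow> 'b) set"
  where "op_span S = {(\<lambda>u. \<Sum>i<n. c i *\<^sub>C T i u) | (n::nat) c T. \<forall>i<n. T i \<in> S}"

definition op_linear_on :: "('a \<Rightarrow> 'b::chilbert_space) set \<Rightarrow> (('a \<Rightarrow> 'b) \<Rightarrow> ('c \<Rightarrow> 'd::chilbert_space)) \<Rightarrow> bool"
  where "op_linear_on M \<Phi> \<longleftrightarrow> (\<forall>S\<in>M. \<forall>T\<in>M. \<Phi> (\<lambda>u. S u + T u) = (\<lambda>v. \<Phi> S v + \<Phi> T v)) \<and>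
    (\<forall>c. \<forall>T\<in>M. \<Phi> (\<lambda>u. c *\<^sub>C T u) = (\<lambda>v. c *\<^sub>C \<Phi> T v))"

section \<open>Von Neumann algebras, ultraweak tensor products and normal maps\<close>

text \<open>The topology on \<open>B(H;K)\<close> induced by the functionals
  \<open>T \<mapsto> \<Sum>n. \<langle>\<xi>\<^sub>n, T \<eta>\<^sub>n\<rangle>\<close> with square-summable \<open>\<xi>\<close> and \<open>\<eta>\<close>.\<close>

definition ultraweak :: "('a::chilbert_space \<Rightarrow> 'b::chilbert_space) topology"
  where "ultraweak = topology_generated_by
    {{T \<in> bounded_ops. (\<Sum>n. cinner (\<xi> n) (T (\<eta> n))) \<in> U} | (\<xi> :: nat \<Rightarrow> 'b) (\<eta> :: nat \<Rightarrow> 'a) U.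
      sq_summable \<xi> \<and> sq_summable \<eta> \<and> open U}"

definition commutant :: "('a::chilbert_space \<Rightarrow> 'a) set \<Rightarrow> ('a \<Rightarrow> 'a) set"
  where "commutant M = {S \<in> bounded_ops. \<forall>T\<in>M. S \<circ> T = T \<circ> S}"

definition von_neumann_algebra :: "('a::chilbert_space \<Rightarrow> 'a) set \<Rightarrow> bool"
  where "von_neumann_algebra A \<longleftrightarrow>
    A \<subseteq> bounded_ops \<and> (\<forall>a\<in>A. adj a \<in> A) \<and> commutant (commutant A) = A"

definition uw_tensor :: "('a::chilbert_space \<Rightarrow> 'a) set \<Rightarrow> ('b::chilbert_space \<Rightarrow> 'b) set \<Rightarrow>
    (('a, 'b) htensor \<Rightarrow> ('a, 'b) htensor) set"
  where "uw_tensor M N = ultraweak closure_of op_span {tensor_op S T | S T. S \<in> M \<and> T \<in> N}"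

text \<open>\<open>A \<otimes> |F\<rangle>\<close>, where \<open>|F\<rangle> = B(\<complex>;F)\<close> is identified with \<open>F\<close> and \<open>H \<otimes> \<complex>\<close> with \<open>H\<close>.\<close>

definition uw_tensor_ket :: "('a::chilbert_space \<Rightarrow> 'a) set \<Rightarrow> ('a \<Rightarrow> ('a, 'b::chilbert_space) htensor) set"
  where "uw_tensor_ket A = ultraweak closure_of op_span {(\<lambda>u. tensor (a u) x) | a x. a \<in> A}"

definition normal_map :: "('a::chilbert_space \<Rightarrow> 'b::chilbert_space) set \<Rightarrow>
    (('a \<Rightarrow> 'b) \<Rightarrow> ('c::chilbert_space \<Rightarrow> 'd::chilbert_space)) \<Rightarrow> bool"
  where "normal_map M \<Phi> \<longleftrightarrow> op_linear_on M \<Phi> \<and> continuous_map (subtopology ultraweak M) ultraweak \<Phi>"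

text \<open>\<open>K\<close> is a bound for the norm of the operator matrix \<open>(a i j)\<close>, \<open>i, j < n\<close>.\<close>

definition matrix_bound :: "nat \<Rightarrow> (nat \<Rightarrow> nat \<Rightarrow> 'a::chilbert_space \<Rightarrow> 'b::chilbert_space) \<Rightarrow> real \<Rightarrow> bool"
  where "matrix_bound n a K \<longleftrightarrow>
    (\<forall>x. (\<Sum>i<n. (norm (\<Sum>j<n. a i j (x j)))\<^sup>2) \<le> K\<^sup>2 * (\<Sum>j<n. (norm (x j))\<^sup>2))"

definition completely_bounded :: "('a::chilbert_space \<Rightarrow> 'b::chilbert_space) set \<Rightarrow>
    (('a \<Rightarrow> 'b) \<Rightarrow> ('c::chilbert_space \<Rightarrow> 'd::chilbert_space)) \<Rightarrow> bool"
  where "completely_bounded M \<Phi> \<longleftrightarrow> (\<exists>C\<ge>0. \<forall>n a. \<forall>K\<ge>0. (\<forall>i<n. \<forall>j<n. a i j \<in> M) \<longrightarrow>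
    matrix_bound n a K \<longrightarrow> matrix_bound n (\<lambda>i j. \<Phi> (a i j)) (C * K))"

text \<open>\<open>id\<^bsub>B(K)\<^esub> \<otimes> \<Phi>\<close> for a normal completely bounded map \<open>\<Phi>\<close> on \<open>M\<close>.\<close>

definition id_tensor_map :: "('a::chilbert_space \<Rightarrow> 'a) set \<Rightarrow>
    (('a \<Rightarrow> 'a) \<Rightarrow> ('b::chilbert_space \<Rightarrow> 'b)) \<Rightarrow>
    (('c::chilbert_space, 'a) htensor \<Rightarrow> ('c, 'a) htensor) \<Rightarrow> (('c, 'b) htensor \<Rightarrow> ('c, 'b) htensor)"
  where "id_tensor_map M \<Phi> = (SOME \<Psi>. normal_map (uw_tensor bounded_ops M) \<Psi> \<and>
    (\<forall>z\<in>bounded_ops. \<forall>a\<in>M. \<Psi> (tensor_op z a) = tensor_op z (\<Phi> a)))"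

section \<open>Step functions and exponential vectors\<close>

type_synonym 'k fockspace = "'k L2 fock"

definition step_functions :: "(real \<Rightarrow> 'k::chilbert_space) set"
  where "step_functions = {(\<lambda>s. \<Sum>i<n. if a i \<le> s \<and> s < b i then c i else 0) | (n::nat) a b c.
    \<forall>i<n. 0 \<le> a i}"

definition restr :: "real set \<Rightarrow> (real \<Rightarrow> 'k::chilbert_space) \<Rightarrow> real \<Rightarrow> 'k"
  where "restr J f = (\<lambda>s. if s \<in> J then f s else 0)"

definition varpi :: "(real \<Rightarrow> 'k::chilbert_space) \<Rightarrow> 'k fockspace"
  where "varpi f = expvec (abs_L2 f)"

definition exp_domain :: "'k::chilbert_space fockspace set"
  where "exp_domain = cspan (varpi ` step_functions)"

definition alg_tensor :: "'a::chilbert_space set \<Rightarrow> 'b::chilbert_space set \<Rightarrow> ('a, 'b) htensor set"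
  where "alg_tensor U V = cspan {tensor u v | u v. u \<in> U \<and> v \<in> V}"

abbreviation proc_domain :: "('h::chilbert_space, 'k::chilbert_space fockspace) htensor set"
  where "proc_domain \<equiv> alg_tensor UNIV exp_domain"

definition ket :: "'b::chilbert_space \<Rightarrow> 'a::chilbert_space \<Rightarrow> ('a, 'b) htensor"
  where "ket x u = tensor u x"

definition bra :: "'b::chilbert_space \<Rightarrow> ('a::chilbert_space, 'b) htensor \<Rightarrow> 'a"
  where "bra x = adj (ket x)"

definition khat :: "'k::chilbert_space \<Rightarrow> complex \<times> 'k"
  where "khat c = (1, c)"

section \<open>Processes\<close>

type_synonym ('h, 'k) fock_op = "('h, 'k fockspace) htensor \<Rightarrow> ('h, 'k fockspace) htensor"

definition adapted :: "(real \<Rightarrow> ('h::chilbert_space, 'k::chilbert_space) fock_op) \<Rightarrow> bool"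
  where "adapted X \<longleftrightarrow> (\<forall>t\<ge>0. \<forall>f\<in>step_functions. \<forall>g\<in>step_functions. \<forall>u.
    bra (varpi f) (X t (ket (varpi g) u)) =
      cinner (varpi (restr {t..} f)) (varpi (restr {t..} g)) *\<^sub>C
      bra (varpi (restr {0..<t} f)) (X t (ket (varpi (restr {0..<t} g)) u)))"

definition operator_process :: "(real \<Rightarrow> ('h::chilbert_space, 'k::chilbert_space) fock_op) \<Rightarrow> bool"
  where "operator_process X \<longleftrightarrow> (\<forall>t\<ge>0. clinear_on proc_domain (X t)) \<and>
    (\<forall>\<xi>. \<forall>\<zeta>\<in>proc_domain. (\<lambda>t. cinner \<xi> (X t \<zeta>)) \<in> borel_measurable (lebesgue_on {0..})) \<and>
    adapted X"

definition process_in :: "('h::chilbert_space \<Rightarrow> 'h) set \<Rightarrow> (real \<Rightarrow> ('h, 'k::chilbert_space) fock_op) \<Rightarrow> bool"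
  where "process_in A X \<longleftrightarrow> operator_process X \<and>
    (\<forall>t\<ge>0. \<forall>f\<in>step_functions. \<forall>g\<in>step_functions. bra (varpi f) \<circ> X t \<circ> ket (varpi g) \<in> A)"

definition bounded_process :: "(real \<Rightarrow> ('h::chilbert_space, 'k::chilbert_space) fock_op) \<Rightarrow> bool"
  where "bounded_process X \<longleftrightarrow> operator_process X \<and> (\<forall>t\<ge>0. opnorm_on proc_domain (X t) < \<infinity>)"

definition locally_uniform_bounds :: "(real \<Rightarrow> ('h::chilbert_space, 'k::chilbert_space) fock_op) \<Rightarrow> bool"
  where "locally_uniform_bounds X \<longleftrightarrow> (\<forall>T\<ge>0. (SUP t\<in>{0..T}. opnorm_on proc_domain (X t)) < \<infinity>)"

definition extension :: "('h::chilbert_space, 'k::chilbert_space) fock_op \<Rightarrow> ('h, 'k) fock_op"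
  where "extension T = (SOME S. S \<in> bounded_ops \<and> (\<forall>\<zeta>\<in>proc_domain. S \<zeta> = T \<zeta>))"

definition coisometric_process :: "(real \<Rightarrow> ('h::chilbert_space, 'k::chilbert_space) fock_op) \<Rightarrow> bool"
  where "coisometric_process X \<longleftrightarrow> bounded_process X \<and>
    (\<forall>t\<ge>0. extension (X t) \<circ> adj (extension (X t)) = id)"

definition holder_half :: "(real \<Rightarrow> ('h::chilbert_space, 'k::chilbert_space) fock_op) \<Rightarrow> bool"
  where "holder_half X \<longleftrightarrow> (\<forall>\<epsilon>\<in>exp_domain. \<forall>T>0.
    (SUP (r, t)\<in>{(r, t). 0 \<le> r \<and> r < t \<and> t \<le> T}.
      ennreal ((t - r) powr (-1/2)) * opnorm_on UNIV (\<lambda>u. X t (ket \<epsilon> u) - X r (ket \<epsilon> u))) < \<infinity>)"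

section \<open>QS cocycles and flows\<close>

text \<open>Operators on \<open>F\<^bsub>[0,r[\<^esub>\<close> and \<open>F\<^bsub>[r,\<infinity>[\<^esub>\<close>. The factors of \<open>F = F\<^bsub>[0,r[\<^esub> \<otimes> F\<^bsub>[r,\<infinity>[\<^esub>\<close> are
  identified with the closed subspaces of \<open>F\<close> generated by the exponential vectors of step
  functions supported by the interval; \<open>fock_join r\<close> is the unitary
  \<open>\<varpi>(f) \<otimes> \<varpi>(g) \<mapsto> \<varpi>(f + g)\<close> from \<open>F\<^bsub>[0,r[\<^esub> \<otimes> F\<^bsub>[r,\<infinity>[\<^esub>\<close> onto \<open>F\<close>, extended by 0 to a coisometry on
  \<open>F \<otimes> F\<close>.\<close>

definition fock_join :: "real \<Rightarrow> ('k::chilbert_space fockspace, 'k fockspace) htensor \<Rightarrow> 'k fockspace"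
  where "fock_join r = (SOME U. U \<in> bounded_ops \<and>
    (\<forall>f\<in>step_functions. \<forall>g\<in>step_functions. U (tensor (varpi (restr {0..<r} f)) (varpi (restr {r..} g))) =
        varpi (\<lambda>s. restr {0..<r} f s + restr {r..} g s)) \<and>
    (\<forall>\<xi>. (\<forall>f\<in>step_functions. \<forall>g\<in>step_functions.
        cinner (tensor (varpi (restr {0..<r} f)) (varpi (restr {r..} g))) \<xi> = 0) \<longrightarrow> U \<xi> = 0))"

definition fock_from :: "real \<Rightarrow> 'k::chilbert_space fockspace set"
  where "fock_from r = closure (cspan {varpi (restr {r..} f) | f. f \<in> step_functions})"

text \<open>\<open>B(F\<^bsub>[r,\<infinity>[\<^esub>)\<close>, its elements being extended by 0 to \<open>F\<close>\<close>

definition ops_from :: "real \<Rightarrow> ('k::chilbert_space fockspace \<Rightarrow> 'k fockspace) set"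
  where "ops_from r = {z \<in> bounded_ops. range z \<subseteq> fock_from r \<and>
    (\<forall>\<xi>. (\<forall>\<eta>\<in>fock_from r. cinner \<eta> \<xi> = 0) \<longrightarrow> z \<xi> = 0)}"

text \<open>The ampliation \<open>z \<mapsto> I\<^bsub>[0,r[\<^esub> \<otimes> z\<close>; \<open>future_algebra r\<close> is the copy \<open>I\<^bsub>[0,r[\<^esub> \<otimes> N\<^bsub>[r,\<infinity>[\<^esub>\<close> of
  \<open>N\<^bsub>[r,\<infinity>[\<^esub>\<close> in \<open>N = B(F)\<close>.\<close>

definition ampliate_from :: "real \<Rightarrow> ('k::chilbert_space fockspace \<Rightarrow> 'k fockspace) \<Rightarrow> ('k fockspace \<Rightarrow> 'k fockspace)"
  where "ampliate_from r z = fock_join r \<circ> tensor_op id z \<circ> adj (fock_join r)"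

definition future_algebra :: "real \<Rightarrow> ('k::chilbert_space fockspace \<Rightarrow> 'k fockspace) set"
  where "future_algebra r = ampliate_from r ` ops_from r"

definition fock_shift :: "real \<Rightarrow> 'k::chilbert_space fockspace \<Rightarrow> 'k fockspace"
  where "fock_shift r = (SOME T. T \<in> bounded_ops \<and>
    (\<forall>f\<in>step_functions. T (varpi f) = varpi (\<lambda>s. if r \<le> s then f (s - r) else 0)))"

text \<open>\<open>\<sigma>\<^sub>r\<close>, with values in \<open>A \<otimes> (I\<^bsub>[0,r[\<^esub> \<otimes> N\<^bsub>[r,\<infinity>[\<^esub>)\<close>\<close>

definition sigma :: "('h::chilbert_space \<Rightarrow> 'h) set \<Rightarrow> real \<Rightarrow> ('h, 'k::chilbert_space) fock_op \<Rightarrow> ('h, 'k) fock_op"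
  where "sigma A r = (SOME \<Phi>. normal_map (uw_tensor A bounded_ops) \<Phi> \<and>
    (\<forall>a\<in>A. \<forall>z\<in>bounded_ops. \<Phi> (tensor_op a z) =
      tensor_op a (ampliate_from r (fock_shift r \<circ> z \<circ> adj (fock_shift r)))))"

text \<open>\<open>k\<^sub>r\<close> hat, i.e. \<open>k\<^bsub>r)\<^esub> \<otimes> id\<close> on \<open>A \<otimes> N\<^bsub>[r,\<infinity>[\<^esub>\<close>. Under the above identification
  \<open>k\<^bsub>r)\<^esub>(a) \<otimes> z = (k\<^bsub>r)\<^esub>(a) \<otimes> I\<^bsub>[r,\<infinity>[\<^esub>) (I \<otimes> z) = k\<^sub>r(a) (I \<otimes> z)\<close>.\<close>

definition cocycle_hat :: "('h::chilbert_space \<Rightarrow> 'h) set \<Rightarrow> (real \<Rightarrow> ('h \<Rightarrow> 'h) \<Rightarrow> ('h, 'k::chilbert_space) fock_op) \<Rightarrow>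
    real \<Rightarrow> ('h, 'k) fock_op \<Rightarrow> ('h, 'k) fock_op"
  where "cocycle_hat A k r = (SOME \<Phi>. normal_map (uw_tensor A (future_algebra r)) \<Phi> \<and>
    (\<forall>a\<in>A. \<forall>Z\<in>future_algebra r. \<Phi> (tensor_op a Z) = k r a \<circ> tensor_op id Z))"

definition mapping_process :: "('h::chilbert_space \<Rightarrow> 'h) set \<Rightarrow>
    (real \<Rightarrow> ('h \<Rightarrow> 'h) \<Rightarrow> ('h, 'k::chilbert_space) fock_op) \<Rightarrow> bool"
  where "mapping_process A k \<longleftrightarrow> (\<forall>t\<ge>0. op_linear_on A (k t)) \<and> (\<forall>a\<in>A. process_in A (\<lambda>t. k t a))"

definition qs_cocycle :: "('h::chilbert_space \<Rightarrow> 'h) set \<Rightarrow>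
    (real \<Rightarrow> ('h \<Rightarrow> 'h) \<Rightarrow> ('h, 'k::chilbert_space) fock_op) \<Rightarrow> bool"
  where "qs_cocycle A k \<longleftrightarrow> mapping_process A k \<and>
    (\<forall>t\<ge>0. normal_map A (k t) \<and> completely_bounded A (k t)) \<and>
    (\<forall>a\<in>A. k 0 a = tensor_op a id) \<and>
    (\<forall>r\<ge>0. \<forall>t\<ge>0. \<forall>a\<in>A. k (r + t) a = cocycle_hat A k r (sigma A r (k t a)))"

definition qs_flow :: "('h::chilbert_space \<Rightarrow> 'h) set \<Rightarrow>
    (real \<Rightarrow> ('h \<Rightarrow> 'h) \<Rightarrow> ('h, 'k::chilbert_space) fock_op) \<Rightarrow> bool"
  where "qs_flow A k \<longleftrightarrow> qs_cocycle A k \<and>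
    (\<forall>a\<in>A. continuous_map (top_of_set {0..}) ultraweak (\<lambda>t. k t a)) \<and>
    (\<forall>t\<ge>0. k t id = id \<and> (\<forall>a\<in>A. k t (adj a) = adj (k t a)) \<and>
      (\<forall>a\<in>A. \<forall>b\<in>A. k t (a \<circ> b) = k t a \<circ> k t b))"

section \<open>QS integrals and the QS differential equation\<close>

type_synonym ('h, 'k) hat_space = "(complex \<times> 'k, ('h, 'k fockspace) htensor) htensor"

text \<open>The linear extensions defining \<open>I \<otimes> Y\<close> (algebraic ampliation) and \<open>\<nabla>\<close> hat\<close>

definition alg_ampliation :: "'b::chilbert_space set \<Rightarrow> ('b \<Rightarrow> 'b) \<Rightarrow> ('a::chilbert_space, 'b) htensor \<Rightarrow> ('a, 'b) htensor"
  where "alg_ampliation D Y = (SOME L. clinear_on (alg_tensor UNIV D) L \<and>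
    (\<forall>x. \<forall>\<zeta>\<in>D. L (tensor x \<zeta>) = tensor x (Y \<zeta>)))"

definition nabla_hat :: "real \<Rightarrow> ('h::chilbert_space, 'k::chilbert_space fockspace) htensor \<Rightarrow> ('h, 'k) hat_space"
  where "nabla_hat s = (SOME L. clinear_on proc_domain L \<and>
    (\<forall>u. \<forall>f\<in>step_functions. L (tensor u (varpi f)) = tensor (khat (f s)) (tensor u (varpi f))))"

definition Delta :: "('h::chilbert_space, 'k::chilbert_space) hat_space \<Rightarrow> ('h, 'k) hat_space"
  where "Delta = tensor_op (\<lambda>(z, c). (0, c)) id"

definition Delta_perp :: "('h::chilbert_space, 'k::chilbert_space) hat_space \<Rightarrow> ('h, 'k) hat_space"
  where "Delta_perp = tensor_op (\<lambda>(z, c). (z, 0)) id"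

definition locally_integrable :: "nat \<Rightarrow> (real \<Rightarrow> 'a::chilbert_space) \<Rightarrow> bool"
  where "locally_integrable p x \<longleftrightarrow> (\<forall>T>0.
    (\<exists>y. strongly_measurable (lebesgue_on {0..T}) y \<and> (AE s in lebesgue_on {0..T}. x s = y s)) \<and>
    (\<integral>\<^sup>+s. ennreal ((norm (x s))^p) \<partial>lebesgue_on {0..T}) < \<infinity>)"

text \<open>\<open>E\<close> with subscript \<open>x \<epsilon>\<close>, \<open>x\<close> in the first factor of the triple tensor product and \<open>\<epsilon>\<close> in
  the third, and its adjoint\<close>

definition hat_ket :: "complex \<times> 'k::chilbert_space \<Rightarrow> 'k fockspace \<Rightarrow> 'h::chilbert_space \<Rightarrow> ('h, 'k) hat_space"
  where "hat_ket x \<epsilon> u = tensor x (tensor u \<epsilon>)"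

definition hat_bra :: "complex \<times> 'k::chilbert_space \<Rightarrow> 'k fockspace \<Rightarrow> ('h::chilbert_space, 'k) hat_space \<Rightarrow> 'h"
  where "hat_bra x \<epsilon> = adj (hat_ket x \<epsilon>)"

text \<open>\<open>Dom t\<close> is the domain of \<open>G t\<close>. In the adaptedness condition the left-hand side reads
  \<open>(\<nabla>\<^sub>t E\<^bsub>\<varpi>(f)\<^esub>)\<^sup>* G\<^sub>t \<nabla>\<^sub>t E\<^bsub>\<varpi>(g)\<^esub>\<close>, where \<open>\<nabla>\<^sub>t E\<^bsub>\<varpi>(f)\<^esub> = E\<^bsub>f(t)\<varpi>(f)\<^esub>\<close> (hats omitted); equality of
  operators includes that the right-hand side is everywhere defined.\<close>

definition qs_integrable :: "(real \<Rightarrow> ('h::chilbert_space, 'k::chilbert_space) hat_space set) \<Rightarrow>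
    (real \<Rightarrow> ('h, 'k) hat_space \<Rightarrow> ('h, 'k) hat_space) \<Rightarrow> bool"
  where "qs_integrable Dom G \<longleftrightarrow>
    (\<forall>t\<ge>0. clinear_on (Dom t) (G t)) \<and>
    (\<forall>\<zeta>\<in>proc_domain. (\<forall>t\<ge>0. nabla_hat t \<zeta> \<in> Dom t) \<and>
      locally_integrable 1 (\<lambda>s. Delta_perp (G s (nabla_hat s \<zeta>))) \<and>
      locally_integrable 2 (\<lambda>s. Delta (G s (nabla_hat s \<zeta>)))) \<and>
    (\<forall>t\<ge>0. \<forall>f\<in>step_functions. \<forall>g\<in>step_functions. \<forall>u.
      hat_ket (khat (g t)) (varpi (restr {0..<t} g)) u \<in> Dom t \<and>
      hat_bra (khat (f t)) (varpi f) (G t (nabla_hat t (ket (varpi g) u))) =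
        cinner (varpi (restr {t..} f)) (varpi (restr {t..} g)) *\<^sub>C
        hat_bra (khat (f t)) (varpi (restr {0..<t} f))
          (G t (hat_ket (khat (g t)) (varpi (restr {0..<t} g)) u)))"

definition is_qs_integral :: "(real \<Rightarrow> ('h::chilbert_space, 'k::chilbert_space) hat_space \<Rightarrow> ('h, 'k) hat_space) \<Rightarrow>
    (real \<Rightarrow> ('h, 'k) fock_op) \<Rightarrow> bool"
  where "is_qs_integral G Z \<longleftrightarrow> operator_process Z \<and>
    (\<forall>\<zeta>\<in>proc_domain. continuous_on {0..} (\<lambda>t. Z t \<zeta>)) \<and>
    (\<forall>t\<ge>0. \<forall>\<zeta>'\<in>proc_domain. \<forall>\<zeta>\<in>proc_domain. cinner \<zeta>' (Z t \<zeta>) =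
      (\<integral>s. cinner (nabla_hat s \<zeta>') (G s (nabla_hat s \<zeta>)) \<partial>lebesgue_on {0..t}))"

text \<open>\<open>Y\<^sub>0 = I\<close>, \<open>dY\<^sub>t = j\<^sub>t(F) Y\<^sub>t d\<Lambda>\<^sub>t\<close> (tildes omitted)\<close>

definition strong_solution :: "('h::chilbert_space \<Rightarrow> 'h) set \<Rightarrow>
    (real \<Rightarrow> ('h \<Rightarrow> 'h) \<Rightarrow> ('h, 'k::chilbert_space) fock_op) \<Rightarrow>
    ((complex \<times> 'k, 'h) htensor \<Rightarrow> (complex \<times> 'k, 'h) htensor) \<Rightarrow>
    (real \<Rightarrow> ('h, 'k) fock_op) \<Rightarrow> bool"
  where "strong_solution A j F Y \<longleftrightarrow>
    (let G = (\<lambda>t. id_tensor_map A (j t) F \<circ> alg_ampliation proc_domain (Y t)) in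
      operator_process Y \<and> qs_integrable (\<lambda>t. alg_tensor UNIV proc_domain) G \<and>
      (\<exists>Z. is_qs_integral G Z \<and> (\<forall>t\<ge>0. \<forall>\<zeta>\<in>proc_domain. Y t \<zeta> = \<zeta> + Z t \<zeta>)))"

end

theory Submission
  imports Defs
begin

text \<open>For a step function \<open>g\<close> the equation for \<open>Y\<close> becomes a fixed-point equation for the vector path
  \<open>y\<^sub>t = Y\<^sub>t (u \<otimes> \<varpi>(g))\<close>. A vector \<open>\<xi>\<close> adapted at time \<open>s\<close> satisfies \<open>P\<^sub>s \<xi> = \<xi>\<close> for the projection \<open>P\<^sub>s\<close> onto
  \<open>\<varpi>(g\<^bsub>[s,\<infinity>[\<^esub>)\<close> in the future factor, and \<open>s \<mapsto> \<parallel>P\<^sub>s \<zeta>\<parallel>\<^sup>2\<close> has derivative the squared norm of the noise part of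
  \<open>\<nabla>\<^sub>s \<zeta>\<close> relative to \<open>g\<close>. Paired with Cauchy--Schwarz this energy identity bounds the norm of a QS integral,
  which makes the integral operator a contraction for an exponential weight and also gives the Hoelder
  estimates. The coefficient \<open>(id \<otimes> j\<^sub>s)(F)\<close> is contractive because \<open>j\<^sub>s\<close> is a normal *-homomorphism, and weakly
  continuous in \<open>s\<close>; multiplicativity upgrades this to strong continuity.\<close>

text \<open>Two obstacles shape the construction. The ampliation of \<open>j s\<close> is given by a
  choice operator, specified as a normal map with prescribed values on elementary tensors, so a
  witness must be built for a normal completely bounded map. Its matrix entries with respect to
  \<open>onb\<close> are immediate; its normality rests on the fact that norm limits of ultraweakly
  continuous functionals on a commutant are again ultraweakly continuous, and this is what the
  Hahn-Banach theorem is for. Secondly, exponential vectors of step functions are far from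
  orthogonal: operators prescribed on them are well defined only through linear independence, and
  norms are reached only through pairings with their span. Uniqueness for the vector equation does
  the structural work. Linearity in \<open>u\<close>, adaptedness and commutation with the commutant
  of \<open>A\<close> all hold because the transformed path solves the equation with transformed
  data. As the spaces may be nonseparable, Bochner measurability is drawn from right-continuity,
  which step functions, gradients and coefficients share.\<close>

abbreviation "\<S> \<equiv> step_functions"

abbreviation (input) "\<B> \<equiv> bounded_ops"

section \<open>Hilbert space preliminaries\<close>

lemma csubspaceD:
  assumes "csubspace D"
  shows "0 \<in> D" "x \<in> D ==> y \<in> D ==> x + y \<in> D" "x \<in> D ==> c *\<^sub>C x \<in> D"
    "x \<in> D ==> y \<in> D ==> x - y \<in> D"
proof -
  show *: "0 \<in> D" "x \<in> D ==> y \<in> D ==> x + y \<in> D" "x \<in> D ==> c *\<^sub>C x \<in> D" for x y c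
    using assms by (auto simp: csubspace_def)
  show "x \<in> D ==> y \<in> D ==> x - y \<in> D"
    using *(2)[of x "- y"] *(3)[of y "-1"] by (simp add: scaleC_minus1)
qed

lemma csubspace_sum:
  assumes "csubspace D" "\<And>i. i \<in> S ==> f i \<in> D" shows "(\<Sum>i\<in>S. f i) \<in> D"
  using assms(2) by (induction S rule: infinite_finite_induct) (auto intro: csubspaceD[OF assms(1)])

lemma cspan_minimal: "csubspace D ==> S \<subseteq> D ==> cspan S \<subseteq> D"
  unfolding cspan_def by (auto intro!: csubspace_sum csubspaceD)

lemma sum_append:
  fixes m n :: nat and f g :: "nat => 'x::comm_monoid_add"
  shows "(\<Sum>i<m. f i) + (\<Sum>i<n. g i) = (\<Sum>i<m+n. if i < m then f i else g (i - m))"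
proof (induction n)
  case 0
  show ?case by (auto intro: sum.cong)
next
  case (Suc n)
  then show ?case by (simp add: add.assoc[symmetric])
qed

lemma csubspace_cspan: "csubspace (cspan S)"
  unfolding csubspace_def
proof (intro conjI ballI allI)
  show "0 \<in> cspan S" unfolding cspan_def by (auto intro!: exI[of _ "0::nat"])
next
  fix x y assume "x \<in> cspan S" "y \<in> cspan S"
  then obtain m n and c d :: "nat => complex" and a b where
    "x = (\<Sum>i<m. c i *\<^sub>C a i)" "\<forall>i<m. a i \<in> S" "y = (\<Sum>i<n. d i *\<^sub>C b i)" "\<forall>i<n. b i \<in> S"
    unfolding cspan_def by blast
  then show "x + y \<in> cspan S"
    unfolding cspan_def
    by (intro CollectI exI[of _ "m + n"] exI[of _ "\<lambda>i. if i < m then c i else d (i - m)"]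
        exI[of _ "\<lambda>i. if i < m then a i else b (i - m)"]) (auto simp: sum_append intro!: sum.cong)
next
  fix r x assume "x \<in> cspan S"
  then obtain m and c :: "nat => complex" and a where
    "x = (\<Sum>i<m. c i *\<^sub>C a i)" "\<forall>i<m. a i \<in> S"
    unfolding cspan_def by blast
  moreover have "r *\<^sub>C (\<Sum>i<m. c i *\<^sub>C a i) = (\<Sum>i<m. (r * c i) *\<^sub>C a i)"
    by (induction m) (auto simp: scaleC_add_right scaleC_scaleC)
  ultimately show "r *\<^sub>C x \<in> cspan S"
    unfolding cspan_def
    by (intro CollectI exI[of _ m] exI[of _ "\<lambda>i. r * c i"] exI[of _ a]) simp
qed

lemma cspan_superset: "x \<in> S ==> x \<in> cspan S"
  unfolding cspan_def by (rule CollectI, rule exI[of _ "1::nat"], rule exI[of _ "\<lambda>_. 1"], rule exI[of _ "\<lambda>_. x"]) simp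

lemma scaleC_sum_right: "r *\<^sub>C (\<Sum>i\<in>S. f i) = (\<Sum>i\<in>S. r *\<^sub>C f i)" for f :: "'i => 'a::cinner_space"
  by (induction S rule: infinite_finite_induct) (auto simp: scaleC_add_right)

lemma scaleC_diff_right: "r *\<^sub>C (x - y) = r *\<^sub>C x - r *\<^sub>C (y::'a::cinner_space)"
  by (metis add_diff_cancel_right' diff_add_cancel scaleC_add_right)

subsection \<open>Bounded operators\<close>

definition op_bound :: "('a::chilbert_space => 'b::chilbert_space) => real => bool"
  where "op_bound T K \<longleftrightarrow> (\<forall>x. norm (T x) \<le> K * norm x)"

lemma bounded_opsI:
  assumes "\<And>x y. T (x + y) = T x + T y" "\<And>c x. T (c *\<^sub>C x) = c *\<^sub>C T x" "op_bound T K"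
  shows "T \<in> \<B>"
  using assms by (auto simp: bounded_ops_def clinear_on_def csubspace_def op_bound_def)

lemma bounded_ops_simps:
  assumes "T \<in> \<B>"
  shows "T (x + y) = T x + T y" "T (c *\<^sub>C x) = c *\<^sub>C T x" "T 0 = 0" "T (x - y) = T x - T y"
    "T (\<Sum>i\<in>S. f i) = (\<Sum>i\<in>S. T (f i))" "T (- x) = - T x"
proof -
  show *: "T (x + y) = T x + T y" "T (c *\<^sub>C x) = c *\<^sub>C T x" for x y c
    using assms by (auto simp: bounded_ops_def clinear_on_def)
  show **: "T 0 = 0" using *(2)[of 0 0] by simp
  show ***: "T (- x) = - T x" for x using *(2)[of "-1" x] by (simp add: scaleC_minus1)
  show "T (x - y) = T x - T y" using *(1)[of x "- y"] by (simp add: ***)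
  show "T (\<Sum>i\<in>S. f i) = (\<Sum>i\<in>S. T (f i))"
    by (induction S rule: infinite_finite_induct) (auto simp: * **)
qed

lemma bounded_ops_bound:
  assumes "T \<in> \<B>" obtains K where "K \<ge> 0" "op_bound T K"
proof -
  obtain K where K: "\<And>x. norm (T x) \<le> K * norm x" using assms by (auto simp: bounded_ops_def)
  have "op_bound T (max K 0)" unfolding op_bound_def
    by (intro allI order.trans[OF K] mult_right_mono) auto
  then show ?thesis using that[of "max K 0"] by simp
qed

lemma bounded_ops_bounded_linear: assumes T: "T \<in> \<B>" shows "bounded_linear T"
proof -
  obtain K where K: "op_bound T K" using T by (metis bounded_ops_bound)
  show "bounded_linear T"
    by (rule bounded_linear_intro[of _ K])
      (use T K in \<open>auto simp: bounded_ops_simps scaleR_scaleC op_bound_def mult.commute\<close>)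
qed

lemmas bounded_ops_tendsto = bounded_linear.tendsto[OF bounded_ops_bounded_linear]
lemmas bounded_ops_continuous_on = bounded_linear.continuous_on[OF bounded_ops_bounded_linear]

lemma bounded_ops_id [simp]: "id \<in> \<B>" "(\<lambda>x. x) \<in> \<B>"
  by (auto intro!: bounded_opsI[of _ 1] simp: op_bound_def)

lemma bounded_ops_compose: "S \<in> \<B> ==> T \<in> \<B> ==> S \<circ> T \<in> \<B>"
proof -
  assume S: "S \<in> \<B>" and T: "T \<in> \<B>"
  obtain K L where "K \<ge> 0" "op_bound S K" "op_bound T L" using S T by (metis bounded_ops_bound)
  then have "norm (S (T x)) \<le> (K * L) * norm x" for x
    unfolding op_bound_def by (metis mult.assoc mult_left_mono order.trans)
  then show ?thesis
    by (intro bounded_opsI[of _ "K * L"]) (auto simp: bounded_ops_simps[OF S] bounded_ops_simps[OF T] op_bound_def)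
qed

lemma bounded_ops_add: "S \<in> \<B> ==> T \<in> \<B> ==> (\<lambda>x. S x + T x) \<in> \<B>"
proof -
  assume S: "S \<in> \<B>" and T: "T \<in> \<B>"
  obtain K L where "op_bound S K" "op_bound T L" using S T by (metis bounded_ops_bound)
  then have "norm (S x + T x) \<le> (K + L) * norm x" for x
    unfolding op_bound_def by (metis add_mono distrib_right norm_triangle_le)
  then show ?thesis
    by (intro bounded_opsI[of _ "K + L"])
      (auto simp: bounded_ops_simps[OF S] bounded_ops_simps[OF T] op_bound_def scaleC_add_right)
qed

lemma bounded_ops_scaleC: "T \<in> \<B> ==> (\<lambda>x. c *\<^sub>C T x) \<in> \<B>"
proof -
  assume T: "T \<in> \<B>"
  obtain L where "op_bound T L" using T by (metis bounded_ops_bound)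
  then have "norm (c *\<^sub>C T x) \<le> (cmod c * L) * norm x" for x
    unfolding op_bound_def norm_scaleC by (metis mult.assoc mult_left_mono norm_ge_zero)
  then show ?thesis
    by (intro bounded_opsI[of _ "cmod c * L"])
      (auto simp: bounded_ops_simps[OF T] op_bound_def scaleC_add_right scaleC_scaleC mult.commute)
qed

lemma bounded_ops_zero: "(\<lambda>x. 0) \<in> \<B>"
  by (rule bounded_opsI[of _ 0]) (auto simp: op_bound_def)

lemma bounded_ops_sum: "(\<And>i. i \<in> S ==> T i \<in> \<B>) ==> (\<lambda>x. \<Sum>i\<in>S. T i x) \<in> \<B>"
  by (induction S rule: infinite_finite_induct) (auto intro: bounded_ops_add bounded_ops_zero)

lemma bounded_bilinear_cinner: "bounded_bilinear (cinner :: 'a::chilbert_space => 'a => complex)"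
proof
  fix x y z :: 'a and r :: real
  show "cinner (x + y) z = cinner x z + cinner y z" by (rule cinner_add_left)
  show "cinner x (y + z) = cinner x y + cinner x z" by (rule cinner_add_right)
  show "cinner (r *\<^sub>R x) y = r *\<^sub>R cinner x y"
    by (simp add: scaleR_scaleC[of r x] cinner_scaleC_left scaleR_conv_of_real)
  show "cinner x (r *\<^sub>R y) = r *\<^sub>R cinner x y"
    by (simp add: scaleR_scaleC[of r y] cinner_scaleC_right scaleR_conv_of_real)
  show "\<exists>K. \<forall>x y::'a. cmod (cinner x y) \<le> norm x * norm y * K"
    by (intro exI[of _ 1] allI) (simp add: norm_cinner_le)
qed

lemmas tendsto_cinner = bounded_bilinear.tendsto[OF bounded_bilinear_cinner]
lemmas continuous_on_cinner' = bounded_bilinear.continuous_on[OF bounded_bilinear_cinner]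
lemmas continuous_cinner = bounded_bilinear.continuous[OF bounded_bilinear_cinner]

lemma bounded_bilinear_scaleC: "bounded_bilinear (scaleC :: complex => 'a::chilbert_space => 'a)"
  by standard (auto simp: scaleC_add_left scaleC_add_right scaleR_scaleC scaleC_scaleC scaleC_complex_def
      norm_scaleC mult.commute intro!: exI[of _ 1])

lemmas tendsto_scaleC = bounded_bilinear.tendsto[OF bounded_bilinear_scaleC]
lemmas continuous_on_scaleC' = bounded_bilinear.continuous_on[OF bounded_bilinear_scaleC]

lemma cinner_eqI: "(\<And>z. cinner z x = cinner z y) ==> x = y" for x y :: "'a::chilbert_space"
  by (metis cinner_diff_right cinner_eq_zero cancel_comm_monoid_add_class.diff_cancel eq_iff_diff_eq_0)

lemma norm_add_orthogonal:
  fixes x y :: "'a::chilbert_space"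
  assumes "cinner x y = 0" shows "(norm (x + y))\<^sup>2 = (norm x)\<^sup>2 + (norm y)\<^sup>2"
  using assms cinner_commute[of y x] by (simp add: norm2_cinner cinner_add_left cinner_add_right)

lemma norm_sum_sq:
  fixes f :: "'i => 'a::chilbert_space"
  shows "complex_of_real ((norm (\<Sum>i\<in>S. f i))\<^sup>2) = (\<Sum>i\<in>S. \<Sum>k\<in>S. cinner (f i) (f k))"
proof -
  have "complex_of_real ((norm (\<Sum>i\<in>S. f i))\<^sup>2) = cinner (\<Sum>i\<in>S. f i) (\<Sum>i\<in>S. f i)" by (rule cinner_self[symmetric])
  also have "\<dots> = (\<Sum>i\<in>S. \<Sum>k\<in>S. cinner (f i) (f k))" by (subst cinner_sum_left) (simp add: cinner_sum_right)
  finally show ?thesis .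
qed

subsection \<open>Projections and the Riesz representation theorem\<close>

lemma csubspace_closure:
  assumes "csubspace (D::'a::chilbert_space set)" shows "csubspace (closure D)"
  unfolding csubspace_def
proof (intro conjI ballI allI)
  show "0 \<in> closure D" using assms closure_subset csubspaceD(1) by blast
  fix x assume x: "x \<in> closure D"
  then obtain f where f: "\<And>n. f n \<in> D" "f \<longlonglongrightarrow> x" unfolding closure_sequential by blast
  show "c *\<^sub>C x \<in> closure D" for c
    unfolding closure_sequential using f csubspaceD(3)[OF assms]
    by (intro exI[of _ "\<lambda>n. c *\<^sub>C f n"]) (auto intro!: tendsto_scaleC)
  fix y assume "y \<in> closure D"
  then obtain g where g: "\<And>n. g n \<in> D" "g \<longlonglongrightarrow> y" unfolding closure_sequential by blast
  show "x + y \<in> closure D"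
    unfolding closure_sequential using f g csubspaceD(2)[OF assms]
    by (intro exI[of _ "\<lambda>n. f n + g n"]) (auto intro!: tendsto_add)
qed

lemma parallelogram:
  fixes x y :: "'a::chilbert_space"
  shows "(norm (x + y))\<^sup>2 + (norm (x - y))\<^sup>2 = 2 * (norm x)\<^sup>2 + 2 * (norm y)\<^sup>2"
  by (simp add: norm2_cinner cinner_add_left cinner_add_right cinner_diff_left cinner_diff_right)

lemma projection_exists:
  fixes D :: "'a::chilbert_space set"
  assumes D: "csubspace D" and cl: "closed D"
  shows "\<exists>p\<in>D. \<forall>d\<in>D. cinner d (x - p) = 0"
proof -
  define \<delta> where "\<delta> = Inf ((\<lambda>d. (norm (x - d))\<^sup>2) ` D)"
  have ne: "(\<lambda>d. (norm (x - d))\<^sup>2) ` D \<noteq> {}" using csubspaceD(1)[OF D] by blast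
  have le: "\<delta> \<le> (norm (x - d))\<^sup>2" if "d \<in> D" for d
    unfolding \<delta>_def using that by (intro cInf_lower bdd_belowI[of _ 0]) auto
  have "\<exists>d\<in>D. (norm (x - d))\<^sup>2 < \<delta> + 1 / Suc n" for n
  proof (rule ccontr)
    assume "\<not> ?thesis"
    then have "\<delta> + 1 / Suc n \<le> \<delta>" unfolding \<delta>_def by (intro cInf_greatest[OF ne]) force
    then show False by (simp add: divide_le_0_iff)
  qed
  then obtain d where d: "\<And>n. d n \<in> D" "\<And>n. (norm (x - d n))\<^sup>2 < \<delta> + 1 / Suc n" by metis
  have lim: "(\<lambda>n. 1 / Suc n) \<longlonglongrightarrow> 0"
    using LIMSEQ_inverse_real_of_nat by (simp add: inverse_eq_divide)
  \<comment> \<open>The midpoint of \<open>d m\<close> and \<open>d n\<close> lies in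
    \<open>D\<close>, so its squared distance to \<open>x\<close> is at least the infimum; the
    parallelogram law turns near minimality of both into closeness.\<close>
  have sqd: "(norm (d m - d n))\<^sup>2 \<le> 2 * (1 / Suc m + 1 / Suc n)" for m n
  proof -
    have "(1/2) *\<^sub>C (d m + d n) \<in> D" by (intro csubspaceD[OF D] d)
    from le[OF this] have "4 * \<delta> \<le> (norm (2 *\<^sub>C (x - (1/2) *\<^sub>C (d m + d n))))\<^sup>2"
      by (simp add: norm_scaleC power_mult_distrib)
    also have "2 *\<^sub>C (x - (1/2) *\<^sub>C (d m + d n)) = (x - d m) + (x - d n)"
      using scaleC_add_left[of 1 1 x] by (simp add: scaleC_diff_right scaleC_scaleC)
    finally show ?thesis
      using parallelogram[of "x - d m" "x - d n"] d(2)[of m] d(2)[of n] by (simp add: norm_minus_commute)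
  qed
  have "Cauchy d"
  proof (rule metric_CauchyI)
    fix e :: real assume e: "e > 0"
    then have "eventually (\<lambda>n. 1 / Suc n < e\<^sup>2 / 4) sequentially"
      by (intro order_tendstoD(2)[OF lim]) auto
    then obtain N where N: "\<And>n. n \<ge> N ==> 1 / Suc n < e\<^sup>2 / 4"
      by (auto simp: eventually_sequentially)
    have "dist (d m) (d n) < e" if "m \<ge> N" "n \<ge> N" for m n
    proof -
      have "(norm (d m - d n))\<^sup>2 < e\<^sup>2" using sqd[of m n] N[OF that(1)] N[OF that(2)] by argo
      then show ?thesis unfolding dist_norm using e by (simp add: power2_less_imp_less)
    qed
    then show "\<exists>M. \<forall>m\<ge>M. \<forall>n\<ge>M. dist (d m) (d n) < e" by blast
  qed
  then obtain p where p: "d \<longlonglongrightarrow> p" using Cauchy_convergent convergent_def by blast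
  have pD: "p \<in> D" using closed_sequentially[OF cl d(1) p] .
  have "(\<lambda>n. \<delta> + 1 / Suc n) \<longlonglongrightarrow> \<delta> + 0" by (intro tendsto_add tendsto_const lim)
  moreover have "(\<lambda>n. (norm (x - d n))\<^sup>2) \<longlonglongrightarrow> (norm (x - p))\<^sup>2" by (intro tendsto_intros p)
  ultimately have np: "(norm (x - p))\<^sup>2 \<le> \<delta>"
    using LIMSEQ_le[of "\<lambda>n. (norm (x - d n))\<^sup>2" _ "\<lambda>n. \<delta> + 1 / Suc n"] less_imp_le[OF d(2)] by auto
  have "cinner e (x - p) = 0" if e: "e \<in> D" for e
  proof (rule ccontr)
    assume ne0: "cinner e (x - p) \<noteq> 0"
    then have "e \<noteq> 0" by auto
    then have npos: "(norm e)\<^sup>2 > 0" by simp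
    \<comment> \<open>The coefficient of the component of \<open>x - p\<close> along
      \<open>e\<close>: by Pythagoras \<open>p + c *\<^sub>C e\<close> would be closer to
      \<open>x\<close> than the minimiser \<open>p\<close> unless this component vanishes.\<close>
    define c where "c = cinner e (x - p) / (norm e)\<^sup>2"
    have "p + c *\<^sub>C e \<in> D" by (intro csubspaceD[OF D] pD e)
    have "c * cinner e e = cinner e (x - p)" using npos by (simp add: c_def cinner_self del: of_real_power)
    then have "cinner (c *\<^sub>C e) (x - p - c *\<^sub>C e) = 0"
      by (simp add: cinner_diff_right[of e "x - p"] cinner_scaleC_left cinner_scaleC_right)
    from norm_add_orthogonal[OF this]
    have "(norm (x - p))\<^sup>2 = (norm (c *\<^sub>C e))\<^sup>2 + (norm (x - p - c *\<^sub>C e))\<^sup>2" by simp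
    moreover have "\<delta> \<le> (norm (x - p - c *\<^sub>C e))\<^sup>2" using le[OF \<open>p + c *\<^sub>C e \<in> D\<close>] by (simp add: diff_diff_eq)
    ultimately have "(norm (c *\<^sub>C e))\<^sup>2 \<le> 0" using np by linarith
    then have "norm (c *\<^sub>C e) = 0" by simp
    then show False using ne0 \<open>e \<noteq> 0\<close> by (simp add: norm_scaleC c_def)
  qed
  then show ?thesis using pD by blast
qed

text \<open>Totality is phrased by a trivial annihilator because the families serve to test vectors;
  \<open>ctotal_closure\<close> converts it into density of the span by the projection
  theorem.\<close>

definition ctotal :: "'a::chilbert_space set => bool"
  where "ctotal S \<longleftrightarrow> (\<forall>x. (\<forall>a\<in>S. cinner a x = 0) --> x = 0)"

lemma ctotalD: "ctotal S ==> (\<And>a. a \<in> S ==> cinner a x = cinner a y) ==> x = y"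
  unfolding ctotal_def by (metis cinner_diff_right cancel_comm_monoid_add_class.diff_cancel eq_iff_diff_eq_0)

lemma ctotal_closure: "ctotal S ==> closure (cspan S) = UNIV"
proof -
  assume S: "ctotal S"
  have "x \<in> closure (cspan S)" for x
  proof -
    obtain p where p: "p \<in> closure (cspan S)" "\<And>d. d \<in> closure (cspan S) ==> cinner d (x - p) = 0"
      using projection_exists[of "closure (cspan S)" x] csubspace_closure csubspace_cspan by blast
    have "x - p = 0" using S p(2) closure_subset cspan_superset unfolding ctotal_def by (metis subsetD)
    then show ?thesis using p by simp
  qed
  then show ?thesis by blast
qed

lemma bounded_ops_eqI:
  assumes "S \<in> \<B>" "T \<in> \<B>" "ctotal B" "\<And>b. b \<in> B ==> S b = T b"
  shows "S = T"
proof
  fix x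
  have "csubspace {x. S x = T x}"
    unfolding csubspace_def
    by (simp add: bounded_ops_simps(1-3)[OF assms(1)] bounded_ops_simps(1-3)[OF assms(2)])
  then have "cspan B \<subseteq> {x. S x = T x}" using assms(4) by (intro cspan_minimal) auto
  moreover have "closed {x. S x = T x}"
    by (rule closed_Collect_eq[OF bounded_ops_continuous_on[OF assms(1) continuous_on_id]
          bounded_ops_continuous_on[OF assms(2) continuous_on_id]])
  ultimately have "closure (cspan B) \<subseteq> {x. S x = T x}" by (rule closure_minimal)
  then show "S x = T x" using ctotal_closure[OF assms(3)] by auto
qed

lemma sum_union_scaleC:
  fixes h :: "'i => 'x::chilbert_space"
  assumes "finite S" "finite S'"
  shows "(\<Sum>i\<in>S\<union>S'. ((if i \<in> S then c i else 0) + (if i \<in> S' then c' i else 0)) *\<^sub>C h i) =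
    (\<Sum>i\<in>S. c i *\<^sub>C h i) + (\<Sum>i\<in>S'. c' i *\<^sub>C h i)"
proof -
  have "(\<Sum>i\<in>S\<union>S'. (if i \<in> S then c i else 0) *\<^sub>C h i) = (\<Sum>i\<in>S. c i *\<^sub>C h i)"
    by (rule sum.mono_neutral_cong_right) (use assms in auto)
  moreover have "(\<Sum>i\<in>S\<union>S'. (if i \<in> S' then c' i else 0) *\<^sub>C h i) = (\<Sum>i\<in>S'. c' i *\<^sub>C h i)"
    by (rule sum.mono_neutral_cong_right) (use assms in auto)
  ultimately show ?thesis unfolding scaleC_add_left sum.distrib by simp
qed

text \<open>The inequality on the family makes \<open>a i \<mapsto> b i\<close> well defined on the span, so that no linear
  independence is needed; the operator is the closure of the graph.\<close>

lemma operator_of_family: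
  fixes a :: "'i => 'a::chilbert_space" and b :: "'i => 'b::chilbert_space"
  assumes tot: "ctotal (a ` I)" and C: "C \<ge> 0"
    and bd: "\<And>S c. finite S ==> S \<subseteq> I ==> norm (\<Sum>i\<in>S. c i *\<^sub>C b i) \<le> C * norm (\<Sum>i\<in>S. c i *\<^sub>C a i)"
  shows "\<exists>T\<in>\<B>. (\<forall>i\<in>I. T (a i) = b i) \<and> op_bound T C"
proof -
  define \<Gamma> where "\<Gamma> = {(\<Sum>i\<in>S. c i *\<^sub>C a i, \<Sum>i\<in>S. c i *\<^sub>C b i) | S c. finite S \<and> S \<subseteq> I}"
  have G: "csubspace \<Gamma>"
    unfolding csubspace_def
  proof (intro conjI ballI allI)
    show "0 \<in> \<Gamma>" unfolding \<Gamma>_def by (auto simp: zero_prod_def intro!: exI[of _ "{}"])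
    fix p assume "p \<in> \<Gamma>"
    then obtain S c where p: "p = (\<Sum>i\<in>S. c i *\<^sub>C a i, \<Sum>i\<in>S. c i *\<^sub>C b i)" "finite S" "S \<subseteq> I"
      unfolding \<Gamma>_def by blast
    have "r *\<^sub>C p = (\<Sum>i\<in>S. (r * c i) *\<^sub>C a i, \<Sum>i\<in>S. (r * c i) *\<^sub>C b i)" for r
      unfolding p scaleC_prod_def by (simp add: scaleC_sum_right scaleC_scaleC)
    then show "r *\<^sub>C p \<in> \<Gamma>" for r
      unfolding \<Gamma>_def using p(2,3) by (intro CollectI exI[of _ S] exI[of _ "\<lambda>i. r * c i"]) simp
    fix q assume "q \<in> \<Gamma>"
    then obtain S' c' where q: "q = (\<Sum>i\<in>S'. c' i *\<^sub>C a i, \<Sum>i\<in>S'. c' i *\<^sub>C b i)" "finite S'" "S' \<subseteq> I"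
      unfolding \<Gamma>_def by blast
    define d where "d i = (if i \<in> S then c i else 0) + (if i \<in> S' then c' i else 0)" for i
    have "p + q = (\<Sum>i\<in>S\<union>S'. d i *\<^sub>C a i, \<Sum>i\<in>S\<union>S'. d i *\<^sub>C b i)"
      unfolding p q d_def by (simp add: sum_union_scaleC p q)
    then show "p + q \<in> \<Gamma>" unfolding \<Gamma>_def using p q by blast
  qed
  have clG: "csubspace (closure \<Gamma>)" by (rule csubspace_closure[OF G])
  have bG: "norm (snd p) \<le> C * norm (fst p)" if "p \<in> closure \<Gamma>" for p
  proof -
    have "\<Gamma> \<subseteq> {p. norm (snd p) \<le> C * norm (fst p)}" using bd unfolding \<Gamma>_def by auto
    moreover have "closed {p::'a \<times> 'b. norm (snd p) \<le> C * norm (fst p)}"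
      by (intro closed_Collect_le continuous_intros)
    ultimately have "closure \<Gamma> \<subseteq> {p. norm (snd p) \<le> C * norm (fst p)}" by (rule closure_minimal)
    then show ?thesis using that by blast
  qed
  have uniq: "y = y'" if "(x, y) \<in> closure \<Gamma>" "(x, y') \<in> closure \<Gamma>" for x y y'
    using bG[OF csubspaceD(4)[OF clG that]] by simp
  have ab: "(a i, b i) \<in> closure \<Gamma>" if "i \<in> I" for i
  proof -
    have "(a i, b i) \<in> \<Gamma>" unfolding \<Gamma>_def
      by (intro CollectI exI[of _ "{i}"] exI[of _ "\<lambda>_. 1"]) (use that in auto)
    then show ?thesis using closure_subset by blast
  qed
  \<comment> \<open>The first projection is bounded below on the closed graph by
    \<open>1 / (1 + C)\<close>, so its image is complete, hence closed; as it contains a total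
    family, it is everything.\<close>
  have "complete (fst ` closure \<Gamma>)"
  proof (rule complete_isometric_image[of "1 / (1 + C)"])
    show "subspace (closure \<Gamma>)"
      unfolding subspace_def using csubspaceD(1-3)[OF clG] by (simp add: scaleR_scaleC)
    show "\<forall>p\<in>closure \<Gamma>. 1 / (1 + C) * norm p \<le> norm (fst p)"
    proof
      fix p assume "p \<in> closure \<Gamma>"
      then have "norm p \<le> (1 + C) * norm (fst p)" using norm_Pair_le[of "fst p" "snd p"] bG by (fastforce simp: distrib_right)
      then show "1 / (1 + C) * norm p \<le> norm (fst p)" using C by (simp add: divide_le_eq mult.commute)
    qed
  qed (use C in \<open>auto simp: complete_eq_closed bounded_linear_fst\<close>)
  then have cl: "closed (fst ` closure \<Gamma>)" by (simp add: complete_eq_closed)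
  have "cspan (a ` I) \<subseteq> fst ` closure \<Gamma>"
  proof (rule cspan_minimal)
    have "\<exists>y. (x + x', y) \<in> closure \<Gamma>" "\<exists>y. (c *\<^sub>C x, y) \<in> closure \<Gamma>"
      if "(x, y) \<in> closure \<Gamma>" "(x', y') \<in> closure \<Gamma>" for x x' y y' c
      using csubspaceD(2)[OF clG that] csubspaceD(3)[OF clG that(1), of c] by (auto simp: scaleC_prod_def)
    moreover have "(0, 0) \<in> closure \<Gamma>" using csubspaceD(1)[OF clG] by (simp add: zero_prod_def)
    moreover have img: "fst ` closure \<Gamma> = {x. \<exists>y. (x, y) \<in> closure \<Gamma>}" by force
    ultimately show "csubspace (fst ` closure \<Gamma>)" unfolding csubspace_def img by blast
  qed (use ab in force)
  then have "closure (cspan (a ` I)) \<subseteq> fst ` closure \<Gamma>" using cl by (rule closure_minimal)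
  then have dom: "\<exists>y. (x, y) \<in> closure \<Gamma>" for x using ctotal_closure[OF tot] by force
  define T where "T x = (THE y. (x, y) \<in> closure \<Gamma>)" for x
  have T: "(x, T x) \<in> closure \<Gamma>" for x
    unfolding T_def by (rule theI') (use dom uniq in blast)
  have "T \<in> \<B>"
  proof (rule bounded_opsI)
    show "T (x + y) = T x + T y" for x y
      using uniq[OF T[of "x + y"]] csubspaceD(2)[OF clG T[of x] T[of y]] by simp
    show "T (c *\<^sub>C x) = c *\<^sub>C T x" for c x
      using uniq[OF T[of "c *\<^sub>C x"]] csubspaceD(3)[OF clG T[of x], of c] by (simp add: scaleC_prod_def)
    show "op_bound T C" using bG[OF T] by (simp add: op_bound_def)
  qed
  moreover have "T (a i) = b i" if "i \<in> I" for i by (rule uniq[OF T ab[OF that]])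
  moreover have "op_bound T C" using bG[OF T] by (simp add: op_bound_def)
  ultimately show ?thesis by blast
qed

lemma riesz:
  fixes \<phi> :: "'a::chilbert_space => complex"
  assumes \<phi>: "\<phi> \<in> \<B>" shows "\<exists>y. \<forall>x. \<phi> x = cinner y x"
proof (cases "\<forall>x. \<phi> x = 0")
  case True
  then show ?thesis by (intro exI[of _ 0]) simp
next
  case False
  then obtain x0 where x0: "\<phi> x0 \<noteq> 0" by blast
  let ?N = "{x. \<phi> x = 0}"
  have "csubspace ?N" unfolding csubspace_def by (auto simp: bounded_ops_simps[OF \<phi>])
  moreover have "closed ?N"
    by (rule closed_Collect_eq[OF bounded_ops_continuous_on[OF \<phi> continuous_on_id] continuous_on_const])
  ultimately obtain p where p: "\<phi> p = 0" "\<And>d. \<phi> d = 0 ==> cinner d (x0 - p) = 0"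
    using projection_exists[of ?N x0] by blast
  define w where "w = x0 - p"
  have w: "\<phi> w \<noteq> 0" using p x0 by (simp add: w_def bounded_ops_simps[OF \<phi>])
  then have w0: "w \<noteq> 0" using bounded_ops_simps(3)[OF \<phi>] by auto
  have "\<phi> x = cinner ((cnj (\<phi> w) / (norm w)\<^sup>2) *\<^sub>C w) x" for x
  proof -
    have "\<phi> (\<phi> w *\<^sub>C x - \<phi> x *\<^sub>C w) = 0" by (simp add: bounded_ops_simps[OF \<phi>] scaleC_complex_def)
    from p(2)[OF this] have "cinner (\<phi> w *\<^sub>C x - \<phi> x *\<^sub>C w) w = 0" by (simp add: w_def)
    then have "cnj (\<phi> w) * cinner x w = cnj (\<phi> x) * complex_of_real ((norm w)\<^sup>2)"
      by (simp add: cinner_diff_left cinner_scaleC_left cinner_self del: of_real_power)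
    then have "cnj (cnj (\<phi> w) * cinner x w) = cnj (cnj (\<phi> x) * complex_of_real ((norm w)\<^sup>2))" by simp
    then have "\<phi> w * cinner w x = \<phi> x * complex_of_real ((norm w)\<^sup>2)"
      using cinner_commute[of w x] by simp
    then show ?thesis using w0 by (simp add: cinner_scaleC_left field_simps)
  qed
  then show ?thesis by blast
qed

lemma norm_le_cinner:
  fixes x :: "'a::chilbert_space"
  assumes "\<And>y. cmod (cinner y x) \<le> C * norm y" "C \<ge> 0" shows "norm x \<le> C"
proof (cases "x = 0")
  case False
  then show ?thesis using assms(1)[of x] by (simp add: cinner_self power2_eq_square norm_mult)
qed (use assms in simp)

lemma adj_cinner:
  fixes T :: "'a::chilbert_space => 'b::chilbert_space"
  assumes T: "T \<in> \<B>"
  shows "cinner (adj T x) y = cinner x (T y)" "cinner y (adj T x) = cinner (T y) x"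
proof -
  have "\<exists>z. \<forall>y. cinner x (T y) = cinner z y" for x
  proof (rule riesz)
    obtain K where K: "op_bound T K" using T by (metis bounded_ops_bound)
    have "cmod (cinner x (T y)) \<le> (norm x * K) * norm y" for y
    proof -
      have "cmod (cinner x (T y)) \<le> norm x * norm (T y)" by (rule norm_cinner_le)
      also have "\<dots> \<le> norm x * (K * norm y)" using K by (intro mult_left_mono) (auto simp: op_bound_def)
      finally show ?thesis by (simp add: mult.assoc)
    qed
    then show "(\<lambda>y. cinner x (T y)) \<in> \<B>"
      by (intro bounded_opsI[of _ "norm x * K"])
        (auto simp: bounded_ops_simps[OF T] cinner_add_right cinner_scaleC_right scaleC_complex_def op_bound_def)
  qed
  then have "\<exists>S. \<forall>x y. cinner x (T y) = cinner (S x) y" by metis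
  then have "\<exists>S. \<forall>x y. cinner (S x) y = cinner x (T y)" by metis
  from someI_ex[OF this] have *: "cinner (adj T x) y = cinner x (T y)" for x y unfolding adj_def by blast
  then show "cinner (adj T x) y = cinner x (T y)" .
  show "cinner y (adj T x) = cinner (T y) x" using * by (metis cinner_commute)
qed

lemma adj_eqI:
  assumes "T \<in> \<B>" "\<And>x y. cinner (S x) y = cinner x (T y)" shows "adj T = S"
proof
  fix x show "adj T x = S x"
    by (rule cinner_eqI) (metis adj_cinner(1)[OF assms(1)] assms(2) cinner_commute)
qed

lemma op_bound_adj:
  assumes T: "T \<in> \<B>" and K: "op_bound T K" "K \<ge> 0" shows "op_bound (adj T) K"
  unfolding op_bound_def
proof
  fix x
  show "norm (adj T x) \<le> K * norm x"
  proof (rule norm_le_cinner)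
    fix y
    have "cmod (cinner y (adj T x)) \<le> norm (T y) * norm x" unfolding adj_cinner[OF T] by (rule norm_cinner_le)
    also have "\<dots> \<le> (K * norm y) * norm x" using K by (intro mult_right_mono) (auto simp: op_bound_def)
    finally show "cmod (cinner y (adj T x)) \<le> K * norm x * norm y" by (simp add: mult_ac)
  qed (use K in simp)
qed

lemma adj_bounded_ops [simp]: assumes T: "T \<in> \<B>" shows "adj T \<in> \<B>"
proof -
  obtain K where K: "K \<ge> 0" "op_bound T K" using T by (rule bounded_ops_bound)
  show ?thesis
  proof (rule bounded_opsI[OF _ _ op_bound_adj[OF T K(2,1)]])
    show "adj T (x + y) = adj T x + adj T y" for x y
      by (rule cinner_eqI) (simp add: adj_cinner[OF T] cinner_add_right)
    show "adj T (c *\<^sub>C x) = c *\<^sub>C adj T x" for c x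
      by (rule cinner_eqI) (simp add: adj_cinner[OF T] cinner_scaleC_right)
  qed
qed

lemma adj_id [simp]: "adj id = id"
  by (rule adj_eqI) simp_all

text \<open>A moment problem. The inequality says that the prescribed inner products depend
  boundedly on the combination, so their conjugates extend to a bounded functional, which Riesz
  represents. Weak integrals become vectors in this way.\<close>

lemma vector_of_family:
  fixes a :: "'i => 'a::chilbert_space" and b :: "'i => complex"
  assumes tot: "ctotal (a ` I)" and C: "C \<ge> 0"
    and bd: "\<And>S c. finite S ==> S \<subseteq> I ==> cmod (\<Sum>i\<in>S. cnj (c i) * b i) \<le> C * norm (\<Sum>i\<in>S. c i *\<^sub>C a i)"
  shows "\<exists>z. (\<forall>i\<in>I. cinner (a i) z = b i) \<and> norm z \<le> C"
proof -
  have "norm (\<Sum>i\<in>S. c i *\<^sub>C cnj (b i)) \<le> C * norm (\<Sum>i\<in>S. c i *\<^sub>C a i)" if "finite S" "S \<subseteq> I" for S c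
  proof -
    have "(\<Sum>i\<in>S. c i *\<^sub>C cnj (b i)) = cnj (\<Sum>i\<in>S. cnj (c i) * b i)" by (simp add: scaleC_complex_def)
    then show ?thesis using bd[OF that] by (simp only: complex_mod_cnj)
  qed
  from operator_of_family[OF tot C this]
  obtain T where T: "T \<in> \<B>" "\<And>i. i \<in> I ==> T (a i) = cnj (b i)" "op_bound T C" by blast
  obtain z where z: "\<And>x. T x = cinner z x" using riesz[OF T(1)] by blast
  have "cinner (a i) z = b i" if "i \<in> I" for i
    using T(2)[OF that] z cinner_commute[of "a i" z] by simp
  moreover have "norm z \<le> C"
    using norm_le_cinner[of z C] T(3) C unfolding op_bound_def z by (metis cinner_commute complex_mod_cnj)
  ultimately show ?thesis by blast
qed

text \<open>The estimate is available only on the span of the family, where \<open>x\<close> itself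
  need not lie. The moment problem with the values \<open>cinner (a i) x\<close> has a solution of
  norm at most \<open>C\<close>, and totality makes it \<open>x\<close>.\<close>

lemma norm_le_cinner_total:
  fixes x :: "'a::chilbert_space"
  assumes tot: "ctotal (a ` I)" and C: "C \<ge> 0"
    and bd: "\<And>S c. finite S ==> S \<subseteq> I ==> cmod (cinner (\<Sum>i\<in>S. c i *\<^sub>C a i) x) \<le> C * norm (\<Sum>i\<in>S. c i *\<^sub>C a i)"
  shows "norm x \<le> C"
proof -
  have "cinner (\<Sum>i\<in>S. c i *\<^sub>C a i) x = (\<Sum>i\<in>S. cnj (c i) * cinner (a i) x)" for S c
    by (simp add: cinner_sum_left cinner_scaleC_left)
  then obtain z where z: "\<forall>i\<in>I. cinner (a i) z = cinner (a i) x" "norm z \<le> C"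
    using vector_of_family[OF tot C, of "\<lambda>i. cinner (a i) x"] bd by force
  then have "z = x" using ctotalD[OF tot, of z x] by blast
  then show ?thesis using z by simp
qed

text \<open>Equiboundedness turns convergence on a total set into convergence everywhere:
  approximate \<open>x\<close> from the span and split into three differences.\<close>

lemma tendsto_bounded_ops_total:
  fixes T :: "'i => 'a::chilbert_space => 'b::chilbert_space"
  assumes T: "\<And>i. T i \<in> \<B>" "\<And>i. op_bound (T i) K" and S: "S \<in> \<B>"
    and tot: "ctotal B" and lim: "\<And>b. b \<in> B ==> ((\<lambda>i. T i b) \<longlongrightarrow> S b) \<F>"
  shows "((\<lambda>i. T i x) \<longlongrightarrow> S x) \<F>"
proof -
  let ?D = "{x. ((\<lambda>i. T i x) \<longlongrightarrow> S x) \<F>}"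
  obtain L where L: "L \<ge> 0" "op_bound S L" using S by (rule bounded_ops_bound)
  have "csubspace ?D" unfolding csubspace_def
    by (auto simp: bounded_ops_simps(1-3)[OF T(1)] bounded_ops_simps(1-3)[OF S]
        intro!: tendsto_add tendsto_scaleC)
  then have D: "cspan B \<subseteq> ?D" using lim by (intro cspan_minimal) auto
  have K: "norm (T i x) \<le> max K 0 * norm x" for i x
    using T(2)[of i] unfolding op_bound_def by (meson max.cobounded1 mult_right_mono norm_ge_zero order_trans)
  show ?thesis
  proof (rule tendstoI)
    fix e :: real assume e: "e > 0"
    let ?q = "max K 0 + L + 1"
    have q: "?q > 0" using L by auto
    have "x \<in> closure (cspan B)" using ctotal_closure[OF tot] by simp
    then obtain y where y: "y \<in> cspan B" "dist y x < e / (2 * ?q)"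
      using q e unfolding closure_approachable by (metis divide_pos_pos mult_pos_pos zero_less_numeral)
    have "eventually (\<lambda>i. dist (T i y) (S y) < e / 2) \<F>"
      using D y(1) e by (intro tendstoD) auto
    then show "eventually (\<lambda>i. dist (T i x) (S x) < e) \<F>"
    proof eventually_elim
      case (elim i)
      have "dist (T i x) (S x) \<le> norm (T i (x - y)) + dist (T i y) (S y) + norm (S (y - x))"
        unfolding dist_norm bounded_ops_simps[OF T(1)] bounded_ops_simps[OF S]
        using norm_triangle_ineq[of "(T i x - T i y) + (T i y - S y)" "S y - S x"]
          norm_triangle_ineq[of "T i x - T i y" "T i y - S y"] by simp
      also have "\<dots> \<le> max K 0 * norm (x - y) + dist (T i y) (S y) + L * norm (y - x)"
        using K[of i "x - y"] L(2) unfolding op_bound_def by (intro add_mono) auto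
      also have "\<dots> = (max K 0 + L) * dist y x + dist (T i y) (S y)"
        by (simp add: dist_norm norm_minus_commute algebra_simps)
      also have "\<dots> \<le> ?q * dist y x + dist (T i y) (S y)" by (intro add_right_mono mult_right_mono) auto
      also have "?q * dist y x < e / 2" using y(2) q by (simp add: field_simps)
      finally show ?case using elim by simp
    qed
  qed
qed

section \<open>Tensor products of vectors and operators\<close>

lemma tensor_add_left: "tensor (u + u') v = tensor u v + tensor u' v"
  by (rule Rep_htensor_inject[THEN iffD1])
    (simp add: Rep_tensor plus_htensor.rep_eq coords_add scaleC_add_left)

lemma tensor_add_right: "tensor u (v + v') = tensor u v + tensor u v'"
  by (rule Rep_htensor_inject[THEN iffD1]) (simp add: Rep_tensor plus_htensor.rep_eq scaleC_add_right)

lemma tensor_scaleC_left: "tensor (c *\<^sub>C u) v = c *\<^sub>C tensor u v"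
  by (rule Rep_htensor_inject[THEN iffD1])
    (simp add: Rep_tensor scaleC_htensor.rep_eq coords_scaleC scaleC_scaleC scaleC_complex_def)

lemma tensor_scaleC_right: "tensor u (c *\<^sub>C v) = c *\<^sub>C tensor u v"
  by (rule Rep_htensor_inject[THEN iffD1])
    (simp add: Rep_tensor scaleC_htensor.rep_eq scaleC_scaleC mult.commute)

lemma tensor_zero [simp]: "tensor 0 v = 0" "tensor u 0 = 0"
  using tensor_scaleC_left[of 0 0 v] tensor_scaleC_right[of u 0 0] by simp_all

lemma tensor_diff_left: "tensor (u - u') v = tensor u v - tensor u' v"
  using tensor_add_left[of "u - u'" u' v] by (simp add: algebra_simps)

lemma tensor_diff_right: "tensor u (v - v') = tensor u v - tensor u v'"
  using tensor_add_right[of u "v - v'" v'] by (simp add: algebra_simps)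

lemma tensor_sum_left: "tensor (\<Sum>i\<in>S. f i) v = (\<Sum>i\<in>S. tensor (f i) v)"
  by (induction S rule: infinite_finite_induct) (auto simp: tensor_add_left)

lemma tensor_sum_right: "tensor u (\<Sum>i\<in>S. f i) = (\<Sum>i\<in>S. tensor u (f i))"
  by (induction S rule: infinite_finite_induct) (auto simp: tensor_add_right)

lemma norm_tensor: "norm (tensor u v) = norm u * norm v"
proof -
  have "complex_of_real ((norm (tensor u v))\<^sup>2) = complex_of_real ((norm u * norm v)\<^sup>2)"
    unfolding cinner_self[symmetric] cinner_tensor
    by (simp add: cinner_self power_mult_distrib)
  then have "(norm (tensor u v))\<^sup>2 = (norm u * norm v)\<^sup>2" by (simp only: of_real_eq_iff)
  then show ?thesis by (simp add: power2_eq_iff_nonneg)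
qed

lemma cinner_tensor_onb:
  assumes "e \<in> onb" shows "cinner (tensor e v) \<xi> = cinner v (Rep_htensor \<xi> e)"
proof -
  have c: "coords e e' = (if e' = e then 1 else 0)" for e'
    using assms onb(1) unfolding coords_def orthonormal_def by auto
  have "cinner (tensor e v) \<xi> = (\<Sum>\<^sub>\<infinity>e'. cinner (coords e e' *\<^sub>C v) (Rep_htensor \<xi> e'))"
    unfolding cinner_htensor.rep_eq Rep_tensor l2_cinner_def ..
  also have "\<dots> = (\<Sum>\<^sub>\<infinity>e'\<in>{e}. cinner (coords e e' *\<^sub>C v) (Rep_htensor \<xi> e'))"
    by (rule infsum_cong_neutral) (auto simp: c)
  also have "\<dots> = cinner v (Rep_htensor \<xi> e)" by (simp add: c)
  finally show ?thesis .
qed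

lemma htensor_eqI: "(\<And>e. e \<in> onb ==> Rep_htensor \<xi> e = Rep_htensor \<eta> e) ==> \<xi> = \<eta>"
  by (rule Rep_htensor_inject[THEN iffD1]) (rule ext, metis htensor_Rep(2))

lemma ctotal_onb: "ctotal onb" unfolding ctotal_def using onb(2) by blast

lemma ctotal_UNIV: "ctotal UNIV" unfolding ctotal_def using cinner_eq_zero by blast

lemma ctotal_tensor:
  assumes "ctotal B" "ctotal C" shows "ctotal {tensor b c | b c. b \<in> B \<and> c \<in> C}"
  unfolding ctotal_def
proof (intro allI impI)
  fix \<xi> :: "('a, 'b) htensor"
  assume \<xi>: "\<forall>a\<in>{tensor b c | b c. b \<in> B \<and> c \<in> C}. cinner a \<xi> = 0"
  have bl: "(\<lambda>b. tensor b c) \<in> \<B>" for c :: 'b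
    by (rule bounded_opsI[of _ "norm c"]) (auto simp: tensor_add_left tensor_scaleC_left norm_tensor op_bound_def)
  have "adj (\<lambda>b. tensor b c) \<xi> = 0" if "c \<in> C" for c
  proof (rule ctotalD[OF assms(1)])
    fix b assume "b \<in> B"
    then show "cinner b (adj (\<lambda>b. tensor b c) \<xi>) = cinner b 0" using \<xi> that by (auto simp: adj_cinner[OF bl])
  qed
  then have "cinner (tensor u c) \<xi> = 0" if "c \<in> C" for c u
    using that adj_cinner(2)[OF bl, of u c \<xi>] by simp
  then have "Rep_htensor \<xi> e = 0" if "e \<in> onb" for e
    using assms(2) cinner_tensor_onb[OF that] unfolding ctotal_def by metis
  then show "\<xi> = 0" by (intro htensor_eqI) (simp add: zero_htensor.rep_eq)
qed

lemma ctotal_tensors: "ctotal (range (\<lambda>(u, v). tensor u v))"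
  using ctotal_tensor[OF ctotal_UNIV ctotal_UNIV] by (rule back_subst[of ctotal]) auto

lemma bounded_ops_eq_tensorI:
  assumes "S \<in> \<B>" "T \<in> \<B>" "\<And>u v. S (tensor u v) = T (tensor u v)"
  shows "S = T"
  by (rule bounded_ops_eqI[OF assms(1,2) ctotal_tensors]) (use assms(3) in auto)

lemma has_sum_finite_sum:
  fixes h :: "'i => 'f => 'x::{topological_comm_monoid_add}"
  assumes "\<And>i. i \<in> S ==> (h i has_sum s i) A"
  shows "((\<lambda>f. \<Sum>i\<in>S. h i f) has_sum (\<Sum>i\<in>S. s i)) A"
  using assms by (induction S rule: infinite_finite_induct) (auto intro: has_sum_add)

text \<open>Expanding the second tensor factors in \<open>onb\<close> reduces the norm of a sum of
  tensors to norms in the first factor. It complements the representation of \<open>htensor\<close>,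
  which takes coordinates in the first factor.\<close>

lemma parseval_sum:
  fixes v :: "'i => 'b::chilbert_space" and u :: "'i => 'a::chilbert_space"
  assumes "finite S"
  shows "((\<lambda>f. (norm (\<Sum>i\<in>S. coords (v i) f *\<^sub>C u i))\<^sup>2) has_sum (norm (\<Sum>i\<in>S. tensor (u i) (v i)))\<^sup>2) UNIV"
proof -
  have hs: "((\<lambda>f. cinner (coords x f) (coords y f)) has_sum cinner x y) UNIV" for x y :: 'b
    using has_sum_infsum[OF l2_cinner_summable[OF sq_summable_coords sq_summable_coords]]
    unfolding parseval[of x y, unfolded l2_cinner_def, symmetric] by blast
  have "((\<lambda>f. \<Sum>i\<in>S. \<Sum>k\<in>S. cinner (u i) (u k) * cinner (coords (v i) f) (coords (v k) f)) has_sum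
      (\<Sum>i\<in>S. \<Sum>k\<in>S. cinner (u i) (u k) * cinner (v i) (v k))) UNIV"
    by (intro has_sum_finite_sum has_sum_cmult_right hs)
  moreover have "(\<Sum>i\<in>S. \<Sum>k\<in>S. cinner (u i) (u k) * cinner (v i) (v k)) =
      complex_of_real ((norm (\<Sum>i\<in>S. tensor (u i) (v i)))\<^sup>2)"
    unfolding norm_sum_sq cinner_tensor ..
  moreover have "(\<Sum>i\<in>S. \<Sum>k\<in>S. cinner (u i) (u k) * cinner (coords (v i) f) (coords (v k) f)) =
      complex_of_real ((norm (\<Sum>i\<in>S. coords (v i) f *\<^sub>C u i))\<^sup>2)" for f
    unfolding norm_sum_sq by (simp add: cinner_scaleC_left cinner_scaleC_right cinner_complex_def mult_ac)
  ultimately have "((\<lambda>f. complex_of_real ((norm (\<Sum>i\<in>S. coords (v i) f *\<^sub>C u i))\<^sup>2)) has_sum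
      complex_of_real ((norm (\<Sum>i\<in>S. tensor (u i) (v i)))\<^sup>2)) UNIV" by simp
  then show ?thesis by (simp only: has_sum_of_real_iff)
qed

text \<open>\<open>S\<close> acts on the factor in which \<open>htensor\<close> takes coordinates,
  so it cannot act coordinatewise. After passing to coordinates of the second factor by
  \<open>parseval_sum\<close>, the bound for \<open>S\<close> applies to each coordinate vector and
  sums up.\<close>

lemma tensor_op_left_exists:
  fixes S :: "'a::chilbert_space => 'c::chilbert_space"
  assumes S: "S \<in> \<B>" "op_bound S K" "K \<ge> 0"
  shows "\<exists>R\<in>\<B>. (\<forall>u (v::'b::chilbert_space). R (tensor u v) = tensor (S u) v) \<and> op_bound R K"
proof -
  have "\<exists>R\<in>\<B>. (\<forall>p\<in>UNIV. R (case p of (u, v) => tensor u (v::'b)) = (case p of (u, v) => tensor (S u) v)) \<and> op_bound R K"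
  proof (rule operator_of_family[OF ctotal_tensors S(3)])
    fix P :: "('a \<times> 'b) set" and c assume P: "finite P"
    have eq: "(\<Sum>p\<in>P. c p *\<^sub>C (case p of (u, v) => tensor (g u) v)) = (\<Sum>p\<in>P. tensor (g (fst p)) (c p *\<^sub>C snd p))"
      for g :: "'a => 'd::chilbert_space"
      by (rule sum.cong) (auto simp: tensor_scaleC_right split: prod.split)
    have e: "(\<Sum>p\<in>P. coords (c p *\<^sub>C snd p) f *\<^sub>C S (fst p)) = S (\<Sum>p\<in>P. coords (c p *\<^sub>C snd p) f *\<^sub>C fst p)" for f
      by (simp add: bounded_ops_simps[OF S(1)])
    have "(norm (\<Sum>p\<in>P. tensor (S (fst p)) (c p *\<^sub>C snd p)))\<^sup>2 \<le> K\<^sup>2 * (norm (\<Sum>p\<in>P. tensor (fst p) (c p *\<^sub>C snd p)))\<^sup>2"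
    proof (rule has_sum_mono[OF parseval_sum[OF P] has_sum_cmult_right[OF parseval_sum[OF P]]])
      fix f
      show "(norm (\<Sum>p\<in>P. coords (c p *\<^sub>C snd p) f *\<^sub>C S (fst p)))\<^sup>2 \<le> K\<^sup>2 * (norm (\<Sum>p\<in>P. coords (c p *\<^sub>C snd p) f *\<^sub>C fst p))\<^sup>2"
        unfolding e power_mult_distrib[symmetric] using S(2) by (intro power_mono) (auto simp: op_bound_def)
    qed
    then have "norm (\<Sum>p\<in>P. tensor (S (fst p)) (c p *\<^sub>C snd p)) \<le> K * norm (\<Sum>p\<in>P. tensor (fst p) (c p *\<^sub>C snd p))"
      using S(3) by (simp only: power_mult_distrib[symmetric]) (erule power2_le_imp_le, simp)
    then show "norm (\<Sum>p\<in>P. c p *\<^sub>C (case p of (u, v) => tensor (S u) v)) \<le> K * norm (\<Sum>p\<in>P. c p *\<^sub>C (case p of (u, v) => tensor u v))"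
      unfolding eq[of S] using eq[of "\<lambda>x. x"] by simp
  qed
  then show ?thesis by force
qed

text \<open>Here the operator acts on every coordinate of the representing family, and square
  summability is inherited with the factor \<open>K\<^sup>2\<close>.\<close>

lemma tensor_op_right_exists:
  fixes T :: "'b::chilbert_space => 'd::chilbert_space"
  assumes T: "T \<in> \<B>" "op_bound T K" "K \<ge> 0"
  shows "\<exists>R\<in>\<B>. (\<forall>(u::'a::chilbert_space) v. R (tensor u v) = tensor u (T v)) \<and> op_bound R K"
proof -
  have b: "sq_summable (\<lambda>e. T (Rep_htensor \<xi> e)) \<and> (\<Sum>\<^sub>\<infinity>e. (norm (T (Rep_htensor \<xi> e)))\<^sup>2) \<le> K\<^sup>2 * (norm \<xi>)\<^sup>2"
    for \<xi> :: "('a, 'b) htensor"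
  proof -
    have le: "(norm (T x))\<^sup>2 \<le> K\<^sup>2 * (norm x)\<^sup>2" for x
      unfolding power_mult_distrib[symmetric] using T(2) by (intro power_mono) (auto simp: op_bound_def)
    have s: "(\<lambda>e. (norm (Rep_htensor \<xi> e))\<^sup>2) summable_on UNIV"
      using htensor_Rep(1)[of \<xi>] by (simp add: sq_summable_def)
    have "(\<lambda>e. norm ((norm (T (Rep_htensor \<xi> e)))\<^sup>2)) summable_on UNIV"
      by (rule Infinite_Sum.abs_summable_on_comparison_test'[OF summable_on_cmult_right[OF s, of "K\<^sup>2"]]) (use le in auto)
    then have s': "(\<lambda>e. (norm (T (Rep_htensor \<xi> e)))\<^sup>2) summable_on UNIV" by simp
    have "(\<Sum>\<^sub>\<infinity>e. (norm (T (Rep_htensor \<xi> e)))\<^sup>2) \<le> (\<Sum>\<^sub>\<infinity>e. K\<^sup>2 * (norm (Rep_htensor \<xi> e))\<^sup>2)"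
      by (rule infsum_mono[OF s' summable_on_cmult_right[OF s]]) (rule le)
    also have "\<dots> = K\<^sup>2 * (norm \<xi>)\<^sup>2"
      by (simp add: infsum_cmult_right' norm2_cinner cinner_htensor.rep_eq Re_l2_cinner htensor_Rep)
    finally show ?thesis using s' by (simp add: sq_summable_def)
  qed
  define R where "R \<xi> = Abs_htensor (\<lambda>e. T (Rep_htensor \<xi> e))" for \<xi> :: "('a, 'b) htensor"
  have R: "Rep_htensor (R \<xi>) = (\<lambda>e. T (Rep_htensor \<xi> e))" for \<xi>
    unfolding R_def by (rule Abs_htensor_inverse) (use b in \<open>auto simp: bounded_ops_simps[OF T(1)] htensor_Rep(2)\<close>)
  have bR: "op_bound R K" unfolding op_bound_def
  proof
    fix \<xi>
    have "(norm (R \<xi>))\<^sup>2 = (\<Sum>\<^sub>\<infinity>e. (norm (T (Rep_htensor \<xi> e)))\<^sup>2)"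
      using b by (simp add: norm2_cinner cinner_htensor.rep_eq Re_l2_cinner R)
    then have "(norm (R \<xi>))\<^sup>2 \<le> (K * norm \<xi>)\<^sup>2" using b by (simp add: power_mult_distrib)
    then show "norm (R \<xi>) \<le> K * norm \<xi>" using T(3) by (elim power2_le_imp_le) simp
  qed
  moreover have "R \<in> \<B>"
    by (rule bounded_opsI[OF _ _ bR])
      (auto intro!: htensor_eqI simp: R plus_htensor.rep_eq scaleC_htensor.rep_eq bounded_ops_simps[OF T(1)])
  moreover have "R (tensor u v) = tensor u (T v)" for u v
    by (rule htensor_eqI) (simp add: R Rep_tensor bounded_ops_simps[OF T(1)])
  ultimately show ?thesis by blast
qed

lemma tensor_op:
  fixes S :: "'a::chilbert_space => 'c::chilbert_space" and T :: "'b::chilbert_space => 'd::chilbert_space"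
  assumes S: "S \<in> \<B>" and T: "T \<in> \<B>"
  shows "tensor_op S T \<in> \<B>" "tensor_op S T (tensor u v) = tensor (S u) (T v)"
    "op_bound S K ==> op_bound T L ==> K \<ge> 0 ==> L \<ge> 0 ==> op_bound (tensor_op S T) (K * L)"
proof -
  have ex: "\<exists>R\<in>\<B>. (\<forall>u v. R (tensor u v) = tensor (S u) (T v)) \<and> op_bound R (K * L)"
    if KL: "op_bound S K" "op_bound T L" "K \<ge> 0" "L \<ge> 0" for K L
  proof -
    obtain R1 where R1: "R1 \<in> \<B>" "\<And>u v. R1 (tensor u v) = tensor (S u) (v :: 'd)" "op_bound R1 K"
      using tensor_op_left_exists[OF S KL(1,3)] by blast
    obtain R2 where R2: "R2 \<in> \<B>" "\<And>u v. R2 (tensor u v) = tensor (u :: 'a) (T v)" "op_bound R2 L"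
      using tensor_op_right_exists[OF T KL(2,4)] by blast
    have "norm (R1 (R2 x)) \<le> K * L * norm x" for x
      using R1(3) R2(3) KL unfolding op_bound_def by (metis mult.assoc mult_left_mono order_trans)
    then show ?thesis using R1 R2 by (intro bexI[of _ "R1 \<circ> R2"]) (auto simp: bounded_ops_compose op_bound_def)
  qed
  obtain K0 L0 where "op_bound S K0" "op_bound T L0" "K0 \<ge> 0" "L0 \<ge> 0" using S T by (meson bounded_ops_bound)
  from ex[OF this] have "\<exists>R. R \<in> \<B> \<and> (\<forall>u v. R (tensor u v) = tensor (S u) (T v))" by blast
  from someI_ex[OF this]
  have *: "tensor_op S T \<in> \<B>" "\<And>u v. tensor_op S T (tensor u v) = tensor (S u) (T v)"
    unfolding tensor_op_def by blast+
  then show "tensor_op S T \<in> \<B>" "tensor_op S T (tensor u v) = tensor (S u) (T v)" by blast+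
  assume "op_bound S K" "op_bound T L" "K \<ge> 0" "L \<ge> 0"
  from ex[OF this] obtain R where R: "R \<in> \<B>" "\<And>u v. R (tensor u v) = tensor (S u) (T v)" "op_bound R (K * L)"
    by blast
  then have "tensor_op S T = R" by (intro bounded_ops_eq_tensorI) (auto simp: *)
  then show "op_bound (tensor_op S T) (K * L)" using R by simp
qed

lemma tensor_op_compose:
  assumes "S \<in> \<B>" "T \<in> \<B>" "S' \<in> \<B>" "T' \<in> \<B>"
  shows "tensor_op S T \<circ> tensor_op S' T' = tensor_op (S \<circ> S') (T \<circ> T')"
  by (rule bounded_ops_eq_tensorI) (simp_all add: bounded_ops_compose tensor_op assms)

lemma adj_tensor_op:
  assumes S: "S \<in> \<B>" and T: "T \<in> \<B>"
  shows "adj (tensor_op S T) = tensor_op (adj S) (adj T)"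
proof (rule bounded_ops_eq_tensorI)
  fix u v
  show "adj (tensor_op S T) (tensor u v) = tensor_op (adj S) (adj T) (tensor u v)"
    by (rule ctotalD[OF ctotal_tensors])
      (auto simp: adj_cinner tensor_op S T cinner_tensor)
qed (simp_all add: tensor_op S T)

lemma ket_bounded [simp]: "ket x \<in> \<B>"
  by (rule bounded_opsI[of _ "norm x"])
    (auto simp: ket_def tensor_add_left tensor_scaleC_left norm_tensor op_bound_def mult.commute)

lemma bra_cinner: "cinner u (bra x \<xi>) = cinner (tensor u x) \<xi>"
  unfolding bra_def by (simp add: adj_cinner) (simp add: ket_def)

lemma bra_bounded [simp]: "bra x \<in> \<B>"
  unfolding bra_def by simp

lemma bra_tensor: "bra x (tensor u v) = cinner x v *\<^sub>C u"
  by (rule cinner_eqI) (simp add: bra_cinner cinner_tensor cinner_scaleC_right)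

definition lket :: "'a::chilbert_space => 'b::chilbert_space => ('a, 'b) htensor" where "lket x v = tensor x v"

definition lbra :: "'a::chilbert_space => ('a, 'b::chilbert_space) htensor => 'b" where "lbra x = adj (lket x)"

lemma lket_bounded [simp]: "lket x \<in> \<B>"
  by (rule bounded_opsI[of _ "norm x"])
    (auto simp: lket_def tensor_add_right tensor_scaleC_right norm_tensor op_bound_def)

lemma lbra_bounded [simp]: "lbra x \<in> \<B>" unfolding lbra_def by simp

lemma lbra_cinner: "cinner v (lbra x \<xi>) = cinner (tensor x v) \<xi>"
  unfolding lbra_def by (simp add: adj_cinner) (simp add: lket_def)

lemma lbra_tensor: "lbra x (tensor u v) = cinner x u *\<^sub>C v"
  by (rule cinner_eqI) (simp add: lbra_cinner cinner_tensor cinner_scaleC_right)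

lemma lbra_onb: "e \<in> onb ==> lbra e \<xi> = Rep_htensor \<xi> e"
  by (rule cinner_eqI) (simp add: lbra_cinner cinner_tensor_onb)

section \<open>Ultraweakly continuous functionals\<close>

definition uw_fun :: "(nat => 'b::chilbert_space) => (nat => 'a::chilbert_space) => ('a => 'b) => complex"
  where "uw_fun \<xi> \<eta> T = (\<Sum>n. cinner (\<xi> n) (T (\<eta> n)))"

definition l2_size :: "(nat => 'a::chilbert_space) => real"
  where "l2_size \<xi> = (\<Sum>n. (norm (\<xi> n))\<^sup>2)"

lemma sq_summable_nat: "sq_summable \<xi> \<longleftrightarrow> summable (\<lambda>n. (norm (\<xi> n))\<^sup>2)" for \<xi> :: "nat => 'a::chilbert_space"
  unfolding sq_summable_def by (rule summable_on_UNIV_nonneg_real_iff) simp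

lemma l2_size_nonneg: "sq_summable \<xi> ==> l2_size \<xi> \<ge> 0"
  unfolding l2_size_def sq_summable_nat by (rule suminf_nonneg) auto

lemma uw_fun_term_bound:
  assumes "op_bound T K" "K \<ge> 0"
  shows "cmod (cinner x (T y)) \<le> K * (((norm x)\<^sup>2 + (norm y)\<^sup>2) / 2)"
proof -
  have "cmod (cinner x (T y)) \<le> norm x * norm (T y)" by (rule norm_cinner_le)
  also have "\<dots> \<le> norm x * (K * norm y)" using assms by (intro mult_left_mono) (auto simp: op_bound_def)
  also have "\<dots> = K * (norm x * norm y)" by simp
  also have "\<dots> \<le> K * (((norm x)\<^sup>2 + (norm y)\<^sup>2) / 2)"
    using assms(2) sum_squares_bound[of "norm x" "norm y"] by (intro mult_left_mono) auto
  finally show ?thesis .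
qed

lemma uw_fun_summable:
  assumes T: "T \<in> \<B>" and "sq_summable \<xi>" "sq_summable \<eta>"
  shows "summable (\<lambda>n. norm (cinner (\<xi> n) (T (\<eta> n))))"
proof -
  obtain K where K: "K \<ge> 0" "op_bound T K" using T by (rule bounded_ops_bound)
  show ?thesis
    by (rule summable_comparison_test'[of "\<lambda>n. K * (((norm (\<xi> n))\<^sup>2 + (norm (\<eta> n))\<^sup>2) / 2)" 0])
      (use assms uw_fun_term_bound[OF K(2,1)] in \<open>auto simp: sq_summable_nat intro!: summable_mult summable_divide summable_add\<close>)
qed

lemma uw_fun_sums:
  assumes "T \<in> \<B>" "sq_summable \<xi>" "sq_summable \<eta>"
  shows "(\<lambda>n. cinner (\<xi> n) (T (\<eta> n))) sums uw_fun \<xi> \<eta> T"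
  unfolding uw_fun_def by (rule summable_sums[OF summable_norm_cancel[OF uw_fun_summable[OF assms]]])

definition vseq :: "'a::zero => nat => 'a" where "vseq x n = (if n = 0 then x else 0)"

lemma sq_summable_vseq [simp]: "sq_summable (vseq x)"
  unfolding sq_summable_nat by (rule summable_finite[of "{0}"]) (auto simp: vseq_def)

lemma uw_fun_vseq: "T 0 = 0 ==> uw_fun (vseq x) (vseq y) T = cinner x (T y)"
  unfolding uw_fun_def by (subst suminf_finite[of "{0}"]) (auto simp: vseq_def)

lemma l2_size_vseq: "l2_size (vseq x) = (norm x)\<^sup>2"
  unfolding l2_size_def by (subst suminf_finite[of "{0}"]) (auto simp: vseq_def)

lemma uw_fun_scale: "uw_fun (\<lambda>n. c *\<^sub>C \<xi> n) \<eta> T = cnj c * uw_fun \<xi> \<eta> T"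
  if "T \<in> \<B>" "sq_summable \<xi>" "sq_summable \<eta>"
  unfolding uw_fun_def cinner_scaleC_left
  by (rule suminf_mult[OF summable_norm_cancel[OF uw_fun_summable[OF that]]])

lemma uw_fun_scale_right: "uw_fun \<xi> (\<lambda>n. c *\<^sub>C \<eta> n) T = c * uw_fun \<xi> \<eta> T"
  if "T \<in> \<B>" "sq_summable \<xi>" "sq_summable \<eta>"
  unfolding uw_fun_def bounded_ops_simps(2)[OF that(1)] cinner_scaleC_right
  by (rule suminf_mult[OF summable_norm_cancel[OF uw_fun_summable[OF that]]])

lemma l2_size_scale: "sq_summable \<xi> ==> l2_size (\<lambda>n. c *\<^sub>C \<xi> n) = (cmod c)\<^sup>2 * l2_size \<xi>"
  unfolding l2_size_def norm_scaleC power_mult_distrib sq_summable_nat by (rule suminf_mult)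

text \<open>A double sequence strung out along \<open>prod_decode\<close>, so that a countable sum
  of functionals \<open>uw_fun\<close> is again one such functional.\<close>

definition merge_seq :: "(nat => nat => 'a) => nat => 'a"
  where "merge_seq \<xi> m = (case prod_decode m of (k, n) => \<xi> k n)"

lemma merge_seq_summable:
  fixes \<xi> :: "nat => nat => 'a::chilbert_space"
  assumes sq: "\<And>k. sq_summable (\<xi> k)" and le: "\<And>k. l2_size (\<xi> k) \<le> c k" and c: "summable c"
  shows "sq_summable (merge_seq \<xi>)" "l2_size (merge_seq \<xi>) \<le> (\<Sum>k. c k)"
proof -
  let ?f = "\<lambda>(k, n). (norm (\<xi> k n))\<^sup>2"
  have hs: "((\<lambda>n. (norm (\<xi> k n))\<^sup>2) has_sum l2_size (\<xi> k)) UNIV" for k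
    unfolding l2_size_def using sq[of k] unfolding sq_summable_nat
    by (intro norm_summable_imp_has_sum) (auto intro: summable_sums)
  have nn: "l2_size (\<xi> k) \<ge> 0" for k by (rule l2_size_nonneg[OF sq])
  have sl: "summable (\<lambda>k. l2_size (\<xi> k))"
    by (rule summable_comparison_test'[OF c, of 0]) (use le nn in auto)
  have "((\<lambda>k. l2_size (\<xi> k)) has_sum (\<Sum>k. l2_size (\<xi> k))) UNIV"
    by (rule norm_summable_imp_has_sum) (use sl nn in \<open>auto intro: summable_sums\<close>)
  note hl = this
  have "?f summable_on UNIV \<times> UNIV"
    by (rule summable_on_SigmaI[where g = "\<lambda>k. l2_size (\<xi> k)"]) (use hs hl in \<open>auto simp: summable_on_def\<close>)
  then have "(?f has_sum (\<Sum>k. l2_size (\<xi> k))) (UNIV \<times> UNIV)"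
    by (intro has_sum_SigmaI[OF _ hl]) (use hs in auto)
  then have "((\<lambda>m. ?f (prod_decode m)) has_sum (\<Sum>k. l2_size (\<xi> k))) UNIV"
    using has_sum_reindex_bij_betw[OF bij_prod_decode, of ?f "\<Sum>k. l2_size (\<xi> k)"] by simp
  then have m: "((\<lambda>m. (norm (merge_seq \<xi> m))\<^sup>2) has_sum (\<Sum>k. l2_size (\<xi> k))) UNIV"
    unfolding merge_seq_def by (rule has_sum_cong[THEN iffD1, rotated]) (auto split: prod.split)
  then show "sq_summable (merge_seq \<xi>)" by (auto simp: sq_summable_def summable_on_def)
  have "l2_size (merge_seq \<xi>) = (\<Sum>k. l2_size (\<xi> k))"
    unfolding l2_size_def[of "merge_seq \<xi>"] using has_sum_imp_sums[OF m] by (rule sums_unique[symmetric])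
  also have "\<dots> \<le> (\<Sum>k. c k)" by (intro suminf_le le sl c)
  finally show "l2_size (merge_seq \<xi>) \<le> (\<Sum>k. c k)" .
qed

lemma uw_fun_merge:
  assumes T: "T \<in> \<B>"
    and \<xi>: "\<And>k. sq_summable (\<xi> k)" "\<And>k. l2_size (\<xi> k) \<le> c k"
    and \<eta>: "\<And>k. sq_summable (\<eta> k)" "\<And>k. l2_size (\<eta> k) \<le> c k" and c: "summable c"
  shows "(\<lambda>k. uw_fun (\<xi> k) (\<eta> k) T) sums uw_fun (merge_seq \<xi>) (merge_seq \<eta>) T"
proof -
  have sq: "sq_summable (merge_seq \<xi>)" "sq_summable (merge_seq \<eta>)"
    using merge_seq_summable(1) \<xi> \<eta> c by blast+
  let ?f = "\<lambda>(k, n). cinner (\<xi> k n) (T (\<eta> k n))"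
  have "((\<lambda>m. cinner (merge_seq \<xi> m) (T (merge_seq \<eta> m))) has_sum uw_fun (merge_seq \<xi>) (merge_seq \<eta>) T) UNIV"
    by (rule norm_summable_imp_has_sum[OF uw_fun_summable[OF T sq] uw_fun_sums[OF T sq]])
  then have "((\<lambda>m. ?f (prod_decode m)) has_sum uw_fun (merge_seq \<xi>) (merge_seq \<eta>) T) UNIV"
    unfolding merge_seq_def by (rule has_sum_cong[THEN iffD1, rotated]) (auto split: prod.split)
  then have "(?f has_sum uw_fun (merge_seq \<xi>) (merge_seq \<eta>) T) (UNIV \<times> UNIV)"
    using has_sum_reindex_bij_betw[OF bij_prod_decode, of ?f] by simp
  then have "((\<lambda>k. uw_fun (\<xi> k) (\<eta> k) T) has_sum uw_fun (merge_seq \<xi>) (merge_seq \<eta>) T) UNIV"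
    by (rule has_sum_SigmaD)
      (use norm_summable_imp_has_sum[OF uw_fun_summable[OF T \<xi>(1) \<eta>(1)] uw_fun_sums[OF T \<xi>(1) \<eta>(1)]] in simp)
  then show ?thesis by (rule has_sum_imp_sums)
qed

text \<open>The infimum of the admissible \<open>c\<close> is the norm of \<open>\<phi>\<close> in
  the quotient of the trace-class functionals by the annihilator of \<open>M\<close>, which is the
  predual norm if \<open>M\<close> is a von Neumann algebra. Bounding both sequences by the same
  constant makes the constants additive, even over countable sums.\<close>

definition normal_on :: "('a::chilbert_space => 'b::chilbert_space) set => (('a => 'b) => complex) => real => bool"
  where "normal_on M \<phi> c \<longleftrightarrow> (\<exists>\<xi> \<eta>. sq_summable \<xi> \<and> sq_summable \<eta> \<and> l2_size \<xi> \<le> c \<and> l2_size \<eta> \<le> c \<and>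
    (\<forall>T\<in>M. \<phi> T = uw_fun \<xi> \<eta> T))"

lemma normal_on_nonneg: "normal_on M \<phi> c ==> c \<ge> 0"
  unfolding normal_on_def using l2_size_nonneg order_trans by blast

text \<open>Completeness of the predual, in the form that absolutely convergent series
  converge.\<close>

lemma normal_on_sums:
  assumes M: "M \<subseteq> \<B>" and n: "\<And>k. normal_on M (\<phi> k) (c k)" and c: "summable c"
    and s: "\<And>T. T \<in> M ==> (\<lambda>k. \<phi> k T) sums \<psi> T"
  shows "normal_on M \<psi> (\<Sum>k. c k)"
proof -
  obtain \<xi> \<eta> where *: "\<And>k. sq_summable (\<xi> k)" "\<And>k. sq_summable (\<eta> k)" "\<And>k. l2_size (\<xi> k) \<le> c k"
      "\<And>k. l2_size (\<eta> k) \<le> c k" "\<And>k T. T \<in> M ==> \<phi> k T = uw_fun (\<xi> k) (\<eta> k) T"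
    using n unfolding normal_on_def by metis
  have "\<psi> T = uw_fun (merge_seq \<xi>) (merge_seq \<eta>) T" if T: "T \<in> M" for T
    using uw_fun_merge[OF _ *(1,3,2,4) c, of T] s[OF T] M T *(5)[OF T] by (auto intro: sums_unique2)
  then show ?thesis
    unfolding normal_on_def using merge_seq_summable[OF *(1,3) c] merge_seq_summable[OF *(2,4) c] by blast
qed

lemma normal_on_zero: "M \<subseteq> \<B> ==> normal_on M (\<lambda>T. 0) 0"
  unfolding normal_on_def
  by (intro exI[of _ "vseq 0"]) (auto simp: l2_size_vseq uw_fun_vseq bounded_ops_simps)

lemma normal_on_cong: "normal_on M \<phi> c ==> (\<And>T. T \<in> M ==> \<phi> T = \<psi> T) ==> normal_on M \<psi> c"
  unfolding normal_on_def by metis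

lemma normal_on_add:
  assumes M: "M \<subseteq> \<B>" and "normal_on M \<phi> a" "normal_on M \<psi> b"
  shows "normal_on M (\<lambda>T. \<phi> T + \<psi> T) (a + b)"
proof -
  define \<theta> where "\<theta> k = (if k = 0 then \<phi> else if k = 1 then \<psi> else (\<lambda>T. 0))" for k :: nat
  define c where "c k = (if k = 0 then a else if k = 1 then b else 0)" for k :: nat
  have s: "(\<lambda>k. \<theta> k T) sums (\<Sum>k\<in>{0,1}. \<theta> k T)" for T by (rule sums_finite) (auto simp: \<theta>_def)
  have sc: "c sums (\<Sum>k\<in>{0,1}. c k)" by (rule sums_finite) (auto simp: c_def)
  have "normal_on M (\<theta> k) (c k)" for k using assms normal_on_zero[OF M] by (auto simp: \<theta>_def c_def)
  from normal_on_sums[OF M this sums_summable[OF sc] s]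
  show ?thesis unfolding sums_unique[OF sc, symmetric] by (simp add: \<theta>_def c_def)
qed

lemma normal_on_scale:
  assumes M: "M \<subseteq> \<B>" and "normal_on M \<phi> a"
  shows "normal_on M (\<lambda>T. c * \<phi> T) (cmod c * a)"
proof -
  obtain \<xi> \<eta> where *: "sq_summable \<xi>" "sq_summable \<eta>" "l2_size \<xi> \<le> a" "l2_size \<eta> \<le> a"
      "\<And>T. T \<in> M ==> \<phi> T = uw_fun \<xi> \<eta> T"
    using assms(2) unfolding normal_on_def by blast
  \<comment> \<open>The scalar is divided between the two sequences with equal moduli
    \<open>sqrt (cmod c)\<close>, to keep their sizes balanced.\<close>
  let ?r = "complex_of_real (sqrt (cmod c))"
  define d where "d = (if c = 0 then 0 else c / ?r)"
  have d: "?r * d = c" by (auto simp: d_def)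
  have "cmod d = sqrt (cmod c)"
    by (auto simp: d_def norm_divide real_div_sqrt)
  then have dn: "(cmod d)\<^sup>2 = cmod c" by simp
  have "uw_fun (\<lambda>n. ?r *\<^sub>C \<xi> n) (\<lambda>n. d *\<^sub>C \<eta> n) T = c * \<phi> T" if "T \<in> M" for T
    using M that *(1,2) d
    by (simp add: subsetD[OF M that] uw_fun_scale uw_fun_scale_right sq_summable_scaleC *(5) mult.assoc[symmetric])
  moreover have "l2_size (\<lambda>n. ?r *\<^sub>C \<xi> n) \<le> cmod c * a" "l2_size (\<lambda>n. d *\<^sub>C \<eta> n) \<le> cmod c * a"
    using * by (auto simp: l2_size_scale dn intro!: mult_left_mono)
  ultimately show ?thesis
    unfolding normal_on_def using sq_summable_scaleC[OF *(1), of ?r] sq_summable_scaleC[OF *(2), of d]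
    by (intro exI[of _ "\<lambda>n. ?r *\<^sub>C \<xi> n"] exI[of _ "\<lambda>n. d *\<^sub>C \<eta> n"]) auto
qed

lemma normal_on_sum:
  assumes M: "M \<subseteq> \<B>" and "\<And>i. i \<in> S ==> \<exists>c. normal_on M (\<phi> i) c"
  shows "\<exists>c. normal_on M (\<lambda>T. \<Sum>i\<in>S. \<phi> i T) c"
  using assms(2)
proof (induction S rule: infinite_finite_induct)
  case (insert x F)
  have "\<exists>b. normal_on M (\<lambda>T. \<Sum>i\<in>F. \<phi> i T) b" using insert by blast
  moreover have "\<exists>a. normal_on M (\<phi> x) a" using insert by blast
  ultimately obtain a b where "normal_on M (\<phi> x) a" "normal_on M (\<lambda>T. \<Sum>i\<in>F. \<phi> i T) b" by blast
  from normal_on_add[OF M this] show ?case using insert by auto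
qed (use normal_on_zero[OF M] in auto)

lemma normal_on_cinner:
  assumes M: "M \<subseteq> \<B>" shows "normal_on M (\<lambda>T. cinner x (T y)) (norm x * norm y)"
proof (cases "x = 0 \<or> y = 0")
  case True
  then have "cinner x (T y) = 0" if "T \<in> M" for T using that M by (auto simp: bounded_ops_simps)
  then show ?thesis using True normal_on_cong[OF normal_on_zero[OF M]] by auto
next
  case False
  \<comment> \<open>Rescaling by \<open>r\<close> and \<open>1 / r\<close> leaves the functional
    unchanged and makes both sizes equal to \<open>norm x * norm y\<close>.\<close>
  define r where "r = sqrt (norm y / norm x)"
  have r: "r > 0" "r\<^sup>2 = norm y / norm x" using False by (auto simp: r_def)
  have "uw_fun (vseq (r *\<^sub>R x)) (vseq ((1/r) *\<^sub>R y)) T = cinner x (T y)" if "T \<in> M" for T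
    using M that r(1) by (auto simp: uw_fun_vseq bounded_ops_simps scaleR_scaleC[of r] scaleR_scaleC[of "1/r"]
        cinner_scaleC_left cinner_scaleC_right subsetD simp flip: of_real_mult)
  moreover have "(norm (r *\<^sub>R x))\<^sup>2 = norm x * norm y"
    using False by (simp add: power_mult_distrib r(2) power2_eq_square[of "norm x"])
  moreover have "(norm ((1/r) *\<^sub>R y))\<^sup>2 = norm x * norm y"
    using False by (simp add: power_mult_distrib power_divide r(2) power2_eq_square[of "norm y"])
  ultimately show ?thesis
    unfolding normal_on_def
    by (intro exI[of _ "vseq (r *\<^sub>R x)"] exI[of _ "vseq ((1/r) *\<^sub>R y)"]) (simp add: l2_size_vseq)
qed

subsection \<open>The ultraweak topology\<close>

lemma openin_ultraweak_basis:
  assumes "sq_summable \<xi>" "sq_summable \<eta>" "open U"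
  shows "openin ultraweak {T \<in> \<B>. uw_fun \<xi> \<eta> T \<in> U}"
  unfolding ultraweak_def openin_topology_generated_by_iff uw_fun_def
  by (rule generate_topology_on.Basis) (use assms in blast)

lemma topspace_ultraweak: "topspace ultraweak = \<B>"
proof -
  have "topspace ultraweak \<subseteq> (\<B> :: ('a => 'b) set)"
    unfolding ultraweak_def topology_generated_by_topspace by auto
  moreover have "openin ultraweak {T \<in> (\<B> :: ('a => 'b) set). uw_fun (vseq 0) (vseq 0) T \<in> UNIV}"
    by (rule openin_ultraweak_basis) auto
  then have "(\<B> :: ('a => 'b) set) \<subseteq> topspace ultraweak"
    using openin_subset by fastforce
  ultimately show ?thesis by blast
qed

text \<open>Basic neighbourhoods come from finitely many functionals and one radius; the induction
  follows the generation of the topology from its subbasis.\<close>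

lemma ultraweak_nbhd:
  assumes "openin ultraweak W" "T0 \<in> W"
  shows "\<exists>P \<delta>. finite P \<and> \<delta> > 0 \<and> (\<forall>p\<in>P. sq_summable (fst p) \<and> sq_summable (snd p)) \<and>
    (\<forall>T\<in>\<B>. (\<forall>p\<in>P. dist (uw_fun (fst p) (snd p) T) (uw_fun (fst p) (snd p) T0) < \<delta>) --> T \<in> W)"
  using assms unfolding ultraweak_def openin_topology_generated_by_iff
proof (induction rule: generate_topology_on.induct)
  case (Int a b)
  have ab: "T0 \<in> a" "T0 \<in> b" using Int.prems by auto
  from Int.IH(1)[OF ab(1)] Int.IH(2)[OF ab(2)] show ?case
  proof (elim exE conjE)
    fix P \<delta> Q \<gamma>
    assume P: "finite P" "(\<delta>::real) > 0" "\<forall>p\<in>P. sq_summable (fst p) \<and> sq_summable (snd p)"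
      "\<forall>T\<in>\<B>. (\<forall>p\<in>P. dist (uw_fun (fst p) (snd p) T) (uw_fun (fst p) (snd p) T0) < \<delta>) --> T \<in> a"
     and Q: "finite Q" "(\<gamma>::real) > 0" "\<forall>p\<in>Q. sq_summable (fst p) \<and> sq_summable (snd p)"
      "\<forall>T\<in>\<B>. (\<forall>p\<in>Q. dist (uw_fun (fst p) (snd p) T) (uw_fun (fst p) (snd p) T0) < \<gamma>) --> T \<in> b"
    show ?thesis
      by (rule exI[of _ "P \<union> Q"], rule exI[of _ "min \<delta> \<gamma>"]) (use P Q in auto)
  qed
next
  case (UN K)
  then obtain k where k: "k \<in> K" "T0 \<in> k" by blast
  from UN.IH[OF this] show ?case
  proof (elim exE conjE)
    fix P \<delta>
    assume "finite P" "(\<delta>::real) > 0" "\<forall>p\<in>P. sq_summable (fst p) \<and> sq_summable (snd p)"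
      "\<forall>T\<in>\<B>. (\<forall>p\<in>P. dist (uw_fun (fst p) (snd p) T) (uw_fun (fst p) (snd p) T0) < \<delta>) --> T \<in> k"
    then show ?thesis using k(1) by (intro exI[of _ P] exI[of _ \<delta>]) auto
  qed
next
  case (Basis s)
  then obtain \<xi> \<eta> U where s: "s = {T \<in> \<B>. uw_fun \<xi> \<eta> T \<in> U}" "sq_summable \<xi>" "sq_summable \<eta>" "open U"
    unfolding uw_fun_def by auto
  then obtain \<delta> where "\<delta> > 0" "\<And>z. dist z (uw_fun \<xi> \<eta> T0) < \<delta> ==> z \<in> U"
    using Basis(2) unfolding open_dist by blast
  then show ?case using s by (intro exI[of _ "{(\<xi>, \<eta>)}"] exI[of _ \<delta>]) auto
qed auto

text \<open>On bounded sets strong convergence implies ultraweak convergence: the terms of the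
  series are dominated uniformly along the filter, so Tannery's theorem exchanges sum and
  limit.\<close>

lemma uw_fun_tendsto:
  assumes T: "\<And>i. T i \<in> \<B>" "\<And>i. op_bound (T i) K" "K \<ge> 0" "T0 \<in> \<B>"
    and lim: "\<And>x. ((\<lambda>i. T i x) \<longlongrightarrow> T0 x) \<F>" and sq: "sq_summable \<xi>" "sq_summable \<eta>"
  shows "((\<lambda>i. uw_fun \<xi> \<eta> (T i)) \<longlongrightarrow> uw_fun \<xi> \<eta> T0) \<F>"
proof (cases "\<F> = bot")
  case False
  let ?h = "\<lambda>n. K * (((norm (\<xi> n))\<^sup>2 + (norm (\<eta> n))\<^sup>2) / 2)"
  have "eventually (\<lambda>(n, i). norm (cinner (\<xi> n) (T i (\<eta> n))) \<le> ?h n) (at_top \<times>\<^sub>F \<F>)"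
    using uw_fun_term_bound[OF T(2,3)] by (intro always_eventually) auto
  moreover have "summable ?h"
    using sq by (auto simp: sq_summable_nat intro!: summable_mult summable_divide summable_add)
  moreover have "((\<lambda>i. cinner (\<xi> n) (T i (\<eta> n))) \<longlongrightarrow> cinner (\<xi> n) (T0 (\<eta> n))) \<F>" for n
    by (intro tendsto_cinner tendsto_const lim)
  ultimately show ?thesis
    unfolding uw_fun_def using False
    by (intro tannerys_theorem[where M = ?h, THEN conjunct2, THEN conjunct2]) auto
qed simp

lemma in_ultraweak_closure:
  assumes T: "\<And>i. T i \<in> \<B>" "\<And>i. op_bound (T i) K" "K \<ge> 0" "T0 \<in> \<B>"
    and lim: "\<And>x. ((\<lambda>i. T i x) \<longlongrightarrow> T0 x) \<F>" and F: "\<F> \<noteq> bot" "eventually (\<lambda>i. T i \<in> S) \<F>"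
  shows "T0 \<in> ultraweak closure_of S"
  unfolding in_closure_of topspace_ultraweak
proof (intro conjI allI impI T(4))
  fix W assume W: "T0 \<in> W \<and> openin ultraweak W"
  from ultraweak_nbhd[OF conjunct2[OF W] conjunct1[OF W]]
  obtain P \<delta> where P: "finite P" "\<delta> > 0" "\<forall>p\<in>P. sq_summable (fst p) \<and> sq_summable (snd p)"
    "\<forall>T\<in>\<B>. (\<forall>p\<in>P. dist (uw_fun (fst p) (snd p) T) (uw_fun (fst p) (snd p) T0) < \<delta>) --> T \<in> W"
    by (elim exE conjE)
  have "eventually (\<lambda>i. \<forall>p\<in>P. dist (uw_fun (fst p) (snd p) (T i)) (uw_fun (fst p) (snd p) T0) < \<delta>) \<F>"
    using P(1,3) tendstoD[OF uw_fun_tendsto[OF T lim] P(2)] by (intro eventually_ball_finite) auto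
  then have "eventually (\<lambda>i. T i \<in> W) \<F>" by (rule eventually_mono) (use P(4) T(1) in blast)
  then have "eventually (\<lambda>i. T i \<in> S \<and> T i \<in> W) \<F>" using F(2) by (simp add: eventually_conj)
  then show "\<exists>y. y \<in> S \<and> y \<in> W" using F(1) eventually_happens by blast
qed

lemma ultraweak_closure_eq:
  assumes T: "T \<in> ultraweak closure_of S" and eq: "\<And>R. R \<in> S ==> uw_fun \<xi> \<eta> R = 0"
    and sq: "sq_summable \<xi>" "sq_summable \<eta>"
  shows "uw_fun \<xi> \<eta> T = 0"
proof (rule ccontr)
  assume "uw_fun \<xi> \<eta> T \<noteq> 0"
  then have "T \<in> {T \<in> \<B>. uw_fun \<xi> \<eta> T \<in> - {0}}"
    using T by (auto simp: in_closure_of topspace_ultraweak)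
  moreover have "openin ultraweak {T \<in> \<B>. uw_fun \<xi> \<eta> T \<in> - {0}}"
    by (rule openin_ultraweak_basis[OF sq]) auto
  ultimately have "\<exists>y. y \<in> S \<and> y \<in> {T \<in> \<B>. uw_fun \<xi> \<eta> T \<in> - {0}}"
    using T unfolding in_closure_of by (elim conjE allE impE) (rule conjI)
  then obtain R where "R \<in> S" "uw_fun \<xi> \<eta> R \<noteq> 0" by auto
  then show False using eq by auto
qed

lemma ultraweak_closure_normal:
  assumes T: "T \<in> ultraweak closure_of S" and S: "S \<subseteq> \<B>"
    and n: "normal_on \<B> \<phi> c" and eq: "\<And>R. R \<in> S ==> \<phi> R = 0"
  shows "\<phi> T = 0"
proof -
  obtain \<xi> \<eta> where *: "sq_summable \<xi>" "sq_summable \<eta>" "\<And>T. T \<in> \<B> ==> \<phi> T = uw_fun \<xi> \<eta> T"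
    using n unfolding normal_on_def by blast
  have "T \<in> \<B>" using T by (auto simp: in_closure_of topspace_ultraweak)
  then show ?thesis using ultraweak_closure_eq[OF T _ *(1,2)] * eq S by (metis subsetD)
qed

text \<open>The linear algebra behind duality: a functional that vanishes on the common kernel of
  finitely many functionals is a combination of them. Addition and scaling are parameters since they
  are pointwise operations on operators in the application.\<close>

lemma combination_of_kernels:
  fixes \<psi> :: "'p => 't => complex" and \<phi> :: "'t => complex"
    and plus :: "'t => 't => 't" and scale :: "complex => 't => 't"
  assumes P: "finite P"
    and M: "\<And>S T. S \<in> M ==> T \<in> M ==> plus S T \<in> M" "\<And>c T. T \<in> M ==> scale c T \<in> M"
    and lin: "\<And>p S T. p \<in> P ==> S \<in> M ==> T \<in> M ==> \<psi> p (plus S T) = \<psi> p S + \<psi> p T"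
      "\<And>p c T. p \<in> P ==> T \<in> M ==> \<psi> p (scale c T) = c * \<psi> p T"
    and \<phi>: "\<And>S T. S \<in> M ==> T \<in> M ==> \<phi> (plus S T) = \<phi> S + \<phi> T"
      "\<And>c T. T \<in> M ==> \<phi> (scale c T) = c * \<phi> T"
    and ker: "\<And>T. T \<in> M ==> (\<And>p. p \<in> P ==> \<psi> p T = 0) ==> \<phi> T = 0"
  shows "\<exists>c. \<forall>T\<in>M. \<phi> T = (\<Sum>p\<in>P. c p * \<psi> p T)"
  using P lin \<phi> ker
proof (induction P arbitrary: \<phi> rule: finite_induct)
  case empty
  then show ?case by auto
next
  case (insert q P)
  show ?case
  proof (cases "\<exists>T0\<in>M. (\<forall>p\<in>P. \<psi> p T0 = 0) \<and> \<psi> q T0 \<noteq> 0")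
    case True
    then obtain T1 where T1: "T1 \<in> M" "\<forall>p\<in>P. \<psi> p T1 = 0" "\<psi> q T1 \<noteq> 0" by blast
    \<comment> \<open>\<open>T0\<close> is dual to \<open>\<psi> q\<close>: the functionals indexed
      by \<open>P\<close> vanish on it and \<open>\<psi> q\<close> takes the value 1. Subtracting
      \<open>\<phi> T0 * \<psi> q\<close> from \<open>\<phi>\<close> removes \<open>q\<close> from
      the problem.\<close>
    define T0 where "T0 = scale (1 / \<psi> q T1) T1"
    have T0: "T0 \<in> M" "\<forall>p\<in>P. \<psi> p T0 = 0" "\<psi> q T0 = 1"
      using T1 M(2) insert.prems(2) by (auto simp: T0_def)
    define \<phi>' where "\<phi>' T = \<phi> T - \<phi> T0 * \<psi> q T" for T
    have "\<exists>c. \<forall>T\<in>M. \<phi>' T = (\<Sum>p\<in>P. c p * \<psi> p T)"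
    proof (rule insert.IH)
      fix T assume T: "T \<in> M" "\<And>p. p \<in> P ==> \<psi> p T = 0"
      let ?R = "plus T (scale (- \<psi> q T) T0)"
      have "\<phi> ?R = 0"
        by (rule insert.prems(5)) (use T T0 M insert.prems(1,2) in auto)
      then show "\<phi>' T = 0" using T T0 M insert.prems(3,4) by (simp add: \<phi>'_def)
    qed (use insert.prems in \<open>auto simp: \<phi>'_def algebra_simps\<close>)
    then obtain c where "\<forall>T\<in>M. \<phi>' T = (\<Sum>p\<in>P. c p * \<psi> p T)" by blast
    then have "\<forall>T\<in>M. \<phi> T = (\<Sum>p\<in>insert q P. (c(q := \<phi> T0)) p * \<psi> p T)"
      using insert.hyps by (auto simp: \<phi>'_def algebra_simps intro!: sum.cong)
    then show ?thesis by blast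
  next
    case False
    have "\<exists>c. \<forall>T\<in>M. \<phi> T = (\<Sum>p\<in>P. c p * \<psi> p T)"
    proof (rule insert.IH)
      fix T assume T: "T \<in> M" "\<And>p. p \<in> P ==> \<psi> p T = 0"
      then have "\<psi> q T = 0" using False by blast
      then show "\<phi> T = 0" using T by (intro insert.prems(5)) auto
    qed (use insert.prems in auto)
    then obtain c where "\<forall>T\<in>M. \<phi> T = (\<Sum>p\<in>P. c p * \<psi> p T)" by blast
    then have "\<forall>T\<in>M. \<phi> T = (\<Sum>p\<in>insert q P. (c(q := 0)) p * \<psi> p T)"
      using insert.hyps by (auto intro!: sum.cong)
    then show ?thesis by blast
  qed
qed

definition op_subspace :: "('a::chilbert_space => 'b::chilbert_space) set => bool"
  where "op_subspace M \<longleftrightarrow> M \<subseteq> \<B> \<and> (\<lambda>x. 0) \<in> M \<and>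
    (\<forall>S\<in>M. \<forall>T\<in>M. (\<lambda>u. S u + T u) \<in> M) \<and> (\<forall>c. \<forall>T\<in>M. (\<lambda>u. c *\<^sub>C T u) \<in> M)"

lemma uw_fun_linear:
  assumes "sq_summable \<xi>" "sq_summable \<eta>" "T \<in> \<B>"
  shows "S \<in> \<B> ==> uw_fun \<xi> \<eta> (\<lambda>u. S u + T u) = uw_fun \<xi> \<eta> S + uw_fun \<xi> \<eta> T"
    "uw_fun \<xi> \<eta> (\<lambda>u. c *\<^sub>C T u) = c * uw_fun \<xi> \<eta> T"
proof -
  note s = uw_fun_sums[OF assms(3,1,2)]
  show "uw_fun \<xi> \<eta> (\<lambda>u. S u + T u) = uw_fun \<xi> \<eta> S + uw_fun \<xi> \<eta> T" if "S \<in> \<B>"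
    using sums_unique[OF sums_add[OF uw_fun_sums[OF that assms(1,2)] s]] by (simp add: uw_fun_def cinner_add_right)
  show "uw_fun \<xi> \<eta> (\<lambda>u. c *\<^sub>C T u) = c * uw_fun \<xi> \<eta> T"
    using sums_unique[OF sums_mult[OF s, of c]] by (simp add: uw_fun_def cinner_scaleC_right)
qed

text \<open>Continuity bounds \<open>cinner x (\<Phi> T y)\<close> by 1 on a basic neighbourhood of
  0, which contains the common kernel of finitely many functionals \<open>uw_fun\<close>. On that
  kernel the bound holds for all multiples of \<open>T\<close>, so the coefficient vanishes there
  and is a combination of these functionals.\<close>

lemma normal_map_cinner:
  assumes M: "op_subspace M" and \<Phi>: "normal_map M \<Phi>"
  shows "\<exists>c. normal_on M (\<lambda>T. cinner x (\<Phi> T y)) c"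
proof -
  have Mb: "M \<subseteq> \<B>" using M by (simp add: op_subspace_def)
  have lin: "\<Phi> (\<lambda>u. S u + T u) = (\<lambda>v. \<Phi> S v + \<Phi> T v)" "\<Phi> (\<lambda>u. c *\<^sub>C T u) = (\<lambda>v. c *\<^sub>C \<Phi> T v)"
    if "S \<in> M" "T \<in> M" for S T c
    using \<Phi> that by (auto simp: normal_map_def op_linear_on_def)
  have cont: "continuous_map (subtopology ultraweak M) ultraweak \<Phi>" using \<Phi> by (simp add: normal_map_def)
  have \<Phi>b: "\<Phi> T \<in> \<B>" if "T \<in> M" for T
    using continuous_map_image_subset_topspace[OF cont] that Mb
    by (auto simp: topspace_ultraweak)
  let ?V = "{S \<in> \<B>. uw_fun (vseq x) (vseq y) S \<in> ball 0 1}"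
  have "openin ultraweak ?V" by (rule openin_ultraweak_basis) auto
  then have "openin (subtopology ultraweak M) {T \<in> topspace (subtopology ultraweak M). \<Phi> T \<in> ?V}"
    by (rule openin_continuous_map_preimage[OF cont])
  then obtain W where W: "openin ultraweak W" "{T \<in> topspace (subtopology ultraweak M). \<Phi> T \<in> ?V} = W \<inter> M"
    unfolding openin_subtopology by auto
  have WM: "T \<in> W \<longleftrightarrow> cmod (cinner x (\<Phi> T y)) < 1" if T: "T \<in> M" for T
  proof -
    have "T \<in> W \<longleftrightarrow> T \<in> {T \<in> topspace (subtopology ultraweak M). \<Phi> T \<in> ?V}" using W(2) T by blast
    also have "\<dots> \<longleftrightarrow> cmod (cinner x (\<Phi> T y)) < 1"
      using T Mb \<Phi>b[OF T] by (auto simp: topspace_ultraweak uw_fun_vseq bounded_ops_simps)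
    finally show ?thesis .
  qed
  have z: "(\<lambda>x. 0) \<in> M" using M by (simp add: op_subspace_def)
  have "\<Phi> (\<lambda>x. 0) = (\<lambda>x. 0)" using lin(2)[OF z z, of 0] by simp
  then have "(\<lambda>x. 0) \<in> W" using WM[OF z] by simp
  from ultraweak_nbhd[OF W(1) this]
  obtain P \<delta> where P: "finite P" "\<delta> > 0" "\<forall>p\<in>P. sq_summable (fst p) \<and> sq_summable (snd p)"
    and PW: "\<forall>T\<in>\<B>. (\<forall>p\<in>P. dist (uw_fun (fst p) (snd p) T) (uw_fun (fst p) (snd p) (\<lambda>x. 0)) < \<delta>) --> T \<in> W"
    by (elim exE conjE)
  have "\<exists>c. \<forall>T\<in>M. cinner x (\<Phi> T y) = (\<Sum>p\<in>P. c p * uw_fun (fst p) (snd p) T)"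
  proof (rule combination_of_kernels[where plus = "\<lambda>S T u. S u + T u" and scale = "\<lambda>c T u. c *\<^sub>C T u"])
    fix T assume T: "T \<in> M" and 0: "\<And>p. p \<in> P ==> uw_fun (fst p) (snd p) T = 0"
    have "cmod c * cmod (cinner x (\<Phi> T y)) < 1" for c
    proof -
      have cT: "(\<lambda>u. c *\<^sub>C T u) \<in> M" using M T by (simp add: op_subspace_def)
      have "(\<lambda>u. c *\<^sub>C T u) \<in> W"
      proof (rule PW[rule_format])
        show "dist (uw_fun (fst p) (snd p) (\<lambda>u. c *\<^sub>C T u)) (uw_fun (fst p) (snd p) (\<lambda>x. 0)) < \<delta>" if "p \<in> P" for p
        proof -
          have "T \<in> \<B>" using T Mb by blast
          from uw_fun_linear(2)[OF _ _ this, of "fst p" "snd p" c]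
          have "uw_fun (fst p) (snd p) (\<lambda>u. c *\<^sub>C T u) = 0" using that P(3) 0 by simp
          moreover have "uw_fun (fst p) (snd p) (\<lambda>x. 0) = 0" by (simp add: uw_fun_def)
          ultimately show ?thesis using P(2) by simp
        qed
      qed (use cT Mb in auto)
      then have "cmod (cinner x (\<Phi> (\<lambda>u. c *\<^sub>C T u) y)) < 1" using WM[OF cT] by blast
      then show ?thesis by (simp add: lin(2)[OF T T] cinner_scaleC_right norm_mult)
    qed
    from this[of "complex_of_real (1 / cmod (cinner x (\<Phi> T y)))"] show "cinner x (\<Phi> T y) = 0"
      by (auto simp: norm_divide split: if_splits)
  next
    fix p S T c assume p: "p \<in> P" and ST: "S \<in> M" "T \<in> M"
    have b: "S \<in> \<B>" "T \<in> \<B>" using ST Mb by auto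
    have sq: "sq_summable (fst p)" "sq_summable (snd p)" using P(3) p by auto
    show "uw_fun (fst p) (snd p) (\<lambda>u. S u + T u) = uw_fun (fst p) (snd p) S + uw_fun (fst p) (snd p) T"
      by (rule uw_fun_linear(1)[OF sq b(2,1)])
  next
    fix p T c assume p: "p \<in> P" and T: "T \<in> M"
    have sq: "sq_summable (fst p)" "sq_summable (snd p)" using P(3) p by auto
    show "uw_fun (fst p) (snd p) (\<lambda>u. c *\<^sub>C T u) = c * uw_fun (fst p) (snd p) T"
      by (rule uw_fun_linear(2)[OF sq]) (use T Mb in auto)
  next
    show "cinner x (\<Phi> (\<lambda>u. S u + T u) y) = cinner x (\<Phi> S y) + cinner x (\<Phi> T y)" if "S \<in> M" "T \<in> M" for S T
      by (simp add: lin(1)[OF that] cinner_add_right)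
    show "cinner x (\<Phi> (\<lambda>u. c *\<^sub>C T u) y) = c * cinner x (\<Phi> T y)" if "T \<in> M" for T c
      by (simp add: lin(2)[OF that that] cinner_scaleC_right)
  qed (use M P(1) in \<open>simp_all add: op_subspace_def\<close>)
  then obtain c where c': "\<forall>T\<in>M. cinner x (\<Phi> T y) = (\<Sum>p\<in>P. c p * uw_fun (fst p) (snd p) T)" by (rule exE)
  have c: "(\<Sum>p\<in>P. c p * uw_fun (fst p) (snd p) T) = cinner x (\<Phi> T y)" if "T \<in> M" for T
    using bspec[OF c' that] by (rule sym)
  have "\<exists>b. normal_on M (\<lambda>T. \<Sum>p\<in>P. c p * uw_fun (fst p) (snd p) T) b"
  proof (rule normal_on_sum[OF Mb])
    fix p assume "p \<in> P"
    then have "normal_on M (uw_fun (fst p) (snd p)) (max (l2_size (fst p)) (l2_size (snd p)))"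
      unfolding normal_on_def using P(3) by (intro exI[of _ "fst p"] exI[of _ "snd p"]) simp
    from normal_on_scale[OF Mb this] show "\<exists>b. normal_on M (\<lambda>T. c p * uw_fun (fst p) (snd p) T) b" by blast
  qed
  then obtain b where "normal_on M (\<lambda>T. \<Sum>p\<in>P. c p * uw_fun (fst p) (snd p) T) b" by (rule exE)
  from normal_on_cong[OF this c] show ?thesis by (rule exI)
qed

subsection \<open>Norm limits of normal functionals\<close>

text \<open>Epigraphs of sublinear functionals on a space \<open>V\<close> of functions are convex cones; a maximal
  cone containing no point \<open>(0, a)\<close> with \<open>a < 0\<close> is the epigraph of a linear functional.\<close>

definition epi_cone :: "('i => complex) set => (('i => complex) \<times> real) set => bool"
  where "epi_cone V H \<longleftrightarrow> fst ` H \<subseteq> V \<and> (\<forall>f a g b. (f, a) \<in> H --> (g, b) \<in> H --> ((\<lambda>i. f i + g i), a + b) \<in> H) \<and>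
    (\<forall>r f a. 0 < r --> (f, a) \<in> H --> ((\<lambda>i. complex_of_real r * f i), r * a) \<in> H) \<and> (\<forall>a. ((\<lambda>i. 0), a) \<in> H --> 0 \<le> a)"

definition adjoin :: "(('i => complex) \<times> real) set => ('i => complex) => real => (('i => complex) \<times> real) set"
  where "adjoin H f c = {((\<lambda>i. g i + complex_of_real t * f i), a + t * c) | g a t. (g, a) \<in> H \<and> 0 \<le> t}"

lemma epi_coneD:
  assumes "epi_cone V H"
  shows "(f, a) \<in> H ==> f \<in> V" "(f, a) \<in> H ==> (g, b) \<in> H ==> ((\<lambda>i. f i + g i), a + b) \<in> H"
    "0 < r ==> (f, a) \<in> H ==> ((\<lambda>i. complex_of_real r * f i), r * a) \<in> H" "((\<lambda>i. 0), a) \<in> H ==> 0 \<le> a"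
proof -
  have "fst ` H \<subseteq> V" using assms unfolding epi_cone_def by blast
  then show "(f, a) \<in> H ==> f \<in> V" using imageI[of "(f, a)" H fst] by auto
qed (use assms in \<open>unfold epi_cone_def, blast+\<close>)

lemma adjoinI: "(g, a) \<in> H ==> 0 \<le> t ==> h = (\<lambda>i. g i + complex_of_real t * f i) ==> b = a + t * c ==> (h, b) \<in> adjoin H f c"
  unfolding adjoin_def by blast

text \<open>Adding the ray through \<open>(f, c)\<close> could create a point \<open>(0, a)\<close>
  with negative \<open>a\<close> only by cancelling \<open>f\<close> against a point over
  \<open>- f\<close>; the condition on \<open>c\<close> excludes exactly this.\<close>

lemma epi_cone_adjoin:
  assumes V: "\<And>f g. f \<in> V ==> g \<in> V ==> (\<lambda>i. f i + g i) \<in> V" "\<And>c f. f \<in> V ==> (\<lambda>i. c * f i) \<in> V"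
    and H: "epi_cone V H" and f: "f \<in> V" and c: "\<And>a. ((\<lambda>i. - f i), a) \<in> H ==> - c \<le> a"
  shows "epi_cone V (adjoin H f c)"
  unfolding epi_cone_def
proof (intro conjI allI impI)
  show "fst ` adjoin H f c \<subseteq> V" unfolding adjoin_def using V f epi_coneD(1)[OF H] by auto
  fix u x assume "(u, x) \<in> adjoin H f c"
  then obtain g a t where u: "(g, a) \<in> H" "0 \<le> t" "u = (\<lambda>i. g i + complex_of_real t * f i)" "x = a + t * c"
    unfolding adjoin_def by blast
  show "((\<lambda>i. complex_of_real r * u i), r * x) \<in> adjoin H f c" if "0 < r" for r
    by (rule adjoinI[OF epi_coneD(3)[OF H that u(1)], of "r * t"]) (use u that in \<open>auto simp: algebra_simps\<close>)
  fix v y assume "(v, y) \<in> adjoin H f c"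
  then obtain h b s where v: "(h, b) \<in> H" "0 \<le> s" "v = (\<lambda>i. h i + complex_of_real s * f i)" "y = b + s * c"
    unfolding adjoin_def by blast
  show "((\<lambda>i. u i + v i), x + y) \<in> adjoin H f c"
    by (rule adjoinI[OF epi_coneD(2)[OF H u(1) v(1)], of "t + s"]) (use u v in \<open>auto simp: algebra_simps\<close>)
next
  fix x assume "((\<lambda>i. 0), x) \<in> adjoin H f c"
  then obtain g a t where u: "(g, a) \<in> H" "0 \<le> t" "\<And>i. 0 = g i + complex_of_real t * f i" "x = a + t * c"
    unfolding adjoin_def by (auto simp: fun_eq_iff)
  then have g: "g = (\<lambda>i. - (complex_of_real t * f i))" by (auto simp: eq_neg_iff_add_eq_0)
  show "0 \<le> x"
  proof (cases "t = 0")
    case True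
    then show ?thesis using epi_coneD(4)[OF H, of a] u g by simp
  next
    case False
    then have "((\<lambda>i. - f i), (1/t) * a) \<in> H" using epi_coneD(3)[OF H _ u(1), of "1/t"] u(2) g by simp
    from c[OF this] False u(2) have "- c * t \<le> a" by (simp add: field_simps)
    then show ?thesis using u(4) by (simp add: mult.commute)
  qed
qed

text \<open>The norming clause for \<open>f0\<close> is built into the initial cone: to the strict
  epigraph of \<open>p\<close> is adjoined the ray through \<open>(- f0, - p f0)\<close>, which
  forces the real functional to be at least \<open>p f0\<close> at \<open>f0\<close>. The fibrewise
  infimum \<open>R\<close> over a maximal cone is the real part; the complex functional is recovered
  from it as \<open>R f - \<i> * R (\<i> f)\<close>.\<close>

lemma hahn_banach:
  fixes V :: "('i => complex) set" and p :: "('i => complex) => real"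
  assumes V: "\<And>f g. f \<in> V ==> g \<in> V ==> (\<lambda>i. f i + g i) \<in> V" "\<And>c f. f \<in> V ==> (\<lambda>i. c * f i) \<in> V"
    and p: "\<And>f g. f \<in> V ==> g \<in> V ==> p (\<lambda>i. f i + g i) \<le> p f + p g"
      "\<And>c f. f \<in> V ==> p (\<lambda>i. c * f i) = cmod c * p f"
    and f0: "f0 \<in> V"
  shows "\<exists>\<Theta>. (\<forall>f\<in>V. \<forall>g\<in>V. \<Theta> (\<lambda>i. f i + g i) = \<Theta> f + \<Theta> g) \<and> (\<forall>c. \<forall>f\<in>V. \<Theta> (\<lambda>i. c * f i) = c * \<Theta> f) \<and>
    (\<forall>f\<in>V. cmod (\<Theta> f) \<le> p f) \<and> p f0 \<le> cmod (\<Theta> f0)"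
proof -
  have neg: "(\<lambda>i. - f i) \<in> V" "p (\<lambda>i. - f i) = p f" if "f \<in> V" for f
    using V(2)[OF that, of "-1"] p(2)[OF that, of "-1"] by simp_all
  have V0: "(\<lambda>i. 0) \<in> V" and p0: "p (\<lambda>i. 0) = 0" using V(2)[OF f0, of 0] p(2)[OF f0, of 0] by simp_all
  define Hp where "Hp = {(f, a). f \<in> V \<and> p f < a}"
  define H0 where "H0 = adjoin Hp (\<lambda>i. - f0 i) (- p f0)"
  have "epi_cone V Hp"
    unfolding epi_cone_def Hp_def using V p by (auto simp: p0 intro: le_less_trans[OF p(1)])
  then have H0: "epi_cone V H0" unfolding H0_def
    by (rule epi_cone_adjoin[rotated 2]) (use V neg f0 in \<open>auto simp: Hp_def\<close>)
  have "\<exists>M\<in>{H. epi_cone V H \<and> H0 \<subseteq> H}. \<forall>X\<in>{H. epi_cone V H \<and> H0 \<subseteq> H}. M \<subseteq> X --> X = M"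
  proof (rule subset_Zorn_nonempty)
    fix \<C> assume C: "\<C> \<noteq> {}" "subset.chain {H. epi_cone V H \<and> H0 \<subseteq> H} \<C>"
    then have CH: "epi_cone V H" "H0 \<subseteq> H" if "H \<in> \<C>" for H using that by (auto simp: subset_chain_def)
    have pair: "\<exists>H\<in>\<C>. x \<in> H \<and> y \<in> H" if xy: "x \<in> \<Union>\<C>" "y \<in> \<Union>\<C>" for x y
    proof -
      obtain X Z where "X \<in> \<C>" "x \<in> X" "Z \<in> \<C>" "y \<in> Z" using xy by blast
      moreover from this have "X \<subseteq> Z \<or> Z \<subseteq> X" using C(2) unfolding subset_chain_def by blast
      ultimately show ?thesis by blast
    qed
    have "epi_cone V (\<Union>\<C>)"
      unfolding epi_cone_def
    proof (intro conjI allI impI)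
      show "fst ` \<Union>\<C> \<subseteq> V" "\<And>a. (\<lambda>i. 0, a) \<in> \<Union>\<C> ==> 0 \<le> a"
        using epi_coneD(1,4)[OF CH(1)] by auto
      show "(\<lambda>i. complex_of_real r * f i, r * a) \<in> \<Union>\<C>" if "0 < r" "(f, a) \<in> \<Union>\<C>" for r f a
        using that epi_coneD(3)[OF CH(1)] by blast
      show "(\<lambda>i. f i + g i, a + b) \<in> \<Union>\<C>" if "(f, a) \<in> \<Union>\<C>" "(g, b) \<in> \<Union>\<C>" for f a g b
        using pair[OF that] epi_coneD(2)[OF CH(1)] by blast
    qed
    then show "\<Union>\<C> \<in> {H. epi_cone V H \<and> H0 \<subseteq> H}" using C(1) CH(2) by blast
  qed (use H0 in auto)
  then obtain H where H: "epi_cone V H" "H0 \<subseteq> H" and max: "\<And>X. epi_cone V X ==> H \<subseteq> X ==> X = H" by auto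
  have "Hp \<subseteq> H0" unfolding H0_def by (auto intro: adjoinI[where t = 0])
  then have HpH: "(f, a) \<in> H" if "f \<in> V" "p f < a" for f a using H(2) that by (auto simp: Hp_def)
  define R where "R f = Inf {a. (f, a) \<in> H}" for f
  have lower: "- b \<le> a" if "(f, a) \<in> H" "((\<lambda>i. - f i), b) \<in> H" for f a b
    using epi_coneD(2)[OF H(1) that] epi_coneD(4)[OF H(1), of "a + b"] by simp
  have ne: "(f, p f + 1) \<in> H" if "f \<in> V" for f using HpH[OF that] by simp
  have R_le: "R f \<le> a" if "(f, a) \<in> H" for f a
    unfolding R_def using that lower[OF _ ne[OF neg(1)[OF epi_coneD(1)[OF H(1) that]]]] by (intro cInf_lower bdd_belowI) auto
  have R_ge: "c \<le> R f" if "f \<in> V" "\<And>a. (f, a) \<in> H ==> c \<le> a" for f c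
    unfolding R_def by (rule cInf_greatest) (use ne that in auto)
  \<comment> \<open>Maximality: the ray through \<open>(f, c)\<close> may be adjoined, so the points
    \<open>(f, e + c)\<close> already belong to \<open>H\<close>. The positive \<open>e\<close> is
    there because \<open>(0, 0)\<close> itself need not lie in the cone.\<close>
  have adj: "R f \<le> c" if f: "f \<in> V" and c: "\<And>a. ((\<lambda>i. - f i), a) \<in> H ==> - c \<le> a" for f c
  proof (rule field_le_epsilon)
    fix e :: real assume "e > 0"
    then have "((\<lambda>i. 0), e) \<in> H" using HpH[OF V0] p0 by simp
    then have "(f, e + 1 * c) \<in> adjoin H f c" by (rule adjoinI) auto
    moreover have "adjoin H f c = H"
      by (rule max[OF epi_cone_adjoin[OF V H(1) f c]]) (auto intro: adjoinI[where t = 0])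
    ultimately show "R f \<le> c + e" using R_le[of f "e + c"] by simp
  qed
  have Rneg: "R (\<lambda>i. - f i) = - R f" if f: "f \<in> V" for f
  proof (rule antisym)
    show "R (\<lambda>i. - f i) \<le> - R f" by (rule adj[OF neg(1)[OF f]]) (simp add: R_le)
    show "- R f \<le> R (\<lambda>i. - f i)"
      by (rule R_ge[OF neg(1)[OF f]]) (use R_ge[OF f, of "- b" for b] lower in \<open>force simp: minus_le_iff\<close>)
  qed
  have sub: "R (\<lambda>i. f i + g i) \<le> R f + R g" if "f \<in> V" "g \<in> V" for f g
  proof -
    have "R (\<lambda>i. f i + g i) - b \<le> R f" if b: "(g, b) \<in> H" for b
      by (rule R_ge[OF \<open>f \<in> V\<close>]) (use R_le[OF epi_coneD(2)[OF H(1) _ b]] in \<open>simp add: diff_le_eq\<close>)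
    then have "R (\<lambda>i. f i + g i) - R f \<le> R g" by (intro R_ge[OF that(2)]) (simp add: algebra_simps)
    then show ?thesis by simp
  qed
  have Radd: "R (\<lambda>i. f i + g i) = R f + R g" if "f \<in> V" "g \<in> V" for f g
    using sub[OF that] sub[OF neg(1)[OF that(1)] neg(1)[OF that(2)]] Rneg[OF V(1)[OF that]] by (simp add: Rneg that)
  have Rpos: "R (\<lambda>i. complex_of_real r * f i) \<le> r * R f" if f: "f \<in> V" and r: "0 < r" for f r
  proof -
    have "R (\<lambda>i. complex_of_real r * f i) / r \<le> R f"
      by (rule R_ge[OF f]) (use R_le[OF epi_coneD(3)[OF H(1) r]] r in \<open>simp add: divide_le_eq mult.commute[of _ r]\<close>)
    then show ?thesis using r by (simp add: field_simps)
  qed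
  have Rsc: "R (\<lambda>i. complex_of_real r * f i) = r * R f" if f: "f \<in> V" for f r
  proof -
    have pos: "R (\<lambda>i. complex_of_real r * f i) = r * R f" if "0 < r" for r
      using Rpos[OF f that] Rpos[OF V(2)[OF f, of "complex_of_real r"], of "1/r"] that by (simp add: field_simps)
    consider "r = 0" | "r > 0" | "- r > 0" by linarith
    then show ?thesis
    proof cases
      case 1 then show ?thesis using Rneg[OF V0] by simp
    next
      case 3 then show ?thesis using pos[of "- r"] Rneg[OF V(2)[OF f, of "complex_of_real r"]] by simp
    qed (rule pos)
  qed
  have Rp: "R f \<le> p f" if "f \<in> V" for f
    by (rule field_le_epsilon) (use R_le[OF HpH[OF that]] in simp)
  have "R (\<lambda>i. - f0 i) \<le> - p f0"
  proof (rule field_le_epsilon)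
    fix e :: real assume "e > 0"
    then have "((\<lambda>i. - f0 i), e + 1 * (- p f0)) \<in> H0"
      unfolding H0_def by (intro adjoinI[where g = "\<lambda>i. 0" and t = 1]) (auto simp: Hp_def V0 p0)
    then show "R (\<lambda>i. - f0 i) \<le> - p f0 + e" using R_le H(2) by fastforce
  qed
  then have Rf0: "R f0 = p f0" using Rneg[OF f0] Rp[OF f0] by simp
  define \<Theta> where "\<Theta> f = Complex (R f) (- R (\<lambda>i. \<i> * f i))" for f
  have add: "\<Theta> (\<lambda>i. f i + g i) = \<Theta> f + \<Theta> g" if "f \<in> V" "g \<in> V" for f g
    using Radd[OF that] Radd[OF V(2)[OF that(1)] V(2)[OF that(2)], of \<i> \<i>]
    by (simp add: \<Theta>_def complex_eq_iff ring_distribs)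
  have sc: "\<Theta> (\<lambda>i. c * f i) = c * \<Theta> f" if f: "f \<in> V" for c f
  proof -
    have c: "c = complex_of_real (Re c) + \<i> * complex_of_real (Im c)" by (simp add: complex_eq_iff)
    have 1: "R (\<lambda>i. d * f i) = Re d * R f + Im d * R (\<lambda>i. \<i> * f i)" for d
    proof -
      have "(\<lambda>i. d * f i) = (\<lambda>i. complex_of_real (Re d) * f i + complex_of_real (Im d) * (\<i> * f i))"
        by (rule ext) (simp add: complex_eq_iff)
      then show ?thesis using Radd[OF V(2)[OF f] V(2)[OF V(2)[OF f]], of "complex_of_real (Re d)" "complex_of_real (Im d)" \<i>]
          Rsc[OF f] Rsc[OF V(2)[OF f]] by simp
    qed
    have "(\<lambda>i. \<i> * (c * f i)) = (\<lambda>i. (\<i> * c) * f i)" by auto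
    then show ?thesis using 1[of c] 1[of "\<i> * c"] by (simp add: \<Theta>_def complex_eq_iff algebra_simps)
  qed
  have bd: "cmod (\<Theta> f) \<le> p f" if f: "f \<in> V" for f
  proof (cases "\<Theta> f = 0")
    case True
    have "0 \<le> p f" using p(1)[OF f neg(1)[OF f]] neg(2)[OF f] p0 by simp
    then show ?thesis using True by simp
  next
    case False
    \<comment> \<open>The phase that makes \<open>\<Theta> f\<close> real, so that its modulus is a
      value of \<open>R\<close>, where \<open>p\<close> bounds it.\<close>
    define c where "c = cnj (\<Theta> f) / cmod (\<Theta> f)"
    have c: "cmod c = 1" using False by (simp add: c_def norm_divide)
    have "c * \<Theta> f = complex_of_real (cmod (\<Theta> f))"
      using False by (simp add: c_def complex_norm_square[symmetric] power2_eq_square mult.commute[of "cnj _"])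
    then have "cmod (\<Theta> f) = Re (\<Theta> (\<lambda>i. c * f i))" by (simp add: sc[OF f])
    also have "\<dots> = R (\<lambda>i. c * f i)" by (simp add: \<Theta>_def)
    also have "\<dots> \<le> p (\<lambda>i. c * f i)" by (rule Rp[OF V(2)[OF f]])
    also have "\<dots> = p f" using p(2)[OF f] c by simp
    finally show ?thesis .
  qed
  have "p f0 \<le> cmod (\<Theta> f0)" using complex_Re_le_cmod[of "\<Theta> f0"] Rf0 by (simp add: \<Theta>_def)
  then show ?thesis using add sc bd by blast
qed

lemma commutant_bounded: "commutant C \<subseteq> \<B>" by (auto simp: commutant_def)

text \<open>The quotient norm of the predual of a commutant agrees with the norm as functional: a
  norming functional on the predual is given by an operator, which lies in the commutant.\<close>

lemma normal_on_of_norm: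
  fixes C :: "('a::chilbert_space => 'a) set"
  assumes C: "C \<subseteq> \<B>" and n: "normal_on (commutant C) \<phi> b"
    and bd: "\<And>T. T \<in> commutant C ==> op_bound T 1 ==> cmod (\<phi> T) \<le> c" and d: "d > c"
  shows "normal_on (commutant C) \<phi> d"
proof -
  let ?M = "commutant C"
  note Mb = commutant_bounded[of C]
  \<comment> \<open>Functionals are required to vanish off the commutant, so that a functional on
    the commutant has a single representative and pointwise operations are the right ones.\<close>
  define X where "X = {\<psi>. (\<exists>b. normal_on ?M \<psi> b) \<and> (\<forall>T. T \<notin> ?M --> \<psi> T = 0)}"
  define p where "p \<psi> = Inf {b. normal_on ?M \<psi> b}" for \<psi>
  have lb: "bdd_below {b. normal_on ?M \<psi> b}" for \<psi>
    by (rule bdd_belowI[of _ 0]) (use normal_on_nonneg in blast)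
  have p_le: "p \<psi> \<le> b" if "normal_on ?M \<psi> b" for \<psi> b
    unfolding p_def using that by (intro cInf_lower lb) auto
  have p_nn: "p \<psi> \<ge> 0" if "normal_on ?M \<psi> b" for \<psi> b
    unfolding p_def using that normal_on_nonneg by (intro cInf_greatest) auto
  have p_ex: "\<exists>a<b. normal_on ?M \<psi> a" if "p \<psi> < b" "normal_on ?M \<psi> e" for \<psi> b e
    using cInf_lessD[of "{b. normal_on ?M \<psi> b}" b] that unfolding p_def by auto
  have XV1: "(\<lambda>i. f i + g i) \<in> X" if "f \<in> X" "g \<in> X" for f g
    using that normal_on_add[OF Mb] unfolding X_def by fastforce
  have XV2: "(\<lambda>i. r * f i) \<in> X" if "f \<in> X" for f r
    using that normal_on_scale[OF Mb] unfolding X_def by fastforce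
  note XV = XV1 XV2
  have psc_le: "p (\<lambda>T. r * f T) \<le> cmod r * p f" if nf: "normal_on ?M f e" and r: "r \<noteq> 0" for f r e
  proof -
    have "p (\<lambda>T. r * f T) / cmod r \<le> p f"
      unfolding p_def[of f]
    proof (rule cInf_greatest)
      fix a assume "a \<in> {b. normal_on ?M f b}"
      then show "p (\<lambda>T. r * f T) / cmod r \<le> a"
        using p_le[OF normal_on_scale[OF Mb, of f a r]] r by (simp add: divide_le_eq mult.commute)
    qed (use nf in auto)
    then show ?thesis using r by (simp add: divide_le_eq mult.commute)
  qed
  have psc: "p (\<lambda>T. r * f T) = cmod r * p f" if fX: "f \<in> X" for f r
  proof -
    obtain e where e: "normal_on ?M f e" using fX by (auto simp: X_def)
    show ?thesis
    proof (cases "r = 0")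
      case True
      have "normal_on ?M (\<lambda>T. r * f T) 0" using True normal_on_zero[OF Mb] by simp
      then show ?thesis using p_le p_nn True by fastforce
    next
      case False
      have "p (\<lambda>T. (1/r) * (r * f T)) \<le> cmod (1/r) * p (\<lambda>T. r * f T)"
        by (rule psc_le[OF normal_on_scale[OF Mb e]]) (use False in simp)
      then have "p f \<le> p (\<lambda>T. r * f T) / cmod r" using False by (simp add: norm_divide)
      then have "cmod r * p f \<le> p (\<lambda>T. r * f T)" using False by (simp add: field_simps)
      then show ?thesis using psc_le[OF e False] by (simp add: antisym)
    qed
  qed
  have padd: "p (\<lambda>T. f T + g T) \<le> p f + p g" if fgX: "f \<in> X" "g \<in> X" for f g
  proof (rule field_le_epsilon)
    fix \<epsilon> :: real assume e: "\<epsilon> > 0"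
    obtain a b where ab: "a < p f + \<epsilon>/2" "normal_on ?M f a" "b < p g + \<epsilon>/2" "normal_on ?M g b"
      using p_ex[of f "p f + \<epsilon>/2"] p_ex[of g "p g + \<epsilon>/2"] fgX e unfolding X_def by fastforce
    show "p (\<lambda>T. f T + g T) \<le> p f + p g + \<epsilon>"
      using p_le[OF normal_on_add[OF Mb ab(2,4)]] ab by linarith
  qed
  define \<phi>0 where "\<phi>0 T = (if T \<in> ?M then \<phi> T else 0)" for T
  have n0: "normal_on ?M \<phi>0 b" by (rule normal_on_cong[OF n]) (simp add: \<phi>0_def)
  have \<phi>0: "\<phi>0 \<in> X" using n0 by (auto simp: X_def \<phi>0_def)
  have "\<exists>\<Theta>. (\<forall>f\<in>X. \<forall>g\<in>X. \<Theta> (\<lambda>i. f i + g i) = \<Theta> f + \<Theta> g) \<and> (\<forall>c. \<forall>f\<in>X. \<Theta> (\<lambda>i. c * f i) = c * \<Theta> f) \<and>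
    (\<forall>f\<in>X. cmod (\<Theta> f) \<le> p f) \<and> p \<phi>0 \<le> cmod (\<Theta> \<phi>0)"
    by (rule hahn_banach) (fact XV padd psc \<phi>0)+
  then obtain \<Theta> where \<Theta>0: "\<forall>f\<in>X. \<forall>g\<in>X. \<Theta> (\<lambda>i. f i + g i) = \<Theta> f + \<Theta> g"
    "\<forall>c. \<forall>f\<in>X. \<Theta> (\<lambda>i. c * f i) = c * \<Theta> f" "\<forall>f\<in>X. cmod (\<Theta> f) \<le> p f" "p \<phi>0 \<le> cmod (\<Theta> \<phi>0)"
    by (elim exE conjE)
  note \<Theta> = \<Theta>0(1,2,3)[rule_format] \<Theta>0(4)
  \<comment> \<open>The vector functionals. Evaluating \<open>\<Theta>\<close> on them gives a
    bounded sesquilinear form, hence an operator \<open>T0\<close> of norm at most 1.\<close>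
  define r1 where "r1 x y T = (if T \<in> ?M then cinner x (T y) else 0)" for x y and T :: "'a => 'a"
  have r1n: "normal_on ?M (r1 x y) (norm x * norm y)" for x y
    by (rule normal_on_cong[OF normal_on_cinner[OF Mb]]) (simp add: r1_def)
  have r1X: "r1 x y \<in> X" for x y using r1n[of x y] by (auto simp: X_def r1_def)
  have r1b: "cmod (\<Theta> (r1 x y)) \<le> norm x * norm y" for x y
    using \<Theta>(3)[OF r1X] p_le[OF r1n] order_trans by blast
  have r1_lin: "r1 x (y + y') = (\<lambda>T. r1 x y T + r1 x y' T)" "r1 (x + x') y = (\<lambda>T. r1 x y T + r1 x' y T)"
    "r1 x (s *\<^sub>C y) = (\<lambda>T. s * r1 x y T)" "r1 (s *\<^sub>C x) y = (\<lambda>T. cnj s * r1 x y T)" for x x' y y' s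
    using Mb by (auto simp: r1_def fun_eq_iff bounded_ops_simps subsetD[OF Mb] cinner_add_right cinner_add_left
        cinner_scaleC_right cinner_scaleC_left)
  have "\<exists>z. \<forall>x. cnj (\<Theta> (r1 x y)) = cinner z x" for y
  proof (rule riesz, rule bounded_opsI[of _ "norm y"])
    show "cnj (\<Theta> (r1 (x + x') y)) = cnj (\<Theta> (r1 x y)) + cnj (\<Theta> (r1 x' y))" for x x'
      by (simp add: r1_lin \<Theta>(1) r1X)
    show "cnj (\<Theta> (r1 (s *\<^sub>C x) y)) = s *\<^sub>C cnj (\<Theta> (r1 x y))" for x s
      by (simp add: r1_lin \<Theta>(2) r1X scaleC_complex_def)
    show "op_bound (\<lambda>x. cnj (\<Theta> (r1 x y))) (norm y)"
      using r1b by (auto simp: op_bound_def mult.commute)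
  qed
  then obtain T0 where T0: "\<And>x y. cnj (\<Theta> (r1 x y)) = cinner (T0 y) x" by metis
  have T0': "cinner x (T0 y) = \<Theta> (r1 x y)" for x y
    using T0[of x y] cinner_commute[of x "T0 y"] by (metis complex_cnj_cnj)
  have T0b: "op_bound T0 1"
    unfolding op_bound_def
  proof
    fix y
    show "norm (T0 y) \<le> 1 * norm y"
    proof (rule norm_le_cinner)
      show "cmod (cinner x (T0 y)) \<le> 1 * norm y * norm x" for x
        using r1b[of x y] by (simp add: T0' mult.commute)
    qed simp
  qed
  have T0l: "T0 \<in> \<B>"
    by (rule bounded_opsI[OF _ _ T0b])
      (rule cinner_eqI, simp add: T0' r1_lin \<Theta>(1,2) r1X cinner_add_right cinner_scaleC_right)+
  \<comment> \<open>\<open>r1 (adj S x) y\<close> and \<open>r1 x (S y)\<close> are the same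
    functional on the commutant, so the form does not distinguish on which side of \<open>T0\<close>
    the operator \<open>S\<close> stands.\<close>
  have T0M: "T0 \<in> ?M"
  proof -
    have "S \<circ> T0 = T0 \<circ> S" if S: "S \<in> C" for S
    proof
      fix y
      have Sb: "S \<in> \<B>" using C S by blast
      show "(S \<circ> T0) y = (T0 \<circ> S) y"
      proof (rule cinner_eqI)
        fix x
        have "r1 (adj S x) y = r1 x (S y)"
        proof
          fix T
          show "r1 (adj S x) y T = r1 x (S y) T"
          proof (cases "T \<in> ?M")
            case True
            then have "T (S y) = S (T y)" using S unfolding commutant_def by (metis (mono_tags, lifting) comp_apply mem_Collect_eq)
            then show ?thesis using True by (simp add: r1_def adj_cinner[OF Sb])
          qed (simp add: r1_def)
        qed
        then show "cinner x ((S \<circ> T0) y) = cinner x ((T0 \<circ> S) y)"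
          by (simp add: adj_cinner(1)[OF Sb, symmetric] T0')
      qed
    qed
    then show ?thesis unfolding commutant_def using T0l by auto
  qed
  \<comment> \<open>\<open>\<Theta>\<close> is evaluation at \<open>T0\<close> on vector
    functionals, hence on the partial sums \<open>\<psi> m\<close>; the remaining tails are small in
    \<open>p\<close>, by which \<open>\<Theta>\<close> is bounded.\<close>
  have "\<Theta> \<phi>0 = \<phi>0 T0"
  proof -
    obtain \<xi> \<eta> where *: "sq_summable \<xi>" "sq_summable \<eta>" "\<And>T. T \<in> ?M ==> \<phi>0 T = uw_fun \<xi> \<eta> T"
      using n0 unfolding normal_on_def by blast
    define \<psi> where "\<psi> m T = (\<Sum>n<m. r1 (\<xi> n) (\<eta> n) T)" for m T
    have \<psi>: "\<psi> m \<in> X \<and> \<Theta> (\<psi> m) = (\<Sum>n<m. cinner (\<xi> n) (T0 (\<eta> n)))" for m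
    proof (induction m)
      case 0
      have "\<psi> 0 = (\<lambda>T. 0 * \<phi>0 T)" by (auto simp: \<psi>_def)
      then show ?case using XV(2)[OF \<phi>0, of 0] \<Theta>(2)[OF \<phi>0, of 0] by simp
    next
      case (Suc m)
      have "\<psi> (Suc m) = (\<lambda>T. \<psi> m T + r1 (\<xi> m) (\<eta> m) T)" by (auto simp: \<psi>_def)
      then show ?case using Suc XV(1)[OF _ r1X] \<Theta>(1)[OF _ r1X] by (simp add: T0')
    qed
    let ?t = "\<lambda>m. l2_size (\<lambda>n. \<xi> (n + m)) + l2_size (\<lambda>n. \<eta> (n + m))"
    have tail: "(\<lambda>m. l2_size (\<lambda>n. \<zeta> (n + m))) \<longlonglongrightarrow> 0 \<and> (\<forall>m. sq_summable (\<lambda>n. \<zeta> (n + m)))"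
      if "sq_summable \<zeta>" for \<zeta> :: "nat => 'a"
      using suminf_exist_split2[of "\<lambda>n. (norm (\<zeta> n))\<^sup>2"] that summable_ignore_initial_segment[of "\<lambda>n. (norm (\<zeta> n))\<^sup>2"]
      unfolding sq_summable_nat l2_size_def by auto
    have est: "cmod (\<Theta> \<phi>0 - \<Theta> (\<psi> m)) \<le> ?t m" for m
    proof -
      let ?d = "\<lambda>T. \<phi>0 T + (-1) * \<psi> m T"
      have mX: "(\<lambda>T. (-1) * \<psi> m T) \<in> X" using XV(2) \<psi> by blast
      have dX: "?d \<in> X" using XV(1)[OF \<phi>0 mX] .
      have "?d T = uw_fun (\<lambda>n. \<xi> (n + m)) (\<lambda>n. \<eta> (n + m)) T" if T: "T \<in> ?M" for T
        using suminf_split_initial_segment[OF sums_summable[OF uw_fun_sums[OF subsetD[OF Mb T] *(1,2)]], of m] T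
        by (simp add: *(3) uw_fun_def \<psi>_def r1_def)
      then have "normal_on ?M ?d (?t m)"
        unfolding normal_on_def using tail[OF *(1)] tail[OF *(2)]
        by (intro exI[of _ "\<lambda>n. \<xi> (n + m)"] exI[of _ "\<lambda>n. \<eta> (n + m)"]) (auto intro: l2_size_nonneg)
      then have "cmod (\<Theta> ?d) \<le> ?t m" using \<Theta>(3)[OF dX] p_le order_trans by blast
      moreover have "\<Theta> ?d = \<Theta> \<phi>0 - \<Theta> (\<psi> m)" using \<Theta>(1)[OF \<phi>0 mX] \<Theta>(2)[of "\<psi> m" "-1"] \<psi> by simp
      ultimately show ?thesis by simp
    qed
    have "(\<lambda>m. \<Theta> \<phi>0 - \<Theta> (\<psi> m)) \<longlonglongrightarrow> 0"
    proof (rule Lim_null_comparison[where g = ?t])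
      show "?t \<longlonglongrightarrow> 0" using tendsto_add[OF conjunct1[OF tail[OF *(1)]] conjunct1[OF tail[OF *(2)]]] by simp
    qed (use est in auto)
    then have "(\<lambda>m. \<Theta> (\<psi> m)) \<longlonglongrightarrow> \<Theta> \<phi>0" using tendsto_diff[OF tendsto_const[of "\<Theta> \<phi>0"]] by fastforce
    moreover have "(\<lambda>m. \<Theta> (\<psi> m)) \<longlonglongrightarrow> uw_fun \<xi> \<eta> T0"
      using uw_fun_sums[OF T0l *(1,2)] \<psi> unfolding sums_def by simp
    ultimately show ?thesis using *(3)[OF T0M] LIMSEQ_unique by metis
  qed
  then have "p \<phi>0 < d" using \<Theta>(4) bd[OF T0M T0b] d T0M by (simp add: \<phi>0_def)
  then obtain a where a: "a < d" "normal_on ?M \<phi>0 a" using p_ex n0 by blast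
  then have "normal_on ?M \<phi>0 d" unfolding normal_on_def by (meson less_imp_le order_trans)
  then show ?thesis by (rule normal_on_cong) (simp add: \<phi>0_def)
qed

text \<open>Completeness of the predual for the norm of functionals: approximants with error
  \<open>(1/2)^n\<close> form a telescoping series, whose terms have small norm as functionals and
  hence, by \<open>normal_on_of_norm\<close>, small constants.\<close>

lemma normal_on_limit:
  fixes C :: "('a::chilbert_space => 'a) set"
  assumes C: "C \<subseteq> \<B>"
    and lim: "\<And>\<epsilon>. \<epsilon> > 0 ==> \<exists>\<psi> b. normal_on (commutant C) \<psi> b \<and> (\<forall>T\<in>commutant C. \<forall>K\<ge>0. op_bound T K --> cmod (\<phi> T - \<psi> T) \<le> \<epsilon> * K)"
  shows "\<exists>b. normal_on (commutant C) \<phi> b"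
proof -
  let ?M = "commutant C"
  note Mb = commutant_bounded[of C]
  have "\<exists>\<psi> b. normal_on ?M \<psi> b \<and> (\<forall>T\<in>?M. \<forall>K\<ge>0. op_bound T K --> cmod (\<phi> T - \<psi> T) \<le> (1/2)^n * K)" for n :: nat
    using lim[of "(1/2)^n"] by simp
  then obtain \<psi> b where \<psi>: "\<And>n. normal_on ?M (\<psi> n) (b n)"
      "\<And>n T K. T \<in> ?M ==> 0 \<le> K ==> op_bound T K ==> cmod (\<phi> T - \<psi> n T) \<le> (1/2)^n * K" by metis
  define \<delta> where "\<delta> n T = (case n of 0 => \<psi> 0 T | Suc m => \<psi> (Suc m) T - \<psi> m T)" for n T
  define c where "c n = (case n of 0 => b 0 | Suc m => 2 * (1/2)^m)" for n
  have n: "normal_on ?M (\<delta> n) (c n)" for n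
  proof (cases n)
    case 0
    then show ?thesis using normal_on_cong[OF \<psi>(1)[of 0], of "\<delta> 0"] by (simp add: \<delta>_def c_def)
  next
    case (Suc m)
    \<comment> \<open>The functional norm is at most \<open>(1/2)^m + (1/2)^Suc m\<close>; the
      constant \<open>2 * (1/2)^m\<close> leaves the strict gap required by
      \<open>normal_on_of_norm\<close>.\<close>
    have "normal_on ?M (\<lambda>T. \<psi> (Suc m) T + (-1) * \<psi> m T) (2 * (1/2)^m)"
    proof (rule normal_on_of_norm[OF C normal_on_add[OF Mb \<psi>(1) normal_on_scale[OF Mb \<psi>(1)]]])
      fix T assume T: "T \<in> ?M" "op_bound T 1"
      have "cmod (\<psi> (Suc m) T + (-1) * \<psi> m T) \<le> cmod (\<phi> T - \<psi> m T) + cmod (\<phi> T - \<psi> (Suc m) T)"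
        using norm_triangle_ineq4[of "\<phi> T - \<psi> m T" "\<phi> T - \<psi> (Suc m) T"] by simp
      also have "\<dots> \<le> (1/2)^m + (1/2)^Suc m" using \<psi>(2)[OF T(1) zero_le_one T(2)] unfolding mult_1_right by (intro add_mono)
      finally show "cmod (\<psi> (Suc m) T + (-1) * \<psi> m T) \<le> (1/2)^m + (1/2)^Suc m" .
    qed simp
    then show ?thesis by (simp add: \<delta>_def[abs_def] c_def Suc)
  qed
  have cs: "summable c"
  proof -
    have "summable (\<lambda>n. c (Suc n))" unfolding c_def by (auto intro!: summable_mult summable_geometric)
    then show ?thesis by (simp add: summable_Suc_iff)
  qed
  have s: "(\<lambda>n. \<delta> n T) sums \<phi> T" if T: "T \<in> ?M" for T
  proof -
    have part: "(\<Sum>n<Suc m. \<delta> n T) = \<psi> m T" for m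
      by (induction m) (auto simp: \<delta>_def)
    have "(\<lambda>m. \<psi> m T) \<longlonglongrightarrow> \<phi> T"
    proof -
      obtain K where K: "K \<ge> 0" "op_bound T K" using T Mb by (meson bounded_ops_bound subsetD)
      have "(\<lambda>m. (1/2) ^ m * K) \<longlonglongrightarrow> 0"
        by (intro tendsto_mult_left_zero LIMSEQ_power_zero) simp
      then have "(\<lambda>m. \<psi> m T - \<phi> T) \<longlonglongrightarrow> 0"
        by (rule Lim_null_comparison[rotated]) (use \<psi>(2)[OF T K] in \<open>simp add: norm_minus_commute\<close>)
      then show ?thesis by (simp add: LIM_zero_iff)
    qed
    then have "(\<lambda>m. \<Sum>n<Suc m. \<delta> n T) \<longlonglongrightarrow> \<phi> T" by (simp only: part)
    then show ?thesis unfolding sums_def by (rule LIMSEQ_imp_Suc)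
  qed
  show ?thesis using normal_on_sums[OF Mb n cs s] by blast
qed

section \<open>Commutants and amplifications\<close>

lemma commutantI: "T \<in> \<B> ==> (\<And>S x. S \<in> C ==> T (S x) = S (T x)) ==> T \<in> commutant C"
  by (auto simp: commutant_def fun_eq_iff)

lemma commutantD: "T \<in> commutant C ==> S \<in> C ==> T (S x) = S (T x)"
  by (auto simp: commutant_def fun_eq_iff)

lemma commutantD_bounded: "T \<in> commutant C ==> T \<in> \<B>"
  by (auto simp: commutant_def)

lemma op_subspace_commutant:
  assumes C: "C \<subseteq> \<B>" shows "op_subspace (commutant C)"
proof -
  have C': "S (x + y) = S x + S y" "S (c *\<^sub>C x) = c *\<^sub>C S x" "S 0 = 0" if "S \<in> C" for S x y c
    using subsetD[OF C that] by (simp_all add: bounded_ops_simps)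
  have "(\<lambda>u. S u + T u) \<in> commutant C" if "S \<in> commutant C" "T \<in> commutant C" for S T
  proof (rule commutantI)
    show "S (R x) + T (R x) = R (S x + T x)" if "R \<in> C" for R x
      using that by (simp add: C' commutantD[OF \<open>S \<in> commutant C\<close>] commutantD[OF \<open>T \<in> commutant C\<close>])
  qed (use that in \<open>simp add: bounded_ops_add commutantD_bounded\<close>)
  moreover have "(\<lambda>u. c *\<^sub>C T u) \<in> commutant C" if "T \<in> commutant C" for c T
  proof (rule commutantI)
    show "c *\<^sub>C T (R x) = R (c *\<^sub>C T x)" if "R \<in> C" for R x
      using that by (simp add: C' commutantD[OF \<open>T \<in> commutant C\<close>])
  qed (use that in \<open>simp add: bounded_ops_scaleC commutantD_bounded\<close>)
  moreover have "(\<lambda>u. 0) \<in> commutant C"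
    by (rule commutantI) (simp_all add: bounded_ops_zero C')
  ultimately show ?thesis
    unfolding op_subspace_def using commutant_bounded by blast
qed

lemma commutant_compose: "S \<in> commutant C ==> T \<in> commutant C ==> S \<circ> T \<in> commutant C"
  by (auto intro!: commutantI bounded_ops_compose simp: commutantD commutantD_bounded)

lemma commutant_adj:
  assumes C: "C \<subseteq> \<B>" "\<And>S. S \<in> C ==> adj S \<in> C" and T: "T \<in> commutant C"
  shows "adj T \<in> commutant C"
proof (rule commutantI)
  have Tb: "T \<in> \<B>" using T by (rule commutantD_bounded)
  then show "adj T \<in> \<B>" by simp
  fix S x assume S: "S \<in> C"
  then have Sb: "S \<in> \<B>" using C by blast
  show "adj T (S x) = S (adj T x)"
  proof (rule cinner_eqI)
    fix z
    have "cinner z (adj T (S x)) = cinner (adj S (T z)) x" using Sb Tb by (simp add: adj_cinner)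
    also have "\<dots> = cinner (T (adj S z)) x" by (simp only: commutantD[OF T C(2)[OF S]])
    also have "\<dots> = cinner (adj S z) (adj T x)" using Tb by (simp only: adj_cinner(2))
    also have "\<dots> = cinner z (S (adj T x))" using Sb by (simp only: adj_cinner(1))
    finally show "cinner z (adj T (S x)) = cinner z (S (adj T x))" .
  qed
qed

text \<open>Commutation with \<open>R\<close> is the vanishing of all functionals
  \<open>cinner x (T (R y)) - cinner (adj R x) (T y)\<close> of \<open>T\<close>, and these are
  ultraweakly continuous.\<close>

lemma ultraweak_closure_commutant:
  assumes C: "C \<subseteq> \<B>" and S: "S \<subseteq> commutant C" and T: "T \<in> ultraweak closure_of S"
  shows "T \<in> commutant C"
proof (rule commutantI)
  show "T \<in> \<B>" using T by (simp add: in_closure_of topspace_ultraweak)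
  fix R y assume R: "R \<in> C"
  then have Rb: "R \<in> \<B>" using C by blast
  show "T (R y) = R (T y)"
  proof (rule cinner_eqI)
    fix x
    have n: "normal_on \<B> (\<lambda>T. cinner x (T (R y)) + (-1) * cinner (adj R x) (T y))
        (norm x * norm (R y) + cmod (-1) * (norm (adj R x) * norm y))"
      by (intro normal_on_add normal_on_scale normal_on_cinner order_refl)
    have "cinner x (T (R y)) + (-1) * cinner (adj R x) (T y) = 0"
    proof (rule ultraweak_closure_normal[OF T _ n])
      show "S \<subseteq> \<B>" using S commutant_bounded by blast
      fix Q assume "Q \<in> S"
      then have "Q (R y) = R (Q y)" using S R by (intro commutantD) auto
      then show "cinner x (Q (R y)) + (-1) * cinner (adj R x) (Q y) = 0" using Rb by (simp add: adj_cinner)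
    qed
    then show "cinner x (T (R y)) = cinner x (R (T y))" using Rb by (simp add: adj_cinner)
  qed
qed

lemma op_span_add: "S \<in> op_span X ==> T \<in> op_span X ==> (\<lambda>u. S u + T u) \<in> op_span X"
proof -
  assume "S \<in> op_span X" "T \<in> op_span X"
  then obtain m n and c d :: "nat => complex" and a b where
    "S = (\<lambda>u. \<Sum>i<m. c i *\<^sub>C a i u)" "\<forall>i<m. a i \<in> X" "T = (\<lambda>u. \<Sum>i<n. d i *\<^sub>C b i u)" "\<forall>i<n. b i \<in> X"
    unfolding op_span_def by blast
  then show ?thesis
    unfolding op_span_def
    by (intro CollectI exI[of _ "m + n"] exI[of _ "\<lambda>i. if i < m then c i else d (i - m)"]
        exI[of _ "\<lambda>i. if i < m then a i else b (i - m)"]) (auto simp: sum_append intro!: sum.cong ext)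
qed

lemma op_span_zero: "(\<lambda>u. 0) \<in> op_span X"
  unfolding op_span_def by (auto intro!: exI[of _ "0::nat"])

lemma op_span_scale: "T \<in> X ==> (\<lambda>u. c *\<^sub>C T u) \<in> op_span X"
  unfolding op_span_def by (rule CollectI, rule exI[of _ "1::nat"], rule exI[of _ "\<lambda>_. c"], rule exI[of _ "\<lambda>_. T"]) simp

lemma op_span_sum: "(\<And>i. i \<in> I ==> T i \<in> op_span X) ==> (\<lambda>u. \<Sum>i\<in>I. T i u) \<in> op_span X"
  by (induction I rule: infinite_finite_induct) (auto intro: op_span_zero op_span_add)

lemma op_span_minimal: "op_subspace M ==> X \<subseteq> M ==> op_span X \<subseteq> M"
proof
  fix T assume M: "op_subspace M" "X \<subseteq> M" "T \<in> op_span X"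
  then obtain m and c :: "nat => complex" and a where T: "T = (\<lambda>u. \<Sum>i<m. c i *\<^sub>C a i u)" "\<forall>i<m. a i \<in> X"
    unfolding op_span_def by blast
  have "k \<le> m ==> (\<lambda>u. \<Sum>i<k. c i *\<^sub>C a i u) \<in> M" for k
  proof (induction k)
    case 0 then show ?case using M(1) by (simp add: op_subspace_def)
  next
    case (Suc k)
    have "a k \<in> M" using Suc T M by auto
    then show ?case using Suc M(1) by (simp add: op_subspace_def)
  qed
  then show "T \<in> M" using T by simp
qed

lemma vna_commutant:
  assumes "von_neumann_algebra A"
  shows "A \<subseteq> \<B>" "commutant A \<subseteq> \<B>" "A = commutant (commutant A)"
    "op_subspace A" "id \<in> A" "a \<in> A ==> b \<in> A ==> a \<circ> b \<in> A" "a \<in> A ==> adj a \<in> A"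
    "a' \<in> commutant A ==> adj a' \<in> commutant A"
proof -
  show 1: "A \<subseteq> \<B>" "commutant A \<subseteq> \<B>" "A = commutant (commutant A)"
    using assms commutant_bounded by (auto simp: von_neumann_algebra_def)
  show "op_subspace A" using op_subspace_commutant[OF 1(2)] 1(3) by simp
  show "id \<in> A" by (subst 1(3)) (auto intro!: commutantI)
  show "a \<in> A ==> b \<in> A ==> a \<circ> b \<in> A" using commutant_compose 1(3) by metis
  show *: "a \<in> A ==> adj a \<in> A" for a using assms by (auto simp: von_neumann_algebra_def)
  show "a' \<in> commutant A ==> adj a' \<in> commutant A" using commutant_adj[OF 1(1) *] .
qed

text \<open>The commutant of \<open>I \<otimes> a'\<close>, for \<open>a'\<close> in the commutant
  of \<open>A\<close>. It turns membership into commutation; \<open>uw_tensor_eq\<close> identifies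
  it with the ultraweak tensor product of \<open>B(K)\<close> and \<open>A\<close>.\<close>

definition amp_commutant :: "('h::chilbert_space => 'h) set => (('c::chilbert_space, 'h) htensor => ('c, 'h) htensor) set"
  where "amp_commutant A = commutant (tensor_op id ` commutant A)"

lemma amp_bounded: "tensor_op id ` commutant A \<subseteq> \<B>"
  by (auto simp: tensor_op commutantD_bounded)

lemma op_subspace_amp: "op_subspace (amp_commutant A)"
  unfolding amp_commutant_def by (rule op_subspace_commutant[OF amp_bounded])

lemma amp_commutant_bounded: "F \<in> amp_commutant A ==> F \<in> \<B>"
  unfolding amp_commutant_def by (rule commutantD_bounded)

lemma amp_commutant_adj: "von_neumann_algebra A ==> F \<in> amp_commutant A ==> adj F \<in> amp_commutant A"
  unfolding amp_commutant_def
proof (rule commutant_adj[OF amp_bounded])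
  fix S assume A: "von_neumann_algebra A" and "S \<in> tensor_op id ` commutant A"
  then obtain a' where a': "a' \<in> commutant A" "S = tensor_op id a'" by blast
  then show "adj S \<in> tensor_op id ` commutant A"
    using vna_commutant(8)[OF A] by (simp add: adj_tensor_op commutantD_bounded)
qed

lemma amp_commutant_compose: "F \<in> amp_commutant A ==> G \<in> amp_commutant A ==> F \<circ> G \<in> amp_commutant A"
  unfolding amp_commutant_def by (rule commutant_compose)

lemma elementary_in_amp:
  fixes z :: "'c::chilbert_space => 'c"
  assumes A: "von_neumann_algebra A" and "z \<in> \<B>" "a \<in> A"
  shows "tensor_op z a \<in> amp_commutant A"
  unfolding amp_commutant_def
proof (rule commutantI)
  have ab: "a \<in> \<B>" using assms vna_commutant(1)[OF A] by blast
  then show "tensor_op z a \<in> \<B>" using assms by (simp add: tensor_op)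
  fix S :: "('c, 'a) htensor => ('c, 'a) htensor" and x assume "S \<in> tensor_op id ` commutant A"
  then obtain a' where a': "a' \<in> commutant A" "S = tensor_op id a'" by blast
  then have "a \<circ> a' = a' \<circ> a" using commutantD[OF a'(1) assms(3)] by auto
  then have "tensor_op z a \<circ> S = S \<circ> tensor_op z a"
    using a' assms ab by (simp add: tensor_op_compose commutantD_bounded)
  then show "tensor_op z a (S x) = S (tensor_op z a x)" by (metis comp_apply)
qed

definition slice :: "'c::chilbert_space => (('c, 'h::chilbert_space) htensor => ('c, 'h) htensor) => 'c => 'h => 'h"
  where "slice x F y = lbra x \<circ> F \<circ> lket y"

lemma slice_cinner: "cinner u (slice x F y v) = cinner (tensor x u) (F (tensor y v))"
  by (simp add: slice_def lbra_cinner) (simp add: lket_def)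

text \<open>A slice commutes with every \<open>a'\<close> in the commutant since \<open>F\<close>
  commutes with \<open>I \<otimes> a'\<close>, and the algebra is its own bicommutant.\<close>

lemma slice_in:
  assumes A: "von_neumann_algebra A" and F: "F \<in> amp_commutant A" shows "slice x F y \<in> A"
proof -
  have Fb: "F \<in> \<B>" using F by (rule amp_commutant_bounded)
  have "slice x F y \<in> commutant (commutant A)"
  proof (rule commutantI)
    show "slice x F y \<in> \<B>" unfolding slice_def using Fb by (intro bounded_ops_compose) auto
    fix a' v assume a': "a' \<in> commutant A"
    then have b: "a' \<in> \<B>" by (rule commutantD_bounded)
    have c: "F (tensor_op id a' \<xi>) = tensor_op id a' (F \<xi>)" for \<xi>
      by (rule commutantD[OF F[unfolded amp_commutant_def]]) (use a' in blast)
    show "slice x F y (a' v) = a' (slice x F y v)"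
    proof (rule cinner_eqI)
      fix u
      have "cinner u (slice x F y (a' v)) = cinner (tensor x u) (F (tensor_op id a' (tensor y v)))"
        using b by (simp add: slice_cinner tensor_op)
      also have "\<dots> = cinner (adj (tensor_op id a') (tensor x u)) (F (tensor y v))"
        unfolding c using b by (simp add: adj_cinner tensor_op(1))
      also have "\<dots> = cinner u (a' (slice x F y v))"
        using b by (simp add: adj_tensor_op tensor_op slice_cinner[symmetric] adj_cinner)
      finally show "cinner u (slice x F y (a' v)) = cinner u (a' (slice x F y v))" .
    qed
  qed
  then show ?thesis using vna_commutant(3)[OF A] by simp
qed

lemma cinner_onb: "e \<in> onb ==> e' \<in> onb ==> cinner e e' = (if e = e' then 1 else 0)"
  using onb(1) unfolding orthonormal_def by blast

definition onb_proj :: "'c::chilbert_space set => 'c => 'c"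
  where "onb_proj J x = (\<Sum>e\<in>J \<inter> onb. cinner e x *\<^sub>C e)"

lemma onb_proj_basis: assumes "finite J" "e \<in> J \<inter> onb" shows "onb_proj J e = e"
proof -
  have "onb_proj J e = (\<Sum>e'\<in>J \<inter> onb. if e' = e then e else 0)"
    unfolding onb_proj_def by (rule sum.cong) (use assms in \<open>auto simp: cinner_onb\<close>)
  then show ?thesis using assms by simp
qed

lemma onb_proj: "onb_proj J \<in> \<B>" "op_bound (onb_proj J) 1"
proof -
  have "norm (onb_proj J x) \<le> 1 * norm x" for x
  proof (cases "finite (J \<inter> onb)")
    case True
    have pe: "cinner e (onb_proj J x) = cinner e x" if "e \<in> J \<inter> onb" for e
    proof -
      have "cinner e (onb_proj J x) = (\<Sum>e'\<in>J \<inter> onb. if e' = e then cinner e x else 0)"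
        unfolding onb_proj_def cinner_sum_right cinner_scaleC_right
        by (rule sum.cong) (use that in \<open>auto simp: cinner_onb\<close>)
      then show ?thesis using True that by simp
    qed
    have *: "cinner (onb_proj J x) y = (\<Sum>e\<in>J \<inter> onb. cnj (cinner e x) * cinner e y)" for y
      unfolding onb_proj_def cinner_sum_left cinner_scaleC_left ..
    have "cinner (onb_proj J x) (onb_proj J x) = cinner (onb_proj J x) x" unfolding * by (simp add: pe)
    then have "(norm (onb_proj J x))\<^sup>2 \<le> norm (onb_proj J x) * norm x"
      unfolding norm2_cinner by (simp add: order_trans[OF complex_Re_le_cmod norm_cinner_le])
    then show ?thesis by (cases "norm (onb_proj J x) = 0") (simp_all add: power2_eq_square)
  qed (simp add: onb_proj_def)
  then show 1: "op_bound (onb_proj J) 1" by (simp add: op_bound_def)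
  show "onb_proj J \<in> \<B>"
    by (rule bounded_opsI[OF _ _ 1]) (simp_all add: onb_proj_def cinner_add_right scaleC_add_left sum.distrib cinner_scaleC_right scaleC_scaleC[symmetric] scaleC_sum_right)
qed

lemma onb_proj_eventually: "e \<in> onb ==> \<forall>\<^sub>F J in finite_subsets_at_top onb. onb_proj J e = e"
  unfolding eventually_finite_subsets_at_top by (intro exI[of _ "{e}"]) (auto intro: onb_proj_basis)

lemma op_bound_id: "op_bound id 1" by (simp add: op_bound_def)

definition coord_proj :: "'c::chilbert_space set => ('c, 'h::chilbert_space) htensor => ('c, 'h) htensor"
  where "coord_proj J \<xi> = (\<Sum>e\<in>J \<inter> onb. tensor e (lbra e \<xi>))"

lemma coord_proj_eq: "coord_proj J = tensor_op (onb_proj J) id"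
proof (rule bounded_ops_eq_tensorI)
  have "(\<lambda>\<xi>. \<Sum>e\<in>J \<inter> onb. (lket e \<circ> lbra e) \<xi>) \<in> \<B>"
    by (intro bounded_ops_sum bounded_ops_compose lket_bounded lbra_bounded)
  then show "coord_proj J \<in> \<B>" by (simp add: coord_proj_def[abs_def] lket_def)
qed (simp_all add: tensor_op onb_proj onb_proj_def coord_proj_def lbra_tensor tensor_sum_left tensor_scaleC_left tensor_scaleC_right)

lemma coord_proj_op: "coord_proj J \<in> \<B>" "op_bound (coord_proj J) 1"
  unfolding coord_proj_eq
  using tensor_op(1)[OF onb_proj(1) bounded_ops_id(1)] tensor_op(3)[OF onb_proj(1) bounded_ops_id(1) onb_proj(2) op_bound_id] by auto

lemma coord_proj_norm: "norm (coord_proj J \<xi>) \<le> norm \<xi>"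
  by (rule order_trans[OF coord_proj_op(2)[unfolded op_bound_def, rule_format]]) simp

text \<open>The net of finite subsets of \<open>onb\<close> stands in for a sequence because the
  basis may be uncountable. On \<open>tensor e v\<close> with \<open>e\<close> in the basis the net
  is eventually constant.\<close>

lemma coord_proj_tendsto: "((\<lambda>J. coord_proj J \<xi>) \<longlongrightarrow> \<xi>) (finite_subsets_at_top onb)"
proof (rule tendsto_bounded_ops_total[where S = "\<lambda>\<xi>. \<xi>", OF coord_proj_op bounded_ops_id(2) ctotal_tensor[OF ctotal_onb ctotal_UNIV]])
  fix b :: "('a, 'b) htensor" assume "b \<in> {tensor b c |b c. b \<in> onb \<and> c \<in> UNIV}"
  then obtain e v where b: "b = tensor e v" "e \<in> onb" by blast
  have "\<forall>\<^sub>F J in finite_subsets_at_top onb. coord_proj J b = b"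
    using onb_proj_eventually[OF b(2)] by eventually_elim (simp add: coord_proj_eq b tensor_op onb_proj)
  then show "((\<lambda>J. coord_proj J b) \<longlongrightarrow> b) (finite_subsets_at_top onb)" by (rule tendsto_eventually)
qed

definition rank_one :: "'c::chilbert_space => 'c => 'c => 'c" where "rank_one x y z = cinner y z *\<^sub>C x"

lemma rank_one_bounded [simp]: "rank_one x y \<in> \<B>"
proof (rule bounded_opsI[of _ "norm y * norm x"])
  show "op_bound (rank_one x y) (norm y * norm x)"
    unfolding op_bound_def rank_one_def norm_scaleC
  proof
    fix z
    have "cmod (cinner y z) * norm x \<le> (norm y * norm z) * norm x" by (intro mult_right_mono norm_cinner_le) auto
    then show "cmod (cinner y z) * norm x \<le> norm y * norm x * norm z" by (simp add: mult_ac)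
  qed
qed (auto simp: rank_one_def cinner_add_right scaleC_add_left cinner_scaleC_right scaleC_scaleC)

lemma rank_one_tensor:
  assumes "a \<in> \<B>" shows "tensor_op (rank_one e e') a \<xi> = tensor e (a (lbra e' \<xi>))"
proof -
  have "tensor_op (rank_one e e') a = lket e \<circ> a \<circ> lbra e'"
    by (rule bounded_ops_eq_tensorI)
      (use assms in \<open>auto simp: tensor_op intro!: bounded_ops_compose\<close>,
       simp add: rank_one_def lbra_tensor lket_def bounded_ops_simps tensor_scaleC_left tensor_scaleC_right)
  then show ?thesis by (simp add: lket_def)
qed

text \<open>A finite corner of \<open>F\<close> is a finite sum of matrix units tensored with slices
  of \<open>F\<close>, thus a combination of elementary tensors.\<close>

lemma coord_proj_compress:
  assumes F: "F \<in> \<B>"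
  shows "coord_proj J (F (coord_proj J \<xi>)) = (\<Sum>e\<in>J \<inter> onb. \<Sum>e'\<in>J \<inter> onb. tensor_op (rank_one e e') (slice e F e') \<xi>)"
proof -
  have b: "slice e F e' \<in> \<B>" for e e'
    unfolding slice_def using F by (intro bounded_ops_compose) auto
  show ?thesis
    unfolding rank_one_tensor[OF b] coord_proj_def
    by (simp add: bounded_ops_simps[OF F] bounded_ops_simps[OF lbra_bounded] tensor_sum_right slice_def lket_def)
qed

text \<open>The closure of the span of the elementary tensors stays inside the commutant, which is
  ultraweakly closed. Conversely, compressions of \<open>F\<close> to finite corners are
  combinations of elementary tensors with entries in \<open>A\<close>, and they converge to
  \<open>F\<close> strongly and boundedly.\<close>

lemma uw_tensor_eq:
  fixes A :: "('h::chilbert_space => 'h) set"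
  assumes A: "von_neumann_algebra A"
  shows "uw_tensor \<B> A = (amp_commutant A :: (('c::chilbert_space, 'h) htensor => ('c, 'h) htensor) set)"
proof
  have el: "{tensor_op (S :: 'c => 'c) T |S T. S \<in> \<B> \<and> T \<in> A} \<subseteq> amp_commutant A"
    using elementary_in_amp[OF A] by blast
  show "uw_tensor \<B> A \<subseteq> (amp_commutant A :: (('c, 'h) htensor => ('c, 'h) htensor) set)"
    unfolding uw_tensor_def
    using ultraweak_closure_commutant[OF amp_bounded] op_span_minimal[OF op_subspace_amp el]
    unfolding amp_commutant_def by blast
  show "(amp_commutant A :: (('c, 'h) htensor => ('c, 'h) htensor) set) \<subseteq> uw_tensor \<B> A"
  proof
    fix F :: "('c, 'h) htensor => ('c, 'h) htensor" assume F: "F \<in> amp_commutant A"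
    then have Fb: "F \<in> \<B>" by (rule amp_commutant_bounded)
    obtain K where K: "K \<ge> 0" "op_bound F K" using Fb by (rule bounded_ops_bound)
    let ?T = "\<lambda>J. coord_proj J \<circ> F \<circ> coord_proj J"
    show "F \<in> uw_tensor \<B> A"
      unfolding uw_tensor_def
    proof (rule in_ultraweak_closure[where T = ?T and \<F> = "finite_subsets_at_top onb"])
      show "?T J \<in> \<B>" for J using Fb by (intro bounded_ops_compose coord_proj_op)
      show "op_bound (?T J) K" for J unfolding op_bound_def
      proof
        fix x
        have "norm (?T J x) \<le> norm (F (coord_proj J x))" by (simp add: coord_proj_norm)
        also have "\<dots> \<le> K * norm (coord_proj J x)" using K by (simp add: op_bound_def)
        also have "\<dots> \<le> K * norm x" using K by (intro mult_left_mono coord_proj_norm)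
        finally show "norm (?T J x) \<le> K * norm x" .
      qed
      show "((\<lambda>J. ?T J x) \<longlongrightarrow> F x) (finite_subsets_at_top onb)" for x
      proof -
        have 1: "((\<lambda>J. F (coord_proj J x)) \<longlongrightarrow> F x) (finite_subsets_at_top onb)"
          by (rule bounded_ops_tendsto[OF Fb coord_proj_tendsto])
        have "((\<lambda>J. coord_proj J (F (coord_proj J x)) - coord_proj J (F x)) \<longlongrightarrow> 0) (finite_subsets_at_top onb)"
        proof (rule Lim_null_comparison[where g = "\<lambda>J. norm (F (coord_proj J x) - F x)"])
          show "\<forall>\<^sub>F J in finite_subsets_at_top onb. norm (coord_proj J (F (coord_proj J x)) - coord_proj J (F x))
              \<le> norm (F (coord_proj J x) - F x)"
            by (intro always_eventually allI) (simp add: coord_proj_norm flip: bounded_ops_simps(4)[OF coord_proj_op(1)])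
          show "((\<lambda>J. norm (F (coord_proj J x) - F x)) \<longlongrightarrow> 0) (finite_subsets_at_top onb)"
            using 1 by (simp add: tendsto_norm_zero_iff LIM_zero_iff)
        qed
        from tendsto_add[OF this coord_proj_tendsto[of "F x"]] show ?thesis by simp
      qed
      show "\<forall>\<^sub>F J in finite_subsets_at_top onb. ?T J \<in> op_span {tensor_op S T |S T. S \<in> \<B> \<and> T \<in> A}"
      proof (intro always_eventually allI)
        fix J
        have "?T J = (\<lambda>\<xi>. \<Sum>e\<in>J \<inter> onb. \<Sum>e'\<in>J \<inter> onb. tensor_op (rank_one e e') (slice e F e') \<xi>)"
          by (rule ext) (simp add: coord_proj_compress[OF Fb])
        moreover have "(\<lambda>\<xi>. 1 *\<^sub>C tensor_op (rank_one e e') (slice e F e') \<xi>) \<in> op_span {tensor_op S T |S T. S \<in> \<B> \<and> T \<in> A}" for e e'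
          by (rule op_span_scale) (use slice_in[OF A F] rank_one_bounded in blast)
        ultimately show "?T J \<in> op_span {tensor_op S T |S T. S \<in> \<B> \<and> T \<in> A}"
          by (simp add: op_span_sum)
      qed
    qed (use K Fb in auto)
  qed
qed

section \<open>The ampliation of a normal completely bounded map\<close>

lemma sum_sq_Rep_le: "finite J ==> (\<Sum>e\<in>J. (norm (Rep_htensor \<zeta> e))\<^sup>2) \<le> (norm \<zeta>)\<^sup>2"
proof -
  assume J: "finite J"
  have "(\<Sum>e\<in>J. (norm (Rep_htensor \<zeta> e))\<^sup>2) \<le> (\<Sum>\<^sub>\<infinity>e. (norm (Rep_htensor \<zeta> e))\<^sup>2)"
    using J htensor_Rep(1)[of \<zeta>] by (intro finite_sum_le_infsum) (auto simp: sq_summable_def)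
  then show ?thesis by (simp add: norm2_cinner[of \<zeta>] cinner_htensor.rep_eq Re_l2_cinner htensor_Rep)
qed

lemma norm_sq_le_sums:
  assumes "\<And>J. finite J ==> J \<subseteq> onb ==> (\<Sum>e\<in>J. (norm (Rep_htensor \<zeta> e))\<^sup>2) \<le> B"
  shows "(norm \<zeta>)\<^sup>2 \<le> B"
proof -
  have "(\<Sum>e\<in>J. (norm (Rep_htensor \<zeta> e))\<^sup>2) \<le> B" if J: "finite J" for J
  proof -
    have "(\<Sum>e\<in>J. (norm (Rep_htensor \<zeta> e))\<^sup>2) = (\<Sum>e\<in>J \<inter> onb. (norm (Rep_htensor \<zeta> e))\<^sup>2)"
      by (rule sum.mono_neutral_right) (use J in \<open>auto simp: htensor_Rep\<close>)
    then show ?thesis using assms[of "J \<inter> onb"] J by simp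
  qed
  then have "(\<Sum>\<^sub>\<infinity>e. (norm (Rep_htensor \<zeta> e))\<^sup>2) \<le> B"
    using htensor_Rep(1)[of \<zeta>] by (intro infsum_le_finite_sums) (auto simp: sq_summable_def)
  then show ?thesis by (simp add: norm2_cinner[of \<zeta>] cinner_htensor.rep_eq Re_l2_cinner htensor_Rep)
qed

lemma htensor_of_coords:
  fixes f :: "'c::chilbert_space => 'b::chilbert_space"
  assumes "\<And>J. finite J ==> J \<subseteq> onb ==> (\<Sum>e\<in>J. (norm (f e))\<^sup>2) \<le> B"
  shows "\<exists>\<zeta>. \<forall>e\<in>onb. Rep_htensor \<zeta> e = f e"
proof -
  define g where "g e = (if e \<in> onb then f e else 0)" for e
  have "(\<Sum>e\<in>J. (norm (g e))\<^sup>2) \<le> B" if J: "finite J" for J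
  proof -
    have "(\<Sum>e\<in>J. (norm (g e))\<^sup>2) = (\<Sum>e\<in>J \<inter> onb. (norm (f e))\<^sup>2)"
      by (rule sum.mono_neutral_cong_right) (use J in \<open>auto simp: g_def\<close>)
    then show ?thesis using assms[of "J \<inter> onb"] J by simp
  qed
  then have "sq_summable g" unfolding sq_summable_def
    by (intro nonneg_bdd_above_summable_on) (auto intro!: bdd_aboveI[where M = B])
  then have "Rep_htensor (Abs_htensor g) = g" by (intro Abs_htensor_inverse) (auto simp: g_def)
  then show ?thesis by (intro exI[of _ "Abs_htensor g"]) (auto simp: g_def)
qed

lemma norm_sum_onb:
  assumes "finite J" "J \<subseteq> onb"
  shows "(norm (\<Sum>e\<in>J. tensor e (x e)))\<^sup>2 = (\<Sum>e\<in>J. (norm (x e))\<^sup>2)"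
proof -
  have "complex_of_real ((norm (\<Sum>e\<in>J. tensor e (x e)))\<^sup>2) = (\<Sum>e\<in>J. \<Sum>e'\<in>J. if e = e' then cinner (x e) (x e') else 0)"
    unfolding norm_sum_sq cinner_tensor using assms(2) by (intro sum.cong refl) (auto simp: cinner_onb subsetD)
  also have "\<dots> = complex_of_real (\<Sum>e\<in>J. (norm (x e))\<^sup>2)"
    using assms(1) by (simp add: cinner_self)
  finally show ?thesis by (simp only: of_real_eq_iff)
qed

lemma ctotal_onb_tensor: "ctotal ((\<lambda>(e, v). tensor e v) ` (onb \<times> UNIV))"
  using ctotal_tensor[OF ctotal_onb ctotal_UNIV] by (rule back_subst[of ctotal]) auto

lemma bounded_ops_eq_onbI:
  assumes "S \<in> \<B>" "T \<in> \<B>"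
    and "\<And>e e' u v. e \<in> onb ==> e' \<in> onb ==> cinner (tensor e u) (S (tensor e' v)) = cinner (tensor e u) (T (tensor e' v))"
  shows "S = T"
proof (rule bounded_ops_eqI[OF assms(1,2) ctotal_onb_tensor])
  fix b :: "('a, 'b) htensor" assume "b \<in> (\<lambda>(e, v). tensor e v) ` (onb \<times> UNIV)"
  then obtain e' v where b: "b = tensor e' v" "e' \<in> onb" by auto
  show "S b = T b"
    by (rule ctotalD[OF ctotal_onb_tensor]) (use assms(3) b in auto)
qed

lemma sq_summable_tensor: "sq_summable \<zeta> ==> sq_summable (\<lambda>n. tensor w (\<zeta> n))" for \<zeta> :: "nat => 'b::chilbert_space"
  unfolding sq_summable_nat norm_tensor power_mult_distrib by (rule summable_mult)

lemma normal_on_slice: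
  assumes "normal_on A \<phi> c" "\<And>F. F \<in> M ==> slice x F y \<in> A"
  shows "\<exists>c. normal_on M (\<lambda>F. \<phi> (slice x F y)) c"
proof -
  obtain \<xi> \<eta> where *: "sq_summable \<xi>" "sq_summable \<eta>" "\<And>T. T \<in> A ==> \<phi> T = uw_fun \<xi> \<eta> T"
    using assms(1) unfolding normal_on_def by blast
  have "\<phi> (slice x F y) = uw_fun (\<lambda>n. tensor x (\<xi> n)) (\<lambda>n. tensor y (\<eta> n)) F" if "F \<in> M" for F
    using assms(2)[OF that] by (simp add: * uw_fun_def slice_cinner)
  then show ?thesis
    unfolding normal_on_def using sq_summable_tensor[OF *(1), of x] sq_summable_tensor[OF *(2), of y]
    by (intro exI[of _ "max (l2_size (\<lambda>n. tensor x (\<xi> n))) (l2_size (\<lambda>n. tensor y (\<eta> n)))"]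
        exI[of _ "\<lambda>n. tensor x (\<xi> n)"] exI[of _ "\<lambda>n. tensor y (\<eta> n)"]) auto
qed

context
  fixes A :: "('h::chilbert_space => 'h) set" and \<Phi> :: "('h => 'h) => ('b::chilbert_space => 'b)" and C :: real
  assumes A: "von_neumann_algebra A" and normal: "normal_map A \<Phi>"
    and C: "C \<ge> 0" and cb: "\<forall>n a. \<forall>K\<ge>0. (\<forall>i<n. \<forall>j<n. a i j \<in> A) --> matrix_bound n a K -->
      matrix_bound n (\<lambda>i j. \<Phi> (a i j)) (C * K)"
begin

lemma map_lin:
  "S \<in> A ==> T \<in> A ==> \<Phi> (\<lambda>u. S u + T u) = (\<lambda>v. \<Phi> S v + \<Phi> T v)"
  "T \<in> A ==> \<Phi> (\<lambda>u. c *\<^sub>C T u) = (\<lambda>v. c *\<^sub>C \<Phi> T v)"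
  using normal by (auto simp: normal_map_def op_linear_on_def)

lemma map_bounded: "a \<in> A ==> \<Phi> a \<in> \<B>"
  using continuous_map_image_subset_topspace[of "subtopology ultraweak A" ultraweak \<Phi>] normal vna_commutant(1)[OF A]
  by (auto simp: normal_map_def topspace_ultraweak)

lemma map_normal: "\<exists>c. normal_on A (\<lambda>a. cinner x (\<Phi> a y)) c"
  by (rule normal_map_cinner[OF vna_commutant(4)[OF A] normal])

text \<open>The slices of \<open>F\<close> over a finite part of the basis form an operator matrix
  of norm at most \<open>K\<close>, being a corner of \<open>F\<close>; complete boundedness
  transfers the bound to their images.\<close>

lemma map_slice_bound:
  assumes F: "F \<in> amp_commutant A" "op_bound F K" "K \<ge> 0" and J: "finite J" "J \<subseteq> onb"
  shows "(\<Sum>e\<in>J. (norm (\<Sum>e'\<in>J. \<Phi> (slice e F e') (x e')))\<^sup>2) \<le> (C * K)\<^sup>2 * (\<Sum>e\<in>J. (norm (x e))\<^sup>2)"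
proof -
  \<comment> \<open>An enumeration of \<open>J\<close>, because operator matrices are indexed by
    natural numbers.\<close>
  obtain h where h: "bij_betw h {..<card J} J"
    using ex_bij_betw_nat_finite[OF J(1)] by (auto simp: atLeast0LessThan)
  have hJ: "h i \<in> J" if "i < card J" for i using h that by (auto simp: bij_betw_def)
  have Fb: "F \<in> \<B>" using F(1) by (rule amp_commutant_bounded)
  let ?n = "card J" and ?a = "\<lambda>i j. slice (h i) F (h j)"
  have "matrix_bound ?n ?a K"
    unfolding matrix_bound_def
  proof
    fix y :: "nat => 'h"
    define g where "g = (\<lambda>e. y (the_inv_into {..<?n} h e))"
    have g: "g (h i) = y i" if "i < ?n" for i
      using that h by (simp add: g_def the_inv_into_f_f bij_betw_def)
    let ?v = "\<Sum>e\<in>J. tensor e (g e)"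
    have "slice e F e' v = Rep_htensor (F (tensor e' v)) e" if "e \<in> J" for e e' v
      using that J(2) by (auto simp: slice_def lket_def lbra_onb)
    then have "(\<Sum>i<?n. (norm (\<Sum>j<?n. ?a i j (y j)))\<^sup>2) = (\<Sum>e\<in>J. (norm (\<Sum>e'\<in>J. lbra e (F (tensor e' (g e')))))\<^sup>2)"
    proof -
      have "(\<Sum>j<?n. ?a i j (y j)) = (\<Sum>e'\<in>J. slice (h i) F e' (g e'))" for i
        unfolding sum.reindex_bij_betw[OF h, of "\<lambda>e'. slice (h i) F e' (g e')", symmetric]
        by (intro sum.cong) (auto simp: g)
      then show ?thesis
        using sum.reindex_bij_betw[OF h, of "\<lambda>e. (norm (\<Sum>e'\<in>J. slice e F e' (g e')))\<^sup>2"]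
        by (simp add: slice_def lket_def)
    qed
    also have "\<dots> = (\<Sum>e\<in>J. (norm (Rep_htensor (F ?v) e))\<^sup>2)"
      using J(2) by (intro sum.cong refl) (simp add: bounded_ops_simps[OF Fb] bounded_ops_simps[OF lbra_bounded] lbra_onb[symmetric] subsetD)
    also have "\<dots> \<le> (norm (F ?v))\<^sup>2" by (rule sum_sq_Rep_le[OF J(1)])
    also have "\<dots> \<le> (K * norm ?v)\<^sup>2" using F(2) by (intro power_mono) (auto simp: op_bound_def)
    also have "\<dots> = K\<^sup>2 * (\<Sum>j<?n. (norm (y j))\<^sup>2)"
      using sum.reindex_bij_betw[OF h, of "\<lambda>e. (norm (g e))\<^sup>2"]
      by (simp add: power_mult_distrib norm_sum_onb[OF J] g)
    finally show "(\<Sum>i<?n. (norm (\<Sum>j<?n. ?a i j (y j)))\<^sup>2) \<le> K\<^sup>2 * (\<Sum>j<?n. (norm (y j))\<^sup>2)" .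
  qed
  then have "matrix_bound ?n (\<lambda>i j. \<Phi> (?a i j)) (C * K)"
    using cb F(3) slice_in[OF A F(1)] by simp
  then have "(\<Sum>i<?n. (norm (\<Sum>j<?n. \<Phi> (?a i j) (x (h j))))\<^sup>2) \<le> (C * K)\<^sup>2 * (\<Sum>j<?n. (norm (x (h j)))\<^sup>2)"
    unfolding matrix_bound_def by (rule spec[of _ "\<lambda>j. x (h j)"])
  moreover have "(\<Sum>j<?n. \<Phi> (?a i j) (x (h j))) = (\<Sum>e'\<in>J. \<Phi> (slice (h i) F e') (x e'))" for i
    by (rule sum.reindex_bij_betw[OF h])
  ultimately show ?thesis
    using sum.reindex_bij_betw[OF h, of "\<lambda>e. (norm (\<Sum>e'\<in>J. \<Phi> (slice e F e') (x e')))\<^sup>2"]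
      sum.reindex_bij_betw[OF h, of "\<lambda>e. (norm (x e))\<^sup>2"] by simp
qed

text \<open>The matrix \<open>\<Phi> (slice e F e')\<close> is prescribed. Each column is square
  summable, which gives the images of the vectors \<open>tensor e' v\<close>; the finite matrix
  bounds then give the estimate required by \<open>operator_of_family\<close>.\<close>

lemma ampliation_exists:
  fixes F :: "('c::chilbert_space, 'h) htensor => ('c, 'h) htensor"
  assumes F: "F \<in> amp_commutant A" "op_bound F K" "K \<ge> 0"
  shows "\<exists>R\<in>\<B>. op_bound R (C * K) \<and>
    (\<forall>e\<in>onb. \<forall>e'\<in>onb. \<forall>u v. cinner (tensor e u) (R (tensor e' v)) = cinner u (\<Phi> (slice e F e') v))"
proof -
  have bs: "\<Phi> (slice e F e') \<in> \<B>" for e e' by (intro map_bounded slice_in[OF A F(1)])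
  have "\<exists>\<zeta>. \<forall>e\<in>onb. Rep_htensor \<zeta> e = \<Phi> (slice e F e') v" if e': "e' \<in> onb" for e' v
  proof (rule htensor_of_coords)
    fix J :: "'c set" assume J: "finite J" "J \<subseteq> onb"
    \<comment> \<open>A vector with one nonzero coordinate extracts the column of index
      \<open>e'\<close> from the matrix bound.\<close>
    let ?x = "\<lambda>e. if e = e' then v else 0"
    have J': "finite (insert e' J)" "insert e' J \<subseteq> onb" using J e' by auto
    have s: "(\<Sum>e''\<in>insert e' J. \<Phi> (slice e F e'') (?x e'')) = \<Phi> (slice e F e') v" for e
    proof -
      have "(\<Sum>e''\<in>insert e' J. \<Phi> (slice e F e'') (?x e'')) = (\<Sum>e''\<in>{e'}. \<Phi> (slice e F e'') (?x e''))"
        by (rule sum.mono_neutral_right) (use J'(1) in \<open>auto simp: bounded_ops_simps[OF bs]\<close>)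
      then show ?thesis by simp
    qed
    have "(\<Sum>e\<in>J. (norm (\<Phi> (slice e F e') v))\<^sup>2) \<le> (\<Sum>e\<in>insert e' J. (norm (\<Phi> (slice e F e') v))\<^sup>2)"
      using J by (intro sum_mono2) auto
    also have "\<dots> \<le> (C * K)\<^sup>2 * (\<Sum>e\<in>insert e' J. (norm (?x e))\<^sup>2)"
      using map_slice_bound[OF F J', of ?x] unfolding s .
    also have "(\<Sum>e\<in>insert e' J. (norm (?x e))\<^sup>2) = (norm v)\<^sup>2"
    proof -
      have "(\<Sum>e\<in>insert e' J. (norm (?x e))\<^sup>2) = (\<Sum>e\<in>{e'}. (norm (?x e))\<^sup>2)"
        by (rule sum.mono_neutral_right) (use J'(1) in auto)
      then show ?thesis by simp
    qed
    finally show "(\<Sum>e\<in>J. (norm (\<Phi> (slice e F e') v))\<^sup>2) \<le> (C * K)\<^sup>2 * (norm v)\<^sup>2" .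
  qed
  then obtain b where b: "\<And>e' v e. e' \<in> onb ==> e \<in> onb ==> Rep_htensor (b e' v) e = \<Phi> (slice e F e') v" by metis
  have CK: "C * K \<ge> 0" using C F(3) by simp
  have "\<exists>R\<in>\<B>. (\<forall>i\<in>onb \<times> UNIV. R (case i of (e, v) => tensor e v) = (case i of (e, v) => b e v)) \<and> op_bound R (C * K)"
  proof (rule operator_of_family[OF ctotal_onb_tensor CK])
    fix S :: "('c \<times> 'b) set" and c assume S: "finite S" "S \<subseteq> onb \<times> UNIV"
    let ?J = "fst ` S"
    \<comment> \<open>The family is indexed by pairs \<open>(e, v)\<close>; terms with the same
      basis vector are collected before the matrix bound applies.\<close>
    define x where "x e = (\<Sum>p\<in>{p\<in>S. fst p = e}. c p *\<^sub>C snd p)" for e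
    have J: "finite ?J" "?J \<subseteq> onb" using S by auto
    have "(\<Sum>p\<in>S. c p *\<^sub>C (case p of (e, v) => tensor e v)) = (\<Sum>p\<in>S. tensor (fst p) (c p *\<^sub>C snd p))"
      by (rule sum.cong) (auto simp: tensor_scaleC_right)
    also have "\<dots> = (\<Sum>e\<in>?J. \<Sum>p\<in>{p\<in>S. fst p = e}. tensor (fst p) (c p *\<^sub>C snd p))"
      by (rule sum.group[symmetric]) (use S in auto)
    also have "\<dots> = (\<Sum>e\<in>?J. tensor e (x e))"
      unfolding x_def tensor_sum_right by (intro sum.cong refl) auto
    finally have a_eq: "(\<Sum>p\<in>S. c p *\<^sub>C (case p of (e, v) => tensor e v)) = (\<Sum>e\<in>?J. tensor e (x e))" .
    let ?B = "\<Sum>p\<in>S. c p *\<^sub>C (case p of (e, v) => b e v)"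
    have lb: "lbra e ?B = (\<Sum>e'\<in>?J. \<Phi> (slice e F e') (x e'))" if e: "e \<in> onb" for e
    proof -
      have "lbra e ?B = (\<Sum>p\<in>S. \<Phi> (slice e F (fst p)) (c p *\<^sub>C snd p))"
        unfolding bounded_ops_simps[OF lbra_bounded]
        by (rule sum.cong) (use S e in \<open>auto simp: lbra_onb b bounded_ops_simps[OF bs]\<close>)
      also have "\<dots> = (\<Sum>e'\<in>?J. \<Sum>p\<in>{p\<in>S. fst p = e'}. \<Phi> (slice e F (fst p)) (c p *\<^sub>C snd p))"
        by (rule sum.group[symmetric]) (use S in auto)
      also have "\<dots> = (\<Sum>e'\<in>?J. \<Phi> (slice e F e') (x e'))"
        unfolding x_def bounded_ops_simps[OF bs] by (intro sum.cong refl) auto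
      finally show ?thesis .
    qed
    have "(norm ?B)\<^sup>2 \<le> (C * K)\<^sup>2 * (norm (\<Sum>e\<in>?J. tensor e (x e)))\<^sup>2"
    proof (rule norm_sq_le_sums)
      fix L :: "'c set" assume L: "finite L" "L \<subseteq> onb"
      let ?x = "\<lambda>e. if e \<in> ?J then x e else 0"
      have LJ: "finite (L \<union> ?J)" "L \<union> ?J \<subseteq> onb" using L J by auto
      have s: "(\<Sum>e'\<in>L \<union> ?J. \<Phi> (slice e F e') (?x e')) = (\<Sum>e'\<in>?J. \<Phi> (slice e F e') (x e'))" for e
        by (rule sum.mono_neutral_cong_right) (use LJ in \<open>auto simp: bounded_ops_simps[OF bs]\<close>)
      have "(\<Sum>e\<in>L. (norm (Rep_htensor ?B e))\<^sup>2) = (\<Sum>e\<in>L. (norm (\<Sum>e'\<in>?J. \<Phi> (slice e F e') (x e')))\<^sup>2)"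
        using L by (intro sum.cong refl) (simp add: lbra_onb[symmetric] lb subsetD)
      also have "\<dots> \<le> (\<Sum>e\<in>L \<union> ?J. (norm (\<Sum>e'\<in>?J. \<Phi> (slice e F e') (x e')))\<^sup>2)"
        using LJ by (intro sum_mono2) auto
      also have "\<dots> \<le> (C * K)\<^sup>2 * (\<Sum>e\<in>L \<union> ?J. (norm (?x e))\<^sup>2)"
        using map_slice_bound[OF F LJ, of ?x] unfolding s .
      also have "(\<Sum>e\<in>L \<union> ?J. (norm (?x e))\<^sup>2) = (\<Sum>e\<in>?J. (norm (x e))\<^sup>2)"
        by (rule sum.mono_neutral_cong_right) (use LJ in auto)
      finally show "(\<Sum>e\<in>L. (norm (Rep_htensor ?B e))\<^sup>2) \<le> (C * K)\<^sup>2 * (norm (\<Sum>e\<in>?J. tensor e (x e)))\<^sup>2"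
        by (simp add: norm_sum_onb[OF J])
    qed
    then show "norm ?B \<le> C * K * norm (\<Sum>p\<in>S. c p *\<^sub>C (case p of (e, v) => tensor e v))"
      unfolding a_eq power_mult_distrib[symmetric] using CK by (elim power2_le_imp_le) simp
  qed
  then obtain R where R: "R \<in> \<B>" "\<forall>i\<in>onb \<times> UNIV. R (case i of (e, v) => tensor e v) = (case i of (e, v) => b e v)"
      "op_bound R (C * K)" by (elim bexE conjE)
  have R2: "R (tensor e v) = b e v" if "e \<in> onb" for e v using bspec[OF R(2), of "(e, v)"] that by simp
  have "cinner (tensor e u) (R (tensor e' v)) = cinner u (\<Phi> (slice e F e') v)" if "e \<in> onb" "e' \<in> onb" for e e' u v
    using that by (simp add: R2 cinner_tensor_onb b)
  then show ?thesis using R by blast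
qed

definition ampliation :: "(('c::chilbert_space, 'h) htensor => ('c, 'h) htensor) => ('c, 'b) htensor => ('c, 'b) htensor"
  where "ampliation F = (THE R. R \<in> \<B> \<and>
    (\<forall>e\<in>onb. \<forall>e'\<in>onb. \<forall>u v. cinner (tensor e u) (R (tensor e' v)) = cinner u (\<Phi> (slice e F e') v)))"

lemma ampliation:
  fixes F :: "('c::chilbert_space, 'h) htensor => ('c, 'h) htensor"
  assumes F: "F \<in> amp_commutant A"
  shows "ampliation F \<in> \<B>" "op_bound F K ==> K \<ge> 0 ==> op_bound (ampliation F) (C * K)"
    "e \<in> onb ==> e' \<in> onb ==> cinner (tensor e u) (ampliation F (tensor e' v)) = cinner u (\<Phi> (slice e F e') v)"
    "R \<in> \<B> ==> (\<And>e e' u v. e \<in> onb ==> e' \<in> onb ==> cinner (tensor e u) (R (tensor e' v)) = cinner u (\<Phi> (slice e F e') v))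
      ==> ampliation F = R"
proof -
  define P where "P R \<longleftrightarrow> R \<in> \<B> \<and>
    (\<forall>e\<in>onb. \<forall>e'\<in>onb. \<forall>u v. cinner (tensor e u) (R (tensor e' v)) = cinner u (\<Phi> (slice e F e') v))" for R
  have uniq: "R = R'" if "P R" "P R'" for R R'
    using that unfolding P_def by (intro bounded_ops_eq_onbI) auto
  have ex: "\<exists>R. P R \<and> op_bound R (C * K)" if "op_bound F K" "K \<ge> 0" for K
    using ampliation_exists[OF F that] unfolding P_def by blast
  obtain K0 where "op_bound F K0" "K0 \<ge> 0" using amp_commutant_bounded[OF F] by (rule bounded_ops_bound)
  then obtain R0 where R0: "P R0" using ex by blast
  have "\<exists>!R. P R" by (rule ex1I[of P, OF R0]) (rule uniq[OF _ R0])
  then have P: "P (ampliation F)" unfolding ampliation_def P_def[symmetric] by (rule theI')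
  then show "ampliation F \<in> \<B>"
    "e \<in> onb ==> e' \<in> onb ==> cinner (tensor e u) (ampliation F (tensor e' v)) = cinner u (\<Phi> (slice e F e') v)"
    by (simp_all add: P_def)
  show "op_bound (ampliation F) (C * K)" if K: "op_bound F K" "K \<ge> 0"
  proof -
    obtain R where "P R" "op_bound R (C * K)" using ex[OF K] by blast
    then show ?thesis using uniq[OF P, of R] by simp
  qed
  show "R \<in> \<B> ==> (\<And>e e' u v. e \<in> onb ==> e' \<in> onb ==> cinner (tensor e u) (R (tensor e' v)) = cinner u (\<Phi> (slice e F e') v))
      ==> ampliation F = R" by (rule uniq[OF P]) (simp add: P_def)
qed

lemma slice_add: "slice x (\<lambda>u. S u + T u) y = (\<lambda>v. slice x S y v + slice x T y v)"
  and slice_scale: "slice x (\<lambda>u. c *\<^sub>C T u) y = (\<lambda>v. c *\<^sub>C slice x T y v)"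
  by (auto simp: slice_def fun_eq_iff bounded_ops_simps[OF lbra_bounded])

lemma ampliation_linear:
  fixes S T :: "('c::chilbert_space, 'h) htensor => ('c, 'h) htensor"
  shows "S \<in> amp_commutant A ==> T \<in> amp_commutant A ==> ampliation (\<lambda>u. S u + T u) = (\<lambda>v. ampliation S v + ampliation T v)"
  "T \<in> amp_commutant A ==> ampliation (\<lambda>u. c *\<^sub>C T u) = (\<lambda>v. c *\<^sub>C ampliation T v)"
proof -
  assume T: "T \<in> amp_commutant A"
  have M: "(\<lambda>u. c *\<^sub>C T u) \<in> amp_commutant A"
    using op_subspace_amp[of A, where 'a = 'c] T by (simp add: op_subspace_def)
  show "ampliation (\<lambda>u. c *\<^sub>C T u) = (\<lambda>v. c *\<^sub>C ampliation T v)"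
    by (rule ampliation(4)[OF M])
      (simp_all add: bounded_ops_scaleC ampliation(1,3)[OF T] slice_scale map_lin(2)[OF slice_in[OF A T]] cinner_scaleC_right)
  assume S: "S \<in> amp_commutant A"
  have M: "(\<lambda>u. S u + T u) \<in> amp_commutant A"
    using op_subspace_amp[of A, where 'a = 'c] S T by (simp add: op_subspace_def)
  show "ampliation (\<lambda>u. S u + T u) = (\<lambda>v. ampliation S v + ampliation T v)"
    by (rule ampliation(4)[OF M])
      (simp_all add: bounded_ops_add ampliation(1,3)[OF T] ampliation(1,3)[OF S] slice_add
        map_lin(1)[OF slice_in[OF A S] slice_in[OF A T]] cinner_add_right)
qed

lemma ampliation_elementary:
  fixes z :: "'c::chilbert_space => 'c"
  assumes z: "z \<in> \<B>" and a: "a \<in> A" shows "ampliation (tensor_op z a) = tensor_op z (\<Phi> a)"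
proof (rule ampliation(4)[OF elementary_in_amp[OF A z a]])
  have ab: "a \<in> \<B>" using a vna_commutant(1)[OF A] by blast
  have s: "slice e (tensor_op z a) e' = (\<lambda>v. cinner e (z e') *\<^sub>C a v)" for e e'
    by (auto simp: slice_def lket_def tensor_op[OF z ab] lbra_tensor fun_eq_iff)
  show "tensor_op z (\<Phi> a) \<in> \<B>" using z map_bounded[OF a] by (simp add: tensor_op)
  show "cinner (tensor e u) (tensor_op z (\<Phi> a) (tensor e' v)) = cinner u (\<Phi> (slice e (tensor_op z a) e') v)" for e e' u v
    using z map_bounded[OF a] a by (simp add: tensor_op s map_lin cinner_tensor cinner_scaleC_right)
qed

text \<open>Replacing \<open>x\<close> and \<open>y\<close> by their truncations to finitely many
  coordinates gives a finite sum of normal functionals of slices. The error is small uniformly on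
  bounded sets, so \<open>normal_on_limit\<close> applies.\<close>

lemma ampliation_vector_normal:
  fixes x y :: "('c::chilbert_space, 'b) htensor"
  shows "\<exists>b. normal_on (amp_commutant A) (\<lambda>F. cinner x (ampliation F y)) b"
proof (rule normal_on_limit[OF amp_bounded, of A, folded amp_commutant_def])
  fix \<epsilon> :: real assume \<epsilon>: "\<epsilon> > 0"
  let ?M = "amp_commutant A :: (('c, 'h) htensor => ('c, 'h) htensor) set"
  have Mb: "?M \<subseteq> \<B>" using amp_commutant_bounded by blast
  let ?err = "\<lambda>J. C * (norm (x - coord_proj J x) * norm y + norm x * norm (y - coord_proj J y))"
  have "(?err \<longlongrightarrow> C * (norm (x - x) * norm y + norm x * norm (y - y))) (finite_subsets_at_top onb)"
    by (intro tendsto_intros coord_proj_tendsto)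
  then have "eventually (\<lambda>J. ?err J < \<epsilon>) (finite_subsets_at_top onb)"
    by (rule order_tendstoD(2)) (use \<epsilon> in simp)
  then obtain J where J: "?err J < \<epsilon>"
    using eventually_happens[of _ "finite_subsets_at_top onb"] by auto
  let ?p = "coord_proj J x" and ?q = "coord_proj J y"
  define \<psi> where "\<psi> F = cinner ?p (ampliation F ?q)" for F
  have \<psi>_eq: "(\<Sum>e'\<in>J \<inter> onb. \<Sum>e\<in>J \<inter> onb. cinner (lbra e x) (\<Phi> (slice e F e') (lbra e' y))) = \<psi> F"
    if F: "F \<in> ?M" for F
    unfolding \<psi>_def coord_proj_def bounded_ops_simps[OF ampliation(1)[OF F]] cinner_sum_right cinner_sum_left
    by (intro sum.cong refl) (simp add: ampliation(3)[OF F])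
  have "\<exists>b. normal_on ?M (\<lambda>F. \<Sum>e'\<in>J \<inter> onb. \<Sum>e\<in>J \<inter> onb. cinner (lbra e x) (\<Phi> (slice e F e') (lbra e' y))) b"
  proof (intro normal_on_sum[OF Mb])
    fix e e'
    obtain c where "normal_on A (\<lambda>a. cinner (lbra e x) (\<Phi> a (lbra e' y))) c" using map_normal by blast
    from normal_on_slice[OF this slice_in[OF A]]
    show "\<exists>b. normal_on ?M (\<lambda>F. cinner (lbra e x) (\<Phi> (slice e F e') (lbra e' y))) b" .
  qed
  then obtain b where "normal_on ?M (\<lambda>F. \<Sum>e'\<in>J \<inter> onb. \<Sum>e\<in>J \<inter> onb. cinner (lbra e x) (\<Phi> (slice e F e') (lbra e' y))) b" by blast
  from normal_on_cong[OF this \<psi>_eq] have nb: "normal_on ?M \<psi> b" by blast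
  have "cmod (cinner x (ampliation F y) - \<psi> F) \<le> \<epsilon> * K" if F: "F \<in> ?M" "0 \<le> K" "op_bound F K" for F K
  proof -
    let ?R = "ampliation F"
    have R: "?R \<in> \<B>" "op_bound ?R (C * K)" using ampliation(1)[OF F(1)] ampliation(2)[OF F(1,3,2)] by auto
    have Rn: "cmod (cinner x (?R y)) \<le> norm x * (C * K * norm y)" for x y
      by (rule order_trans[OF norm_cinner_le]) (use R(2) in \<open>auto simp: op_bound_def intro: mult_left_mono\<close>)
    have "cinner x (?R y) - \<psi> F = cinner (x - ?p) (?R y) + cinner ?p (?R (y - ?q))"
      by (simp add: \<psi>_def bounded_ops_simps[OF R(1)] cinner_diff_left cinner_diff_right)
    also have "cmod \<dots> \<le> norm (x - ?p) * (C * K * norm y) + norm ?p * (C * K * norm (y - ?q))"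
      by (intro norm_triangle_le add_mono Rn)
    also have "\<dots> \<le> norm (x - ?p) * (C * K * norm y) + norm x * (C * K * norm (y - ?q))"
      using C F(2) by (intro add_left_mono mult_right_mono coord_proj_norm) auto
    also have "\<dots> = ?err J * K" by (simp add: algebra_simps)
    also have "\<dots> \<le> \<epsilon> * K" using J F(2) by (intro mult_right_mono) auto
    finally show ?thesis .
  qed
  then show "\<exists>\<psi> b. normal_on ?M \<psi> b \<and> (\<forall>T\<in>?M. \<forall>K\<ge>0. op_bound T K --> cmod (cinner x (ampliation T y) - \<psi> T) \<le> \<epsilon> * K)"
    using nb by blast
qed

text \<open>Each term is normal, but with a constant about which nothing is known.
  \<open>normal_on_of_norm\<close> replaces it by a bound for the functional norm, with a surplus
  \<open>(1/2)^n\<close> that provides strictness and remains summable.\<close>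

lemma ampliation_normal:
  fixes \<xi> \<eta> :: "nat => ('c::chilbert_space, 'b) htensor"
  assumes sq: "sq_summable \<xi>" "sq_summable \<eta>"
  shows "\<exists>b. normal_on (amp_commutant A) (\<lambda>F. uw_fun \<xi> \<eta> (ampliation F)) b"
proof -
  let ?M = "amp_commutant A :: (('c, 'h) htensor => ('c, 'h) htensor) set"
  have Mb: "?M \<subseteq> \<B>" using amp_commutant_bounded by blast
  let ?c = "\<lambda>n. C * (((norm (\<xi> n))\<^sup>2 + (norm (\<eta> n))\<^sup>2) / 2)"
  have n: "normal_on ?M (\<lambda>F. cinner (\<xi> n) (ampliation F (\<eta> n))) (?c n + (1/2)^n)" for n
  proof -
    obtain b where "normal_on ?M (\<lambda>F. cinner (\<xi> n) (ampliation F (\<eta> n))) b" using ampliation_vector_normal by blast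
    then show ?thesis
      unfolding amp_commutant_def
    proof (rule normal_on_of_norm[OF amp_bounded, of _ _ _ "?c n"])
      fix T :: "('c, 'h) htensor => ('c, 'h) htensor"
      assume "T \<in> commutant (tensor_op id ` commutant A)" "op_bound T 1"
      then have "op_bound (ampliation T) C" using ampliation(2)[of T 1] by (simp add: amp_commutant_def)
      then show "cmod (cinner (\<xi> n) (ampliation T (\<eta> n))) \<le> ?c n" using C by (rule uw_fun_term_bound)
    qed simp
  qed
  have c: "summable (\<lambda>n. ?c n + (1/2)^n)"
    using sq unfolding sq_summable_nat by (intro summable_add summable_mult summable_divide) (auto intro: summable_geometric)
  show ?thesis
    by (rule exI, rule normal_on_sums[OF Mb n c], rule uw_fun_sums[OF ampliation(1) sq])
qed

end

section \<open>From the explicit ampliation to the chosen map \<open>id_tensor_map\<close>\<close>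

lemma continuous_map_uw_fun:
  assumes sq: "sq_summable \<xi>" "sq_summable \<eta>"
  shows "continuous_map ultraweak euclidean (\<lambda>T. uw_fun \<xi> \<eta> T)"
  unfolding continuous_map_def
  using openin_ultraweak_basis[OF sq] by (auto simp: topspace_ultraweak)

lemma continuous_map_cinner: "continuous_map ultraweak euclidean (\<lambda>T. cinner x (T y))"
proof (rule continuous_map_eq[OF continuous_map_uw_fun[of "vseq x" "vseq y"]])
  fix T :: "'a => 'b" assume "T \<in> topspace ultraweak"
  then have "T 0 = 0" by (simp add: topspace_ultraweak bounded_ops_simps)
  then show "uw_fun (vseq x) (vseq y) T = cinner x (T y)" by (rule uw_fun_vseq)
qed auto

lemma normal_mapI:
  assumes M: "M \<subseteq> \<B>" and lin: "op_linear_on M \<Psi>" and b: "\<And>T. T \<in> M ==> \<Psi> T \<in> \<B>"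
    and n: "\<And>\<xi> \<eta>. sq_summable \<xi> ==> sq_summable \<eta> ==> \<exists>c. normal_on M (\<lambda>T. uw_fun \<xi> \<eta> (\<Psi> T)) c"
  shows "normal_map M \<Psi>"
  unfolding normal_map_def
proof
  have top: "topspace (subtopology ultraweak M) = M" using M by (auto simp: topspace_ultraweak)
  show "continuous_map (subtopology ultraweak M) ultraweak \<Psi>"
    unfolding ultraweak_def[where 'a = 'c and 'b = 'd]
  proof (rule continuous_on_generated_topo)
    fix V assume "V \<in> {{T \<in> \<B>. (\<Sum>n. cinner (\<xi> n) (T (\<eta> n))) \<in> U} | (\<xi> :: nat => 'd) (\<eta> :: nat => 'c) U.
      sq_summable \<xi> \<and> sq_summable \<eta> \<and> open U}"
    then obtain \<xi> :: "nat => 'd" and \<eta> :: "nat => 'c" and U where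
      V: "V = {T \<in> \<B>. uw_fun \<xi> \<eta> T \<in> U}" "sq_summable \<xi>" "sq_summable \<eta>" "open U"
      unfolding uw_fun_def by blast
    obtain \<xi>' \<eta>' where *: "sq_summable \<xi>'" "sq_summable \<eta>'" "\<And>T. T \<in> M ==> uw_fun \<xi> \<eta> (\<Psi> T) = uw_fun \<xi>' \<eta>' T"
      using n[OF V(2,3)] unfolding normal_on_def by blast
    have "\<Psi> -` V \<inter> topspace (subtopology ultraweak M) = {T \<in> \<B>. uw_fun \<xi>' \<eta>' T \<in> U} \<inter> M"
      unfolding top using M b * by (auto simp: V(1))
    then show "openin (subtopology ultraweak M) (\<Psi> -` V \<inter> topspace (subtopology ultraweak M))"
      using openin_ultraweak_basis[OF *(1,2) V(4)] openin_subtopology by blast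
  next
    \<comment> \<open>A subbasic set that imposes no restriction; through it the image lies in the
      union of the subbasis.\<close>
    let ?V = "{T \<in> \<B>. (\<Sum>n. cinner (vseq (0::'d) n) (T (vseq (0::'c) n))) \<in> (UNIV :: complex set)}"
    have V: "\<Psi> ` M \<subseteq> ?V" using b by auto
    show "\<Psi> ` topspace (subtopology ultraweak M) \<subseteq> \<Union> {{T \<in> \<B>. (\<Sum>n. cinner (\<xi> n) (T (\<eta> n))) \<in> U} | (\<xi> :: nat => 'd) (\<eta> :: nat => 'c) U.
      sq_summable \<xi> \<and> sq_summable \<eta> \<and> open U}"
      unfolding top
    proof (rule subset_trans[OF V Union_upper], rule CollectI)
      show "\<exists>(\<xi> :: nat => 'd) (\<eta> :: nat => 'c) U. ?V = {T \<in> \<B>. (\<Sum>n. cinner (\<xi> n) (T (\<eta> n))) \<in> U} \<and>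
        sq_summable \<xi> \<and> sq_summable \<eta> \<and> open U"
        by (rule exI[of _ "vseq 0"], rule exI[of _ "vseq 0"], rule exI[of _ UNIV])
          (intro conjI refl sq_summable_vseq open_UNIV)
    qed
  qed
qed (rule lin)

locale normal_cb =
  fixes A :: "('h::chilbert_space => 'h) set" and \<Phi> :: "('h => 'h) => ('b::chilbert_space => 'b)"
  assumes A: "von_neumann_algebra A" and normal: "normal_map A \<Phi>" and cb: "completely_bounded A \<Phi>"
begin

lemma id_tensor_map_exists:
  "\<exists>\<Psi>. normal_map (uw_tensor \<B> A) (\<Psi> :: (('c::chilbert_space, 'h) htensor => ('c, 'h) htensor) => _) \<and>
    (\<forall>z\<in>\<B>. \<forall>a\<in>A. \<Psi> (tensor_op z a) = tensor_op z (\<Phi> a))"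
proof -
  obtain C where C: "C \<ge> 0" "\<forall>n a. \<forall>K\<ge>0. (\<forall>i<n. \<forall>j<n. a i j \<in> A) --> matrix_bound n a K -->
      matrix_bound n (\<lambda>i j. \<Phi> (a i j)) (C * K)"
    using cb unfolding completely_bounded_def by (elim exE conjE)
  note ctx = A normal C
  have "normal_map (amp_commutant A) (ampliation \<Phi> :: (('c, 'h) htensor => ('c, 'h) htensor) => _)"
  proof (rule normal_mapI)
    show "amp_commutant A \<subseteq> (\<B> :: (('c, 'h) htensor => ('c, 'h) htensor) set)"
      using amp_commutant_bounded by blast
    show "op_linear_on (amp_commutant A) (ampliation \<Phi> :: (('c, 'h) htensor => ('c, 'h) htensor) => _)"
      unfolding op_linear_on_def using ampliation_linear[OF ctx] by blast
  qed (use ampliation(1)[OF ctx] ampliation_normal[OF ctx] in blast)+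
  then show ?thesis
    unfolding uw_tensor_eq[OF A] using ampliation_elementary[OF ctx] by blast
qed

lemma id_tensor_map:
  shows id_tensor_map_normal: "normal_map (amp_commutant A)
      (id_tensor_map A \<Phi> :: (('c::chilbert_space, 'h) htensor => ('c, 'h) htensor) => _)"
    and id_tensor_map_elementary: "z \<in> \<B> ==> a \<in> A ==>
      id_tensor_map A \<Phi> (tensor_op (z :: 'c => 'c) a) = tensor_op z (\<Phi> a)"
proof -
  have "normal_map (uw_tensor \<B> A) (id_tensor_map A \<Phi> :: (('c::chilbert_space, 'h) htensor => ('c, 'h) htensor) => _) \<and>
    (\<forall>z\<in>(\<B> :: ('c => 'c) set). \<forall>a\<in>A. id_tensor_map A \<Phi> (tensor_op z a) = tensor_op z (\<Phi> a))"
    unfolding id_tensor_map_def by (rule someI_ex[OF id_tensor_map_exists])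
  then show "normal_map (amp_commutant A) (id_tensor_map A \<Phi> :: (('c, 'h) htensor => ('c, 'h) htensor) => _)"
    "z \<in> \<B> ==> a \<in> A ==> id_tensor_map A \<Phi> (tensor_op (z :: 'c => 'c) a) = tensor_op z (\<Phi> a)"
    unfolding uw_tensor_eq[OF A] by blast+
qed

lemma \<Phi>_lin:
  "S \<in> A ==> T \<in> A ==> \<Phi> (\<lambda>u. S u + T u) = (\<lambda>v. \<Phi> S v + \<Phi> T v)"
  "T \<in> A ==> \<Phi> (\<lambda>u. c *\<^sub>C T u) = (\<lambda>v. c *\<^sub>C \<Phi> T v)"
  using normal by (auto simp: normal_map_def op_linear_on_def)

lemma \<Phi>_bounded: "a \<in> A ==> \<Phi> a \<in> \<B>"
  using continuous_map_image_subset_topspace[of "subtopology ultraweak A" ultraweak \<Phi>] normal vna_commutant(1)[OF A]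
  by (auto simp: normal_map_def topspace_ultraweak)

lemma A_zero: "(\<lambda>u. 0) \<in> A" using vna_commutant(4)[OF A] by (simp add: op_subspace_def)

lemma A_sum: "(\<And>i. i \<in> I ==> T i \<in> A) ==> (\<lambda>u. \<Sum>i\<in>I. T i u) \<in> A"
  using vna_commutant(4)[OF A] by (induction I rule: infinite_finite_induct) (auto simp: op_subspace_def)

lemma \<Phi>_sum: "(\<And>i. i \<in> I ==> T i \<in> A) ==> \<Phi> (\<lambda>u. \<Sum>i\<in>I. T i u) = (\<lambda>v. \<Sum>i\<in>I. \<Phi> (T i) v)"
proof (induction I rule: infinite_finite_induct)
  case (insert x F)
  then show ?case using \<Phi>_lin(1)[of "T x" "\<lambda>u. \<Sum>i\<in>F. T i u"] A_sum[of F T] by simp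
qed (use \<Phi>_lin(2)[OF A_zero, of 0] in simp_all)

lemma id_tensor_map_bounded: "G \<in> amp_commutant A ==> id_tensor_map A \<Phi> G \<in> \<B>"
  using continuous_map_image_subset_topspace[of "subtopology ultraweak (amp_commutant A)" ultraweak "id_tensor_map A \<Phi>"]
    id_tensor_map_normal amp_commutant_bounded
  by (auto simp: normal_map_def topspace_ultraweak)

text \<open>The chosen map is specified only on elementary tensors. Both sides are normal
  functionals of \<open>G\<close> that agree there, and elementary tensors span an ultraweakly dense
  subspace; thus the slices determine the ampliation.\<close>

lemma id_tensor_map_cinner:
  fixes x y :: "'c::chilbert_space"
  assumes G: "G \<in> amp_commutant A"
  shows "cinner (tensor x u) (id_tensor_map A \<Phi> G (tensor y v)) = cinner u (\<Phi> (slice x G y) v)"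
proof -
  let ?M = "amp_commutant A :: (('c, 'h) htensor => ('c, 'h) htensor) set"
  let ?\<psi> = "\<lambda>G. cinner (tensor x u) (id_tensor_map A \<Phi> G (tensor y v)) + (-1) * cinner u (\<Phi> (slice x G y) v)"
  have M: "op_subspace ?M" by (rule op_subspace_amp)
  have Mb: "?M \<subseteq> \<B>" using amp_commutant_bounded by blast
  obtain c where "normal_on A (\<lambda>a. cinner u (\<Phi> a v)) c"
    using normal_map_cinner[OF vna_commutant(4)[OF A] normal] by blast
  from normal_on_slice[OF this slice_in[OF A]]
  obtain c where c: "normal_on ?M (\<lambda>G. cinner u (\<Phi> (slice x G y) v)) c" by blast
  obtain d where "normal_on ?M (\<lambda>G. cinner (tensor x u) (id_tensor_map A \<Phi> G (tensor y v))) d"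
    using normal_map_cinner[OF M id_tensor_map_normal] by blast
  from normal_on_add[OF Mb this normal_on_scale[OF Mb c]]
  obtain e where "normal_on ?M ?\<psi> e" by blast
  then obtain \<xi> \<eta> where *: "sq_summable \<xi>" "sq_summable \<eta>" "\<And>T. T \<in> ?M ==> ?\<psi> T = uw_fun \<xi> \<eta> T"
    unfolding normal_on_def by blast
  let ?N = "{T \<in> ?M. uw_fun \<xi> \<eta> T = 0}"
  have N: "op_subspace ?N"
    unfolding op_subspace_def
  proof (intro conjI ballI allI)
    show "?N \<subseteq> \<B>" using Mb by blast
    show "(\<lambda>x. 0) \<in> ?N" using M by (simp add: op_subspace_def) (simp add: uw_fun_def)
    fix S T r assume S: "S \<in> ?N" and T: "T \<in> ?N"
    have b: "S \<in> \<B>" "T \<in> \<B>" using S T Mb by auto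
    show "(\<lambda>u. S u + T u) \<in> ?N" using S T M uw_fun_linear(1)[OF *(1,2) b(2,1)] by (simp add: op_subspace_def)
  next
    fix T r assume T: "T \<in> ?N"
    then have b: "T \<in> \<B>" using Mb by auto
    show "(\<lambda>u. r *\<^sub>C T u) \<in> ?N" using T M uw_fun_linear(2)[OF *(1,2) b] by (simp add: op_subspace_def)
  qed
  have "{tensor_op S T |S T. S \<in> \<B> \<and> T \<in> A} \<subseteq> ?N"
  proof clarify
    fix z :: "'c => 'c" and a assume z: "z \<in> \<B>" and a: "a \<in> A"
    have ab: "a \<in> \<B>" using a vna_commutant(1)[OF A] by blast
    have s: "slice x (tensor_op z a) y = (\<lambda>v. cinner x (z y) *\<^sub>C a v)"
      by (auto simp: slice_def lket_def tensor_op[OF z ab] lbra_tensor fun_eq_iff)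
    have "?\<psi> (tensor_op z a) = 0"
      using z a by (simp add: id_tensor_map_elementary tensor_op \<Phi>_bounded s \<Phi>_lin cinner_tensor cinner_scaleC_right)
    then show "tensor_op z a \<in> amp_commutant A \<and> uw_fun \<xi> \<eta> (tensor_op z a) = 0"
      using *(3)[OF elementary_in_amp[OF A z a]] elementary_in_amp[OF A z a] by simp
  qed
  from op_span_minimal[OF N this]
  have "uw_fun \<xi> \<eta> R = 0" if "R \<in> op_span {tensor_op S T |S T. S \<in> \<B> \<and> T \<in> A}" for R using that by blast
  moreover have "G \<in> ultraweak closure_of op_span {tensor_op S T |S T. S \<in> \<B> \<and> T \<in> A}"
    using G unfolding uw_tensor_eq[OF A, symmetric] uw_tensor_def .
  ultimately have "uw_fun \<xi> \<eta> G = 0" using ultraweak_closure_eq *(1,2) by blast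
  then show ?thesis using *(3)[OF G] by simp
qed

text \<open>By the slice formula the chosen map coincides with \<open>ampliation\<close> and
  inherits its bound.\<close>

lemma id_tensor_map_cb:
  shows "\<exists>C\<ge>0. \<forall>(G :: ('c::chilbert_space, 'h) htensor => _)\<in>amp_commutant A. \<forall>K\<ge>0. op_bound G K --> op_bound (id_tensor_map A \<Phi> G) (C * K)"
proof -
  obtain C where C: "C \<ge> 0" "\<forall>n a. \<forall>K\<ge>0. (\<forall>i<n. \<forall>j<n. a i j \<in> A) --> matrix_bound n a K -->
      matrix_bound n (\<lambda>i j. \<Phi> (a i j)) (C * K)"
    using cb unfolding completely_bounded_def by (elim exE conjE)
  note ctx = A normal C
  have "op_bound (id_tensor_map A \<Phi> G) (C * K)" if G: "G \<in> amp_commutant A" "K \<ge> 0" "op_bound G K"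
    for G :: "('c, 'h) htensor => ('c, 'h) htensor" and K
  proof -
    have "ampliation \<Phi> G = id_tensor_map A \<Phi> G"
      by (rule ampliation(4)[OF ctx G(1) id_tensor_map_bounded[OF G(1)]]) (auto simp: id_tensor_map_cinner[OF G(1)])
    then show ?thesis using ampliation(2)[OF ctx G(1,3,2)] by simp
  qed
  then show ?thesis using C(1) by blast
qed

end

section \<open>Ampliations of normal star homomorphisms\<close>

lemma slice_adj: "F \<in> \<B> ==> slice x (adj F) y = adj (slice y F x)"
proof -
  assume F: "F \<in> \<B>"
  then have b: "slice y F x \<in> \<B>" unfolding slice_def by (intro bounded_ops_compose) auto
  show ?thesis
  proof
    fix v
    show "slice x (adj F) y v = adj (slice y F x) v"
    proof (rule cinner_eqI)
      fix u
      have "cinner u (slice x (adj F) y v) = cnj (cinner (tensor y v) (F (tensor x u)))"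
        by (simp add: slice_cinner adj_cinner[OF F]) (rule cinner_commute)
      also have "\<dots> = cinner u (adj (slice y F x) v)"
        unfolding slice_cinner[symmetric] adj_cinner[OF b] by (rule cinner_commute[symmetric])
      finally show "cinner u (slice x (adj F) y v) = cinner u (adj (slice y F x) v)" .
    qed
  qed
qed

locale normal_hom = normal_cb +
  assumes hom: "a \<in> A ==> b \<in> A ==> \<Phi> (a \<circ> b) = \<Phi> a \<circ> \<Phi> b" and star: "a \<in> A ==> \<Phi> (adj a) = adj (\<Phi> a)"
begin

lemma id_tensor_map_adj:
  fixes G :: "('c::chilbert_space, 'a) htensor => ('c, 'a) htensor"
  assumes G: "G \<in> amp_commutant A" shows "id_tensor_map A \<Phi> (adj G) = adj (id_tensor_map A \<Phi> G)"
proof (rule bounded_ops_eq_tensorI)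
  have G': "adj G \<in> amp_commutant A" by (rule amp_commutant_adj[OF A G])
  have Rb: "id_tensor_map A \<Phi> G \<in> \<B>" by (rule id_tensor_map_bounded[OF G])
  show "id_tensor_map A \<Phi> (adj G) \<in> \<B>" by (rule id_tensor_map_bounded[OF G'])
  show "adj (id_tensor_map A \<Phi> G) \<in> \<B>" using Rb by simp
  fix y :: 'c and v
  show "id_tensor_map A \<Phi> (adj G) (tensor y v) = adj (id_tensor_map A \<Phi> G) (tensor y v)"
  proof (rule ctotalD[OF ctotal_tensors])
    fix a :: "('c, 'b) htensor" assume "a \<in> range (\<lambda>(u, v). tensor u v)"
    then obtain x u where a: "a = tensor x u" by auto
    have sA: "slice y G x \<in> A" by (rule slice_in[OF A G])
    have "cinner a (id_tensor_map A \<Phi> (adj G) (tensor y v)) = cinner u (\<Phi> (adj (slice y G x)) v)"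
      unfolding a id_tensor_map_cinner[OF G'] slice_adj[OF amp_commutant_bounded[OF G]] ..
    also have "\<dots> = cinner (\<Phi> (slice y G x) u) v" by (simp add: star[OF sA] adj_cinner[OF \<Phi>_bounded[OF sA]])
    also have "\<dots> = cnj (cinner (tensor y v) (id_tensor_map A \<Phi> G a))"
      unfolding a id_tensor_map_cinner[OF G] by (rule cinner_commute)
    also have "\<dots> = cinner a (adj (id_tensor_map A \<Phi> G) (tensor y v))"
      unfolding adj_cinner[OF Rb] by (rule cinner_commute[symmetric])
    finally show "cinner a (id_tensor_map A \<Phi> (adj G) (tensor y v)) = cinner a (adj (id_tensor_map A \<Phi> G) (tensor y v))" .
  qed
qed

lemma lbra_id_tensor_map: "G \<in> amp_commutant A ==> lbra x (id_tensor_map A \<Phi> G (tensor y v)) = \<Phi> (slice x G y) v"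
  by (rule cinner_eqI) (simp add: lbra_cinner id_tensor_map_cinner)

text \<open>With a finite projection inserted between \<open>F\<close> and \<open>G\<close>, a slice
  of the product is a finite sum of products of slices, on which \<open>\<Phi>\<close> is
  multiplicative. Normality of \<open>\<Phi>\<close> removes the projection on one side of the
  identity, strong convergence on the other.\<close>

lemma id_tensor_map_compose:
  fixes G :: "('c::chilbert_space, 'a) htensor => ('c, 'a) htensor"
  assumes F: "F \<in> amp_commutant A" and G: "G \<in> amp_commutant A"
  shows "id_tensor_map A \<Phi> (F \<circ> G) = id_tensor_map A \<Phi> F \<circ> id_tensor_map A \<Phi> G"
proof (rule bounded_ops_eq_tensorI)
  have FG: "F \<circ> G \<in> amp_commutant A" by (rule amp_commutant_compose[OF F G])
  have b: "id_tensor_map A \<Phi> F \<in> \<B>" "id_tensor_map A \<Phi> G \<in> \<B>" "F \<in> \<B>" "G \<in> \<B>"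
    using F G id_tensor_map_bounded amp_commutant_bounded by auto
  show "id_tensor_map A \<Phi> (F \<circ> G) \<in> \<B>" by (rule id_tensor_map_bounded[OF FG])
  show "id_tensor_map A \<Phi> F \<circ> id_tensor_map A \<Phi> G \<in> \<B>" using b by (intro bounded_ops_compose)
  fix y :: 'c and v
  show "id_tensor_map A \<Phi> (F \<circ> G) (tensor y v) = (id_tensor_map A \<Phi> F \<circ> id_tensor_map A \<Phi> G) (tensor y v)"
  proof (rule ctotalD[OF ctotal_tensors])
    fix a :: "('c, 'b) htensor" assume "a \<in> range (\<lambda>(u, v). tensor u v)"
    then obtain x u where a: "a = tensor x u" by auto
    let ?\<F> = "finite_subsets_at_top onb :: 'c set filter"
    define T where "T J = slice x (F \<circ> coord_proj J \<circ> G) y" for J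
    have T: "T J = (\<lambda>w. \<Sum>e\<in>J \<inter> onb. (slice x F e \<circ> slice e G y) w)" for J
      by (rule ext) (simp add: T_def slice_def lket_def coord_proj_def bounded_ops_simps[OF b(3)] bounded_ops_simps[OF lbra_bounded])
    obtain K L where KL: "K \<ge> 0" "op_bound F K" "L \<ge> 0" "op_bound G L" using b(3,4) by (meson bounded_ops_bound)
    have Tb: "T J \<in> \<B>" for J
      unfolding T_def slice_def using b(3,4) by (intro bounded_ops_compose coord_proj_op) auto
    have lb: "norm (lbra x \<zeta>) \<le> norm x * norm \<zeta>" for \<zeta> :: "('c, 'a) htensor"
    proof (rule norm_le_cinner)
      show "cmod (cinner z (lbra x \<zeta>)) \<le> norm x * norm \<zeta> * norm z" for z
        using norm_cinner_le[of "tensor x z" \<zeta>] by (simp add: lbra_cinner norm_tensor mult_ac)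
    qed simp
    have Tn: "op_bound (T J) (norm x * (K * (L * norm y)))" for J
      unfolding op_bound_def
    proof
      fix w
      have "norm (T J w) \<le> norm x * norm (F (coord_proj J (G (tensor y w))))"
        by (simp add: T_def slice_def lket_def lb)
      also have "\<dots> \<le> norm x * (K * norm (coord_proj J (G (tensor y w))))"
        using KL(2) by (intro mult_left_mono) (auto simp: op_bound_def)
      also have "\<dots> \<le> norm x * (K * norm (G (tensor y w)))"
        using KL(1) by (intro mult_left_mono coord_proj_norm) auto
      also have "\<dots> \<le> norm x * (K * (L * norm (tensor y w)))"
        using KL by (intro mult_left_mono) (auto simp: op_bound_def)
      finally show "norm (T J w) \<le> norm x * (K * (L * norm y)) * norm w" by (simp add: norm_tensor mult_ac)
    qed
    have Tlim: "((\<lambda>J. T J w) \<longlongrightarrow> slice x (F \<circ> G) y w) ?\<F>" for w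
    proof -
      have "((\<lambda>J. lbra x (F (coord_proj J (G (tensor y w))))) \<longlongrightarrow> lbra x (F (G (tensor y w)))) ?\<F>"
        by (rule bounded_ops_tendsto[OF lbra_bounded bounded_ops_tendsto[OF b(3) coord_proj_tendsto]])
      then show ?thesis by (simp add: T_def slice_def lket_def)
    qed
    have sA: "slice x F e \<in> A" "slice e G y \<in> A" "slice x (F \<circ> G) y \<in> A" for e
      by (intro slice_in[OF A] F G FG)+
    have TA: "T J \<in> A" for J unfolding T by (intro A_sum vna_commutant(6)[OF A] sA)
    obtain \<xi> \<eta> where n: "sq_summable \<xi>" "sq_summable \<eta>" "\<And>a. a \<in> A ==> cinner u (\<Phi> a v) = uw_fun \<xi> \<eta> a"
      using normal_map_cinner[OF vna_commutant(4)[OF A] normal, of u v] unfolding normal_on_def by blast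
    have "((\<lambda>J. uw_fun \<xi> \<eta> (T J)) \<longlongrightarrow> uw_fun \<xi> \<eta> (slice x (F \<circ> G) y)) ?\<F>"
      by (rule uw_fun_tendsto[OF Tb Tn _ _ Tlim n(1,2)]) (use KL sA(3) vna_commutant(1)[OF A] in auto)
    then have 1: "((\<lambda>J. cinner u (\<Phi> (T J) v)) \<longlongrightarrow> cinner a (id_tensor_map A \<Phi> (F \<circ> G) (tensor y v))) ?\<F>"
      by (simp add: n(3)[OF TA] n(3)[OF sA(3)] a id_tensor_map_cinner[OF FG])
    have eq: "cinner u (\<Phi> (T J) v) = cinner a (id_tensor_map A \<Phi> F (coord_proj J (id_tensor_map A \<Phi> G (tensor y v))))" for J
    proof -
      have "\<Phi> (T J) = (\<lambda>v. \<Sum>e\<in>J \<inter> onb. \<Phi> (slice x F e \<circ> slice e G y) v)"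
        unfolding T by (rule \<Phi>_sum) (intro vna_commutant(6)[OF A] sA)
      then have "cinner u (\<Phi> (T J) v) = (\<Sum>e\<in>J \<inter> onb. cinner u (\<Phi> (slice x F e) (\<Phi> (slice e G y) v)))"
        by (simp add: hom[OF sA(1,2)] cinner_sum_right)
      also have "\<dots> = (\<Sum>e\<in>J \<inter> onb. cinner a (id_tensor_map A \<Phi> F (tensor e (lbra e (id_tensor_map A \<Phi> G (tensor y v))))))"
        by (simp add: a id_tensor_map_cinner[OF F] lbra_id_tensor_map[OF G])
      also have "\<dots> = cinner a (id_tensor_map A \<Phi> F (coord_proj J (id_tensor_map A \<Phi> G (tensor y v))))"
        by (simp add: coord_proj_def bounded_ops_simps[OF b(1)] cinner_sum_right)
      finally show ?thesis .
    qed
    have "((\<lambda>J. cinner a (id_tensor_map A \<Phi> F (coord_proj J (id_tensor_map A \<Phi> G (tensor y v))))) \<longlongrightarrow>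
      cinner a (id_tensor_map A \<Phi> F (id_tensor_map A \<Phi> G (tensor y v)))) ?\<F>"
      by (intro tendsto_cinner tendsto_const bounded_ops_tendsto[OF b(1) coord_proj_tendsto])
    then have 2: "((\<lambda>J. cinner u (\<Phi> (T J) v)) \<longlongrightarrow> cinner a (id_tensor_map A \<Phi> F (id_tensor_map A \<Phi> G (tensor y v)))) ?\<F>"
      by (simp only: eq)
    show "cinner a (id_tensor_map A \<Phi> (F \<circ> G) (tensor y v)) = cinner a ((id_tensor_map A \<Phi> F \<circ> id_tensor_map A \<Phi> G) (tensor y v))"
      using tendsto_unique[OF _ 1 2] by simp
  qed
qed

text \<open>The C*-identity turns a bound \<open>c\<close> for the ampliation into \<open>sqrt c\<close>, so that the infimum of
  the bounds is at most 1.\<close>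

lemma id_tensor_map_contractive:
  fixes G :: "('c::chilbert_space, 'a) htensor => ('c, 'a) htensor"
  assumes G: "G \<in> amp_commutant A" "op_bound G K" "K \<ge> 0" shows "op_bound (id_tensor_map A \<Phi> G) K"
proof -
  let ?M = "amp_commutant A :: (('c, 'a) htensor => ('c, 'a) htensor) set"
  define S where "S = {c. c \<ge> 0 \<and> (\<forall>G\<in>?M. \<forall>K\<ge>0. op_bound G K --> op_bound (id_tensor_map A \<Phi> G) (c * K))}"
  have sq: "sqrt c \<in> S" if c: "c \<in> S" for c
    unfolding S_def
  proof (intro CollectI conjI ballI allI impI)
    show "0 \<le> sqrt c" using c by (simp add: S_def)
    fix G :: "('c, 'a) htensor => ('c, 'a) htensor" and K assume G: "G \<in> ?M" "0 \<le> K" "op_bound G K"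
    have Gb: "G \<in> \<B>" by (rule amp_commutant_bounded[OF G(1)])
    have G2: "adj G \<circ> G \<in> ?M" by (intro amp_commutant_compose amp_commutant_adj[OF A] G)
    have "op_bound (adj G \<circ> G) (K * K)"
      using op_bound_adj[OF Gb G(3,2)] G(2,3) unfolding op_bound_def
      by (metis comp_apply mult.assoc mult_left_mono order_trans)
    then have b2: "op_bound (id_tensor_map A \<Phi> (adj G \<circ> G)) (c * (K * K))"
      using c G2 G(2) unfolding S_def by auto
    have Rb: "id_tensor_map A \<Phi> G \<in> \<B>" by (rule id_tensor_map_bounded[OF G(1)])
    show "op_bound (id_tensor_map A \<Phi> G) (sqrt c * K)"
      unfolding op_bound_def
    proof
      fix x
      have "complex_of_real ((norm (id_tensor_map A \<Phi> G x))\<^sup>2) = cinner x (id_tensor_map A \<Phi> (adj G \<circ> G) x)"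
        by (simp add: id_tensor_map_compose[OF amp_commutant_adj[OF A G(1)] G(1)] id_tensor_map_adj[OF G(1)]
            adj_cinner[OF Rb] cinner_self)
      then have "(norm (id_tensor_map A \<Phi> G x))\<^sup>2 = cmod (cinner x (id_tensor_map A \<Phi> (adj G \<circ> G) x))"
        by (metis abs_of_nonneg norm_of_real zero_le_power2)
      also have "\<dots> \<le> norm x * norm (id_tensor_map A \<Phi> (adj G \<circ> G) x)" by (rule norm_cinner_le)
      also have "\<dots> \<le> norm x * (c * (K * K) * norm x)" using b2 by (intro mult_left_mono) (auto simp: op_bound_def)
      also have "\<dots> = (sqrt c * K * norm x)\<^sup>2"
        using c by (simp add: S_def power_mult_distrib) (simp add: power2_eq_square mult_ac)
      finally show "norm (id_tensor_map A \<Phi> G x) \<le> sqrt c * K * norm x"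
        by (rule power2_le_imp_le) (use c G(2) in \<open>simp add: S_def\<close>)
    qed
  qed
  obtain c0 where c0: "c0 \<in> S" using id_tensor_map_cb[where 'c = 'c] unfolding S_def by blast
  have bdd: "bdd_below S" by (rule bdd_belowI[of _ 0]) (auto simp: S_def)
  have I0: "Inf S \<ge> 0" using c0 by (intro cInf_greatest) (auto simp: S_def)
  have I2: "(Inf S)\<^sup>2 \<le> Inf S"
    proof (rule cInf_greatest)
      fix c assume c: "c \<in> S"
      have "Inf S \<le> sqrt c" by (rule cInf_lower[OF sq[OF c] bdd])
      then have "(Inf S)\<^sup>2 \<le> (sqrt c)\<^sup>2" using I0 by (intro power_mono)
      then show "(Inf S)\<^sup>2 \<le> c" using c by (simp add: S_def)
    qed (use c0 in auto)
  have I1: "Inf S \<le> 1"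
  proof (rule ccontr)
    assume "\<not> Inf S \<le> 1"
    then have "1 * Inf S < Inf S * Inf S" by (intro mult_strict_right_mono) auto
    then show False using I2 by (simp add: power2_eq_square)
  qed
  have "norm (id_tensor_map A \<Phi> G x) \<le> K * norm x" for x
  proof (rule field_le_epsilon)
    fix \<epsilon> :: real assume e: "\<epsilon> > 0"
    have q: "K * norm x + 1 > 0" using G(3) by (simp add: add_nonneg_pos)
    \<comment> \<open>The margin is chosen so that after multiplication by \<open>K * norm x\<close>
      it stays below \<open>\<epsilon>\<close>; adding 1 keeps the denominator positive.\<close>
    then have "Inf S < 1 + \<epsilon> / (K * norm x + 1)" using I1 e by (smt (verit) divide_pos_pos)
    then obtain c where c: "c \<in> S" "c < 1 + \<epsilon> / (K * norm x + 1)" using cInf_lessD[of S] c0 by blast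
    have "norm (id_tensor_map A \<Phi> G x) \<le> c * K * norm x" using c(1) G unfolding S_def op_bound_def by blast
    also have "\<dots> = c * (K * norm x)" by simp
    also have "\<dots> \<le> (1 + \<epsilon> / (K * norm x + 1)) * (K * norm x)" using c(2) G(3) by (intro mult_right_mono) auto
    also have "\<dots> \<le> K * norm x + \<epsilon>"
    proof -
      have "\<epsilon> / (K * norm x + 1) * (K * norm x) \<le> \<epsilon> / (K * norm x + 1) * (K * norm x + 1)"
        using e q by (intro mult_left_mono) auto
      then show ?thesis using q by (simp add: distrib_right)
    qed
    finally show "norm (id_tensor_map A \<Phi> G x) \<le> K * norm x + \<epsilon>" .
  qed
  then show ?thesis by (simp add: op_bound_def)
qed

end

section \<open>Right-continuous functions and step functions\<close>

text \<open>Grid points of mesh \<open>1 / (n + 1)\<close> strictly above \<open>s\<close>.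
  Strictness matters, since the limit along \<open>at_right s\<close> excludes \<open>s\<close>
  itself.\<close>

lemma floor_approx_right:
  "filterlim (\<lambda>n. (of_int \<lfloor>s * (real n + 1)\<rfloor> + 1) / (real n + 1)) (at_right s) sequentially"
proof -
  let ?q = "\<lambda>n. (of_int \<lfloor>s * (real n + 1)\<rfloor> + 1) / (real n + 1)"
  have gt: "?q n > s" for n
  proof -
    have "s * (real n + 1) < of_int \<lfloor>s * (real n + 1)\<rfloor> + 1" by linarith
    then show ?thesis by (simp add: pos_less_divide_eq add_nonneg_pos)
  qed
  have le: "?q n \<le> s + 1 / (real n + 1)" for n
  proof -
    have "of_int \<lfloor>s * (real n + 1)\<rfloor> + 1 \<le> s * (real n + 1) + 1" by linarith
    then have "?q n \<le> (s * (real n + 1) + 1) / (real n + 1)" by (intro divide_right_mono) auto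
    also have "\<dots> = s + 1 / (real n + 1)" by (simp add: add_divide_distrib add_nonneg_pos less_imp_neq[symmetric])
    finally show ?thesis .
  qed
  have "(\<lambda>n. s + 1 / (real n + 1)) \<longlonglongrightarrow> s + 0"
    using LIMSEQ_inverse_real_of_nat by (intro tendsto_add tendsto_const) (simp add: inverse_eq_divide add.commute)
  then have "?q \<longlonglongrightarrow> s"
    by (intro tendsto_sandwich[of "\<lambda>_. s" ?q sequentially "\<lambda>n. s + 1 / (real n + 1)"])
      (use gt le less_imp_le in \<open>auto intro!: always_eventually\<close>)
  then show ?thesis unfolding filterlim_at using gt by (auto simp: less_imp_neq[symmetric] intro!: always_eventually)
qed

text \<open>Sampling at the grid points above \<open>s\<close> gives approximants with countably
  many values, which makes the range separable. This is where the strong measurability of the paths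
  integrated below comes from.\<close>

lemma strongly_measurable_right_continuous:
  fixes x :: "real => 'a::metric_space"
  assumes id: "(\<lambda>s. s) \<in> borel_measurable M" and rc: "\<And>s. s \<in> space M ==> (x \<longlongrightarrow> x s) (at_right s)"
  shows "strongly_measurable M x"
proof (rule strongly_measurable_LIMSEQ)
  let ?q = "\<lambda>n s. (of_int \<lfloor>s * (real n + 1)\<rfloor> + 1) / (real n + 1)"
  fix n
  define g where "g k = x ((of_int k + 1) / (real n + 1))" for k :: int
  have g: "(\<lambda>s. x (?q n s)) = (\<lambda>s. g \<lfloor>s * (real n + 1)\<rfloor>)" by (simp add: g_def)
  have "(\<lambda>s. \<lfloor>s * (real n + 1)\<rfloor>) \<in> measurable M (count_space UNIV)"
    by (rule measurable_compose[OF id]) measurable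
  then have "(\<lambda>s. g \<lfloor>s * (real n + 1)\<rfloor>) \<in> borel_measurable M"
    by (rule measurable_compose) simp
  moreover have "(\<lambda>s. g \<lfloor>s * (real n + 1)\<rfloor>) ` space M \<subseteq> closure (range g)"
    using closure_subset by fastforce
  moreover have "countable (range g)" by simp
  ultimately show "strongly_measurable M (\<lambda>s. x (?q n s))" unfolding strongly_measurable_def g by blast
next
  fix s assume "s \<in> space M"
  from rc[OF this] floor_approx_right[of s]
  show "(\<lambda>n. x ((of_int \<lfloor>s * (real n + 1)\<rfloor> + 1) / (real n + 1))) \<longlonglongrightarrow> x s"
    by (rule filterlim_compose)
qed

definition piece :: "real => real => 'k::chilbert_space => real => 'k"
  where "piece a b c s = (if a \<le> s \<and> s < b then c else 0)"

lemma step_functions_eq: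
  "\<S> = {(\<lambda>s. \<Sum>i<n. piece (a i) (b i) (c i) s) | (n::nat) a b c. \<forall>i<n. 0 \<le> a i}"
  by (simp add: step_functions_def piece_def)

lemma step_piece: "0 \<le> a ==> piece a b c \<in> \<S>"
  unfolding step_functions_eq
  by (rule CollectI, rule exI[of _ "1::nat"], rule exI[of _ "\<lambda>_. a"], rule exI[of _ "\<lambda>_. b"], rule exI[of _ "\<lambda>_. c"]) auto

lemma step_zero: "(\<lambda>s. 0) \<in> \<S>"
  unfolding step_functions_eq by (auto intro!: exI[of _ "0::nat"])

lemma step_add:
  assumes "f \<in> \<S>" "g \<in> \<S>" shows "(\<lambda>s. f s + g s) \<in> \<S>"
proof -
  obtain m n :: nat and a b c a' b' c' where
    "f = (\<lambda>s. \<Sum>i<m. piece (a i) (b i) (c i) s)" "\<forall>i<m. 0 \<le> a i"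
    "g = (\<lambda>s. \<Sum>i<n. piece (a' i) (b' i) (c' i) s)" "\<forall>i<n. 0 \<le> a' i"
    using assms unfolding step_functions_eq by blast
  then show ?thesis
    unfolding step_functions_eq
    by (intro CollectI exI[of _ "m + n"] exI[of _ "\<lambda>i. if i < m then a i else a' (i - m)"]
        exI[of _ "\<lambda>i. if i < m then b i else b' (i - m)"] exI[of _ "\<lambda>i. if i < m then c i else c' (i - m)"])
      (auto simp: sum_append intro!: ext sum.cong)
qed

lemma step_induct [consumes 1, case_names zero piece add]:
  assumes "f \<in> \<S>"
    and "P (\<lambda>s. 0)" "\<And>a b c. 0 \<le> a ==> P (piece a b c)"
    and "\<And>f g. f \<in> \<S> ==> g \<in> \<S> ==> P f ==> P g ==> P (\<lambda>s. f s + g s)"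
  shows "P f"
proof -
  obtain n :: nat and a b c where f: "f = (\<lambda>s. \<Sum>i<n. piece (a i) (b i) (c i) s)" "\<forall>i<n. 0 \<le> a i"
    using assms(1) unfolding step_functions_eq by blast
  have "k \<le> n ==> (\<lambda>s. \<Sum>i<k. piece (a i) (b i) (c i) s) \<in> \<S> \<and> P (\<lambda>s. \<Sum>i<k. piece (a i) (b i) (c i) s)" for k
  proof (induction k)
    case 0 then show ?case by (simp add: step_zero assms(2))
  next
    case (Suc k)
    then have "0 \<le> a k" using f(2) by simp
    with Suc show ?case by (simp add: step_add step_piece assms(3,4))
  qed
  then show ?thesis using f(1) by blast
qed

lemma step_map:
  assumes "f \<in> \<S>" "h 0 = 0" "\<And>x y. h (x + y) = h x + h y"
  shows "(\<lambda>s. h (f s)) \<in> \<S>"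
  using assms(1)
proof (induction rule: step_induct)
  case (piece a b c)
  have "(\<lambda>s. h (piece a b c s)) = piece a b (h c)" by (auto simp: piece_def assms(2))
  then show ?case using piece by (simp add: step_piece)
qed (simp_all add: assms step_zero step_add)

lemma step_scaleC: "f \<in> \<S> ==> (\<lambda>s. c *\<^sub>C f s) \<in> \<S>"
  by (rule step_map) (auto simp: scaleC_add_right)

lemma step_diff: "f \<in> \<S> ==> g \<in> \<S> ==> (\<lambda>s. f s - g s) \<in> \<S>"
  using step_add[of f "\<lambda>s. (-1) *\<^sub>C g s"] step_scaleC[of g "-1"] by (simp add: scaleC_minus1)

lemma step_restr_below: "f \<in> \<S> ==> restr {0..<t} f \<in> \<S>"
proof (induction rule: step_induct)
  case (piece a b c)
  have "restr {0..<t} (piece a b c) = piece a (min b t) c" using piece by (auto simp: restr_def piece_def)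
  then show ?case using piece by (simp add: step_piece)
next
  case (add f g)
  have "restr {0..<t} (\<lambda>s. f s + g s) = (\<lambda>s. restr {0..<t} f s + restr {0..<t} g s)" by (auto simp: restr_def)
  then show ?case using add by (simp add: step_add)
qed (simp add: restr_def step_zero)

lemma step_restr_above: "f \<in> \<S> ==> restr {t..} f \<in> \<S>"
proof (induction rule: step_induct)
  case (piece a b c)
  have "restr {t..} (piece a b c) = piece (max a t) b c" using piece by (auto simp: restr_def piece_def)
  then show ?case using piece by (simp add: step_piece)
next
  case (add f g)
  have "restr {t..} (\<lambda>s. f s + g s) = (\<lambda>s. restr {t..} f s + restr {t..} g s)" by (auto simp: restr_def)
  then show ?case using add by (simp add: step_add)
qed (simp add: restr_def step_zero)

lemma step_neg: "f \<in> \<S> ==> s < 0 ==> f s = 0"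
  by (induction rule: step_induct) (auto simp: piece_def)

lemma step_right_continuous: "f \<in> \<S> ==> (f \<longlongrightarrow> f s) (at_right s)"
proof (induction rule: step_induct)
  case (piece a b c)
  have "eventually (\<lambda>u. piece a b c u = piece a b c s) (at_right s)"
  proof (cases "a \<le> s \<and> s < b")
    case True
    then show ?thesis unfolding eventually_at_right_field by (intro exI[of _ b]) (auto simp: piece_def)
  next
    case False
    show ?thesis
    proof (cases "s < a")
      case True
      then show ?thesis unfolding eventually_at_right_field by (intro exI[of _ a]) (auto simp: piece_def)
    next
      case F: False
      then have "b \<le> s" using False by auto
      then show ?thesis unfolding eventually_at_right_field by (intro exI[of _ "s + 1"]) (auto simp: piece_def)
    qed
  qed
  then show ?case by (rule tendsto_eventually)
qed (auto intro: tendsto_add)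

lemma step_piecewise_continuous: "f \<in> \<S> ==> \<exists>S. finite S \<and> (\<forall>s. s \<notin> S --> isCont f s)"
proof (induction rule: step_induct)
  case (piece a b c)
  have "isCont (piece a b c) s" if "s \<notin> {a, b}" for s
  proof -
    have "eventually (\<lambda>u. piece a b c u = piece a b c s) (nhds s)"
    proof (cases "s < a \<or> b < s")
      case True
      then have "eventually (\<lambda>u. u < a \<or> b < u) (nhds s)"
        by (intro eventually_nhds_in_open[of "{..<a} \<union> {b<..}" s, simplified]) auto
      then show ?thesis by eventually_elim (use True in \<open>auto simp: piece_def\<close>)
    next
      case False
      then have "s \<in> {a<..<b}" using that by auto
      then have "eventually (\<lambda>u. u \<in> {a<..<b}) (nhds s)" by (intro eventually_nhds_in_open) auto
      then show ?thesis by eventually_elim (use False that in \<open>auto simp: piece_def\<close>)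
    qed
    then show ?thesis by (subst isCont_cong) auto
  qed
  then show ?case by (intro exI[of _ "{a, b}"]) auto
next
  case (add f g)
  then obtain S S' where "finite S" "finite S'" "\<forall>s. s \<notin> S --> isCont f s" "\<forall>s. s \<notin> S' --> isCont g s" by blast
  then show ?case by (intro exI[of _ "S \<union> S'"]) auto
qed auto

lemma step_bounded: "f \<in> \<S> ==> \<exists>B. \<forall>s. norm (f s) \<le> B"
proof (induction rule: step_induct)
  case (piece a b c)
  then show ?case by (intro exI[of _ "norm c"]) (auto simp: piece_def)
next
  case (add f g)
  then obtain B C where "\<forall>s. norm (f s) \<le> B" "\<forall>s. norm (g s) \<le> C" by blast
  then show ?case by (intro exI[of _ "B + C"]) (auto intro: norm_triangle_le add_mono)
qed auto

lemma halfline_id: "(\<lambda>s. s) \<in> borel_measurable halfline"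
  unfolding halfline_def by (rule measurable_restrict_space1) simp

lemma step_sq_integrable: "f \<in> \<S> ==> sq_integrable halfline f"
proof (induction rule: step_induct)
  case zero
  then show ?case by (rule sq_integrable_zero)
next
  case (piece a b c)
  have "(\<integral>\<^sup>+s. ennreal ((norm (piece a b c s))\<^sup>2) \<partial>halfline) = (\<integral>\<^sup>+s. ennreal ((norm (piece a b c s))\<^sup>2) * indicator {0..} s \<partial>lborel)"
    unfolding halfline_def by (subst nn_integral_restrict_space) auto
  also have "\<dots> \<le> (\<integral>\<^sup>+s. ennreal ((norm c)\<^sup>2) * indicator {a..b} s \<partial>lborel)"
    by (intro nn_integral_mono) (auto simp: piece_def indicator_def)
  also have "\<dots> = ennreal ((norm c)\<^sup>2) * emeasure lborel {a..b}" by (simp add: nn_integral_cmult_indicator)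
  also have "\<dots> < \<infinity>" by (simp add: ennreal_mult_less_top emeasure_lborel_Icc_eq)
  finally show ?case unfolding sq_integrable_def
    using strongly_measurable_right_continuous[OF halfline_id step_right_continuous[OF step_piece[OF piece]]] by blast
next
  case (add f g)
  then show ?case by (intro sq_integrable_add)
qed

lemma step_L2_rel: "f \<in> \<S> ==> L2_rel f f"
  by (simp add: L2_rel_refl step_sq_integrable)

section \<open>Step functions as a total set of square-integrable functions\<close>

lemma abs_L2_step:
  assumes f: "f \<in> \<S>" and g: "g \<in> \<S>"
  shows "cinner (abs_L2 f) (abs_L2 g) = (\<integral>s. cinner (f s) (g s) \<partial>halfline)"
    "abs_L2 (\<lambda>s. f s + g s) = abs_L2 f + abs_L2 g" "abs_L2 (\<lambda>s. f s - g s) = abs_L2 f - abs_L2 g"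
    "abs_L2 (\<lambda>s. c *\<^sub>C f s) = c *\<^sub>C abs_L2 f"
  using step_L2_rel[OF f] step_L2_rel[OF g]
  by (simp_all add: cinner_L2.abs_eq plus_L2.abs_eq minus_L2.abs_eq scaleC_L2.abs_eq)

lemma step_cinner_integrable: "f \<in> \<S> ==> g \<in> \<S> ==> integrable halfline (\<lambda>s. cinner (f s) (g s))"
  by (intro cinner_integrable step_sq_integrable)

text \<open>Right-continuous functions that agree almost everywhere agree everywhere. Distinct step
  functions thus give distinct vectors, on which the linear independence of the exponential vectors
  rests.\<close>

lemma abs_L2_step_inject:
  assumes f: "f \<in> \<S>" and g: "g \<in> \<S>" and eq: "abs_L2 f = abs_L2 g"
  shows "f = g"
proof
  fix s
  show "f s = g s"
  proof (cases "s < 0")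
    case True then show ?thesis using step_neg f g by metis
  next
    case s: False
    have "L2_rel f g" using eq f g step_L2_rel Quotient3_rel[OF Quotient3_L2] by metis
    then have "AE u in halfline. f u = g u" by (simp add: L2_rel_def)
    then have AE: "AE u in lborel. u \<in> {0..} --> f u = g u"
      unfolding halfline_def by (subst (asm) AE_restrict_space_iff) auto
    show ?thesis
    proof (rule ccontr)
      assume ne: "f s \<noteq> g s"
      have "((\<lambda>u. f u - g u) \<longlongrightarrow> f s - g s) (at_right s)" by (intro tendsto_diff step_right_continuous f g)
      then have "eventually (\<lambda>u. dist (f u - g u) (f s - g s) < norm (f s - g s)) (at_right s)"
        using ne by (intro tendstoD) auto
      then obtain b where b: "b > s" "\<And>u. s < u ==> u < b ==> dist (f u - g u) (f s - g s) < norm (f s - g s)"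
        unfolding eventually_at_right_field by blast
      have "AE u in lborel. u \<notin> {s<..<b}"
        using AE
      proof eventually_elim
        case (elim u)
        show ?case
        proof
          assume "u \<in> {s<..<b}"
          then have "f u = g u" "dist (f u - g u) (f s - g s) < norm (f s - g s)" using elim s b(2)[of u] by simp_all
          then show False by (simp add: dist_norm norm_minus_commute)
        qed
      qed
      then have "emeasure lborel {s<..<b} = 0"
        by (subst (asm) AE_iff_measurable[of "{s<..<b}"]) auto
      then show False using b(1) by (simp add: emeasure_lborel_Ioo)
    qed
  qed
qed

text \<open>The positive and negative parts of \<open>\<phi>\<close> are densities of two measures
  with the same finite values on half-lines. The measures coincide, so the parts agree almost
  everywhere and, never being positive together, vanish.\<close>

lemma AE_zero_of_intervals:
  fixes \<phi> :: "real => real"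
  assumes int: "integrable lborel \<phi>" and zero: "\<And>x. (\<integral>s. indicator {x<..} s * \<phi> s \<partial>lborel) = 0"
  shows "AE s in lborel. \<phi> s = 0"
proof -
  have [measurable]: "\<phi> \<in> borel_measurable borel" using int by auto
  let ?p = "\<lambda>s. ennreal (\<phi> s)" and ?n = "\<lambda>s. ennreal (- \<phi> s)"
  have e: "emeasure (density lborel ?p) {x<..} = emeasure (density lborel ?n) {x<..} \<and> emeasure (density lborel ?p) {x<..} < \<infinity>" for x
  proof -
    let ?\<psi> = "\<lambda>s. indicator {x<..} s * \<phi> s"
    have i: "integrable lborel ?\<psi>" using integrable_mult_indicator[OF _ int, of "{x<..}"] by simp
    have p: "emeasure (density lborel ?p) {x<..} = (\<integral>\<^sup>+s. ennreal (?\<psi> s) \<partial>lborel)"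
      by (subst emeasure_density) (auto intro!: nn_integral_cong simp: indicator_def)
    have n: "emeasure (density lborel ?n) {x<..} = (\<integral>\<^sup>+s. ennreal (- ?\<psi> s) \<partial>lborel)"
      by (subst emeasure_density) (auto intro!: nn_integral_cong simp: indicator_def)
    have fin: "(\<integral>\<^sup>+s. ennreal (?\<psi> s) \<partial>lborel) < \<infinity>" "(\<integral>\<^sup>+s. ennreal (- ?\<psi> s) \<partial>lborel) < \<infinity>"
      using integrableD(2)[OF i] integrableD(3)[OF i] by (auto simp: less_top)
    have "enn2real (\<integral>\<^sup>+s. ennreal (?\<psi> s) \<partial>lborel) = enn2real (\<integral>\<^sup>+s. ennreal (- ?\<psi> s) \<partial>lborel)"
      using real_lebesgue_integral_def[OF i] zero by simp
    then have "ennreal (enn2real (\<integral>\<^sup>+s. ennreal (?\<psi> s) \<partial>lborel)) = ennreal (enn2real (\<integral>\<^sup>+s. ennreal (- ?\<psi> s) \<partial>lborel))"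
      by (rule arg_cong)
    then have "(\<integral>\<^sup>+s. ennreal (?\<psi> s) \<partial>lborel) = (\<integral>\<^sup>+s. ennreal (- ?\<psi> s) \<partial>lborel)"
      using fin by (simp only: ennreal_enn2real infinity_ennreal_def)
    then show ?thesis unfolding p n using fin by simp
  qed
  have "density lborel ?p = density lborel ?n"
    by (rule measure_eqI_lessThan) (use e in \<open>auto simp: e[THEN conjunct1, symmetric]\<close>)
  then have "AE s in lborel. ?p s = ?n s"
    by (subst (asm) sigma_finite_measure.density_unique_iff[OF sigma_finite_lborel]) auto
  then show ?thesis
    by eventually_elim (metis ennreal_eq_0_iff ennreal_neg neg_le_0_iff_le order_antisym le_cases)
qed

text \<open>Testing against \<open>piece\<close> shows that \<open>cinner c (h s)\<close> vanishes
  for almost every \<open>s\<close>, with a null set that depends on \<open>c\<close>. The separable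
  range of the representative \<open>h\<close> leaves only countably many \<open>c\<close> to
  test.\<close>

lemma ctotal_step: "ctotal (abs_L2 ` (\<S> :: (real => 'k::chilbert_space) set))"
  unfolding ctotal_def
proof (intro allI impI)
  fix x :: "'k L2" assume x: "\<forall>a\<in>abs_L2 ` \<S>. cinner a x = 0"
  define h where "h = rep_L2 x"
  have h: "sq_integrable halfline h" "x = abs_L2 h"
    unfolding h_def L2_rel_refl[symmetric]
    by (simp_all add: Quotient3_rep_reflp[OF Quotient3_L2] Quotient3_abs_rep[OF Quotient3_L2])
  have hr: "L2_rel h h" using h by (simp add: L2_rel_refl)
  have z: "AE s in halfline. cinner c (h s) = 0" for c
  proof -
    have "AE s in lborel. indicator {0..<real n} s *\<^sub>R (cinner c (h s)) = 0" for n
    proof -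
      let ?\<theta> = "\<lambda>s. indicator {0..<real n} s *\<^sub>R cinner c (h s)"
      have P: "piece 0 (real n) c \<in> \<S>" by (rule step_piece) simp
      have "integrable halfline (\<lambda>s. cinner (piece 0 (real n) c s) (h s))"
        by (intro cinner_integrable step_sq_integrable P h)
      then have "integrable lborel (\<lambda>s. indicator {0..} s *\<^sub>R cinner (piece 0 (real n) c s) (h s))"
        unfolding halfline_def by (subst (asm) integrable_restrict_space) (auto simp: set_integrable_def)
      also have "(\<lambda>s. indicator {0..} s *\<^sub>R cinner (piece 0 (real n) c s) (h s)) = ?\<theta>"
        by (auto simp: piece_def indicator_def)
      finally have int: "integrable lborel ?\<theta>" .
      have zero: "(\<integral>s. indicator {a<..} s *\<^sub>R ?\<theta> s \<partial>lborel) = 0" for a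
      proof -
        \<comment> \<open>Step functions are supported by the half-line, hence the left endpoint
          \<open>max a 0\<close>.\<close>
        have P: "piece (max a 0) (real n) c \<in> \<S>" by (rule step_piece) simp
        have "0 = cinner (abs_L2 (piece (max a 0) (real n) c)) (abs_L2 h)" using x P h(2) by auto
        also have "\<dots> = (\<integral>s. cinner (piece (max a 0) (real n) c s) (h s) \<partial>halfline)"
          by (rule cinner_L2.abs_eq[OF step_L2_rel[OF P] hr])
        also have "\<dots> = (\<integral>s. indicator {0..} s *\<^sub>R cinner (piece (max a 0) (real n) c s) (h s) \<partial>lborel)"
          unfolding halfline_def by (subst integral_restrict_space) (auto simp: set_lebesgue_integral_def)
        also have "\<dots> = (\<integral>s. indicator {a..} s *\<^sub>R ?\<theta> s \<partial>lborel)"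
          by (rule Bochner_Integration.integral_cong) (auto simp: piece_def indicator_def)
        also have "\<dots> = (\<integral>s. indicator {a<..} s *\<^sub>R ?\<theta> s \<partial>lborel)"
        proof (rule integral_cong_AE)
          have [measurable]: "?\<theta> \<in> borel_measurable borel" using int by auto
          show "(\<lambda>s. indicator {a..} s *\<^sub>R ?\<theta> s) \<in> borel_measurable lborel" by measurable
          show "(\<lambda>s. indicator {a<..} s *\<^sub>R ?\<theta> s) \<in> borel_measurable lborel" by measurable
          show "AE s in lborel. indicator {a..} s *\<^sub>R ?\<theta> s = indicator {a<..} s *\<^sub>R ?\<theta> s"
            using AE_lborel_singleton[of a] by eventually_elim (auto simp: indicator_def)
        qed
        finally show ?thesis by simp
      qed
      have ia: "integrable lborel (\<lambda>s. indicator {a<..} s *\<^sub>R ?\<theta> s)" for a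
        by (rule integrable_mult_indicator[OF _ int]) simp
      have "AE s in lborel. Re (?\<theta> s) = 0"
      proof (rule AE_zero_of_intervals)
        show "integrable lborel (\<lambda>s. Re (?\<theta> s))" using int by (rule integrable_Re)
        show "(\<integral>s. indicator {a<..} s * Re (?\<theta> s) \<partial>lborel) = 0" for a
          using integral_Re[OF ia[of a]] zero[of a] by (simp add: mult.assoc)
      qed
      moreover have "AE s in lborel. Im (?\<theta> s) = 0"
      proof (rule AE_zero_of_intervals)
        show "integrable lborel (\<lambda>s. Im (?\<theta> s))" using int by (rule integrable_Im)
        show "(\<integral>s. indicator {a<..} s * Im (?\<theta> s) \<partial>lborel) = 0" for a
          using integral_Im[OF ia[of a]] zero[of a] by (simp add: mult.assoc)
      qed
      ultimately show ?thesis by eventually_elim (simp only: complex_eq_iff zero_complex.simps)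
    qed
    then have "AE s in lborel. \<forall>n. indicator {0..<real n} s *\<^sub>R (cinner c (h s)) = 0"
      unfolding AE_all_countable by blast
    then have "AE s in lborel. s \<in> {0..} --> cinner c (h s) = 0"
    proof eventually_elim
      case (elim s)
      obtain n where "s < real n" using reals_Archimedean2 by blast
      then show ?case using elim[rule_format, of n] by (auto simp: indicator_def)
    qed
    then show ?thesis unfolding halfline_def by (subst AE_restrict_space_iff) auto
  qed
  obtain D where D: "countable D" "h ` space halfline \<subseteq> closure D"
    using h(1) unfolding sq_integrable_def strongly_measurable_def by blast
  have "AE s in halfline. \<forall>d\<in>D. cinner d (h s) = 0" using z D(1) by (simp add: AE_ball_countable)
  then have "AE s in halfline. h s = 0"
  proof (rule AE_mp, intro AE_I2 impI)
    fix s assume s: "s \<in> space halfline" and d: "\<forall>d\<in>D. cinner d (h s) = 0"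
    have "closed {d. cinner d (h s) = 0}"
      by (intro closed_Collect_eq continuous_on_cinner' continuous_intros)
    then have "closure D \<subseteq> {d. cinner d (h s) = 0}" using d by (intro closure_minimal) auto
    then have "cinner (h s) (h s) = 0" using D(2) s by blast
    then show "h s = 0" by (rule cinner_eq_zero)
  qed
  then have "L2_rel h (\<lambda>s. 0)" using h(1) by (simp add: L2_rel_def sq_integrable_zero)
  then have "abs_L2 h = abs_L2 (\<lambda>s. 0)" using Quotient3_rel[OF Quotient3_L2] by metis
  then show "x = 0" using h(2) by (simp add: zero_L2_def)
qed

section \<open>Exponential vectors\<close>

lemma scaleC_eq_0_iff [simp]: "c *\<^sub>C x = 0 \<longleftrightarrow> c = 0 \<or> x = 0" for x :: "'a::chilbert_space"
  using norm_scaleC[of c x] by (metis mult_eq_0_iff norm_eq_zero)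

subsection \<open>Totality\<close>

text \<open>The homogeneous polynomial of degree \<open>n\<close> whose coefficients are the values
  of \<open>\<phi>\<close> on lists, in the recursive form that suits induction on the
  degree.\<close>

fun list_form :: "'a set => nat => ('a list => complex) => ('a => complex) => complex" where
  "list_form J 0 \<phi> p = \<phi> []"
| "list_form J (Suc n) \<phi> p = (\<Sum>x\<in>J. p x * list_form J n (\<lambda>l. \<phi> (x # l)) p)"

lemma list_form_eq:
  assumes J: "finite J"
  shows "(\<Sum>l\<in>{l. set l \<subseteq> J \<and> length l = n}. prod_list (map p l) * \<phi> l) = list_form J n \<phi> p"
proof (induction n arbitrary: \<phi>)
  case 0
  have "{l::'a list. set l \<subseteq> J \<and> length l = 0} = {[]}" by auto
  then show ?case by simp
next
  case (Suc n)
  have "(\<Sum>l\<in>{l. set l \<subseteq> J \<and> length l = Suc n}. prod_list (map p l) * \<phi> l) =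
      (\<Sum>(l, x)\<in>{l. set l \<subseteq> J \<and> length l = n} \<times> J. p x * (prod_list (map p l) * \<phi> (x # l)))"
    unfolding lists_length_Suc_eq by (subst sum.reindex) (auto simp: inj_on_def case_prod_unfold mult.assoc)
  also have "\<dots> = (\<Sum>x\<in>J. \<Sum>l\<in>{l. set l \<subseteq> J \<and> length l = n}. p x * (prod_list (map p l) * \<phi> (x # l)))"
    by (subst sum.cartesian_product[symmetric], subst sum.swap) simp
  also have "\<dots> = list_form J (Suc n) \<phi> p"
    unfolding sum_distrib_left[symmetric] Suc.IH by simp
  finally show ?case .
qed

text \<open>For a symmetric multilinear form, differentiating in the direction \<open>e\<close>
  inserts \<open>e\<close> into one of \<open>n + 1\<close> equivalent slots.\<close>

lemma list_form_deriv:
  assumes J: "finite J" "e \<in> J" and sym: "\<And>l l'. mset l = mset l' ==> \<phi> l = \<phi> l'"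
  shows "((\<lambda>z. list_form J (Suc n) \<phi> (p(e := p e + z))) has_field_derivative
    of_nat (Suc n) * list_form J n (\<lambda>l. \<phi> (e # l)) (p(e := p e + z))) (at z)"
  using sym
proof (induction n arbitrary: \<phi>)
  case 0
  have "((\<lambda>z. \<Sum>x\<in>J. (p(e := p e + z)) x * \<phi> [x]) has_field_derivative (\<Sum>x\<in>J. if x = e then \<phi> [x] else 0)) (at z)"
    by (rule DERIV_sum) (auto intro!: derivative_eq_intros)
  then show ?case using J by simp
next
  case (Suc n)
  let ?q = "\<lambda>z. p(e := p e + z)"
  have "((\<lambda>z. \<Sum>x\<in>J. ?q z x * list_form J (Suc n) (\<lambda>l. \<phi> (x # l)) (?q z)) has_field_derivative
    (\<Sum>x\<in>J. (if x = e then 1 else 0) * list_form J (Suc n) (\<lambda>l. \<phi> (x # l)) (?q z) +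
      (of_nat (Suc n) * list_form J n (\<lambda>l. \<phi> (x # e # l)) (?q z)) * ?q z x)) (at z)"
  proof (rule DERIV_sum)
    fix x
    have d1: "((\<lambda>z. ?q z x) has_field_derivative (if x = e then 1 else 0)) (at z)"
      by (auto intro!: derivative_eq_intros)
    have d2: "((\<lambda>z. list_form J (Suc n) (\<lambda>l. \<phi> (x # l)) (?q z)) has_field_derivative
        of_nat (Suc n) * list_form J n (\<lambda>l. \<phi> (x # e # l)) (?q z)) (at z)"
      by (rule Suc.IH) (rule Suc.prems, simp)
    show "((\<lambda>z. ?q z x * list_form J (Suc n) (\<lambda>l. \<phi> (x # l)) (?q z)) has_field_derivative
      (if x = e then 1 else 0) * list_form J (Suc n) (\<lambda>l. \<phi> (x # l)) (?q z) +
      (of_nat (Suc n) * list_form J n (\<lambda>l. \<phi> (x # e # l)) (?q z)) * ?q z x) (at z)"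
      by (rule DERIV_mult[OF d1 d2])
  qed
  also have "(\<Sum>x\<in>J. (if x = e then 1 else 0) * list_form J (Suc n) (\<lambda>l. \<phi> (x # l)) (?q z) +
      (of_nat (Suc n) * list_form J n (\<lambda>l. \<phi> (x # e # l)) (?q z)) * ?q z x) =
      list_form J (Suc n) (\<lambda>l. \<phi> (e # l)) (?q z) + of_nat (Suc n) * list_form J (Suc n) (\<lambda>l. \<phi> (e # l)) (?q z)"
  proof -
    have "\<phi> (x # e # l) = \<phi> (e # x # l)" for x l by (rule Suc.prems) simp
    then have "(\<Sum>x\<in>J. (of_nat (Suc n) * list_form J n (\<lambda>l. \<phi> (x # e # l)) (?q z)) * ?q z x) =
        of_nat (Suc n) * list_form J (Suc n) (\<lambda>l. \<phi> (e # l)) (?q z)"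
      by (simp add: sum_distrib_left mult_ac del: fun_upd_apply of_nat_Suc)
    moreover have "(\<Sum>x\<in>J. (if x = e then 1 else 0) * list_form J (Suc n) (\<lambda>l. \<phi> (x # l)) (?q z)) =
        (\<Sum>x\<in>J. if x = e then list_form J (Suc n) (\<lambda>l. \<phi> (x # l)) (?q z) else 0)"
      by (intro sum.cong) auto
    ultimately show ?thesis using J by (simp add: sum.distrib del: list_form.simps)
  qed
  finally show ?case by (simp add: distrib_right add.commute del: fun_upd_apply)
qed

text \<open>Polarisation by differentiation: a polynomial that vanishes identically has vanishing
  derivatives, and differentiating along the entries of \<open>l\<close> isolates the symmetric
  coefficient.\<close>

lemma list_form_zero:
  assumes J: "finite J" and sym: "\<And>l l'. mset l = mset l' ==> \<phi> l = \<phi> l'"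
    and z: "\<And>p. list_form J n \<phi> p = 0" and l: "set l \<subseteq> J" "length l = n"
  shows "\<phi> l = 0"
  using sym z l
proof (induction n arbitrary: \<phi> l)
  case 0
  have "list_form J 0 \<phi> (\<lambda>_. 0) = 0" by (rule "0.prems"(2))
  then show ?case using "0.prems"(4) by simp
next
  case (Suc n)
  obtain e l' where l: "l = e # l'" "length l' = n" using Suc.prems(4) unfolding length_Suc_conv by blast
  have le: "e \<in> J" "set l' \<subseteq> J" using Suc.prems(3) unfolding l(1) by auto
  have "list_form J n (\<lambda>l. \<phi> (e # l)) p = 0" for p
  proof -
    have "((\<lambda>z. 0::complex) has_field_derivative of_nat (Suc n) * list_form J n (\<lambda>l. \<phi> (e # l)) (p(e := p e + 0))) (at 0)"
      using list_form_deriv[OF J le(1), of \<phi> n p 0, OF Suc.prems(1)] Suc.prems(2) by (simp only:)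
    then have "of_nat (Suc n) * list_form J n (\<lambda>l. \<phi> (e # l)) (p(e := p e + 0)) = 0"
      by (rule DERIV_unique) (rule DERIV_const)
    then show ?thesis by (simp del: of_nat_Suc)
  qed
  moreover have "\<phi> (e # l1) = \<phi> (e # l2)" if "mset l1 = mset l2" for l1 l2
    by (rule Suc.prems(1)) (simp add: that)
  ultimately show ?case unfolding l(1) using Suc.IH[OF _ _ le(2) l(2), of "\<lambda>l. \<phi> (e # l)"] by blast
qed

lemma power_series_zero:
  fixes a :: "nat => complex"
  assumes "\<And>w. (\<lambda>n. a n * w ^ n) sums 0" shows "a m = 0"
proof (induction m rule: less_induct)
  case (less m)
  have "((\<lambda>w. 0) \<longlongrightarrow> a (0 + m)) (at (0::complex))"
  proof (rule powser_limit_0_strong[of 1 "\<lambda>n. a (n + m)" "\<lambda>w. 0"])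
    fix w :: complex assume w: "w \<noteq> 0"
    have "(\<Sum>n<m. a n * w ^ n) = 0" using less by simp
    then have "(\<lambda>n. a (n + m) * w ^ (n + m)) sums 0"
      using sums_iff_shift[of "\<lambda>n. a n * w ^ n" m 0] assms[of w] by simp
    then have "(\<lambda>n. (a (n + m) * w ^ (n + m)) / w ^ m) sums (0 / w ^ m)" by (rule sums_divide)
    then show "(\<lambda>n. a (n + m) * w ^ n) sums 0" using w by (simp add: power_add)
  qed simp
  then show ?case using LIM_unique[OF tendsto_const] by fastforce
qed

lemma norm_expvec [simp]: "norm (expvec f) = 1"
proof -
  have "cinner (expvec f) (expvec f) = 1" unfolding cinner_expvec cinner_self[of f] by simp
  then show ?thesis by (simp add: norm_cinner)
qed

lemma tendsto_expvec: "f \<longlonglongrightarrow> g ==> (\<lambda>n. expvec (f n)) \<longlonglongrightarrow> expvec g"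
proof -
  assume f: "f \<longlonglongrightarrow> g"
  have eq: "(norm (expvec (f n) - expvec g))\<^sup>2 = 2 - 2 * Re (cinner (expvec g) (expvec (f n)))" for n
    using norm2_cinner[of "expvec (f n)"] norm2_cinner[of "expvec g"] cinner_commute[of "expvec (f n)" "expvec g"]
    by (simp add: norm2_cinner cinner_diff_left cinner_diff_right)
  have "(\<lambda>n. 2 - 2 * Re (cinner (expvec g) (expvec (f n)))) \<longlonglongrightarrow>
      2 - 2 * Re (exp (cinner g g - complex_of_real ((norm g)\<^sup>2 / 2 + (norm g)\<^sup>2 / 2)))"
    unfolding cinner_expvec by (intro tendsto_intros tendsto_cinner f tendsto_exp) auto
  then have "(\<lambda>n. (norm (expvec (f n) - expvec g))\<^sup>2) \<longlonglongrightarrow> 0" by (simp add: eq cinner_self)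
  then have "(\<lambda>n. sqrt ((norm (expvec (f n) - expvec g))\<^sup>2)) \<longlonglongrightarrow> sqrt 0" by (rule tendsto_real_sqrt)
  then show ?thesis by (simp add: tendsto_norm_zero_iff LIM_zero_iff)
qed

text \<open>For \<open>f w\<close> conjugate-linear in a parameter \<open>w\<close>, the pairing
  with \<open>\<xi>\<close> is, up to a Gaussian factor, a power series in \<open>w\<close> whose
  coefficients are the forms \<open>list_form\<close> of \<open>\<xi>\<close> at an arbitrary point
  \<open>p\<close>. All of them vanish, hence so do the symmetric coordinates of
  \<open>\<xi>\<close>.\<close>

lemma expvec_total: "(\<And>f. cinner (expvec f) \<xi> = 0) ==> \<xi> = 0" for \<xi> :: "'a::chilbert_space fock"
proof -
  assume z: "\<And>f. cinner (expvec f) \<xi> = 0"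
  have "Rep_fock \<xi> l = 0" if l: "set l \<subseteq> onb" for l
  proof -
    let ?J = "set l" and ?\<phi> = "Rep_fock \<xi>"
    have J: "finite ?J" by simp
    have "list_form ?J n ?\<phi> p = 0" for n p
    proof -
      \<comment> \<open>Conjugated coefficients, because the inner product is conjugate-linear in
        its first argument.\<close>
      define f where "f w = (\<Sum>e\<in>?J. (cnj w * cnj (p e)) *\<^sub>C e)" for w
      have cf: "coords (f w) e = (if e \<in> ?J then cnj w * cnj (p e) else 0)" for w e
      proof (cases "e \<in> onb")
        case True
        have "cinner e (f w) = (\<Sum>e'\<in>?J. if e' = e then cnj w * cnj (p e) else 0)"
          unfolding f_def cinner_sum_right cinner_scaleC_right
          by (rule sum.cong) (use True l in \<open>auto simp: cinner_onb subsetD\<close>)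
        then show ?thesis using True by (simp add: coords_def)
      qed (use l in \<open>auto simp: coords_def\<close>)
      \<comment> \<open>The normalisation depends on \<open>w\<close> but is never 0; it is divided
        out for each \<open>w\<close> separately.\<close>
      define K where "K w = exp (- (norm (f w))\<^sup>2 / 2)" for w
      let ?L = "\<lambda>n. {l'. set l' \<subseteq> ?J \<and> length l' = n}"
      have zero: "prod_list (map (coords (f w)) l') = 0" if "\<not> set l' \<subseteq> ?J" for l' w
        using that unfolding prod_list_zero_iff by (force simp: cf image_iff)
      have pr: "cnj (prod_list (map (coords (f w)) l')) = w ^ length l' * prod_list (map p l')" if "set l' \<subseteq> ?J" for l' w
        using that by (induction l') (auto simp: cf)
      have "(\<lambda>n. (list_form ?J n ?\<phi> p / complex_of_real (sqrt (fact n))) * w ^ n) sums 0" for w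
      proof -
        let ?g = "\<lambda>l'. cinner (Rep_fock (expvec (f w)) l') (?\<phi> l')"
        have "(?g has_sum 0) UNIV"
          using has_sum_infsum[OF l2_cinner_summable[OF fock_Rep(1) fock_Rep(1)], of "expvec (f w)" \<xi>] z[of "f w"]
          unfolding cinner_fock.rep_eq l2_cinner_def by simp
        moreover have bij: "bij_betw snd (Sigma UNIV (\<lambda>n. {l'::'a list. length l' = n})) UNIV"
          by (auto simp: bij_betw_def inj_on_def image_iff)
        ultimately have S: "((\<lambda>x. ?g (snd x)) has_sum 0) (Sigma UNIV (\<lambda>n. {l'. length l' = n}))"
          using has_sum_reindex_bij_betw[OF bij, of ?g 0] by simp
        have "((\<lambda>n. complex_of_real (K w) * ((list_form ?J n ?\<phi> p / complex_of_real (sqrt (fact n))) * w ^ n)) has_sum 0) UNIV"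
        proof (rule has_sum_SigmaD[OF S])
          fix n :: nat
          have "(?g has_sum (\<Sum>l'\<in>?L n. ?g l')) (?L n)"
            by (rule has_sum_finite) (simp add: finite_lists_length_eq)
          then have "(?g has_sum (\<Sum>l'\<in>?L n. ?g l')) {l'. length l' = n}"
          proof (rule has_sum_cong_neutral[THEN iffD1, rotated -1])
            fix l' assume "l' \<in> {l'. length l' = n} - ?L n"
            then have "prod_list (map (coords (f w)) l') = 0" by (intro zero) auto
            then show "?g l' = 0" by (simp add: Rep_expvec cinner_complex_def)
          qed auto
          moreover have "(\<Sum>l'\<in>?L n. ?g l') =
              complex_of_real (K w) * ((list_form ?J n ?\<phi> p / complex_of_real (sqrt (fact n))) * w ^ n)"
          proof -
            have "(\<Sum>l'\<in>?L n. ?g l') = (\<Sum>l'\<in>?L n. (complex_of_real (K w) / complex_of_real (sqrt (fact n)) * w ^ n) *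
                (prod_list (map p l') * ?\<phi> l'))"
              by (intro sum.cong refl) (auto simp: Rep_expvec cinner_complex_def pr K_def mult_ac)
            also have "\<dots> = (complex_of_real (K w) / complex_of_real (sqrt (fact n)) * w ^ n) * list_form ?J n ?\<phi> p"
              unfolding sum_distrib_left[symmetric] list_form_eq[OF J] ..
            finally show ?thesis by simp
          qed
          ultimately show "((\<lambda>y. ?g (snd (n, y))) has_sum
              complex_of_real (K w) * ((list_form ?J n ?\<phi> p / complex_of_real (sqrt (fact n))) * w ^ n)) {l'. length l' = n}"
            by simp
        qed
        then have "(\<lambda>n. complex_of_real (K w) * ((list_form ?J n ?\<phi> p / complex_of_real (sqrt (fact n))) * w ^ n)) sums 0"
          by (rule has_sum_imp_sums)
        from sums_mult[OF this, of "1 / complex_of_real (K w)"] show ?thesis by (simp add: K_def)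
      qed
      from power_series_zero[OF this, of n] show ?thesis by simp
    qed
    from list_form_zero[OF J fock_Rep(3) this, of l "length l"] show ?thesis by simp
  qed
  then have "Rep_fock \<xi> = (\<lambda>l. 0)" using fock_Rep(2)[of _ \<xi>] by blast
  then show "\<xi> = 0" by (intro Rep_fock_inject[THEN iffD1]) (simp add: zero_fock.rep_eq)
qed

text \<open>Step functions are dense by \<open>ctotal_step\<close>, and \<open>expvec\<close> is
  continuous, so a vector orthogonal to their exponential vectors is orthogonal to all exponential
  vectors.\<close>

lemma ctotal_varpi: "ctotal (varpi ` (\<S> :: (real => 'k::chilbert_space) set))"
  unfolding ctotal_def
proof (intro allI impI)
  fix \<xi> :: "'k fockspace" assume \<xi>: "\<forall>a\<in>varpi ` \<S>. cinner a \<xi> = 0"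
  let ?D = "abs_L2 ` (\<S> :: (real => 'k) set)"
  have "csubspace ?D"
    unfolding csubspace_def
  proof (intro conjI ballI allI)
    show "0 \<in> ?D" unfolding zero_L2_def using step_zero by (rule imageI)
    show "x + y \<in> ?D" if "x \<in> ?D" "y \<in> ?D" for x y
      using that by (auto simp: abs_L2_step(2)[symmetric] intro: step_add)
    show "c *\<^sub>C x \<in> ?D" if "x \<in> ?D" for c x
      using that by (auto simp: abs_L2_step(4)[symmetric] intro: step_scaleC)
  qed
  then have "cspan ?D \<subseteq> ?D" by (rule cspan_minimal) simp
  then have cl: "closure ?D = UNIV" using ctotal_closure[OF ctotal_step] closure_mono by blast
  show "\<xi> = 0"
  proof (rule expvec_total)
    fix f :: "'k L2"
    have "f \<in> closure ?D" using cl by simp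
    then obtain g where g: "\<And>n. g n \<in> ?D" "g \<longlonglongrightarrow> f" unfolding closure_sequential by blast
    have "(\<lambda>n. cinner (expvec (g n)) \<xi>) \<longlonglongrightarrow> cinner (expvec f) \<xi>"
      by (intro tendsto_cinner tendsto_const tendsto_expvec g)
    moreover have "cinner (expvec (g n)) \<xi> = 0" for n using g(1)[of n] \<xi> by (auto simp: varpi_def)
    ultimately show "cinner (expvec f) \<xi> = 0" by (simp add: LIMSEQ_const_iff)
  qed
qed

subsection \<open>Linear independence\<close>

lemma varpi_cinner: "cinner (varpi f) (varpi g) =
    exp (cinner (abs_L2 f) (abs_L2 g) - complex_of_real ((norm (abs_L2 f))\<^sup>2 / 2 + (norm (abs_L2 g))\<^sup>2 / 2))"
  unfolding varpi_def by (rule cinner_expvec)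

text \<open>Dedekind's argument: the characters \<open>h \<mapsto> exp \<langle>h, f\<rangle>\<close> of the additive group of step functions
  are distinct.\<close>

lemma characters_independent:
  fixes w :: "(real => 'k::chilbert_space) => 'h::chilbert_space"
  assumes "finite S" "S \<subseteq> \<S>"
    and "\<And>h. h \<in> \<S> ==> (\<Sum>f\<in>S. exp (cinner (abs_L2 h) (abs_L2 f)) *\<^sub>C w f) = 0"
  shows "\<forall>f\<in>S. w f = 0"
  using assms
proof (induction S arbitrary: w rule: finite_induct)
  case (insert g S)
  let ?\<chi> = "\<lambda>f h. exp (cinner (abs_L2 h) (abs_L2 f))"
  have g: "g \<in> \<S>" and S: "S \<subseteq> \<S>" using insert.prems by auto
  have mult: "?\<chi> f (\<lambda>s. h s + h' s) = ?\<chi> f h * ?\<chi> f h'" if "h \<in> \<S>" "h' \<in> \<S>" for f h h'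
    using that by (simp add: abs_L2_step cinner_add_left exp_add)
  have "w f = 0" if f: "f \<in> S" for f
  proof -
    have fg: "f \<in> \<S>" "f \<noteq> g" using f S insert.hyps by auto
    define d where "d = abs_L2 f - abs_L2 g"
    have d: "d \<noteq> 0" using abs_L2_step_inject[OF fg(1) g] fg(2) by (auto simp: d_def)
    \<comment> \<open>The scale makes \<open>cinner (abs_L2 h') d\<close> equal to 1, so the
      characters of \<open>f\<close> and \<open>g\<close> differ at \<open>h'\<close> by the factor
      \<open>exp 1\<close>.\<close>
    let ?c = "complex_of_real (1 / (norm d)\<^sup>2)"
    define h' where "h' = (\<lambda>s. ?c *\<^sub>C (f s - g s))"
    have h': "h' \<in> \<S>" unfolding h'_def by (intro step_scaleC step_diff fg g)
    have "abs_L2 h' = ?c *\<^sub>C d"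
      unfolding h'_def d_def using fg g by (simp add: abs_L2_step step_diff)
    then have "cinner (abs_L2 h') d = ?c * cinner d d" by (simp add: cinner_scaleC_left)
    then have "cinner (abs_L2 h') (abs_L2 f) = cinner (abs_L2 h') (abs_L2 g) + 1"
    proof -
      have "cinner (abs_L2 h') d = 1" using \<open>cinner (abs_L2 h') d = ?c * cinner d d\<close> d by (simp add: cinner_self)
      then have "cinner (abs_L2 h') (abs_L2 f) - cinner (abs_L2 h') (abs_L2 g) = 1" by (simp add: d_def cinner_diff_right)
      then show ?thesis by (simp add: diff_eq_eq add.commute)
    qed
    then have "?\<chi> f h' = ?\<chi> g h' * exp 1" by (simp add: exp_add)
    moreover have "exp (1::complex) \<noteq> 1" using exp_of_real[of 1] by (metis exp_eq_one_iff of_real_1 of_real_eq_1_iff zero_neq_one)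
    ultimately have ne: "?\<chi> f h' - ?\<chi> g h' \<noteq> 0" by simp
    \<comment> \<open>The relation at \<open>h + h'\<close> minus \<open>?\<chi> g h'\<close> times
      the relation at \<open>h\<close> no longer contains the term of \<open>g\<close>; the
      induction hypothesis applies to the modified coefficients.\<close>
    have "\<forall>f\<in>S. (?\<chi> f h' - ?\<chi> g h') *\<^sub>C w f = 0"
    proof (rule insert.IH[OF S])
      fix h :: "real => 'k" assume h: "h \<in> \<S>"
      have "(\<Sum>f\<in>insert g S. ?\<chi> f (\<lambda>s. h s + h' s) *\<^sub>C w f) = 0" using step_add[OF h h'] by (rule insert.prems(2))
      then have 1: "(?\<chi> g h * ?\<chi> g h') *\<^sub>C w g + (\<Sum>f\<in>S. (?\<chi> f h * ?\<chi> f h') *\<^sub>C w f) = 0"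
        using insert.hyps by (simp add: mult[OF h h'])
      have "?\<chi> g h' *\<^sub>C (\<Sum>f\<in>insert g S. ?\<chi> f h *\<^sub>C w f) = 0" using insert.prems(2)[OF h] by simp
      then have 2: "(?\<chi> g h * ?\<chi> g h') *\<^sub>C w g + (\<Sum>f\<in>S. (?\<chi> f h * ?\<chi> g h') *\<^sub>C w f) = 0"
        using insert.hyps by (simp add: scaleC_add_right scaleC_sum_right scaleC_scaleC mult.commute)
      have "(\<Sum>f\<in>S. ?\<chi> f h *\<^sub>C ((?\<chi> f h' - ?\<chi> g h') *\<^sub>C w f)) =
          (\<Sum>f\<in>S. (?\<chi> f h * ?\<chi> f h') *\<^sub>C w f) - (\<Sum>f\<in>S. (?\<chi> f h * ?\<chi> g h') *\<^sub>C w f)"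
        unfolding sum_subtractf[symmetric]
      proof (intro sum.cong refl)
        fix f
        show "?\<chi> f h *\<^sub>C ((?\<chi> f h' - ?\<chi> g h') *\<^sub>C w f) = (?\<chi> f h * ?\<chi> f h') *\<^sub>C w f - (?\<chi> f h * ?\<chi> g h') *\<^sub>C w f"
          unfolding scaleC_scaleC eq_diff_eq scaleC_add_left[symmetric] distrib_left[symmetric] by simp
      qed
      also have "\<dots> = 0" using add_left_imp_eq[OF trans[OF 1 2[symmetric]]] by simp
      finally show "(\<Sum>f\<in>S. ?\<chi> f h *\<^sub>C ((?\<chi> f h' - ?\<chi> g h') *\<^sub>C w f)) = 0" .
    qed
    then have "(?\<chi> f h' - ?\<chi> g h') *\<^sub>C w f = 0" using f by blast
    then show "w f = 0" using ne by simp
  qed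
  note wS = this
  have "?\<chi> g (\<lambda>s. 0) *\<^sub>C w g + (\<Sum>f\<in>S. ?\<chi> f (\<lambda>s. 0) *\<^sub>C w f) = 0"
    using insert.prems(2)[OF step_zero] insert.hyps by simp
  moreover have "(\<Sum>f\<in>S. ?\<chi> f (\<lambda>s. 0) *\<^sub>C w f) = 0" using wS by simp
  moreover have "abs_L2 (\<lambda>s. 0::'k) = 0" by (simp add: zero_L2_def)
  ultimately have "w g = 0" by simp
  then show ?case using wS by blast
qed simp

text \<open>Pairing the second factor with every \<open>varpi h\<close> turns the relation into one
  between characters with vector coefficients; the normalising factors \<open>?k\<close> are nonzero
  and are absorbed.\<close>

lemma exp_independent:
  fixes u :: "(real => 'k::chilbert_space) => 'h::chilbert_space"
  assumes S: "finite S" "S \<subseteq> \<S>" and z: "(\<Sum>f\<in>S. tensor (u f) (varpi f)) = 0" and f: "f \<in> S"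
  shows "u f = 0"
proof -
  let ?k = "\<lambda>f. exp (- complex_of_real ((norm (abs_L2 f))\<^sup>2 / 2))"
  have "\<forall>f\<in>S. ?k f *\<^sub>C u f = 0"
  proof (rule characters_independent[OF S])
    fix h :: "real => 'k" assume "h \<in> \<S>"
    have "bra (varpi h) (\<Sum>f\<in>S. tensor (u f) (varpi f)) = (\<Sum>f\<in>S. cinner (varpi h) (varpi f) *\<^sub>C u f)"
      by (simp add: bounded_ops_simps[OF bra_bounded] bra_tensor)
    also have "\<dots> = (\<Sum>f\<in>S. ?k h *\<^sub>C (exp (cinner (abs_L2 h) (abs_L2 f)) *\<^sub>C (?k f *\<^sub>C u f)))"
      by (intro sum.cong refl) (simp add: varpi_cinner scaleC_scaleC exp_add[symmetric] algebra_simps)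
    also have "\<dots> = ?k h *\<^sub>C (\<Sum>f\<in>S. exp (cinner (abs_L2 h) (abs_L2 f)) *\<^sub>C (?k f *\<^sub>C u f))"
      by (rule scaleC_sum_right[symmetric])
    finally have "?k h *\<^sub>C (\<Sum>f\<in>S. exp (cinner (abs_L2 h) (abs_L2 f)) *\<^sub>C (?k f *\<^sub>C u f)) = 0"
      using z by (simp add: bounded_ops_simps[OF bra_bounded])
    then show "(\<Sum>f\<in>S. exp (cinner (abs_L2 h) (abs_L2 f)) *\<^sub>C (?k f *\<^sub>C u f)) = 0"
      by simp
  qed
  then have "?k f *\<^sub>C u f = 0" using f by blast
  then show ?thesis by simp
qed

section \<open>The domain of exponential vectors and the gradient\<close>

definition exp_sum :: "(real => 'k::chilbert_space) set => ((real => 'k) => 'h::chilbert_space) => ('h, 'k fockspace) htensor"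
  where "exp_sum S u = (\<Sum>f\<in>S. tensor (u f) (varpi f))"

lemma sum_union_extend:
  fixes b :: "'x::zero => 'f => 'z::comm_monoid_add"
  assumes "finite S" "finite S'" "\<And>f. b 0 f = 0"
  shows "(\<Sum>f\<in>S\<union>S'. b (if f \<in> S then u f else 0) f) = (\<Sum>f\<in>S. b (u f) f)"
  by (rule sum.mono_neutral_cong_right) (use assms in auto)

text \<open>The sums are indexed by finite sets of distinct step functions, so that
  \<open>exp_independent\<close> makes the coefficients unique up to zeros. Sums over different
  index sets are compared by extending the coefficients by 0.\<close>

lemma proc_domain_eq:
  "(proc_domain :: ('h::chilbert_space, 'k::chilbert_space fockspace) htensor set) =
    {exp_sum S u | S u. finite S \<and> S \<subseteq> \<S>}" (is "_ = ?R")
proof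
  have R: "csubspace ?R"
    unfolding csubspace_def
  proof (intro conjI ballI allI)
    show "0 \<in> ?R" by (auto simp: exp_sum_def intro!: exI[of _ "{}"])
    fix x assume "x \<in> ?R"
    then obtain S u where x: "x = exp_sum S u" "finite S" "S \<subseteq> \<S>" by blast
    have "c *\<^sub>C x = exp_sum S (\<lambda>f. c *\<^sub>C u f)" for c by (simp add: x exp_sum_def scaleC_sum_right tensor_scaleC_left)
    then show "c *\<^sub>C x \<in> ?R" for c using x by blast
    fix y assume "y \<in> ?R"
    then obtain S' u' where y: "y = exp_sum S' u'" "finite S'" "S' \<subseteq> \<S>" by blast
    have "x + y = exp_sum (S \<union> S') (\<lambda>f. (if f \<in> S then u f else 0) + (if f \<in> S' then u' f else 0))"
      using sum_union_extend[of S S' "\<lambda>u f. tensor u (varpi f)" u] sum_union_extend[of S' S "\<lambda>u f. tensor u (varpi f)" u'] x y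
      by (simp add: exp_sum_def tensor_add_left sum.distrib Un_commute)
    then show "x + y \<in> ?R" using x y by blast
  qed
  show "proc_domain \<subseteq> ?R"
    unfolding alg_tensor_def
  proof (rule cspan_minimal[OF R], clarify)
    fix v :: 'h and \<epsilon> :: "'k fockspace" assume e: "\<epsilon> \<in> exp_domain"
    have "exp_domain \<subseteq> {\<epsilon>. tensor v \<epsilon> \<in> ?R}"
      unfolding exp_domain_def
    proof (rule cspan_minimal)
      show "csubspace {\<epsilon>. tensor v \<epsilon> \<in> ?R}"
        unfolding csubspace_def using csubspaceD[OF R] by (simp only: mem_Collect_eq tensor_add_right tensor_scaleC_right tensor_zero) blast
      show "varpi ` \<S> \<subseteq> {\<epsilon>. tensor v \<epsilon> \<in> ?R}"
        by (auto simp: exp_sum_def intro!: exI[of _ "{_}"] exI[of _ "\<lambda>_. v"])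
    qed
    then show "\<exists>S u. tensor v \<epsilon> = exp_sum S u \<and> finite S \<and> S \<subseteq> \<S>" using e by blast
  qed
  show "?R \<subseteq> proc_domain"
  proof clarify
    fix S :: "(real => 'k) set" and u :: "(real => 'k) => 'h" assume S: "S \<subseteq> \<S>"
    have "csubspace (proc_domain :: ('h, 'k fockspace) htensor set)" unfolding alg_tensor_def by (rule csubspace_cspan)
    then show "exp_sum S u \<in> proc_domain"
      unfolding exp_sum_def
    proof (rule csubspace_sum)
      fix f assume "f \<in> S"
      then have "varpi f \<in> exp_domain" unfolding exp_domain_def using S by (intro cspan_superset) auto
      then show "tensor (u f) (varpi f) \<in> proc_domain" unfolding alg_tensor_def by (intro cspan_superset) auto
    qed
  qed
qed

lemma csubspace_proc_domain: "csubspace proc_domain" unfolding alg_tensor_def by (rule csubspace_cspan)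

lemma tensor_varpi_in: "f \<in> \<S> ==> tensor u (varpi f) \<in> proc_domain"
  unfolding proc_domain_eq by (rule CollectI, rule exI[of _ "{f}"], rule exI[of _ "\<lambda>_. u"]) (simp add: exp_sum_def)

lemma clinear_on_sum:
  assumes L: "clinear_on D L" and "finite S" "\<And>i. i \<in> S ==> x i \<in> D"
  shows "L (\<Sum>i\<in>S. x i) = (\<Sum>i\<in>S. L (x i))"
proof -
  have D: "csubspace D" and add: "\<And>x y. x \<in> D ==> y \<in> D ==> L (x + y) = L x + L y"
    using L by (auto simp: clinear_on_def)
  have "0 \<in> D" using csubspaceD(1)[OF D] .
  then have L0: "L 0 = 0" using add[of 0 0] by simp
  show ?thesis using assms(2,3)
    by (induction S rule: finite_induct) (auto simp: add csubspace_sum[OF D] L0)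
qed

lemma proc_domain_linear_eq:
  assumes L: "clinear_on proc_domain L" "clinear_on proc_domain L'" and \<zeta>: "\<zeta> \<in> proc_domain"
    and eq: "\<And>u f. f \<in> \<S> ==> L (tensor u (varpi f)) = L' (tensor u (varpi f))"
  shows "L \<zeta> = L' \<zeta>"
proof -
  obtain S u where S: "\<zeta> = exp_sum S u" "finite S" "S \<subseteq> \<S>" using \<zeta> unfolding proc_domain_eq by blast
  have in_dom: "tensor (u f) (varpi f) \<in> proc_domain" if "f \<in> S" for f using S(3) that by (intro tensor_varpi_in) auto
  have "L \<zeta> = (\<Sum>f\<in>S. L (tensor (u f) (varpi f)))"
    unfolding S(1) exp_sum_def by (rule clinear_on_sum[OF L(1) S(2) in_dom])
  moreover have "L' \<zeta> = (\<Sum>f\<in>S. L' (tensor (u f) (varpi f)))"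
    unfolding S(1) exp_sum_def by (rule clinear_on_sum[OF L(2) S(2) in_dom])
  moreover have "(\<Sum>f\<in>S. L (tensor (u f) (varpi f))) = (\<Sum>f\<in>S. L' (tensor (u f) (varpi f)))"
    by (intro sum.cong refl eq) (use S(3) in auto)
  ultimately show ?thesis by simp
qed

text \<open>The coefficients of a vector of the domain are unique up to zeros, so prescribing the
  images of \<open>tensor u (varpi f)\<close> linearly in \<open>u\<close> is consistent. This
  supplies the operators selected by \<open>nabla_hat\<close> and by the solution process.\<close>

lemma linear_extension:
  fixes b :: "'h::chilbert_space => (real => 'k::chilbert_space) => 'z::chilbert_space"
  assumes add: "\<And>u v f. f \<in> \<S> ==> b (u + v) f = b u f + b v f"
    and scale: "\<And>c u f. f \<in> \<S> ==> b (c *\<^sub>C u) f = c *\<^sub>C b u f"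
  shows "\<exists>L. clinear_on proc_domain L \<and> (\<forall>u. \<forall>f\<in>\<S>. L (tensor u (varpi f)) = b u f)"
proof -
  \<comment> \<open>Linearity of \<open>b\<close> is assumed only for step functions; the value 0
    elsewhere makes it hold for every \<open>f\<close>.\<close>
  define b' where "b' u f = (if f \<in> \<S> then b u f else 0)" for u f
  have add': "b' (u + v) f = b' u f + b' v f" and scale': "b' (c *\<^sub>C u) f = c *\<^sub>C b' u f" for u v f c
    by (auto simp: b'_def add scale)
  have z: "b' 0 f = 0" for f using scale'[of 0 0 f] by simp
  have diff': "b' (u - v) f = b' u f - b' v f" for u v f using add'[of "u - v" v f] by simp
  define P where "P \<zeta> y \<longleftrightarrow> (\<exists>S u. \<zeta> = exp_sum S u \<and> finite S \<and> S \<subseteq> \<S> \<and> y = (\<Sum>f\<in>S. b' (u f) f))" for \<zeta> y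
  have uniq: "y = y'" if P: "P \<zeta> y" "P \<zeta> y'" for \<zeta> y y'
  proof -
    obtain S u S' u' where *: "\<zeta> = exp_sum S u" "finite S" "S \<subseteq> \<S>" "y = (\<Sum>f\<in>S. b' (u f) f)"
      "\<zeta> = exp_sum S' u'" "finite S'" "S' \<subseteq> \<S>" "y' = (\<Sum>f\<in>S'. b' (u' f) f)"
      using P unfolding P_def by blast
    let ?d = "\<lambda>f. (if f \<in> S then u f else 0) - (if f \<in> S' then u' f else 0)"
    have "(\<Sum>f\<in>S\<union>S'. tensor (?d f) (varpi f)) = 0"
      using sum_union_extend[of S S' "\<lambda>u f. tensor u (varpi f)" u] sum_union_extend[of S' S "\<lambda>u f. tensor u (varpi f)" u'] *
      by (simp add: exp_sum_def tensor_diff_left sum_subtractf Un_commute)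
    then have "?d f = 0" if "f \<in> S \<union> S'" for f
      by (rule exp_independent[rotated 2, OF _ that]) (use * in auto)
    then have "(\<Sum>f\<in>S\<union>S'. b' (?d f) f) = 0" using z by simp
    then show ?thesis
      using sum_union_extend[of S S' b' u] sum_union_extend[of S' S b' u'] * z
      by (simp add: diff' sum_subtractf Un_commute)
  qed
  define L where "L \<zeta> = (THE y. P \<zeta> y)" for \<zeta>
  have L: "L \<zeta> = y" if "P \<zeta> y" for \<zeta> y
    unfolding L_def using that uniq by (intro the_equality) auto
  have Pex: "\<exists>y. P \<zeta> y" if "\<zeta> \<in> proc_domain" for \<zeta> using that unfolding proc_domain_eq P_def by blast
  have Padd: "P (\<zeta> + \<zeta>') (y + y')" if P: "P \<zeta> y" "P \<zeta>' y'" for \<zeta> \<zeta>' y y'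
  proof -
    obtain S u S' u' where *: "\<zeta> = exp_sum S u" "finite S" "S \<subseteq> \<S>" "y = (\<Sum>f\<in>S. b' (u f) f)"
      "\<zeta>' = exp_sum S' u'" "finite S'" "S' \<subseteq> \<S>" "y' = (\<Sum>f\<in>S'. b' (u' f) f)"
      using P unfolding P_def by blast
    let ?d = "\<lambda>f. (if f \<in> S then u f else 0) + (if f \<in> S' then u' f else 0)"
    have "\<zeta> + \<zeta>' = exp_sum (S \<union> S') ?d"
      using sum_union_extend[of S S' "\<lambda>u f. tensor u (varpi f)" u] sum_union_extend[of S' S "\<lambda>u f. tensor u (varpi f)" u'] *
      by (simp add: exp_sum_def tensor_add_left sum.distrib Un_commute)
    moreover have "y + y' = (\<Sum>f\<in>S\<union>S'. b' (?d f) f)"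
      using sum_union_extend[of S S' b' u] sum_union_extend[of S' S b' u'] * z
      by (simp add: add' sum.distrib Un_commute)
    ultimately show ?thesis unfolding P_def using * by (intro exI[of _ "S \<union> S'"] exI[of _ ?d]) auto
  qed
  have Psc: "P (c *\<^sub>C \<zeta>) (c *\<^sub>C y)" if P: "P \<zeta> y" for c \<zeta> y
  proof -
    obtain S u where *: "\<zeta> = exp_sum S u" "finite S" "S \<subseteq> \<S>" "y = (\<Sum>f\<in>S. b' (u f) f)"
      using P unfolding P_def by blast
    then show ?thesis unfolding P_def
      by (intro exI[of _ S] exI[of _ "\<lambda>f. c *\<^sub>C u f"]) (auto simp: exp_sum_def scaleC_sum_right tensor_scaleC_left scale')
  qed
  have "clinear_on proc_domain L"
    unfolding clinear_on_def
  proof (intro conjI ballI allI csubspace_proc_domain)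
    fix \<zeta> :: "('h, 'k fockspace) htensor" assume z: "\<zeta> \<in> proc_domain"
    obtain y where y: "P \<zeta> y" using Pex[OF z] by blast
    show "L (c *\<^sub>C \<zeta>) = c *\<^sub>C L \<zeta>" for c by (simp add: L[OF y] L[OF Psc[OF y]])
    fix \<zeta>' :: "('h, 'k fockspace) htensor" assume z': "\<zeta>' \<in> proc_domain"
    obtain y' where y': "P \<zeta>' y'" using Pex[OF z'] by blast
    show "L (\<zeta> + \<zeta>') = L \<zeta> + L \<zeta>'" by (simp add: L[OF y] L[OF y'] L[OF Padd[OF y y']])
  qed
  moreover have "L (tensor u (varpi f)) = b u f" if "f \<in> \<S>" for u f
    by (rule L, unfold P_def, rule exI[of _ "{f}"], rule exI[of _ "\<lambda>_. u"]) (use that in \<open>auto simp: exp_sum_def b'_def\<close>)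
  ultimately show ?thesis by blast
qed

lemma
  fixes u :: "'h::chilbert_space" and f :: "real => 'k::chilbert_space"
  shows nabla_hat_linear: "clinear_on proc_domain (nabla_hat s :: ('h, 'k fockspace) htensor => _)"
    and nabla_hat_varpi: "f \<in> \<S> ==> nabla_hat s (tensor u (varpi f)) = tensor (khat (f s)) (tensor u (varpi f))"
proof -
  have "\<exists>L. clinear_on proc_domain L \<and>
    (\<forall>u::'h. \<forall>f::real => 'k\<in>\<S>. L (tensor u (varpi f)) = tensor (khat (f s)) (tensor u (varpi f)))"
    by (rule linear_extension) (auto simp: tensor_add_left tensor_add_right tensor_scaleC_left tensor_scaleC_right)
  note * = someI_ex[OF this, folded nabla_hat_def]
  show "clinear_on proc_domain (nabla_hat s :: ('h, 'k fockspace) htensor => _)" by (rule conjunct1[OF *])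
  show "f \<in> \<S> ==> nabla_hat s (tensor u (varpi f)) = tensor (khat (f s)) (tensor u (varpi f))"
    using conjunct2[OF *] by blast
qed

section \<open>Past and future\<close>

definition splice :: "real => (real => 'k::chilbert_space) => (real => 'k) => real => 'k"
  where "splice t f g s = (if s < t then f s else g s)"

definition tail :: "real => (real => 'k::chilbert_space) => (real => 'k) => complex"
  where "tail t f g = cinner (varpi (restr {t..} f)) (varpi (restr {t..} g))"

lemma splice_same [simp]: "splice t f f = f" by (auto simp: splice_def)

lemma splice_below: "s < t ==> splice t f g s = f s" by (simp add: splice_def)

lemma restr_splice [simp]: "restr {0..<t} (splice t f g) = restr {0..<t} f" "restr {t..} (splice t f g) = restr {t..} g"
  by (auto simp: restr_def splice_def)

lemma restr_splice_below: "s \<le> t ==> restr {0..<s} (splice t f g) = restr {0..<s} f"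
  by (auto simp: restr_def splice_def)

lemma step_splice:
  assumes "f \<in> \<S>" "g \<in> \<S>" "0 \<le> t" shows "splice t f g \<in> \<S>"
proof -
  have "splice t f g = (\<lambda>s. restr {0..<t} f s + restr {t..} g s)"
    using step_neg[OF assms(1)] assms(3) by (force simp: splice_def restr_def)
  then show ?thesis using step_add[OF step_restr_below step_restr_above] assms by simp
qed

lemma step_cinner_split:
  assumes f: "f \<in> \<S>" and g: "g \<in> \<S>" and t: "0 \<le> t"
  shows "cinner (abs_L2 f) (abs_L2 g) = cinner (abs_L2 (restr {0..<t} f)) (abs_L2 (restr {0..<t} g)) +
    cinner (abs_L2 (restr {t..} f)) (abs_L2 (restr {t..} g))"
proof -
  have split: "abs_L2 f = abs_L2 (restr {0..<t} f) + abs_L2 (restr {t..} f)" if f: "f \<in> \<S>" for f :: "real => 'a"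
  proof -
    have "f = (\<lambda>s. restr {0..<t} f s + restr {t..} f s)" using step_neg[OF f] t by (force simp: restr_def)
    then show ?thesis using abs_L2_step(2)[OF step_restr_below[OF f, of t] step_restr_above[OF f, of t]] by simp
  qed
  have ort: "cinner (abs_L2 (restr {0..<t} f)) (abs_L2 (restr {t..} g)) = 0"
    if "f \<in> \<S>" "g \<in> \<S>" for f g :: "real => 'a"
  proof -
    have "cinner (restr {0..<t} f s) (restr {t..} g s) = 0" for s by (simp add: restr_def)
    then show ?thesis by (simp add: abs_L2_step(1)[OF step_restr_below step_restr_above] that)
  qed
  have "cinner (abs_L2 (restr {t..} f)) (abs_L2 (restr {0..<t} g)) = 0"
    using ort[OF g f] cinner_commute by (metis complex_cnj_zero)
  then show ?thesis by (simp add: split[OF f] split[OF g] cinner_add_left cinner_add_right ort[OF f g])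
qed

lemma varpi_cinner_split:
  assumes f: "f \<in> \<S>" and g: "g \<in> \<S>" and t: "0 \<le> t"
  shows "cinner (varpi f) (varpi g) = cinner (varpi (restr {0..<t} f)) (varpi (restr {0..<t} g)) * tail t f g"
proof -
  have n: "(norm (abs_L2 f))\<^sup>2 = (norm (abs_L2 (restr {0..<t} f)))\<^sup>2 + (norm (abs_L2 (restr {t..} f)))\<^sup>2"
    if f: "f \<in> \<S>" for f :: "real => 'a"
    unfolding norm2_cinner step_cinner_split[OF f f t] by simp
  show ?thesis
    unfolding varpi_cinner tail_def exp_add[symmetric] step_cinner_split[OF assms] n[OF f] n[OF g]
    by (simp add: field_simps)
qed

lemma tail_same [simp]: "tail t f f = 1" by (simp add: tail_def varpi_def cinner_self)

lemma tail_commute: "tail t f g = cnj (tail t g f)" unfolding tail_def by (rule cinner_commute)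

lemma tail_splice [simp]: "tail t f (splice t f' g) = tail t f g" "tail t (splice t f' g) f = tail t g f"
  by (simp_all add: tail_def)

lemma tail_split:
  assumes "f \<in> \<S>" "g \<in> \<S>" "0 \<le> s" "s \<le> t"
  shows "tail s f g = cinner (varpi (restr {0..<t} (restr {s..} f))) (varpi (restr {0..<t} (restr {s..} g))) * tail t f g"
proof -
  have "restr {t..} (restr {s..} f) = restr {t..} f" for f :: "real => 'a" using assms(4) by (auto simp: restr_def)
  then have "tail t (restr {s..} f) (restr {s..} g) = tail t f g" by (simp add: tail_def)
  then show ?thesis
    using varpi_cinner_split[OF step_restr_above[OF assms(1), of s] step_restr_above[OF assms(2), of s], of t] assms
    by (simp add: tail_def)
qed

text \<open>Inner products factorise at time \<open>t\<close>, so both families have the same Gram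
  matrix and the correspondence is isometric.\<close>

lemma fock_split_exists:
  assumes t: "0 \<le> t"
  shows "\<exists>U\<in>\<B>. \<forall>f\<in>(\<S> :: (real => 'k::chilbert_space) set).
    U (varpi f) = tensor (varpi (restr {0..<t} f)) (varpi (restr {t..} f))"
proof -
  let ?b = "\<lambda>f::real => 'k. tensor (varpi (restr {0..<t} f)) (varpi (restr {t..} f))"
  have "\<exists>U\<in>\<B>. (\<forall>f\<in>\<S>. U (varpi f) = ?b f) \<and> op_bound U 1"
  proof (rule operator_of_family[OF ctotal_varpi])
    fix S :: "(real => 'k) set" and c assume S: "finite S" "S \<subseteq> \<S>"
    have "complex_of_real ((norm (\<Sum>f\<in>S. c f *\<^sub>C ?b f))\<^sup>2) = complex_of_real ((norm (\<Sum>f\<in>S. c f *\<^sub>C varpi f))\<^sup>2)"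
      unfolding norm_sum_sq
    proof (intro sum.cong refl)
      fix f g assume "f \<in> S" "g \<in> S"
      then have "cinner (varpi f) (varpi g) = cinner (?b f) (?b g)"
        using S by (subst varpi_cinner_split[OF _ _ t]) (auto simp: tail_def cinner_tensor)
      then show "cinner (c f *\<^sub>C ?b f) (c g *\<^sub>C ?b g) = cinner (c f *\<^sub>C varpi f) (c g *\<^sub>C varpi g)"
        by (simp add: cinner_scaleC_left cinner_scaleC_right)
    qed
    then have "(norm (\<Sum>f\<in>S. c f *\<^sub>C ?b f))\<^sup>2 = (norm (\<Sum>f\<in>S. c f *\<^sub>C varpi f))\<^sup>2" by (simp only: of_real_eq_iff)
    then show "norm (\<Sum>f\<in>S. c f *\<^sub>C ?b f) \<le> 1 * norm (\<Sum>f\<in>S. c f *\<^sub>C varpi f)" by (simp add: power2_eq_iff_nonneg)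
  qed simp
  then show ?thesis by blast
qed

text \<open>A rank-one operator on the future factor, conjugated by the splitting isometry
  \<open>U\<close>. No formula for \<open>adj U\<close> is available, so the result is read off from
  pairings with exponential vectors.\<close>

lemma future_op_exists:
  fixes g h :: "real => 'k::chilbert_space"
  assumes t: "0 \<le> t" and g: "g \<in> \<S>"
  shows "\<exists>W\<in>\<B>. \<forall>f\<in>\<S>. W (varpi f) = tail t h f *\<^sub>C varpi (splice t f g)"
proof -
  obtain U where U: "U \<in> \<B>"
    "\<And>f::real => 'k. f \<in> \<S> ==> U (varpi f) = tensor (varpi (restr {0..<t} f)) (varpi (restr {t..} f))"
    using fock_split_exists[OF t] by blast
  define R where "R = tensor_op (id :: 'k fockspace => _) (rank_one (varpi (restr {t..} g)) (varpi (restr {t..} h)))"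
  have R: "R \<in> \<B>" unfolding R_def by (rule tensor_op) simp_all
  have "(adj U \<circ> R \<circ> U) (varpi f) = tail t h f *\<^sub>C varpi (splice t f g)" if f: "f \<in> \<S>" for f
  proof (rule ctotalD[OF ctotal_varpi], clarify)
    fix f' :: "real => 'k" assume f': "f' \<in> \<S>"
    have "(adj U \<circ> R \<circ> U) (varpi f) = adj U (tensor (varpi (restr {0..<t} f)) (tail t h f *\<^sub>C varpi (restr {t..} g)))"
      by (simp add: U(2)[OF f] R_def tensor_op(2) rank_one_def tail_def)
    then have "cinner (varpi f') ((adj U \<circ> R \<circ> U) (varpi f)) =
        tail t h f * (cinner (varpi (restr {0..<t} f')) (varpi (restr {0..<t} f)) * tail t f' g)"
      by (simp add: adj_cinner[OF U(1)] U(2)[OF f'] tensor_scaleC_right cinner_scaleC_right cinner_tensor tail_def)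
    also have "\<dots> = cinner (varpi f') (tail t h f *\<^sub>C varpi (splice t f g))"
      unfolding cinner_scaleC_right varpi_cinner_split[OF f' step_splice[OF f g t] t] by simp
    finally show "cinner (varpi f') ((adj U \<circ> R \<circ> U) (varpi f)) = cinner (varpi f') (tail t h f *\<^sub>C varpi (splice t f g))" .
  qed
  moreover have "adj U \<circ> R \<circ> U \<in> \<B>" by (intro bounded_ops_compose R U adj_bounded_ops)
  ultimately show ?thesis by blast
qed

text \<open>\<open>I \<otimes> |\<varpi>(g\<^bsub>[t,\<infinity>[\<^esub>)\<rangle>\<langle>\<varpi>(h\<^bsub>[t,\<infinity>[\<^esub>)|\<close> with respect to the factorisation of \<open>F\<close> at time \<open>t\<close>.\<close>

definition future_op :: "real => (real => 'k::chilbert_space) => (real => 'k) => ('h::chilbert_space, 'k) fock_op"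
  where "future_op t g h = tensor_op id (SOME W. W \<in> \<B> \<and>
    (\<forall>f\<in>\<S>. W (varpi f) = tail t h f *\<^sub>C varpi (splice t f g)))"

lemma future_op:
  assumes "0 \<le> t" "g \<in> \<S>"
  shows future_op_bounded: "future_op t g h \<in> \<B>"
    and future_op_varpi: "f \<in> \<S> ==>
      future_op t g h (tensor u (varpi f)) = tail t h f *\<^sub>C tensor u (varpi (splice t f g))"
proof -
  let ?W = "SOME W. W \<in> \<B> \<and> (\<forall>f\<in>\<S>. W (varpi f) = tail t h f *\<^sub>C varpi (splice t f g))"
  have *: "?W \<in> \<B> \<and> (\<forall>f\<in>\<S>. ?W (varpi f) = tail t h f *\<^sub>C varpi (splice t f g))"
    by (rule someI_ex[OF future_op_exists[OF assms, unfolded Bex_def]])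
  show "future_op t g h \<in> \<B>" unfolding future_op_def using * by (intro tensor_op) auto
  show "f \<in> \<S> ==>
      future_op t g h (tensor u (varpi f)) = tail t h f *\<^sub>C tensor u (varpi (splice t f g))"
    unfolding future_op_def using * by (simp add: tensor_op(2) tensor_scaleC_right)
qed

lemma ctotal_tensor_varpi:
  "ctotal ((\<lambda>(u, f). tensor (u::'h::chilbert_space) (varpi f)) ` (UNIV \<times> (\<S> :: (real => 'k::chilbert_space) set)))"
proof -
  have *: "(\<lambda>(u, f). tensor (u::'h) (varpi f)) ` (UNIV \<times> (\<S> :: (real => 'k) set)) =
      {tensor b c | b c. b \<in> UNIV \<and> c \<in> varpi ` \<S>}" by auto
  show ?thesis unfolding * by (rule ctotal_tensor[OF ctotal_UNIV ctotal_varpi])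
qed

lemma bounded_ops_eq_varpiI:
  fixes S T :: "('h::chilbert_space, 'k::chilbert_space) fock_op"
  assumes "S \<in> \<B>" "T \<in> \<B>"
    and "\<And>u f v f'. f \<in> \<S> ==> f' \<in> \<S> ==>
      cinner (tensor v (varpi f')) (S (tensor u (varpi f))) = cinner (tensor v (varpi f')) (T (tensor u (varpi f)))"
  shows "S = T"
proof (rule bounded_ops_eqI[OF assms(1,2) ctotal_tensor_varpi], clarify)
  fix u :: 'h and f :: "real => 'k" assume f: "f \<in> \<S>"
  show "S (tensor u (varpi f)) = T (tensor u (varpi f))"
    by (rule ctotalD[OF ctotal_tensor_varpi]) (use assms(3) f in auto)
qed

lemma cinner_future_op:
  assumes t: "0 \<le> t" and g: "g \<in> \<S>" and f: "f \<in> \<S>" and f': "f' \<in> \<S>"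
  shows "cinner (tensor v (varpi f')) (future_op t g h (tensor u (varpi f))) =
    cinner v u * (tail t f' g * tail t h f * cinner (varpi (restr {0..<t} f')) (varpi (restr {0..<t} f)))"
  unfolding future_op_varpi[OF t g f] cinner_scaleC_right cinner_tensor
    varpi_cinner_split[OF f' step_splice[OF f g t] t] by simp

lemma adj_future_op:
  fixes g h :: "real => 'k::chilbert_space"
  assumes t: "0 \<le> t" and g: "g \<in> \<S>" and h: "h \<in> \<S>"
  shows "adj (future_op t g h) = (future_op t h g :: ('h::chilbert_space, 'k) fock_op)"
proof (rule bounded_ops_eq_varpiI)
  fix u v :: 'h and f f' :: "real => 'k" assume f: "f \<in> \<S>" "f' \<in> \<S>"
  have "cinner (tensor v (varpi f')) (adj (future_op t g h) (tensor u (varpi f))) =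
      cnj (cinner (tensor u (varpi f)) (future_op t g h (tensor v (varpi f'))))"
    unfolding adj_cinner(2)[OF future_op_bounded[OF t g]] by (rule cinner_commute)
  also have "\<dots> = cinner (tensor v (varpi f')) (future_op t h g (tensor u (varpi f)))"
    unfolding cinner_future_op[OF t g f(2,1)] cinner_future_op[OF t h f]
    using cinner_commute[of v u] tail_commute[of t f' h] tail_commute[of t g f]
      cinner_commute[of "varpi (restr {0..<t} f')" "varpi (restr {0..<t} f)"] by simp
  finally show "cinner (tensor v (varpi f')) (adj (future_op t g h) (tensor u (varpi f))) =
    cinner (tensor v (varpi f')) (future_op t h g (tensor u (varpi f)))" .
qed (simp_all add: future_op_bounded assms)

lemma bounded_ops_eq_on_varpiI:
  fixes R S :: "('h::chilbert_space, 'k::chilbert_space) fock_op"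
  assumes "R \<in> \<B>" "S \<in> \<B>"
    and "\<And>u f. f \<in> \<S> ==> R (tensor u (varpi f)) = S (tensor u (varpi f))"
  shows "R = S"
  by (rule bounded_ops_eqI[OF assms(1,2) ctotal_tensor_varpi]) (use assms(3) in auto)

abbreviation past_proj :: "real => (real => 'k::chilbert_space) => ('h::chilbert_space, 'k) fock_op"
  where "past_proj t g \<equiv> future_op t g g"

text \<open>The ranges increase with time: a vector whose future from \<open>s\<close> on is that of
  \<open>g\<close> has in particular this future from \<open>t\<close> on.\<close>

lemma past_proj_later:
  assumes s: "0 \<le> s" "s \<le> t" and g: "g \<in> \<S>"
  shows "past_proj t g (past_proj s g x) = past_proj s g (x :: ('h::chilbert_space, 'k::chilbert_space fockspace) htensor)"
proof -
  have t: "0 \<le> t" using s by simp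
  have "past_proj t g \<circ> past_proj s g = (past_proj s g :: ('h, 'k) fock_op)"
  proof (rule bounded_ops_eq_on_varpiI)
    fix u :: 'h and f :: "real => 'k" assume f: "f \<in> \<S>"
    have sp: "splice t (splice s f g) g = splice s f g" using s by (auto simp: splice_def)
    have "restr {t..} (splice s f g) = restr {t..} g" using s by (auto simp: splice_def restr_def)
    then have "tail t g (splice s f g) = 1" using tail_same[of t g] by (simp only: tail_def)
    then show "(past_proj t g \<circ> past_proj s g) (tensor u (varpi f)) = past_proj s g (tensor u (varpi f))"
      by (simp add: future_op_varpi[OF s(1) g f] future_op_varpi[OF t g step_splice[OF f g s(1)]]
          bounded_ops_simps[OF future_op_bounded[OF t g]] sp)
  qed (intro bounded_ops_compose future_op_bounded s t g)+
  then show ?thesis by (metis comp_apply)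
qed

lemma past_proj_norm:
  assumes t: "0 \<le> t" and g: "g \<in> \<S>"
  shows "norm (past_proj t g x) \<le> norm x"
proof -
  let ?P = "past_proj t g"
  have "(norm (?P x))\<^sup>2 = Re (cinner (adj ?P (?P x)) x)"
    unfolding norm2_cinner adj_cinner(1)[OF future_op_bounded[OF t g]] ..
  also have "\<dots> = Re (cinner (?P x) x)" unfolding adj_future_op[OF t g g] past_proj_later[OF t order_refl g] ..
  also have "\<dots> \<le> norm (?P x) * norm x" by (rule order_trans[OF complex_Re_le_cmod norm_cinner_le])
  finally show ?thesis by (cases "norm (?P x) = 0") (simp_all add: power2_eq_square)
qed

lemma adapted_iff:
  fixes X :: "real => ('h::chilbert_space, 'k::chilbert_space) fock_op"
  shows "adapted X \<longleftrightarrow> (\<forall>t\<ge>0. \<forall>f\<in>\<S>. \<forall>g\<in>\<S>. \<forall>u v.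
    cinner (tensor v (varpi f)) (X t (tensor u (varpi g))) =
    tail t f g * cinner (tensor v (varpi (restr {0..<t} f))) (X t (tensor u (varpi (restr {0..<t} g)))))"
proof -
  have "(bra (varpi f) \<xi> = tail t f g *\<^sub>C bra (varpi (restr {0..<t} f)) \<eta>) \<longleftrightarrow>
      (\<forall>v. cinner (tensor v (varpi f)) \<xi> = tail t f g * cinner (tensor v (varpi (restr {0..<t} f))) \<eta>)"
    for f g t and \<xi> \<eta> :: "('h, 'k fockspace) htensor"
    unfolding bra_cinner[symmetric] cinner_scaleC_right[symmetric] by (metis cinner_eqI)
  then show ?thesis unfolding adapted_def ket_def tail_def[symmetric] by blast
qed

subsection \<open>The energy identity\<close>

lemma head_cinner:
  fixes f g :: "real => 'k::chilbert_space"
  assumes f: "f \<in> \<S>" and g: "g \<in> \<S>" and t: "0 \<le> t"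
  shows "((\<lambda>s. cinner (f s) (g s)) has_integral cinner (abs_L2 (restr {0..<t} f)) (abs_L2 (restr {0..<t} g))) {0..t}"
proof -
  let ?\<phi> = "\<lambda>s. indicator {0..<t} s *\<^sub>R cinner (f s) (g s)"
  have eq: "cinner (restr {0..<t} f s) (restr {0..<t} g s) = ?\<phi> s" for s by (simp add: restr_def indicator_def)
  have h: "halfline = restrict_space lborel {0::real..}" by (rule halfline_def)
  have i: "integrable halfline ?\<phi>"
    using step_cinner_integrable[OF step_restr_below[OF f, of t] step_restr_below[OF g, of t]] by (simp add: eq)
  then have i': "integrable lborel ?\<phi>"
    unfolding h by (subst (asm) integrable_restrict_space) (auto elim!: Bochner_Integration.integrable_cong[THEN iffD1, rotated -1] simp: indicator_def)
  have "cinner (abs_L2 (restr {0..<t} f)) (abs_L2 (restr {0..<t} g)) = (\<integral>s. ?\<phi> s \<partial>halfline)"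
    unfolding abs_L2_step(1)[OF step_restr_below[OF f] step_restr_below[OF g]] eq ..
  also have "\<dots> = (\<integral>s. ?\<phi> s \<partial>lborel)"
    unfolding h by (subst integral_restrict_space) (auto intro!: Bochner_Integration.integral_cong simp: indicator_def)
  finally have "(?\<phi> has_integral cinner (abs_L2 (restr {0..<t} f)) (abs_L2 (restr {0..<t} g))) UNIV"
    using has_integral_integral_lborel[OF i'] by simp
  then have "((\<lambda>s. if s \<in> {0..t} then cinner (f s) (g s) else 0) has_integral cinner (abs_L2 (restr {0..<t} f)) (abs_L2 (restr {0..<t} g))) UNIV"
    by (rule has_integral_spike_finite[of "{t}", rotated 2]) (auto simp: indicator_def)
  then show ?thesis by (simp only: has_integral_restrict_UNIV)
qed

text \<open>All time dependence sits in the exponential of the primitive of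
  \<open>cinner (f s - g s) (f' s - g s)\<close>, so differentiating a Gram entry multiplies it by
  the inner product of the noise components.\<close>

lemma past_proj_gram:
  assumes t: "0 \<le> t" and g: "g \<in> \<S>" and f: "f \<in> \<S>" and f': "f' \<in> \<S>"
  shows "cinner (past_proj t g (tensor v (varpi f))) (past_proj t g (tensor u (varpi f'))) =
    cinner v u * (cinner (varpi f) (varpi g) * cinner (varpi g) (varpi f')) *
    exp (integral {0..t} (\<lambda>s. cinner (f s - g s) (f' s - g s)))"
proof -
  let ?r = "\<lambda>f. abs_L2 (restr {0..<t} f)" and ?hd = "\<lambda>f g. cinner (varpi (restr {0..<t} f)) (varpi (restr {0..<t} g))"
  have d: "?r (\<lambda>s. f s - g s) = ?r f - ?r g" if "f \<in> \<S>" for f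
  proof -
    have "restr {0..<t} (\<lambda>s. f s - g s) = (\<lambda>s. restr {0..<t} f s - restr {0..<t} g s)" by (auto simp: restr_def)
    then show ?thesis using abs_L2_step(3)[OF step_restr_below[OF that] step_restr_below[OF g]] by simp
  qed
  have int: "integral {0..t} (\<lambda>s. cinner (f s - g s) (f' s - g s)) = cinner (?r f - ?r g) (?r f' - ?r g)"
    using head_cinner[OF step_diff[OF f g] step_diff[OF f' g] t] by (simp only: d f f' integral_unique)
  have hd: "?hd f f' = ?hd f g * ?hd g f' * exp (cinner (?r f - ?r g) (?r f' - ?r g))"
    unfolding varpi_cinner exp_add[symmetric]
    by (rule arg_cong[of _ _ exp]) (simp add: cinner_diff_left cinner_diff_right cinner_self[of "?r g"] field_simps)
  have "cinner (past_proj t g (tensor v (varpi f))) (past_proj t g (tensor u (varpi f'))) =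
      cinner (tensor v (varpi f)) (past_proj t g (tensor u (varpi f')))"
    using adj_cinner(2)[OF future_op_bounded[OF t g], of "tensor v (varpi f)" g "past_proj t g (tensor u (varpi f'))"]
    unfolding adj_future_op[OF t g g] past_proj_later[OF t order_refl g] by simp
  also have "\<dots> = cinner v u * (tail t f g * tail t g f' * ?hd f f')" by (rule cinner_future_op[OF t g f' f])
  finally show ?thesis
    unfolding int hd varpi_cinner_split[OF f g t] varpi_cinner_split[OF g f' t] by (simp add: mult_ac)
qed

text \<open>\<open>N\<close> is a sum of Gram entries, and by \<open>past_proj_gram\<close> its
  derivative is the same sum with extra factors \<open>\<phi> f f' s\<close>, which is the squared
  norm under the integral. Step functions are continuous off a finite set, which the fundamental
  theorem of calculus tolerates.\<close>

lemma energy_identity: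
  fixes u :: "(real => 'k::chilbert_space) => 'h::chilbert_space"
  assumes rt: "0 \<le> r" "r \<le> t" and g: "g \<in> \<S>" and S: "finite S" "S \<subseteq> \<S>"
  defines "N \<equiv> \<lambda>s. (norm (past_proj s g (exp_sum S u)))\<^sup>2"
  shows "((\<lambda>s. (norm (\<Sum>f\<in>S. tensor (0::complex, f s - g s) (past_proj s g (tensor (u f) (varpi f)))))\<^sup>2)
    has_integral N t - N r) {r..t}"
proof -
  define \<phi> where "\<phi> f f' s = cinner (f s - g s) (f' s - g s)" for f f' :: "real => 'k" and s
  define c where "c f f' = cinner (u f) (u f') * (cinner (varpi f) (varpi g) * cinner (varpi g) (varpi f'))" for f f'
  define M where "M s = (\<Sum>f\<in>S. \<Sum>f'\<in>S. c f f' * exp (integral {0..s} (\<phi> f f')))" for s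
  define M' where "M' s = (\<Sum>f\<in>S. \<Sum>f'\<in>S. c f f' * (\<phi> f f' s * exp (integral {0..s} (\<phi> f f'))))" for s
  have st: "f \<in> \<S>" if "f \<in> S" for f using S(2) that by blast
  have M: "complex_of_real (N s) = M s" if "0 \<le> s" for s
    unfolding N_def M_def exp_sum_def bounded_ops_simps(5)[OF future_op_bounded[OF that g]] norm_sum_sq
    by (intro sum.cong refl) (simp add: past_proj_gram[OF that g st st] c_def \<phi>_def[abs_def])
  have M': "complex_of_real ((norm (\<Sum>f\<in>S. tensor (0::complex, f s - g s) (past_proj s g (tensor (u f) (varpi f)))))\<^sup>2) = M' s"
    if "0 \<le> s" for s
    unfolding M'_def norm_sum_sq
    by (intro sum.cong refl)
      (simp add: past_proj_gram[OF that g st st] c_def \<phi>_def[abs_def] cinner_tensor cinner_prod_def cinner_complex_def)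
  have "\<forall>f\<in>insert g S. \<exists>E. finite E \<and> (\<forall>s. s \<notin> E --> isCont f s)"
    using st g by (intro ballI step_piecewise_continuous) auto
  then obtain E where "\<forall>f\<in>insert g S. finite (E f) \<and> (\<forall>s. s \<notin> E f --> isCont f s)"
    by (elim exE[OF bchoice])
  then have E: "finite (E f)" "s \<notin> E f ==> isCont f s" if "f \<in> insert g S" for f s using that by auto
  define X where "X = (\<Union>f\<in>insert g S. E f)"
  have X: "finite X" unfolding X_def using S(1) E by blast
  have int: "\<phi> f f' integrable_on {0..t}" if "f \<in> S" "f' \<in> S" for f f'
    unfolding \<phi>_def using head_cinner[OF step_diff[OF st[OF that(1)] g] step_diff[OF st[OF that(2)] g], of t] rt
    by (auto simp: integrable_on_def)
  have cont: "isCont (\<phi> f f') s" if "f \<in> S" "f' \<in> S" "s \<notin> X" for f f' s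
  proof -
    have "isCont f s" "isCont f' s" "isCont g s" by (rule E(2); use that in \<open>simp add: X_def\<close>)+
    then show ?thesis unfolding \<phi>_def by (intro continuous_cinner continuous_intros)
  qed
  have "(M' has_integral M t - M r) {r..t}"
  proof (rule fundamental_theorem_of_calculus_interior_strong[OF X rt(2)])
    have "continuous_on {r..t} (\<lambda>s. integral {0..s} (\<phi> f f'))" if "f \<in> S" "f' \<in> S" for f f'
      by (rule continuous_on_subset[OF indefinite_integral_continuous_1[OF int[OF that]]]) (use rt in auto)
    then show "continuous_on {r..t} M" unfolding M_def by (intro continuous_intros) auto
    fix s assume s: "s \<in> {r<..<t} - X"
    have "((\<lambda>s. c f f' * exp (integral {0..s} (\<phi> f f'))) has_vector_derivative
        c f f' * (\<phi> f f' s * exp (integral {0..s} (\<phi> f f')))) (at s)" if "f \<in> S" "f' \<in> S" for f f'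
    proof -
      have "((\<lambda>s. integral {0..s} (\<phi> f f')) has_vector_derivative \<phi> f f' s) (at s within ({0..t} - {}))"
        by (rule integral_has_vector_derivative_continuous_at[OF int[OF that]])
          (use s rt cont[OF that] in \<open>auto intro: continuous_within_subset\<close>)
      then have "((\<lambda>s. integral {0..s} (\<phi> f f')) has_vector_derivative \<phi> f f' s) (at s)"
        using s rt by (simp add: at_within_Icc_at)
      from field_vector_diff_chain_at[OF this DERIV_exp]
      show ?thesis unfolding o_def by (rule has_vector_derivative_mult_right)
    qed
    then show "(M has_vector_derivative M' s) (at s)"
      unfolding M_def M'_def by (intro has_vector_derivative_sum)
  qed
  then have "((\<lambda>s. Re (M' s)) has_integral Re (M t - M r)) {r..t}" by (rule has_integral_Re)
  moreover have "Re (M t - M r) = N t - N r" using M[of t, symmetric] M[of r, symmetric] rt by simp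
  ultimately have "((\<lambda>s. Re (M' s)) has_integral N t - N r) {r..t}" by simp
  then show ?thesis by (rule has_integral_cong[THEN iffD1, rotated]) (use M' rt in \<open>simp flip: M'\<close>)
qed

text \<open>Optimising over \<open>\<mu>\<close> takes the place of Cauchy-Schwarz for integrals:
  only integrals of squares enter, and the product of the two functions never has to be
  integrated.\<close>

lemma le_of_weighted:
  fixes X A z b :: real
  assumes z: "z \<ge> 0" and b: "b \<ge> 0" and le: "\<And>\<mu>. \<mu> > 0 ==> X \<le> A + \<mu> / 2 * z\<^sup>2 + b / (2 * \<mu>)"
  shows "X \<le> A + z * sqrt b"
proof (rule field_le_epsilon)
  fix e :: real assume e: "e > 0"
  define d where "d = e / (z + sqrt b + 1)"
  have p: "z + sqrt b + 1 > 0" using z b by (simp add: add_nonneg_pos)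
  have d: "d > 0" "d * (z + sqrt b) \<le> e" using e p unfolding d_def by (auto simp: field_simps)
  \<comment> \<open>Close to the minimiser \<open>sqrt b / z\<close>; the shift by \<open>d\<close>
    keeps it positive and finite when \<open>z\<close> or \<open>b\<close> is 0.\<close>
  let ?\<mu> = "(sqrt b + d) / (z + d)"
  have pos: "sqrt b + d > 0" "z + d > 0" using d z b by (auto intro: add_nonneg_pos)
  have "z\<^sup>2 \<le> z * (z + d)" using z d by (simp add: power2_eq_square distrib_left)
  then have "?\<mu> / 2 * z\<^sup>2 \<le> ?\<mu> / 2 * (z * (z + d))" by (rule mult_left_mono) (use pos in auto)
  also have "\<dots> = (sqrt b + d) * z / 2" using pos by (simp add: field_simps)
  finally have 1: "?\<mu> / 2 * z\<^sup>2 \<le> (sqrt b + d) * z / 2" .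
  have "b \<le> sqrt b * (sqrt b + d)" using b d by (simp add: distrib_left)
  then have "b / (sqrt b + d) \<le> sqrt b" using pos by (simp add: divide_le_eq)
  then have "b / (sqrt b + d) * ((z + d) / 2) \<le> sqrt b * ((z + d) / 2)" by (rule mult_right_mono) (use pos in auto)
  moreover have "b / (2 * ?\<mu>) = b / (sqrt b + d) * ((z + d) / 2)" using pos by (simp add: field_simps)
  ultimately have 2: "b / (2 * ?\<mu>) \<le> sqrt b * ((z + d) / 2)" by (simp only:)
  have "X \<le> A + ?\<mu> / 2 * z\<^sup>2 + b / (2 * ?\<mu>)" by (rule le) (use pos in auto)
  also have "\<dots> \<le> A + z * sqrt b + d * (z + sqrt b) / 2" using 1 2 by (simp add: field_simps)
  also have "\<dots> \<le> A + z * sqrt b + e" using d e by simp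
  finally show "X \<le> A + z * sqrt b + e" .
qed

lemma tensor_op_id_right:
  assumes "T \<in> \<B>"
  shows "tensor_op id T \<in> \<B>" "tensor_op id T (tensor u v) = tensor u (T v)"
    "adj (tensor_op id T) = tensor_op id (adj T)"
  using assms by (simp_all add: tensor_op adj_tensor_op)

lemma nabla_hat_exp_sum:
  assumes "finite S" "S \<subseteq> \<S>"
  shows "nabla_hat s (exp_sum S u) = (\<Sum>f\<in>S. tensor (khat (f s)) (tensor (u f) (varpi f)))"
proof -
  have "nabla_hat s (exp_sum S u) = (\<Sum>f\<in>S. nabla_hat s (tensor (u f) (varpi f)))"
    unfolding exp_sum_def by (rule clinear_on_sum[OF nabla_hat_linear assms(1)]) (use assms(2) tensor_varpi_in in auto)
  then show ?thesis using assms(2) by (simp add: nabla_hat_varpi subset_iff)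
qed

text \<open>The noise part of the integrand is controlled by Cauchy--Schwarz and the energy identity, the
  time part by the bound on \<open>g\<close>.\<close>

lemma energy_estimate:
  fixes x :: "real => ('h::chilbert_space, 'k::chilbert_space) hat_space"
  assumes rt: "0 \<le> r" "r \<le> t" and g: "g \<in> \<S>" and c: "\<And>s. norm (khat (g s)) \<le> c"
    and \<zeta>: "\<zeta> \<in> proc_domain"
    and P: "\<And>s. s \<in> {r..t} ==> tensor_op id (past_proj s g) (x s) = x s"
    and b: "\<And>s. s \<in> {r..t} ==> norm (x s) \<le> \<beta> s"
    and b1: "(\<beta> has_integral b1) {r..t}" and b2: "((\<lambda>s. (\<beta> s)\<^sup>2) has_integral b2) {r..t}"
    and X: "((\<lambda>s. cinner (nabla_hat s \<zeta>) (x s)) has_integral X) {r..t}"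
  shows "cmod X \<le> (c * b1 + sqrt b2) * norm \<zeta>"
proof -
  obtain S u where S: "\<zeta> = exp_sum S u" "finite S" "S \<subseteq> \<S>" using \<zeta> unfolding proc_domain_eq by blast
  have st: "f \<in> \<S>" if "f \<in> S" for f using S(3) that by blast
  define D where "D s = (\<Sum>f\<in>S. tensor (0::complex, f s - g s) (past_proj s g (tensor (u f) (varpi f))))" for s
  let ?N = "\<lambda>s. (norm (past_proj s g \<zeta>))\<^sup>2"
  have D: "((\<lambda>s. (norm (D s))\<^sup>2) has_integral ?N t - ?N r) {r..t}"
    unfolding D_def S(1) by (rule energy_identity[OF rt g S(2,3)])
  have "?N t \<le> (norm \<zeta>)\<^sup>2" using past_proj_norm[OF order_trans[OF rt] g, of \<zeta>] by (intro power_mono) auto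
  moreover have "0 \<le> ?N r" by simp
  ultimately have N: "?N t - ?N r \<le> (norm \<zeta>)\<^sup>2" by linarith
  have c0: "c \<ge> 0" using norm_ge_zero c by (rule order_trans)
  have point: "cmod (cinner (nabla_hat s \<zeta>) (x s)) \<le> (c * norm \<zeta> + norm (D s)) * \<beta> s" if s: "s \<in> {r..t}" for s
  proof -
    have s0: "0 \<le> s" using s rt by auto
    note P_b = future_op_bounded[OF s0 g, of g]
    let ?Q = "tensor_op id (past_proj s g) :: ('h, 'k) hat_space => _"
    have "past_proj s g \<zeta> = (\<Sum>f\<in>S. past_proj s g (tensor (u f) (varpi f)))"
      unfolding S(1) exp_sum_def by (rule bounded_ops_simps(5)[OF P_b])
    moreover have "?Q (nabla_hat s \<zeta>) = (\<Sum>f\<in>S. tensor (khat (f s)) (past_proj s g (tensor (u f) (varpi f))))"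
      unfolding S(1) nabla_hat_exp_sum[OF S(2,3)]
      by (simp add: bounded_ops_simps(5)[OF tensor_op_id_right(1)[OF P_b]] tensor_op_id_right(2)[OF P_b])
    \<comment> \<open>\<open>khat (f s) = khat (g s) + (0, f s - g s)\<close>: the projected
      gradient splits into a part along \<open>g\<close> and the noise part
      \<open>D s\<close>.\<close>
    moreover have "(\<Sum>f\<in>S. tensor (khat (f s)) (past_proj s g (tensor (u f) (varpi f)))) =
        tensor (khat (g s)) (\<Sum>f\<in>S. past_proj s g (tensor (u f) (varpi f))) + D s"
      unfolding D_def tensor_sum_right sum.distrib[symmetric] tensor_add_left[symmetric] by (simp add: khat_def)
    ultimately have Q: "?Q (nabla_hat s \<zeta>) = tensor (khat (g s)) (past_proj s g \<zeta>) + D s" by simp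
    \<comment> \<open>Adaptedness of \<open>x s\<close> inserts the projection, which then moves to
      the other entry and meets the gradient.\<close>
    have "cinner (nabla_hat s \<zeta>) (x s) = cinner (nabla_hat s \<zeta>) (?Q (x s))" using P[OF s] by simp
    also have "\<dots> = cinner (?Q (nabla_hat s \<zeta>)) (x s)"
      using adj_cinner(1)[OF tensor_op_id_right(1)[OF P_b], of "nabla_hat s \<zeta>" "x s"]
      unfolding tensor_op_id_right(3)[OF P_b] adj_future_op[OF s0 g g] by simp
    finally have "cmod (cinner (nabla_hat s \<zeta>) (x s)) \<le> norm (?Q (nabla_hat s \<zeta>)) * norm (x s)"
      by (simp only: norm_cinner_le)
    also have "norm (?Q (nabla_hat s \<zeta>)) \<le> norm (khat (g s)) * norm (past_proj s g \<zeta>) + norm (D s)"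
      unfolding Q by (rule order_trans[OF norm_triangle_ineq]) (simp add: norm_tensor)
    also have "norm (khat (g s)) * norm (past_proj s g \<zeta>) \<le> c * norm \<zeta>"
      by (intro mult_mono c past_proj_norm s0 g c0 norm_ge_zero)
    finally have "cmod (cinner (nabla_hat s \<zeta>) (x s)) \<le> (c * norm \<zeta> + norm (D s)) * norm (x s)"
      by (simp add: mult_right_mono)
    also have "\<dots> \<le> (c * norm \<zeta> + norm (D s)) * \<beta> s" by (rule mult_left_mono[OF b[OF s]]) (simp add: c0)
    finally show ?thesis .
  qed
  have "cmod X \<le> c * b1 * norm \<zeta> + norm \<zeta> * sqrt b2"
  proof (rule le_of_weighted)
    show "b2 \<ge> 0" using b2 by (rule has_integral_nonneg) simp
    fix \<mu> :: real assume \<mu>: "\<mu> > 0"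
    have "((\<lambda>s. c * norm \<zeta> * \<beta> s + (\<mu> / 2 * (norm (D s))\<^sup>2 + 1 / (2 * \<mu>) * (\<beta> s)\<^sup>2)) has_integral
        c * norm \<zeta> * b1 + (\<mu> / 2 * (?N t - ?N r) + 1 / (2 * \<mu>) * b2)) {r..t}"
      by (intro has_integral_add has_integral_mult_right b1 b2 D)
    moreover have "cmod (cinner (nabla_hat s \<zeta>) (x s)) \<le> c * norm \<zeta> * \<beta> s + (\<mu> / 2 * (norm (D s))\<^sup>2 + 1 / (2 * \<mu>) * (\<beta> s)\<^sup>2)"
      if s: "s \<in> {r..t}" for s
    proof -
      \<comment> \<open>Young's inequality with weight \<open>\<mu>\<close> for the product of the
        noise norm and \<open>\<beta> s\<close>.\<close>
      have "0 \<le> (\<mu> * norm (D s) - \<beta> s)\<^sup>2 / (2 * \<mu>)" using \<mu> by simp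
      also have "\<dots> = \<mu> / 2 * (norm (D s))\<^sup>2 + 1 / (2 * \<mu>) * (\<beta> s)\<^sup>2 - norm (D s) * \<beta> s"
        using \<mu> by (simp add: power2_eq_square field_simps)
      finally show ?thesis using point[OF s] by (simp add: distrib_right)
    qed
    ultimately have "cmod X \<le> c * norm \<zeta> * b1 + (\<mu> / 2 * (?N t - ?N r) + 1 / (2 * \<mu>) * b2)"
      using X by (metis (no_types, lifting) has_integral_iff integral_norm_bound_integral)
    also have "\<mu> / 2 * (?N t - ?N r) \<le> \<mu> / 2 * (norm \<zeta>)\<^sup>2" using N \<mu> by simp
    finally show "cmod X \<le> c * b1 * norm \<zeta> + \<mu> / 2 * (norm \<zeta>)\<^sup>2 + b2 / (2 * \<mu>)" by (simp add: mult_ac)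
  qed simp
  then show ?thesis by (simp add: algebra_simps)
qed

section \<open>The coefficient of the QS differential equation\<close>

locale flow =
  fixes A :: "('h::chilbert_space => 'h) set"
    and j :: "real => ('h => 'h) => ('h, 'k::chilbert_space) fock_op"
    and F :: "(complex \<times> 'k, 'h) htensor => (complex \<times> 'k, 'h) htensor"
  assumes A: "von_neumann_algebra A" and flow: "qs_flow A j" and F: "F \<in> uw_tensor \<B> A"
begin

lemma F_amp: "F \<in> amp_commutant A" using F unfolding uw_tensor_eq[OF A] .

lemma hom: "0 \<le> s ==> normal_hom A (j s)"
  using flow A unfolding qs_flow_def qs_cocycle_def by unfold_locales auto

lemma process: "a \<in> A ==> process_in A (\<lambda>s. j s a)"
  using flow unfolding qs_flow_def qs_cocycle_def mapping_process_def by auto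

lemma j_bounded: "0 \<le> s ==> a \<in> A ==> j s a \<in> \<B>"
  using normal_cb.\<Phi>_bounded[OF normal_hom.axioms(1)[OF hom]] .

lemma j_weakly_continuous:
  assumes a: "a \<in> A" shows "continuous_on UNIV (\<lambda>s. cinner \<eta> (j (max 0 s) a \<zeta>))"
proof -
  have "continuous_map (top_of_set {0..}) ultraweak (\<lambda>s. j s a)" using flow a unfolding qs_flow_def by blast
  from continuous_map_compose[OF this continuous_map_cinner]
  have "continuous_on {0..} (\<lambda>s. cinner \<eta> (j s a \<zeta>))" by (simp add: o_def)
  then show ?thesis by (rule continuous_on_compose2) (auto intro: continuous_intros)
qed

text \<open>Extended to negative times by its value at \<open>0\<close>.\<close>

definition K :: "((complex \<times> 'k, 'h) htensor => (complex \<times> 'k, 'h) htensor) => real => ('h, 'k) hat_space => ('h, 'k) hat_space"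
  where "K G s = id_tensor_map A (j (max 0 s)) G"

lemma K_eq: "0 \<le> s ==> K G s = id_tensor_map A (j s) G" by (simp add: K_def)

context
  fixes G :: "(complex \<times> 'k, 'h) htensor => (complex \<times> 'k, 'h) htensor"
  assumes G: "G \<in> amp_commutant A"
begin

lemma K_bounded: "K G s \<in> \<B>"
  unfolding K_def by (rule normal_cb.id_tensor_map_bounded[OF normal_hom.axioms(1)[OF hom] G]) simp

lemma K_bound: "op_bound G \<kappa> ==> 0 \<le> \<kappa> ==> op_bound (K G s) \<kappa>"
  unfolding K_def by (rule normal_hom.id_tensor_map_contractive[OF hom G]) simp_all

lemma K_cinner: "cinner (tensor x u) (K G s (tensor y v)) = cinner u (j (max 0 s) (slice x G y) v)"
  unfolding K_def by (rule normal_cb.id_tensor_map_cinner[OF normal_hom.axioms(1)[OF hom] G]) simp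

text \<open>The slice formula reduces elementary tensors to the ultraweak continuity of
  \<open>j\<close>. The uniform bound of \<open>K G s\<close> extends this first to all right
  entries and then, after conjugation, to all left entries.\<close>

lemma K_weakly_continuous: "((\<lambda>s. cinner \<eta> (K G s \<zeta>)) \<longlongrightarrow> cinner \<eta> (K G s0 \<zeta>)) (at s0)"
proof -
  obtain \<kappa> where \<kappa>: "0 \<le> \<kappa>" "op_bound G \<kappa>" using bounded_ops_bound[OF amp_commutant_bounded[OF G]] by blast
  note b = K_bound[OF \<kappa>(2,1)]
  have func: "(\<lambda>\<zeta>. cinner \<xi> (T \<zeta>)) \<in> \<B> \<and> op_bound (\<lambda>\<zeta>. cinner \<xi> (T \<zeta>)) (norm \<xi> * \<kappa>)"
    if T: "T \<in> \<B>" "op_bound T \<kappa>" for \<xi> :: "'z::chilbert_space" and T :: "'y::chilbert_space => 'z"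
  proof -
    have "cmod (cinner \<xi> (T \<zeta>)) \<le> norm \<xi> * (\<kappa> * norm \<zeta>)" for \<zeta>
      using T(2) by (intro order_trans[OF norm_cinner_le] mult_left_mono) (auto simp: op_bound_def)
    then have "op_bound (\<lambda>\<zeta>. cinner \<xi> (T \<zeta>)) (norm \<xi> * \<kappa>)" by (simp add: op_bound_def mult.assoc)
    then show ?thesis
      by (intro conjI bounded_opsI) (auto simp: bounded_ops_simps[OF T(1)] cinner_add_right cinner_scaleC_right scaleC_complex_def)
  qed
  have tot: "ctotal {tensor x u | (x :: complex \<times> 'k) (u :: ('h, 'k fockspace) htensor). x \<in> UNIV \<and> u \<in> UNIV}"
    by (rule ctotal_tensor[OF ctotal_UNIV ctotal_UNIV])
  have 1: "((\<lambda>s. cinner (tensor x u) (K G s \<zeta>)) \<longlongrightarrow> cinner (tensor x u) (K G s0 \<zeta>)) (at s0)" for x u \<zeta>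
  proof (rule tendsto_bounded_ops_total[where T = "\<lambda>s \<zeta>. cinner (tensor x u) (K G s \<zeta>)", OF _ _ _ tot])
    fix b :: "('h, 'k) hat_space" assume "b \<in> {tensor x u | x u. x \<in> UNIV \<and> u \<in> UNIV}"
    then obtain y v where b: "b = tensor y v" by blast
    have "slice x G y \<in> A" by (rule slice_in[OF A G])
    from j_weakly_continuous[OF this, of u v]
    show "((\<lambda>s. cinner (tensor x u) (K G s b)) \<longlongrightarrow> cinner (tensor x u) (K G s0 b)) (at s0)"
      unfolding b K_cinner by (simp add: continuous_on_def)
  qed (use func[OF K_bounded b] in auto)
  have "((\<lambda>s. cinner (K G s \<zeta>) \<eta>) \<longlongrightarrow> cinner (K G s0 \<zeta>) \<eta>) (at s0)" for \<eta>
  proof (rule tendsto_bounded_ops_total[where T = "\<lambda>s \<eta>. cinner (K G s \<zeta>) \<eta>", OF _ _ _ tot])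
    have "op_bound (\<lambda>\<eta>. cinner (K G s \<zeta>) \<eta>) (\<kappa> * norm \<zeta>)" for s
      unfolding op_bound_def using b[of s]
      by (auto intro!: order_trans[OF norm_cinner_le] mult_right_mono simp: op_bound_def)
    then show "op_bound (\<lambda>\<eta>. cinner (K G s \<zeta>) \<eta>) (\<kappa> * norm \<zeta>)" for s .
    then show "(\<lambda>\<eta>. cinner (K G s \<zeta>) \<eta>) \<in> \<B>" for s
      by (intro bounded_opsI) (auto simp: cinner_add_right cinner_scaleC_right scaleC_complex_def)
    then show "(\<lambda>\<eta>. cinner (K G s0 \<zeta>) \<eta>) \<in> \<B>" .
    fix b :: "('h, 'k) hat_space" assume "b \<in> {tensor x u | x u. x \<in> UNIV \<and> u \<in> UNIV}"
    then obtain y v where b: "b = tensor y v" by blast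
    show "((\<lambda>s. cinner (K G s \<zeta>) b) \<longlongrightarrow> cinner (K G s0 \<zeta>) b) (at s0)"
      unfolding b using tendsto_cnj[OF 1[of y v \<zeta>]] by (simp add: cinner_commute[symmetric])
  qed
  from tendsto_cnj[OF this] show ?thesis by (simp add: cinner_commute[symmetric])
qed

text \<open>Matrix coefficients of \<open>K G s\<close> are those of \<open>j\<close> at slices, so
  commutation with all \<open>j (max 0 s) a\<close> passes to the ampliation. It is applied to
  operators on the future and to the commutant of \<open>A\<close>.\<close>

lemma K_commute:
  assumes W: "W \<in> \<B>" and comm: "\<And>a v. a \<in> A ==> j (max 0 s) a (W v) = W (j (max 0 s) a v)"
  shows "K G s (tensor_op id W \<zeta>) = tensor_op id W (K G s \<zeta>)"
proof -
  have "K G s \<circ> tensor_op id W = tensor_op id W \<circ> K G s"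
  proof (rule bounded_ops_eq_tensorI)
    fix y :: "complex \<times> 'k" and v
    show "(K G s \<circ> tensor_op id W) (tensor y v) = (tensor_op id W \<circ> K G s) (tensor y v)"
    proof (rule ctotalD[OF ctotal_tensors], clarify)
      fix x :: "complex \<times> 'k" and u :: "('h, 'k fockspace) htensor"
      have "cinner (tensor x u) ((tensor_op id W \<circ> K G s) (tensor y v)) = cinner (adj (tensor_op id W) (tensor x u)) (K G s (tensor y v))"
        by (simp add: adj_cinner(1)[OF tensor_op_id_right(1)[OF W]])
      also have "\<dots> = cinner (tensor x (adj W u)) (K G s (tensor y v))"
        by (simp add: tensor_op_id_right[OF W] tensor_op_id_right(2)[OF adj_bounded_ops[OF W]])
      also have "\<dots> = cinner u (W (j (max 0 s) (slice x G y) v))"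
        unfolding K_cinner adj_cinner(1)[OF W] ..
      also have "\<dots> = cinner (tensor x u) ((K G s \<circ> tensor_op id W) (tensor y v))"
        by (simp add: tensor_op_id_right(2)[OF W] K_cinner comm[OF slice_in[OF A G]])
      finally show "cinner (tensor x u) ((K G s \<circ> tensor_op id W) (tensor y v)) =
          cinner (tensor x u) ((tensor_op id W \<circ> K G s) (tensor y v))" ..
    qed
  qed (intro bounded_ops_compose K_bounded tensor_op_id_right W)+
  then show ?thesis by (metis comp_apply)
qed

lemma K_adj: "K (adj G) s = adj (K G s)"
  unfolding K_def by (rule normal_hom.id_tensor_map_adj[OF hom G]) simp

end

text \<open>\<open>(norm (K G s \<zeta>))\<^sup>2\<close> is a matrix coefficient of
  \<open>K (adj G \<circ> G) s\<close>, hence continuous in \<open>s\<close>; weak convergence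
  together with convergence of the norms is strong convergence.\<close>

lemma K_continuous: assumes G: "G \<in> amp_commutant A" shows "isCont (\<lambda>s. K G s \<zeta>) s0"
proof -
  have G2: "adj G \<circ> G \<in> amp_commutant A" by (intro amp_commutant_compose amp_commutant_adj A G)
  have comp: "K (adj G \<circ> G) s = adj (K G s) \<circ> K G s" for s
    unfolding K_adj[OF G, symmetric] unfolding K_def
    by (rule normal_hom.id_tensor_map_compose[OF hom amp_commutant_adj[OF A G] G]) simp
  have sq: "(norm (K G s \<zeta>))\<^sup>2 = Re (cinner \<zeta> (K (adj G \<circ> G) s \<zeta>))" for s
    by (simp add: comp adj_cinner[OF K_bounded[OF G]] norm2_cinner)
  have eq: "(norm (K G s \<zeta> - K G s0 \<zeta>))\<^sup>2 = Re (cinner \<zeta> (K (adj G \<circ> G) s \<zeta>)) -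
      2 * Re (cinner (K G s0 \<zeta>) (K G s \<zeta>)) + Re (cinner \<zeta> (K (adj G \<circ> G) s0 \<zeta>))" for s
    using sq[of s] sq[of s0] cinner_commute[of "K G s \<zeta>" "K G s0 \<zeta>"]
    by (simp add: norm2_cinner cinner_diff_left cinner_diff_right)
  have "((\<lambda>s. (norm (K G s \<zeta> - K G s0 \<zeta>))\<^sup>2) \<longlongrightarrow> Re (cinner \<zeta> (K (adj G \<circ> G) s0 \<zeta>)) -
      2 * Re (cinner (K G s0 \<zeta>) (K G s0 \<zeta>)) + Re (cinner \<zeta> (K (adj G \<circ> G) s0 \<zeta>))) (at s0)"
    unfolding eq by (intro tendsto_intros K_weakly_continuous G G2)
  also have "Re (cinner \<zeta> (K (adj G \<circ> G) s0 \<zeta>)) - 2 * Re (cinner (K G s0 \<zeta>) (K G s0 \<zeta>)) +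
      Re (cinner \<zeta> (K (adj G \<circ> G) s0 \<zeta>)) = 0"
    using eq[of s0] by simp
  finally have "((\<lambda>s. sqrt ((norm (K G s \<zeta> - K G s0 \<zeta>))\<^sup>2)) \<longlongrightarrow> sqrt 0) (at s0)" by (rule tendsto_real_sqrt)
  then show ?thesis unfolding isCont_def by (simp add: tendsto_norm_zero_iff LIM_zero_iff)
qed

text \<open>Adaptedness says weakly that \<open>j s a\<close> acts as the identity on the future of
  \<open>s\<close>; operators on the later future of \<open>t\<close> therefore commute with
  it.\<close>

lemma j_future_op:
  assumes s: "0 \<le> s" "s \<le> t" and g: "g \<in> \<S>" and h: "h \<in> \<S>" and a: "a \<in> A"
  shows "j s a (future_op t g h v) = future_op t g h (j s a v)"
proof -
  have t: "0 \<le> t" using s by simp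
  have ad: "cinner (tensor v (varpi f)) (j s a (tensor u (varpi f'))) =
      tail s f f' * cinner (tensor v (varpi (restr {0..<s} f))) (j s a (tensor u (varpi (restr {0..<s} f'))))"
    if f: "f \<in> \<S>" "f' \<in> \<S>" for v u f f'
    using process[OF a] s f unfolding process_in_def operator_process_def adapted_iff by blast
  have "j s a \<circ> future_op t g h = future_op t g h \<circ> j s a"
  proof (rule bounded_ops_eq_varpiI)
    fix u v :: 'h and f f' :: "real => 'k" assume f: "f \<in> \<S>" "f' \<in> \<S>"
    note sp = step_splice[OF f(1) g t] step_splice[OF f(2) h t]
    have r: "restr {0..<t} (restr {s..} (splice t f g)) = restr {0..<t} (restr {s..} f)" for f g :: "real => 'k"
      by (auto simp: restr_def splice_def)
    \<comment> \<open>Both sides are the overlap of \<open>f'\<close> and \<open>f\<close> on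
      \<open>[s, t[\<close> times the factors \<open>tail t h f\<close> and
      \<open>tail t f' g\<close> from the future of \<open>t\<close>.\<close>
    have tl: "tail t h f * tail s f' (splice t f g) = cnj (tail t g f') * tail s (splice t f' h) f"
      unfolding tail_split[OF f(2) sp(1) s] tail_split[OF sp(2) f(1) s]
      by (simp add: r tail_commute[of t f' g, symmetric] mult_ac)
    have "cinner (tensor v (varpi f')) ((j s a \<circ> future_op t g h) (tensor u (varpi f))) =
        tail t h f * (tail s f' (splice t f g) *
        cinner (tensor v (varpi (restr {0..<s} f'))) (j s a (tensor u (varpi (restr {0..<s} f)))))"
      by (simp add: future_op_varpi[OF t g f(1)] bounded_ops_simps(2)[OF j_bounded[OF s(1) a]] cinner_scaleC_right
          ad[OF f(2) sp(1)] restr_splice_below[OF s(2)])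
    also have "\<dots> = cinner (adj (future_op t g h) (tensor v (varpi f'))) (j s a (tensor u (varpi f)))"
      unfolding adj_future_op[OF t g h] future_op_varpi[OF t h f(2)] cinner_scaleC_left ad[OF sp(2) f(1)] restr_splice_below[OF s(2)]
        mult.assoc[symmetric] tl ..
    also have "\<dots> = cinner (tensor v (varpi f')) ((future_op t g h \<circ> j s a) (tensor u (varpi f)))"
      by (simp add: adj_cinner(1)[OF future_op_bounded[OF t g]])
    finally show "cinner (tensor v (varpi f')) ((j s a \<circ> future_op t g h) (tensor u (varpi f))) =
        cinner (tensor v (varpi f')) ((future_op t g h \<circ> j s a) (tensor u (varpi f)))" .
  qed (intro bounded_ops_compose j_bounded future_op_bounded s t g a)+
  then show ?thesis by (metis comp_apply)
qed

text \<open>The exponential matrix elements of \<open>j s a\<close> lie in \<open>A\<close>, so each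
  of them commutes with \<open>a'\<close>.\<close>

lemma j_commutant:
  assumes s: "0 \<le> s" and a: "a \<in> A" and a': "a' \<in> commutant A"
  shows "j s a (tensor_op a' id v) = tensor_op a' id (j s a v)"
proof -
  have b: "a' \<in> \<B>" using a' by (rule commutantD_bounded)
  have T: "tensor_op a' (id :: 'k fockspace => _) \<in> \<B>" by (rule tensor_op(1)[OF b bounded_ops_id(1)])
  have "j s a \<circ> tensor_op a' id = tensor_op a' id \<circ> j s a"
  proof (rule bounded_ops_eq_varpiI)
    fix u v :: 'h and f f' :: "real => 'k" assume f: "f \<in> \<S>" "f' \<in> \<S>"
    let ?B = "bra (varpi f') \<circ> j s a \<circ> ket (varpi f)"
    have B: "?B \<in> A" using process[OF a] f s unfolding process_in_def by blast
    have "cinner (tensor v (varpi f')) ((j s a \<circ> tensor_op a' id) (tensor u (varpi f))) = cinner v (?B (a' u))"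
      by (simp add: tensor_op(2)[OF b bounded_ops_id(1)] bra_cinner ket_def)
    also have "\<dots> = cinner (adj a' v) (?B u)" unfolding adj_cinner(1)[OF b] commutantD[OF a' B] ..
    also have "\<dots> = cinner (adj (tensor_op a' id) (tensor v (varpi f'))) (j s a (tensor u (varpi f)))"
      by (simp add: adj_tensor_op[OF b bounded_ops_id(1)] tensor_op(2)[OF adj_bounded_ops[OF b] bounded_ops_id(1)] bra_cinner ket_def)
    also have "\<dots> = cinner (tensor v (varpi f')) ((tensor_op a' id \<circ> j s a) (tensor u (varpi f)))"
      by (simp add: adj_cinner(1)[OF T])
    finally show "cinner (tensor v (varpi f')) ((j s a \<circ> tensor_op a' id) (tensor u (varpi f))) =
        cinner (tensor v (varpi f')) ((tensor_op a' id \<circ> j s a) (tensor u (varpi f)))" .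
  qed (intro bounded_ops_compose j_bounded T s a)+
  then show ?thesis by (metis comp_apply)
qed

lemma K_future_op:
  assumes "G \<in> amp_commutant A" "0 \<le> s" "s \<le> t" "g \<in> \<S>" "h \<in> \<S>"
  shows "K G s (tensor_op id (future_op t g h) \<zeta>) = tensor_op id (future_op t g h) (K G s \<zeta>)"
  by (rule K_commute[OF assms(1) future_op_bounded]) (use assms j_future_op in auto)

lemma K_commutant:
  assumes "0 \<le> s" "a' \<in> commutant A"
  shows "K F s (tensor_op id (tensor_op a' id) \<zeta>) = tensor_op id (tensor_op a' id) (K F s \<zeta>)"
  by (rule K_commute[OF F_amp tensor_op(1)[OF commutantD_bounded[OF assms(2)] bounded_ops_id(1)]]) (use assms j_commutant in auto)

definition \<kappa> :: real where "\<kappa> = (SOME \<kappa>. 0 \<le> \<kappa> \<and> op_bound F \<kappa>)"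

lemma \<kappa>: "0 \<le> \<kappa>" "norm (K F s \<zeta>) \<le> \<kappa> * norm \<zeta>"
proof -
  have "\<exists>\<kappa>. 0 \<le> \<kappa> \<and> op_bound F \<kappa>" using bounded_ops_bound[OF amp_commutant_bounded[OF F_amp]] by blast
  from someI_ex[OF this] have *: "0 \<le> \<kappa>" "op_bound F \<kappa>" unfolding \<kappa>_def by auto
  show "0 \<le> \<kappa>" by fact
  show "norm (K F s \<zeta>) \<le> \<kappa> * norm \<zeta>" using K_bound[OF F_amp *(2,1)] by (simp add: op_bound_def)
qed

end

section \<open>The vector equation\<close>

lemma right_continuous_integrable:
  fixes \<phi> :: "real => complex"
  assumes rc: "\<And>s. s \<in> {a..b} ==> (\<phi> \<longlongrightarrow> \<phi> s) (at_right s)" and B: "\<And>s. s \<in> {a..b} ==> cmod (\<phi> s) \<le> B"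
  shows "integrable (lebesgue_on {a..b}) \<phi>" "\<phi> integrable_on {a..b}"
proof -
  have "(\<lambda>s. s) \<in> borel_measurable (lebesgue_on {a..b})" by (intro measurable_restrict_space1 measurable_completion) simp
  then have "strongly_measurable (lebesgue_on {a..b}) \<phi>"
    by (rule strongly_measurable_right_continuous) (use rc in auto)
  then have m: "\<phi> \<in> borel_measurable (lebesgue_on {a..b})" by (rule strongly_measurable_D)
  then show "integrable (lebesgue_on {a..b}) \<phi>"
    by (intro finite_measure.integrable_const_bound[where B = B]) (use B in \<open>auto intro!: AE_I2 finite_measureI simp: emeasure_restrict_space emeasure_lborel_Icc_eq\<close>)
  show "\<phi> integrable_on {a..b}"
    by (rule measurable_bounded_by_integrable_imp_integrable[OF m, where g = "\<lambda>_. B"]) (use B in auto)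
qed

lemma nabla_hat_right_continuous:
  assumes "\<zeta> \<in> proc_domain" shows "((\<lambda>s. nabla_hat s \<zeta>) \<longlongrightarrow> nabla_hat s0 \<zeta>) (at_right s0)"
proof -
  obtain S u where S: "\<zeta> = exp_sum S u" "finite S" "S \<subseteq> \<S>" using assms unfolding proc_domain_eq by blast
  show ?thesis
    unfolding S(1) nabla_hat_exp_sum[OF S(2,3)]
  proof (rule tendsto_sum)
    fix f assume "f \<in> S"
    then have "((\<lambda>s. khat (f s)) \<longlongrightarrow> khat (f s0)) (at_right s0)"
      unfolding khat_def using S(3) by (intro tendsto_Pair tendsto_const step_right_continuous) auto
    from bounded_ops_tendsto[OF ket_bounded this]
    show "((\<lambda>s. tensor (khat (f s)) (tensor (u f) (varpi f))) \<longlongrightarrow> tensor (khat (f s0)) (tensor (u f) (varpi f))) (at_right s0)"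
      by (simp add: ket_def)
  qed
qed

lemma khat_bounded: "f \<in> \<S> ==> \<exists>c. \<forall>s. norm (khat (f s)) \<le> c"
proof -
  assume "f \<in> \<S>"
  then obtain B where B: "norm (f s) \<le> B" for s using step_bounded by blast
  have "norm (khat (f s)) \<le> 1 + B" for s using norm_Pair_le[of "1::complex" "f s"] B[of s] by (simp add: khat_def)
  then show ?thesis by blast
qed

lemma nabla_hat_bounded: assumes "\<zeta> \<in> proc_domain" shows "\<exists>B. \<forall>s. norm (nabla_hat s \<zeta>) \<le> B"
proof -
  obtain S u where S: "\<zeta> = exp_sum S u" "finite S" "S \<subseteq> \<S>" using assms unfolding proc_domain_eq by blast
  have "\<forall>f\<in>S. \<exists>c. \<forall>s. norm (khat (f s)) \<le> c" using khat_bounded S(3) by blast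
  then obtain c where c: "\<forall>f\<in>S. \<forall>s. norm (khat (f s)) \<le> c f" by (elim exE[OF bchoice])
  have "norm (nabla_hat s \<zeta>) \<le> (\<Sum>f\<in>S. c f * norm (tensor (u f) (varpi f)))" for s
    unfolding S(1) nabla_hat_exp_sum[OF S(2,3)]
    by (rule sum_norm_le) (use c in \<open>auto simp: norm_tensor[of "khat _"] intro!: mult_right_mono\<close>)
  then show ?thesis by blast
qed

lemma nabla_hat_integrable:
  assumes \<zeta>: "\<zeta> \<in> proc_domain" and rc: "\<And>s. s \<in> {a..b} ==> (x \<longlongrightarrow> x s) (at_right s)"
    and B: "\<And>s. s \<in> {a..b} ==> norm (x s) \<le> B"
  shows "integrable (lebesgue_on {a..b}) (\<lambda>s. cinner (nabla_hat s \<zeta>) (x s))" "(\<lambda>s. cinner (nabla_hat s \<zeta>) (x s)) integrable_on {a..b}"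
proof -
  obtain C where C: "norm (nabla_hat s \<zeta>) \<le> C" for s using nabla_hat_bounded[OF \<zeta>] by blast
  have C0: "0 \<le> C" using norm_ge_zero C by (rule order_trans)
  have *: "cmod (cinner (nabla_hat s \<zeta>) (x s)) \<le> C * B" if "s \<in> {a..b}" for s
    by (intro order_trans[OF norm_cinner_le] mult_mono C B that C0 norm_ge_zero)
  have rc': "((\<lambda>s. cinner (nabla_hat s \<zeta>) (x s)) \<longlongrightarrow> cinner (nabla_hat s \<zeta>) (x s)) (at_right s)" if "s \<in> {a..b}" for s
    by (rule tendsto_cinner[OF nabla_hat_right_continuous[OF \<zeta>] rc[OF that]])
  show "integrable (lebesgue_on {a..b}) (\<lambda>s. cinner (nabla_hat s \<zeta>) (x s))" "(\<lambda>s. cinner (nabla_hat s \<zeta>) (x s)) integrable_on {a..b}"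
    by (rule right_continuous_integrable[OF rc' *]; assumption)+
qed

lemma proc_domain_ctotal: "(\<And>\<zeta>. \<zeta> \<in> proc_domain ==> cinner \<zeta> x = cinner \<zeta> y) ==> x = (y :: ('h::chilbert_space, 'k::chilbert_space fockspace) htensor)"
  by (rule ctotalD[OF ctotal_tensor_varpi]) (auto simp: tensor_varpi_in)

lemma energy_norm:
  fixes x :: "real => ('h::chilbert_space, 'k::chilbert_space) hat_space"
  assumes rt: "0 \<le> r" "r \<le> t" and g: "g \<in> \<S>" and c: "\<And>s. norm (khat (g s)) \<le> c"
    and P: "\<And>s. s \<in> {r..t} ==> tensor_op id (past_proj s g) (x s) = x s"
    and b: "\<And>s. s \<in> {r..t} ==> norm (x s) \<le> \<beta> s"
    and b1: "(\<beta> has_integral b1) {r..t}" and b2: "((\<lambda>s. (\<beta> s)\<^sup>2) has_integral b2) {r..t}"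
    and X: "\<And>\<zeta>. \<zeta> \<in> proc_domain ==> ((\<lambda>s. cinner (nabla_hat s \<zeta>) (x s)) has_integral cinner \<zeta> z) {r..t}"
  shows "norm z \<le> c * b1 + sqrt b2"
proof (rule norm_le_cinner_total[OF ctotal_tensor_varpi])
  have c0: "c \<ge> 0" using norm_ge_zero c by (rule order_trans)
  have "b1 \<ge> 0" using b1 by (rule has_integral_nonneg) (use b in \<open>auto intro: order_trans[OF norm_ge_zero]\<close>)
  moreover have "b2 \<ge> 0" using b2 by (rule has_integral_nonneg) simp
  ultimately show "0 \<le> c * b1 + sqrt b2" using c0 by simp
  fix S :: "('h \<times> (real => 'k)) set" and d assume "S \<subseteq> UNIV \<times> \<S>"
  then have "(\<Sum>i\<in>S. d i *\<^sub>C (case i of (u, f) => tensor u (varpi f))) \<in> (proc_domain :: ('h, 'k fockspace) htensor set)"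
    by (intro csubspace_sum[OF csubspace_proc_domain] csubspaceD(3)[OF csubspace_proc_domain]) (auto intro: tensor_varpi_in)
  from energy_estimate[OF rt g c this P b b1 b2 X[OF this]]
  show "cmod (cinner (\<Sum>i\<in>S. d i *\<^sub>C (case i of (u, f) => tensor u (varpi f))) z) \<le>
      (c * b1 + sqrt b2) * norm (\<Sum>i\<in>S. d i *\<^sub>C (case i of (u, f) => tensor u (varpi f)))" .
qed

text \<open>The weak integral prescribes inner products with exponential vectors, and
  \<open>energy_estimate\<close> is exactly the bound under which \<open>vector_of_family\<close>
  produces the vector.\<close>

lemma integral_vector_exists:
  fixes x :: "real => ('h::chilbert_space, 'k::chilbert_space) hat_space"
  assumes t: "0 \<le> t" and g: "g \<in> \<S>"
    and P: "\<And>s. s \<in> {0..t} ==> tensor_op id (past_proj s g) (x s) = x s"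
    and rc: "\<And>s. s \<in> {0..t} ==> (x \<longlongrightarrow> x s) (at_right s)" and B: "\<And>s. s \<in> {0..t} ==> norm (x s) \<le> B"
  shows "\<exists>z. \<forall>\<zeta>\<in>proc_domain. ((\<lambda>s. cinner (nabla_hat s \<zeta>) (x s)) has_integral cinner \<zeta> z) {0..t}"
proof -
  let ?I = "\<lambda>\<zeta>. integral {0..t} (\<lambda>s. cinner (nabla_hat s \<zeta>) (x s))"
  have I: "((\<lambda>s. cinner (nabla_hat s \<zeta>) (x s)) has_integral ?I \<zeta>) {0..t}" if "\<zeta> \<in> proc_domain" for \<zeta>
    using nabla_hat_integrable(2)[OF that rc B] by (simp add: integrable_integral)
  obtain c where c: "norm (khat (g s)) \<le> c" for s using khat_bounded[OF g] by blast
  have c0: "c \<ge> 0" using norm_ge_zero c by (rule order_trans)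
  have B0: "B \<ge> 0" using order_trans[OF norm_ge_zero B[of 0]] t by simp
  have b: "((\<lambda>s. B) has_integral t * B) {0..t}" "((\<lambda>s. B\<^sup>2) has_integral t * B\<^sup>2) {0..t}"
    using has_integral_const_real[of B 0 t] has_integral_const_real[of "B\<^sup>2" 0 t] t by auto
  let ?a = "\<lambda>(u, f). tensor u (varpi f) :: ('h, 'k fockspace) htensor"
  have in_dom: "?a i \<in> proc_domain" if "i \<in> UNIV \<times> \<S>" for i using that by (auto intro: tensor_varpi_in)
  have comb: "?I (\<Sum>i\<in>S. d i *\<^sub>C ?a i) = (\<Sum>i\<in>S. cnj (d i) * ?I (?a i))"
    if S: "finite S" "S \<subseteq> UNIV \<times> \<S>" for S d
  proof -
    have sc: "nabla_hat s (d i *\<^sub>C ?a i) = d i *\<^sub>C nabla_hat s (?a i)" if "i \<in> S" for i s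
      using nabla_hat_linear[of s] in_dom that S unfolding clinear_on_def by blast
    have "nabla_hat s (\<Sum>i\<in>S. d i *\<^sub>C ?a i) = (\<Sum>i\<in>S. nabla_hat s (d i *\<^sub>C ?a i))" for s
      by (rule clinear_on_sum[OF nabla_hat_linear S(1)]) (use S(2) in_dom csubspaceD(3)[OF csubspace_proc_domain] in blast)
    also have "(\<Sum>i\<in>S. nabla_hat s (d i *\<^sub>C ?a i)) = (\<Sum>i\<in>S. d i *\<^sub>C nabla_hat s (?a i))" for s
      by (rule sum.cong[OF refl sc])
    finally have eq: "cinner (nabla_hat s (\<Sum>i\<in>S. d i *\<^sub>C ?a i)) (x s) = (\<Sum>i\<in>S. cnj (d i) * cinner (nabla_hat s (?a i)) (x s))" for s
      by (simp only: cinner_sum_left cinner_scaleC_left)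
    show ?thesis unfolding eq
      by (rule integral_unique, intro has_integral_sum[OF S(1)] has_integral_mult_right I in_dom) (use S(2) in auto)
  qed
  have "\<exists>z. (\<forall>i\<in>UNIV \<times> \<S>. cinner (?a i) z = ?I (?a i)) \<and> norm z \<le> c * (t * B) + sqrt (t * B\<^sup>2)"
  proof (rule vector_of_family[OF ctotal_tensor_varpi])
    show "0 \<le> c * (t * B) + sqrt (t * B\<^sup>2)" using c0 B0 t by simp
    fix S :: "('h \<times> (real => 'k)) set" and d assume S: "finite S" "S \<subseteq> UNIV \<times> \<S>"
    have dom: "(\<Sum>i\<in>S. d i *\<^sub>C ?a i) \<in> proc_domain"
      by (rule csubspace_sum[OF csubspace_proc_domain]) (use S(2) in_dom csubspaceD(3)[OF csubspace_proc_domain] in blast)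
    show "cmod (\<Sum>i\<in>S. cnj (d i) * ?I (?a i)) \<le> (c * (t * B) + sqrt (t * B\<^sup>2)) * norm (\<Sum>i\<in>S. d i *\<^sub>C ?a i)"
      unfolding comb[OF S, symmetric] by (rule energy_estimate[OF order_refl t g c dom P B b I[OF dom]])
  qed
  then obtain z where z: "\<And>i. i \<in> UNIV \<times> \<S> ==> cinner (?a i) z = ?I (?a i)" by (elim exE conjE) blast
  have "((\<lambda>s. cinner (nabla_hat s \<zeta>) (x s)) has_integral cinner \<zeta> z) {0..t}" if \<zeta>: "\<zeta> \<in> proc_domain" for \<zeta>
  proof -
    obtain S u where S: "\<zeta> = exp_sum S u" "finite S" "S \<subseteq> \<S>" using \<zeta> unfolding proc_domain_eq by blast
    have "((\<lambda>s. \<Sum>f\<in>S. cinner (nabla_hat s (tensor (u f) (varpi f))) (x s)) has_integral (\<Sum>f\<in>S. cinner (tensor (u f) (varpi f)) z)) {0..t}"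
    proof (rule has_integral_sum[OF S(2)])
      fix f assume "f \<in> S"
      then have f: "f \<in> \<S>" using S(3) by blast
      show "((\<lambda>s. cinner (nabla_hat s (tensor (u f) (varpi f))) (x s)) has_integral cinner (tensor (u f) (varpi f)) z) {0..t}"
        using z[of "(u f, f)"] I[OF tensor_varpi_in[OF f, of "u f"]] f by simp
    qed
    moreover have "nabla_hat s \<zeta> = (\<Sum>f\<in>S. nabla_hat s (tensor (u f) (varpi f)))" for s
      unfolding S(1) exp_sum_def by (rule clinear_on_sum[OF nabla_hat_linear S(2)]) (use S(3) tensor_varpi_in in auto)
    ultimately show ?thesis by (simp add: S(1) exp_sum_def cinner_sum_left)
  qed
  then show ?thesis by blast
qed

definition khat_bound :: "(real => 'k::chilbert_space) => real"
  where "khat_bound g = (SOME c. \<forall>s. norm (khat (g s)) \<le> c)"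

lemma khat_bound: "g \<in> \<S> ==> norm (khat (g s)) \<le> khat_bound g"
  unfolding khat_bound_def using someI_ex[OF khat_bounded] by blast

lemma khat_bound_nonneg: "g \<in> \<S> ==> 0 \<le> khat_bound g"
  by (rule order_trans[OF norm_ge_zero khat_bound])

section \<open>The equation for a single exponential vector\<close>

context flow
begin

text \<open>The integrand along a path that starts from an exponential vector of \<open>g\<close>:
  there the gradient amounts to tensoring with \<open>khat (g s)\<close>.\<close>

definition drive :: "(real => 'k) => (real => ('h, 'k fockspace) htensor) => real => ('h, 'k) hat_space"
  where "drive g y s = K F s (tensor (khat (g s)) (y s))"

lemma drive_bound: "g \<in> \<S> ==> norm (drive g y s) \<le> \<kappa> * khat_bound g * norm (y s)"
proof -
  assume g: "g \<in> \<S>"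
  have "norm (drive g y s) \<le> \<kappa> * (norm (khat (g s)) * norm (y s))"
    unfolding drive_def norm_tensor[symmetric] by (rule \<kappa>(2))
  also have "\<dots> \<le> \<kappa> * (khat_bound g * norm (y s))" by (intro mult_left_mono mult_right_mono khat_bound g \<kappa>(1) norm_ge_zero)
  finally show ?thesis by simp
qed

lemma drive_diff: "drive g (\<lambda>s. y s - y' s) s = drive g y s - drive g y' s"
  and drive_add: "drive g (\<lambda>s. y s + y' s) s = drive g y s + drive g y' s"
  and drive_scaleC: "drive g (\<lambda>s. c *\<^sub>C y s) s = c *\<^sub>C drive g y s"
  by (simp_all add: drive_def tensor_diff_right tensor_add_right tensor_scaleC_right bounded_ops_simps[OF K_bounded[OF F_amp]])

lemma drive_past:
  assumes s: "0 \<le> s" and g: "g \<in> \<S>" and y: "past_proj s g (y s) = y s"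
  shows "tensor_op id (past_proj s g) (drive g y s) = drive g y s"
  unfolding drive_def K_future_op[OF F_amp s order_refl g g, symmetric] tensor_op_id_right(2)[OF future_op_bounded[OF s g]] y ..

text \<open>\<open>K F\<close> is known to be continuous only strongly, so the increment is split:
  its uniform bound handles the change of the argument, strong continuity the change of time at a
  fixed argument.\<close>

lemma drive_right_continuous:
  assumes g: "g \<in> \<S>" and y: "(y \<longlongrightarrow> y s0) (at_right s0)"
  shows "(drive g y \<longlongrightarrow> drive g y s0) (at_right s0)"
proof -
  let ?w = "\<lambda>s. tensor (khat (g s)) (y s)"
  have "((\<lambda>s. tensor (khat (g s)) (y s0)) \<longlongrightarrow> ?w s0) (at_right s0)"
    using bounded_ops_tendsto[OF ket_bounded[of "y s0"] tendsto_Pair[OF tendsto_const[of "1::complex"] step_right_continuous[OF g]]]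
    by (simp add: ket_def khat_def)
  moreover have "((\<lambda>s. tensor (khat (g s)) (y s - y s0)) \<longlongrightarrow> 0) (at_right s0)"
  proof (rule Lim_null_comparison)
    have "norm (tensor (khat (g s)) (y s - y s0)) \<le> khat_bound g * norm (y s - y s0)" for s
      unfolding norm_tensor by (intro mult_right_mono khat_bound g norm_ge_zero)
    then show "\<forall>\<^sub>F s in at_right s0. norm (tensor (khat (g s)) (y s - y s0)) \<le> khat_bound g * norm (y s - y s0)" by simp
    show "((\<lambda>s. khat_bound g * norm (y s - y s0)) \<longlongrightarrow> 0) (at_right s0)"
      using y by (intro tendsto_mult_right_zero tendsto_norm_zero) (simp add: LIM_zero)
  qed
  ultimately have "((\<lambda>s. tensor (khat (g s)) (y s0) + tensor (khat (g s)) (y s - y s0)) \<longlongrightarrow> ?w s0 + 0) (at_right s0)"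
    by (rule tendsto_add)
  then have w: "(?w \<longlongrightarrow> ?w s0) (at_right s0)" by (simp add: tensor_add_right[symmetric])
  have "((\<lambda>s. K F s (?w s - ?w s0)) \<longlongrightarrow> 0) (at_right s0)"
  proof (rule Lim_null_comparison)
    show "\<forall>\<^sub>F s in at_right s0. norm (K F s (?w s - ?w s0)) \<le> \<kappa> * norm (?w s - ?w s0)" by (simp add: \<kappa>(2))
    show "((\<lambda>s. \<kappa> * norm (?w s - ?w s0)) \<longlongrightarrow> 0) (at_right s0)"
      using w by (intro tendsto_mult_right_zero tendsto_norm_zero) (simp add: LIM_zero)
  qed
  moreover have "((\<lambda>s. K F s (?w s0)) \<longlongrightarrow> K F s0 (?w s0)) (at_right s0)"
    using K_continuous[OF F_amp, where \<zeta> = "?w s0" and ?s0.0 = s0] unfolding isCont_def by (rule tendsto_within_subset) simp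
  ultimately have "((\<lambda>s. K F s (?w s - ?w s0) + K F s (?w s0)) \<longlongrightarrow> 0 + K F s0 (?w s0)) (at_right s0)"
    by (rule tendsto_add)
  then show ?thesis unfolding drive_def[abs_def] by (simp add: bounded_ops_simps(4)[OF K_bounded[OF F_amp]])
qed

definition past :: "real => (real => 'k) => (real => ('h, 'k fockspace) htensor) => bool"
  where "past T g y \<longleftrightarrow> continuous_on {0..T} y \<and> (\<forall>s\<in>{0..T}. past_proj s g (y s) = y s)"

text \<open>The integral equation in weak form on a bounded time interval, with an arbitrary initial
  vector, so that solutions can be added, rescaled and transported by operators.\<close>

definition solves :: "real => (real => 'k) => ('h, 'k fockspace) htensor => (real => ('h, 'k fockspace) htensor) => bool"
  where "solves T g \<xi> y \<longleftrightarrow> past T g y \<and> (\<forall>t\<in>{0..T}. \<forall>\<zeta>\<in>proc_domain.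
    ((\<lambda>s. cinner (nabla_hat s \<zeta>) (drive g y s)) has_integral cinner \<zeta> (y t - \<xi>)) {0..t})"

lemma past_right_continuous: "past T g y ==> s \<in> {0..<T} ==> (y \<longlongrightarrow> y s) (at_right s)"
proof -
  assume "past T g y" and s: "s \<in> {0..<T}"
  then have "(y \<longlongrightarrow> y s) (at s within {0..T})" by (auto simp: past_def continuous_on_def)
  then have "(y \<longlongrightarrow> y s) (at s within {s..T})" by (rule tendsto_within_subset) (use s in auto)
  then show ?thesis using s by (simp add: at_within_Icc_at_right)
qed

text \<open>The exponential weight, with \<open>L = \<kappa> * khat_bound g\<close>: the first term
  makes the time part of the integral at most a quarter of the weighted bound, the second does the
  same for the noise part, and 1 keeps the rate positive. The two quarters give the contraction
  factor one half.\<close>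

definition rate :: "(real => 'k) => real"
  where "rate g = 4 * khat_bound g * (\<kappa> * khat_bound g) + 8 * (\<kappa> * khat_bound g)\<^sup>2 + 1"

lemma rate_pos: "g \<in> \<S> ==> rate g > 0"
  unfolding rate_def using khat_bound_nonneg[of g] \<kappa>(1) by (intro add_nonneg_pos add_nonneg_nonneg mult_nonneg_nonneg) auto

lemma has_integral_exp:
  assumes "l > 0" "(0::real) \<le> t"
  shows "((\<lambda>s. exp (l * s)) has_integral (exp (l * t) - 1) / l) {0..t}"
proof -
  have "((\<lambda>s. exp (l * s)) has_integral exp (l * t) / l - exp (l * 0) / l) {0..t}"
    by (rule fundamental_theorem_of_calculus[OF assms(2)])
      (use assms(1) in \<open>auto intro!: derivative_eq_intros simp: has_real_derivative_iff_has_vector_derivative[symmetric]\<close>)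
  then show ?thesis by (simp add: diff_divide_distrib)
qed

lemma integral_contraction:
  assumes t: "0 \<le> t" and g: "g \<in> \<S>" and D: "0 \<le> D"
    and P: "\<And>s. s \<in> {0..t} ==> past_proj s g (y s) = y s"
    and b: "\<And>s. s \<in> {0..t} ==> norm (y s) \<le> D * exp (rate g * s)"
    and z: "\<And>\<zeta>. \<zeta> \<in> proc_domain ==> ((\<lambda>s. cinner (nabla_hat s \<zeta>) (drive g y s)) has_integral cinner \<zeta> z) {0..t}"
  shows "norm z \<le> D / 2 * exp (rate g * t)"
proof -
  let ?c = "khat_bound g" and ?l = "rate g"
  define L where "L = \<kappa> * ?c"
  have c: "0 \<le> ?c" and L: "0 \<le> L" using khat_bound_nonneg[OF g] \<kappa>(1) by (auto simp: L_def)
  have l: "?l > 0" by (rule rate_pos[OF g])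
  have i1: "((\<lambda>s. L * D * exp (?l * s)) has_integral L * D * ((exp (?l * t) - 1) / ?l)) {0..t}"
    by (intro has_integral_mult_right has_integral_exp l t)
  have i2: "((\<lambda>s. (L * D * exp (?l * s))\<^sup>2) has_integral (L * D)\<^sup>2 * ((exp (2 * ?l * t) - 1) / (2 * ?l))) {0..t}"
  proof -
    have "(L * D * exp (?l * s))\<^sup>2 = (L * D)\<^sup>2 * exp (2 * ?l * s)" for s
      unfolding power_mult_distrib exp_double[symmetric] by (simp add: mult_ac)
    then show ?thesis using has_integral_mult_right[OF has_integral_exp[of "2 * ?l" t], of "(L * D)\<^sup>2"] l t by simp
  qed
  have bd: "norm (drive g y s) \<le> L * D * exp (?l * s)" if "s \<in> {0..t}" for s
  proof -
    have "norm (drive g y s) \<le> L * norm (y s)" unfolding L_def by (rule drive_bound[OF g])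
    also have "\<dots> \<le> L * (D * exp (?l * s))" by (rule mult_left_mono[OF b[OF that] L])
    finally show ?thesis by simp
  qed
  have "norm z \<le> ?c * (L * D * ((exp (?l * t) - 1) / ?l)) + sqrt ((L * D)\<^sup>2 * ((exp (2 * ?l * t) - 1) / (2 * ?l)))"
    by (rule energy_norm[OF order_refl t g khat_bound[OF g] drive_past[OF _ g P] bd i1 i2 z]) auto
  also have "?c * (L * D * ((exp (?l * t) - 1) / ?l)) \<le> D / 4 * exp (?l * t)"
  proof -
    have "4 * ?c * L \<le> ?l" unfolding rate_def L_def by simp
    then have "?c * L / ?l \<le> 1 / 4" using l by (simp add: field_simps)
    then have "(?c * L / ?l) * (D * (exp (?l * t) - 1)) \<le> 1 / 4 * (D * (exp (?l * t) - 1))"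
      by (rule mult_right_mono) (use D l t in auto)
    also have "\<dots> \<le> 1 / 4 * (D * exp (?l * t))" using D by (simp add: mult_left_mono)
    finally show ?thesis by (simp add: mult_ac)
  qed
  also have "sqrt ((L * D)\<^sup>2 * ((exp (2 * ?l * t) - 1) / (2 * ?l))) \<le> D / 4 * exp (?l * t)"
  proof (rule real_le_lsqrt)
    \<comment> \<open>This is \<open>8 * L\<^sup>2 \<le> rate g\<close> doubled; the square root of
      \<open>1 / 16\<close> is the quarter allotted to the noise part.\<close>
    have "16 * L\<^sup>2 \<le> 2 * ?l" unfolding rate_def L_def[symmetric] using c L by simp
    then have "L\<^sup>2 / (2 * ?l) \<le> 1 / 16" using l by (simp add: field_simps)
    then have "L\<^sup>2 / (2 * ?l) * (D\<^sup>2 * (exp (2 * ?l * t) - 1)) \<le> 1 / 16 * (D\<^sup>2 * (exp (2 * ?l * t) - 1))"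
      by (rule mult_right_mono) (use l t in auto)
    also have "\<dots> \<le> 1 / 16 * (D\<^sup>2 * exp (2 * ?l * t))" by (simp add: mult_left_mono)
    also have "\<dots> = (D / 4 * exp (?l * t))\<^sup>2"
      using exp_double[of "?l * t"] by (simp add: power_mult_distrib power_divide mult_ac)
    finally show "(L * D)\<^sup>2 * ((exp (2 * ?l * t) - 1) / (2 * ?l)) \<le> (D / 4 * exp (?l * t))\<^sup>2"
      by (simp add: power_mult_distrib mult_ac)
  qed (use D in simp)
  finally show ?thesis by simp
qed

text \<open>Each application of the contraction halves the weighted bound of a solution with zero
  initial vector; continuity on the compact interval provides the bound to start with.\<close>

lemma homogeneous_zero:
  assumes g: "g \<in> \<S>" and y: "solves T g 0 y" and t: "t \<in> {0..T}"
  shows "y t = 0"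
proof -
  have "bounded (y ` {0..T})"
    using y by (intro compact_imp_bounded compact_continuous_image) (auto simp: solves_def past_def)
  then obtain B where B: "B > 0" "\<And>s. s \<in> {0..T} ==> norm (y s) \<le> B" unfolding bounded_pos by blast
  have "\<forall>s\<in>{0..T}. norm (y s) \<le> (B / 2 ^ n) * exp (rate g * s)" for n
  proof (induction n)
    case 0
    have "B * 1 \<le> B * exp (rate g * s)" if "s \<in> {0..T}" for s
      using that B(1) rate_pos[OF g] by (intro mult_left_mono) auto
    then show ?case using B(2) by force
  next
    case (Suc n)
    show ?case
    proof
      fix s assume s: "s \<in> {0..T}"
      have "norm (y s) \<le> (B / 2 ^ n) / 2 * exp (rate g * s)"
        by (rule integral_contraction[OF _ g, where y = y]) (use s Suc y B(1) in \<open>auto simp: solves_def past_def\<close>)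
      then show "norm (y s) \<le> (B / 2 ^ Suc n) * exp (rate g * s)" by (simp add: mult_ac)
    qed
  qed
  then have le: "norm (y t) \<le> (B * exp (rate g * t)) * (1 / 2) ^ n" for n
    using t by (auto simp: power_divide mult_ac)
  have "(\<lambda>n. (B * exp (rate g * t)) * (1 / 2) ^ n) \<longlonglongrightarrow> (B * exp (rate g * t)) * 0"
    by (intro tendsto_mult tendsto_const LIMSEQ_realpow_zero) auto
  then have "norm (y t) \<le> 0" by (intro LIMSEQ_le_const[where X = "\<lambda>n. (B * exp (rate g * t)) * (1 / 2) ^ n"]) (use le in auto)
  then show ?thesis by simp
qed

lemma solves_add:
  assumes g: "g \<in> \<S>" and y: "solves T g \<xi> y" and y': "solves T g \<xi>' y'"
  shows "solves T g (\<xi> + \<xi>') (\<lambda>s. y s + y' s)"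
  unfolding solves_def past_def
proof (intro conjI ballI)
  show "continuous_on {0..T} (\<lambda>s. y s + y' s)" using y y' by (auto simp: solves_def past_def intro: continuous_on_add)
  show "past_proj s g (y s + y' s) = y s + y' s" if "s \<in> {0..T}" for s
  proof -
    have "0 \<le> s" using that by simp
    then show ?thesis using y y' that by (simp add: solves_def past_def bounded_ops_simps(1)[OF future_op_bounded[OF _ g]])
  qed
  fix t and \<zeta> :: "('h, 'k fockspace) htensor" assume t: "t \<in> {0..T}" "\<zeta> \<in> proc_domain"
  have "((\<lambda>s. cinner (nabla_hat s \<zeta>) (drive g y s) + cinner (nabla_hat s \<zeta>) (drive g y' s)) has_integral
      cinner \<zeta> (y t - \<xi>) + cinner \<zeta> (y' t - \<xi>')) {0..t}"
    using y y' t by (intro has_integral_add) (auto simp: solves_def)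
  then show "((\<lambda>s. cinner (nabla_hat s \<zeta>) (drive g (\<lambda>s. y s + y' s) s)) has_integral cinner \<zeta> (y t + y' t - (\<xi> + \<xi>'))) {0..t}"
    by (simp add: drive_add cinner_add_right cinner_diff_right algebra_simps)
qed

lemma solves_scaleC:
  assumes g: "g \<in> \<S>" and y: "solves T g \<xi> y"
  shows "solves T g (c *\<^sub>C \<xi>) (\<lambda>s. c *\<^sub>C y s)"
  unfolding solves_def past_def
proof (intro conjI ballI)
  show "continuous_on {0..T} (\<lambda>s. c *\<^sub>C y s)"
    using y by (auto simp: solves_def past_def intro: continuous_on_scaleC' continuous_on_const)
  show "past_proj s g (c *\<^sub>C y s) = c *\<^sub>C y s" if "s \<in> {0..T}" for s
  proof -
    have "0 \<le> s" using that by simp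
    then show ?thesis using y that by (simp add: solves_def past_def bounded_ops_simps(2)[OF future_op_bounded[OF _ g]])
  qed
  fix t and \<zeta> :: "('h, 'k fockspace) htensor" assume t: "t \<in> {0..T}" "\<zeta> \<in> proc_domain"
  have "((\<lambda>s. c * cinner (nabla_hat s \<zeta>) (drive g y s)) has_integral c * cinner \<zeta> (y t - \<xi>)) {0..t}"
    using y t by (intro has_integral_mult_right) (auto simp: solves_def)
  then show "((\<lambda>s. cinner (nabla_hat s \<zeta>) (drive g (\<lambda>s. c *\<^sub>C y s) s)) has_integral cinner \<zeta> (c *\<^sub>C y t - c *\<^sub>C \<xi>)) {0..t}"
    by (simp add: drive_scaleC cinner_scaleC_right scaleC_diff_right[symmetric])
qed

lemma solves_unique:
  assumes g: "g \<in> \<S>" and y: "solves T g \<xi> y" and y': "solves T g \<xi> y'" and t: "t \<in> {0..T}"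
  shows "y t = y' t"
proof -
  have "solves T g (\<xi> + (-1) *\<^sub>C \<xi>) (\<lambda>s. y s + (-1) *\<^sub>C y' s)" by (intro solves_add solves_scaleC g y y')
  then have "solves T g 0 (\<lambda>s. y s - y' s)" by (simp add: scaleC_minus1)
  from homogeneous_zero[OF g this t] show ?thesis by simp
qed

text \<open>Over an interval of length \<open>t - r\<close> the time part is of order
  \<open>t - r\<close> and the noise part of order \<open>sqrt (t - r)\<close>; the latter is the
  source of the Hoelder exponent.\<close>

lemma integral_increment:
  assumes rt: "0 \<le> r" "r \<le> t" and g: "g \<in> \<S>"
    and P: "\<And>s. s \<in> {r..t} ==> tensor_op id (past_proj s g) (x s) = x s"
    and b: "\<And>s. s \<in> {r..t} ==> norm (x s) \<le> B"
    and z: "\<And>\<zeta>. \<zeta> \<in> proc_domain ==> ((\<lambda>s. cinner (nabla_hat s \<zeta>) (x s :: ('h, 'k) hat_space)) has_integral cinner \<zeta> z) {r..t}"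
  shows "norm z \<le> B * (khat_bound g * sqrt (t - r) + 1) * sqrt (t - r)"
proof -
  have B: "0 \<le> B" using order_trans[OF norm_ge_zero b[of r]] rt by simp
  have "((\<lambda>s. B) has_integral (t - r) * B) {r..t}" "((\<lambda>s. B\<^sup>2) has_integral (t - r) * B\<^sup>2) {r..t}"
    using has_integral_const_real[of B r t] has_integral_const_real[of "B\<^sup>2" r t] rt by auto
  from energy_norm[OF rt g khat_bound[OF g] P b this z]
  have "norm z \<le> khat_bound g * ((t - r) * B) + sqrt ((t - r) * B\<^sup>2)" by simp
  also have "\<dots> = B * (khat_bound g * sqrt (t - r) + 1) * sqrt (t - r)"
    unfolding real_sqrt_mult using rt B by (simp add: algebra_simps)
  finally show ?thesis .
qed

lemma integral_continuous:
  assumes g: "g \<in> \<S>"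
    and P: "\<And>s. s \<in> {0..T} ==> tensor_op id (past_proj s g) (x s) = x s"
    and b: "\<And>s. s \<in> {0..T} ==> norm (x s) \<le> B"
    and z: "\<And>t \<zeta>. t \<in> {0..T} ==> \<zeta> \<in> proc_domain ==>
      ((\<lambda>s. cinner (nabla_hat s \<zeta>) (x s :: ('h, 'k) hat_space)) has_integral cinner \<zeta> (z t)) {0..t}"
  shows "continuous_on {0..T} z"
    and "0 \<le> r ==> r \<le> t ==> t \<le> T ==> norm (z t - z r) \<le> B * (khat_bound g * sqrt (t - r) + 1) * sqrt (t - r)"
proof -
  have inc: "norm (z t - z r) \<le> B * (khat_bound g * sqrt (t - r) + 1) * sqrt (t - r)"
    if rt: "0 \<le> r" "r \<le> t" "t \<le> T" for r t
  proof (rule integral_increment[OF rt(1,2) g, where x = x])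
    fix \<zeta> :: "('h, 'k fockspace) htensor" assume \<zeta>: "\<zeta> \<in> proc_domain"
    have "(\<lambda>s. cinner (nabla_hat s \<zeta>) (x s)) integrable_on {r..t}"
      by (rule integrable_on_subinterval[OF has_integral_integrable[OF z[of t \<zeta>]]]) (use rt \<zeta> in auto)
    then have i: "((\<lambda>s. cinner (nabla_hat s \<zeta>) (x s)) has_integral integral {r..t} (\<lambda>s. cinner (nabla_hat s \<zeta>) (x s))) {r..t}"
      by (rule integrable_integral)
    have "((\<lambda>s. cinner (nabla_hat s \<zeta>) (x s)) has_integral cinner \<zeta> (z r) + integral {r..t} (\<lambda>s. cinner (nabla_hat s \<zeta>) (x s))) {0..t}"
      by (rule has_integral_combine[OF rt(1,2) z i]) (use rt \<zeta> in auto)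
    then have "cinner \<zeta> (z r) + integral {r..t} (\<lambda>s. cinner (nabla_hat s \<zeta>) (x s)) = cinner \<zeta> (z t)"
      by (rule has_integral_unique) (use z[of t \<zeta>] rt \<zeta> in auto)
    then show "((\<lambda>s. cinner (nabla_hat s \<zeta>) (x s)) has_integral cinner \<zeta> (z t - z r)) {r..t}"
      using i by (simp only: cinner_diff_right eq_diff_eq[symmetric] add.commute) simp
  qed (use rt P b in auto)
  then show "0 \<le> r ==> r \<le> t ==> t \<le> T ==> norm (z t - z r) \<le> B * (khat_bound g * sqrt (t - r) + 1) * sqrt (t - r)" .
  let ?h = "\<lambda>d. B * (khat_bound g * sqrt d + 1) * sqrt d"
  have h: "norm (z s - z s0) \<le> ?h \<bar>s - s0\<bar>" if "s \<in> {0..T}" "s0 \<in> {0..T}" for s s0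
    using inc[of s s0] inc[of s0 s] that by (cases "s \<le> s0") (auto simp: norm_minus_commute abs_if)
  show "continuous_on {0..T} z"
    unfolding continuous_on_def
  proof
    fix s0 assume s0: "s0 \<in> {0..T}"
    have "((\<lambda>s. ?h \<bar>s - s0\<bar>) \<longlongrightarrow> ?h \<bar>s0 - s0\<bar>) (at s0 within {0..T})" by (intro tendsto_intros)
    then have "((\<lambda>s. ?h \<bar>s - s0\<bar>) \<longlongrightarrow> 0) (at s0 within {0..T})" by simp
    then have "((\<lambda>s. z s - z s0) \<longlongrightarrow> 0) (at s0 within {0..T})"
      by (rule Lim_null_comparison[rotated]) (use h s0 in \<open>auto simp: eventually_at_filter\<close>)
    then show "(z \<longlongrightarrow> z s0) (at s0 within {0..T})" by (simp add: LIM_zero_iff)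
  qed
qed

end

text \<open>Operators that can be pulled through a QS integral up to time \<open>T\<close>: their
  adjoints preserve the domain and commute with the gradient. The condition stops before
  \<open>T\<close> because the relevant operators alter exponential vectors from \<open>T\<close>
  on.\<close>

definition nabla_compat :: "real => ('h::chilbert_space, 'k::chilbert_space) fock_op => bool"
  where "nabla_compat T R \<longleftrightarrow> R \<in> \<B> \<and> (\<forall>\<zeta>\<in>proc_domain. adj R \<zeta> \<in> proc_domain \<and>
    (\<forall>s<T. nabla_hat s (adj R \<zeta>) = tensor_op id (adj R) (nabla_hat s \<zeta>)))"

lemma nabla_compatI:
  fixes R :: "('h::chilbert_space, 'k::chilbert_space) fock_op"
  assumes R: "R \<in> \<B>"
    and *: "\<And>u f. f \<in> \<S> ==> \<exists>c v f'. f' \<in> \<S> \<and> adj R (tensor u (varpi f)) = c *\<^sub>C tensor v (varpi f') \<and> (\<forall>s<T. f' s = f s)"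
  shows "nabla_compat T R"
  unfolding nabla_compat_def
proof (intro conjI ballI allI impI R)
  fix \<zeta> :: "('h, 'k fockspace) htensor" assume "\<zeta> \<in> proc_domain"
  then obtain S u where S: "\<zeta> = exp_sum S u" "finite S" "S \<subseteq> \<S>" unfolding proc_domain_eq by blast
  note aR = adj_bounded_ops[OF R]
  have dom: "adj R (tensor (u f) (varpi f)) \<in> proc_domain" if fS: "f \<in> S" for f
  proof -
    obtain c v f' where f': "f' \<in> \<S>" "adj R (tensor (u f) (varpi f)) = c *\<^sub>C tensor v (varpi f')"
      using *[of f "u f"] S(3) fS by blast
    show ?thesis unfolding f'(2) by (rule csubspaceD(3)[OF csubspace_proc_domain tensor_varpi_in[OF f'(1)]])
  qed
  have eq: "adj R \<zeta> = (\<Sum>f\<in>S. adj R (tensor (u f) (varpi f)))"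
    unfolding S(1) exp_sum_def by (rule bounded_ops_simps(5)[OF aR])
  show "adj R \<zeta> \<in> proc_domain" unfolding eq by (rule csubspace_sum[OF csubspace_proc_domain dom])
  fix s assume s: "s < T"
  have "nabla_hat s (adj R (tensor (u f) (varpi f))) = tensor_op id (adj R) (tensor (khat (f s)) (tensor (u f) (varpi f)))" if f: "f \<in> S" for f
  proof -
    obtain c v f' where f': "f' \<in> \<S>" "adj R (tensor (u f) (varpi f)) = c *\<^sub>C tensor v (varpi f')" "f' s = f s"
      using *[of f "u f"] S(3) f s by blast
    have "nabla_hat s (c *\<^sub>C tensor v (varpi f')) = c *\<^sub>C nabla_hat s (tensor v (varpi f'))"
      using nabla_hat_linear[of s] tensor_varpi_in[OF f'(1), of v] unfolding clinear_on_def by blast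
    then show ?thesis
      by (simp add: f' nabla_hat_varpi tensor_op_id_right(2)[OF aR] tensor_scaleC_right)
  qed
  then have "nabla_hat s (adj R \<zeta>) = (\<Sum>f\<in>S. tensor_op id (adj R) (tensor (khat (f s)) (tensor (u f) (varpi f))))"
    unfolding eq by (subst clinear_on_sum[OF nabla_hat_linear S(2) dom]) auto
  then show "nabla_hat s (adj R \<zeta>) = tensor_op id (adj R) (nabla_hat s \<zeta>)"
    unfolding S(1) nabla_hat_exp_sum[OF S(2,3)] by (simp add: bounded_ops_simps(5)[OF tensor_op_id_right(1)[OF aR]])
qed

lemma nabla_compat_future_op:
  fixes g h :: "real => 'k::chilbert_space"
  assumes T: "0 \<le> T" and g: "g \<in> \<S>" and h: "h \<in> \<S>"
  shows "nabla_compat T (future_op T g h)"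
proof (rule nabla_compatI[OF future_op_bounded[OF T g]])
  fix u and f :: "real => 'k" assume f: "f \<in> \<S>"
  show "\<exists>c v f'. f' \<in> \<S> \<and> adj (future_op T g h) (tensor u (varpi f)) = c *\<^sub>C tensor v (varpi f') \<and> (\<forall>s<T. f' s = f s)"
    by (rule exI[of _ "tail T g f"], rule exI[of _ u], rule exI[of _ "splice T f h"])
      (simp add: step_splice[OF f h T] adj_future_op[OF T g h] future_op_varpi[OF T h f] splice_below)
qed

lemma nabla_compat_left:
  assumes a: "a \<in> \<B>"
  shows "nabla_compat T (tensor_op a id :: ('h::chilbert_space, 'k::chilbert_space) fock_op)"
proof (rule nabla_compatI[OF tensor_op(1)[OF a bounded_ops_id(1)]])
  fix u and f :: "real => 'k" assume f: "f \<in> \<S>"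
  show "\<exists>c v f'. f' \<in> \<S> \<and> adj (tensor_op a id) (tensor u (varpi f)) = c *\<^sub>C tensor v (varpi f') \<and> (\<forall>s<T. f' s = f s)"
    by (rule exI[of _ 1], rule exI[of _ "adj a u"], rule exI[of _ f])
      (simp add: f adj_tensor_op[OF a bounded_ops_id(1)] tensor_op(2)[OF adj_bounded_ops[OF a] bounded_ops_id(1)])
qed

lemma integral_intertwine:
  assumes R: "nabla_compat T R" and t: "t \<le> T" and \<zeta>: "\<zeta> \<in> proc_domain"
    and z: "\<And>\<zeta>. \<zeta> \<in> proc_domain ==> ((\<lambda>s. cinner (nabla_hat s \<zeta>) (x s)) has_integral cinner \<zeta> z) {0..t}"
    and y: "\<And>s. 0 \<le> s ==> s < t ==> y s = tensor_op id R (x s)"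
  shows "((\<lambda>s. cinner (nabla_hat s \<zeta>) (y s)) has_integral cinner \<zeta> (R z)) {0..t}"
proof -
  have Rb: "R \<in> \<B>" and dom: "adj R \<zeta> \<in> proc_domain"
    and nab: "\<And>s. s < T ==> nabla_hat s (adj R \<zeta>) = tensor_op id (adj R) (nabla_hat s \<zeta>)"
    using R \<zeta> unfolding nabla_compat_def by blast+
  have "((\<lambda>s. cinner (nabla_hat s (adj R \<zeta>)) (x s)) has_integral cinner \<zeta> (R z)) {0..t}"
    using z[OF dom] by (simp add: adj_cinner(1)[OF Rb])
  then show ?thesis
  \<comment> \<open>The gradient relation is available only before \<open>T\<close>, and
    \<open>t\<close> may equal \<open>T\<close>; a single endpoint does not affect the
    integral.\<close>
  proof (rule has_integral_spike_finite[of "{t}", rotated 2])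
    fix s assume s: "s \<in> {0..t} - {t}"
    then have "s < T" using t by auto
    then show "cinner (nabla_hat s \<zeta>) (y s) = cinner (nabla_hat s (adj R \<zeta>)) (x s)"
      using s by (simp add: nab y tensor_op_id_right(3)[OF Rb, symmetric] adj_cinner(1)[OF tensor_op_id_right(1)[OF Rb]])
  qed simp
qed

context flow
begin

text \<open>Transport of solutions. With \<open>solves_unique\<close> it shows that the solution for
  transformed data is the transformed solution, which yields adaptedness and membership in the
  tensor product with \<open>A\<close>.\<close>

lemma solves_intertwine:
  assumes y: "solves T g' \<xi> y" and R: "nabla_compat T R"
    and K: "\<And>s \<zeta>. 0 \<le> s ==> s \<le> T ==> K F s (tensor_op id R \<zeta>) = tensor_op id R (K F s \<zeta>)"
    and P: "\<And>s. s \<in> {0..T} ==> past_proj s g (R (y s)) = R (y s)" and g: "\<And>s. s < T ==> g s = g' s"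
  shows "solves T g (R \<xi>) (\<lambda>s. R (y s))"
  unfolding solves_def past_def
proof (intro conjI ballI)
  have Rb: "R \<in> \<B>" using R by (simp add: nabla_compat_def)
  show "continuous_on {0..T} (\<lambda>s. R (y s))" using y bounded_ops_continuous_on[OF Rb] by (auto simp: solves_def past_def)
  show "past_proj s g (R (y s)) = R (y s)" if "s \<in> {0..T}" for s using P[OF that] .
  fix t and \<zeta> :: "('h, 'k fockspace) htensor" assume t: "t \<in> {0..T}" and \<zeta>: "\<zeta> \<in> proc_domain"
  have "((\<lambda>s. cinner (nabla_hat s \<zeta>) (drive g (\<lambda>s. R (y s)) s)) has_integral cinner \<zeta> (R (y t - \<xi>))) {0..t}"
  proof (rule integral_intertwine[OF R _ \<zeta>, where x = "drive g' y"])
    show "drive g (\<lambda>s. R (y s)) s = tensor_op id R (drive g' y s)" if "0 \<le> s" "s < t" for s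
      using that t g by (simp add: drive_def K[symmetric] tensor_op_id_right(2)[OF Rb])
  qed (use y t in \<open>auto simp: solves_def\<close>)
  then show "((\<lambda>s. cinner (nabla_hat s \<zeta>) (drive g (\<lambda>s. R (y s)) s)) has_integral cinner \<zeta> (R (y t) - R \<xi>)) {0..t}"
    by (simp add: bounded_ops_simps(4)[OF Rb])
qed

section \<open>Picard iteration\<close>

lemma drive_driving:
  assumes g: "g \<in> \<S>" and y: "\<And>T. past T g y"
  shows "0 \<le> s ==> tensor_op id (past_proj s g) (drive g y s) = drive g y s"
    and "0 \<le> s ==> (drive g y \<longlongrightarrow> drive g y s) (at_right s)"
    and "\<exists>B. \<forall>s\<in>{0..T}. norm (drive g y s) \<le> B"
proof -
  show "0 \<le> s ==> tensor_op id (past_proj s g) (drive g y s) = drive g y s"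
    by (rule drive_past[OF _ g]) (use y[of s] in \<open>auto simp: past_def\<close>)
  show "0 \<le> s ==> (drive g y \<longlongrightarrow> drive g y s) (at_right s)"
    by (rule drive_right_continuous[OF g past_right_continuous[OF y[of "s + 1"]]]) simp
  have "bounded (y ` {0..T})"
    using y[of T] by (intro compact_imp_bounded compact_continuous_image) (auto simp: past_def)
  then obtain B where B: "\<And>s. s \<in> {0..T} ==> norm (y s) \<le> B" unfolding bounded_pos by blast
  have "norm (drive g y s) \<le> \<kappa> * khat_bound g * B" if "s \<in> {0..T}" for s
    by (rule order_trans[OF drive_bound[OF g, where y = y and s = s] mult_left_mono[OF B[OF that]]]) (simp add: \<kappa>(1) khat_bound_nonneg g)
  then show "\<exists>B. \<forall>s\<in>{0..T}. norm (drive g y s) \<le> B" by blast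
qed

context
  fixes g :: "real => 'k" and \<xi> :: "('h, 'k fockspace) htensor"
  assumes g: "g \<in> \<S>" and \<xi>: "\<And>s. 0 \<le> s ==> past_proj s g \<xi> = \<xi>"
begin

definition picard :: "(real => ('h, 'k fockspace) htensor) => real => ('h, 'k fockspace) htensor"
  where "picard y t = \<xi> + (SOME z. \<forall>\<zeta>\<in>proc_domain. ((\<lambda>s. cinner (nabla_hat s \<zeta>) (drive g y s)) has_integral cinner \<zeta> z) {0..t})"

lemma picard:
  assumes y: "\<And>T. past T g y" and t: "0 \<le> t" and \<zeta>: "\<zeta> \<in> proc_domain"
  shows "((\<lambda>s. cinner (nabla_hat s \<zeta>) (drive g y s)) has_integral cinner \<zeta> (picard y t - \<xi>)) {0..t}"
proof -
  obtain B where B: "\<forall>s\<in>{0..t}. norm (drive g y s) \<le> B" using drive_driving(3)[OF g y] by blast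
  have "\<exists>z. \<forall>\<zeta>\<in>proc_domain. ((\<lambda>s. cinner (nabla_hat s \<zeta>) (drive g y s)) has_integral cinner \<zeta> z) {0..t}"
    by (rule integral_vector_exists[OF t g, where B = B]) (use drive_driving(1,2)[OF g y] B in auto)
  from someI_ex[OF this] \<zeta> show ?thesis unfolding picard_def by simp
qed

lemma picard_past:
  assumes y: "\<And>T. past T g y" shows "past T g (picard y)"
  unfolding past_def
proof (intro conjI ballI)
  obtain B where B: "\<forall>s\<in>{0..T}. norm (drive g y s) \<le> B" using drive_driving(3)[OF g y] by blast
  have "continuous_on {0..T} (\<lambda>t. picard y t - \<xi>)"
    by (rule integral_continuous(1)[OF g, where x = "drive g y" and B = B]) (use drive_driving(1)[OF g y] B picard[OF y] in auto)
  then have "continuous_on {0..T} (\<lambda>t. (picard y t - \<xi>) + \<xi>)" by (intro continuous_on_add continuous_on_const)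
  then show "continuous_on {0..T} (picard y)" by simp
  fix t assume "t \<in> {0..T}"
  then have t: "0 \<le> t" by simp
  \<comment> \<open>The integrand at time \<open>s\<close> is fixed by the projection at
    \<open>s\<close>, hence by the one at the later time \<open>t\<close>, which can be pulled out
    of the integral.\<close>
  have "past_proj t g (picard y t - \<xi>) = picard y t - \<xi>"
  proof (rule proc_domain_ctotal)
    fix \<zeta> :: "('h, 'k fockspace) htensor" assume \<zeta>: "\<zeta> \<in> proc_domain"
    have "((\<lambda>s. cinner (nabla_hat s \<zeta>) (drive g y s)) has_integral cinner \<zeta> (past_proj t g (picard y t - \<xi>))) {0..t}"
    proof (rule integral_intertwine[OF nabla_compat_future_op[OF t g g] order_refl \<zeta> picard[OF y t]])
      fix s assume s: "0 \<le> s" "s < t"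
      have "past_proj t g (past_proj s g (y s)) = past_proj s g (y s)" by (rule past_proj_later) (use s g in auto)
      then have "past_proj t g (y s) = y s" using y[of s] s by (simp add: past_def)
      then show "drive g y s = tensor_op id (past_proj t g) (drive g y s)"
        unfolding drive_def using s
        by (subst K_future_op[OF F_amp s(1) _ g g, symmetric]) (simp_all add: tensor_op_id_right(2)[OF future_op_bounded[OF t g]])
    qed
    then show "cinner \<zeta> (past_proj t g (picard y t - \<xi>)) = cinner \<zeta> (picard y t - \<xi>)"
      by (rule has_integral_unique) (rule picard[OF y t \<zeta>])
  qed
  then show "past_proj t g (picard y t) = picard y t" by (simp add: bounded_ops_simps(4)[OF future_op_bounded[OF t g]] \<xi>[OF t])
qed

lemma picard_contraction:
  assumes y: "\<And>T. past T g y" and y': "\<And>T. past T g y'" and D: "0 \<le> D"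
    and b: "\<And>s. 0 \<le> s ==> norm (y s - y' s) \<le> D * exp (rate g * s)" and t: "0 \<le> t"
  shows "norm (picard y t - picard y' t) \<le> D / 2 * exp (rate g * t)"
proof (rule integral_contraction[OF t g D, where y = "\<lambda>s. y s - y' s"])
  fix \<zeta> :: "('h, 'k fockspace) htensor" assume \<zeta>: "\<zeta> \<in> proc_domain"
  from has_integral_diff[OF picard[OF y t \<zeta>] picard[OF y' t \<zeta>]]
  show "((\<lambda>s. cinner (nabla_hat s \<zeta>) (drive g (\<lambda>s. y s - y' s) s)) has_integral cinner \<zeta> (picard y t - picard y' t)) {0..t}"
    by (simp add: drive_diff cinner_diff_right)
next
  show "past_proj s g (y s - y' s) = y s - y' s" if "s \<in> {0..t}" for s
  proof -
    have "0 \<le> s" using that by simp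
    then show ?thesis using y[of s] y'[of s] by (simp add: past_def bounded_ops_simps(4)[OF future_op_bounded[OF _ g]])
  qed
qed (use b in auto)

text \<open>The iterates contract in the norm weighted by \<open>exp (rate g * t)\<close> and
  converge locally uniformly. The constant path \<open>\<xi>\<close> is itself the image of the zero
  path, so the first difference, and with it all others, is controlled by \<open>norm \<xi>\<close>
  alone.\<close>

lemma solution_exists:
  "\<exists>y. (\<forall>T. solves T g \<xi> y) \<and> (\<forall>t\<ge>0. norm (y t) \<le> 2 * exp (rate g * t) * norm \<xi>)"
proof -
  define Y where "Y n = (picard ^^ n) (\<lambda>_. \<xi>)" for n
  have Y_Suc: "Y (Suc n) = picard (Y n)" for n by (simp add: Y_def)
  have pY: "past T g (Y n)" for T n
  proof (induction n arbitrary: T)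
    case 0 show ?case by (simp add: Y_def past_def \<xi>)
  next
    case (Suc n) show ?case unfolding Y_Suc by (rule picard_past[OF Suc])
  qed
  have p0: "past T g (\<lambda>_. 0)" for T
    unfolding past_def using bounded_ops_simps(3)[OF future_op_bounded[OF _ g]] by auto
  have e1: "1 \<le> exp (rate g * t)" if "0 \<le> t" for t using that rate_pos[OF g] by simp
  have zero: "picard (\<lambda>_. 0) t = \<xi>" if t: "0 \<le> t" for t
  proof -
    have "norm (picard (\<lambda>_. 0) t - \<xi>) \<le> 0 / 2 * exp (rate g * t)"
      by (rule integral_contraction[OF t g order_refl, where y = "\<lambda>_. 0"]) (use picard[OF p0 t] p0[of t] in \<open>auto simp: past_def\<close>)
    then show ?thesis by simp
  qed
  have step: "norm (Y (Suc n) t - Y n t) \<le> norm \<xi> / 2 ^ Suc n * exp (rate g * t)" if "0 \<le> t" for n t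
    using that
  proof (induction n arbitrary: t)
    case 0
    have "norm (picard (Y 0) t - picard (\<lambda>_. 0) t) \<le> norm \<xi> / 2 * exp (rate g * t)"
    proof (rule picard_contraction[OF pY p0 _ _ 0])
      show "norm (Y 0 s - 0) \<le> norm \<xi> * exp (rate g * s)" if "0 \<le> s" for s
        using mult_left_mono[OF e1[OF that], of "norm \<xi>"] by (simp add: Y_def)
    qed simp
    then show ?case using 0 by (simp add: Y_Suc zero) (simp add: Y_def)
  next
    case (Suc n)
    have "norm (picard (Y (Suc n)) t - picard (Y n) t) \<le> norm \<xi> / 2 ^ Suc n / 2 * exp (rate g * t)"
      by (rule picard_contraction[OF pY pY _ Suc.IH Suc.prems]) auto
    then show ?case by (simp add: Y_Suc[of "Suc n"] Y_Suc[of n, symmetric] mult.commute)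
  qed
  have tele: "norm (Y (n + m) t - Y n t) \<le> norm \<xi> * exp (rate g * t) * ((1/2) ^ n - (1/2) ^ (n + m))" if t: "0 \<le> t" for n m t
  proof (induction m)
    case (Suc m)
    have "norm (Y (n + Suc m) t - Y n t) \<le> norm (Y (Suc (n + m)) t - Y (n + m) t) + norm (Y (n + m) t - Y n t)"
      using norm_triangle_ineq[of "Y (Suc (n + m)) t - Y (n + m) t" "Y (n + m) t - Y n t"] by simp
    also have "\<dots> \<le> norm \<xi> / 2 ^ Suc (n + m) * exp (rate g * t) + norm \<xi> * exp (rate g * t) * ((1/2) ^ n - (1/2) ^ (n + m))"
      by (intro add_mono step t Suc)
    also have "\<dots> = norm \<xi> * exp (rate g * t) * ((1/2) ^ n - (1/2) ^ (n + Suc m))"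
      by (simp add: field_simps power_divide)
    finally show ?case .
  qed simp
  have close: "norm (Y m t - Y n t) \<le> norm \<xi> * exp (rate g * t) * (1/2) ^ n" if "0 \<le> t" "n \<le> m" for m n t
  proof -
    have "norm (Y (n + (m - n)) t - Y n t) \<le> norm \<xi> * exp (rate g * t) * ((1/2) ^ n - (1/2) ^ (n + (m - n)))"
      by (rule tele[OF that(1)])
    also have "\<dots> \<le> norm \<xi> * exp (rate g * t) * (1/2) ^ n" by (intro mult_left_mono) auto
    finally show ?thesis using that(2) by simp
  qed
  have lim0: "(\<lambda>n. C * (1/2) ^ n) \<longlonglongrightarrow> 0" for C :: real
    by (intro tendsto_mult_right_zero LIMSEQ_realpow_zero) auto
  have "convergent (\<lambda>n. Y n t)" if t: "0 \<le> t" for t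
    unfolding Cauchy_convergent_iff[symmetric]
  proof (rule metric_CauchyI)
    fix e :: real assume e: "e > 0"
    obtain N where N: "norm \<xi> * exp (rate g * t) * (1/2) ^ N < e / 2"
      using order_tendstoD(2)[OF lim0[of "norm \<xi> * exp (rate g * t)"], of "e/2"] e by (auto simp: eventually_sequentially)
    have "dist (Y m t) (Y n t) < e" if "N \<le> m" "N \<le> n" for m n
      using close[OF t that(1)] close[OF t that(2)] N norm_triangle_ineq4[of "Y m t - Y N t" "Y n t - Y N t"]
      by (simp add: dist_norm)
    then show "\<exists>M. \<forall>m\<ge>M. \<forall>n\<ge>M. dist (Y m t) (Y n t) < e" by blast
  qed
  then have "\<forall>t\<ge>0. \<exists>l. (\<lambda>n. Y n t) \<longlonglongrightarrow> l" by (simp add: convergent_def)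
  then obtain y where y: "\<And>t. 0 \<le> t ==> (\<lambda>n. Y n t) \<longlonglongrightarrow> y t" by metis
  have yb: "norm (y t - Y n t) \<le> norm \<xi> * exp (rate g * t) * (1/2) ^ n" if t: "0 \<le> t" for n t
    by (rule LIMSEQ_le_const2[OF tendsto_norm[OF tendsto_diff[OF y[OF t] tendsto_const]]]) (use close[OF t] in blast)
  have py: "past T g y" for T
    unfolding past_def
  proof (intro conjI ballI)
    have "uniform_limit {0..T} Y y sequentially"
      unfolding uniform_limit_iff
    proof (intro allI impI)
      fix e :: real assume e: "e > 0"
      have le: "dist (Y n t) (y t) \<le> norm \<xi> * exp (rate g * T) * (1/2) ^ n" if "t \<in> {0..T}" for n t
      proof -
        have "norm \<xi> * exp (rate g * t) \<le> norm \<xi> * exp (rate g * T)"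
          using that rate_pos[OF g] by (intro mult_left_mono) auto
        then have "norm \<xi> * exp (rate g * t) * (1/2) ^ n \<le> norm \<xi> * exp (rate g * T) * (1/2) ^ n" by (rule mult_right_mono) simp
        then show ?thesis using yb[of t n] that by (simp add: dist_norm norm_minus_commute)
      qed
      have "\<forall>\<^sub>F n in sequentially. norm \<xi> * exp (rate g * T) * (1/2) ^ n < e" by (rule order_tendstoD(2)[OF lim0 e])
      then show "\<forall>\<^sub>F n in sequentially. \<forall>t\<in>{0..T}. dist (Y n t) (y t) < e"
        by eventually_elim (use le in \<open>meson le_less_trans\<close>)
    qed
    then show "continuous_on {0..T} y"
      by (rule uniform_limit_theorem[rotated]) (use pY in \<open>auto simp: past_def\<close>)
    fix s assume s: "s \<in> {0..T}"
    then have s0: "0 \<le> s" by simp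
    have "(\<lambda>n. past_proj s g (Y n s)) \<longlonglongrightarrow> past_proj s g (y s)"
      by (rule bounded_ops_tendsto[OF future_op_bounded[OF s0 g] y[OF s0]])
    moreover have "past_proj s g (Y n s) = Y n s" for n using pY[of T n] s by (simp add: past_def)
    ultimately show "past_proj s g (y s) = y s" using LIMSEQ_unique y[OF s0] by simp
  qed
  have fix_y: "picard y t = y t" if t: "0 \<le> t" for t
  proof -
    have "norm (picard y t - Y (Suc n) t) \<le> norm \<xi> * (1/2) ^ n / 2 * exp (rate g * t)" for n
      unfolding Y_Suc by (rule picard_contraction[OF py pY _ _ t]) (use yb in \<open>auto simp: mult_ac\<close>)
    then have "norm (picard y t - Y (Suc n) t) \<le> norm \<xi> / 2 * exp (rate g * t) * (1/2) ^ n" for n by (simp add: mult_ac)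
    then have "(\<lambda>n. picard y t - Y (Suc n) t) \<longlonglongrightarrow> 0"
      by (intro Lim_null_comparison[OF always_eventually lim0]) blast
    moreover have "(\<lambda>n. picard y t - Y (Suc n) t) \<longlonglongrightarrow> picard y t - y t"
      using LIMSEQ_Suc[OF y[OF t]] by (intro tendsto_diff tendsto_const)
    ultimately show ?thesis using LIMSEQ_unique by fastforce
  qed
  have "solves T g \<xi> y" for T unfolding solves_def using py[of T] picard[OF py] fix_y by auto
  moreover have "norm (y t) \<le> 2 * exp (rate g * t) * norm \<xi>" if t: "0 \<le> t" for t
  proof -
    \<comment> \<open>The distance to the zeroth iterate \<open>\<xi>\<close> and the norm of
      \<open>\<xi>\<close> contribute one multiple of \<open>exp (rate g * t)\<close> each, whence
      the factor 2.\<close>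
    have "norm (y t) \<le> norm (y t - \<xi>) + norm \<xi>" using norm_triangle_ineq[of "y t - \<xi>" \<xi>] by simp
    also have "\<dots> \<le> norm \<xi> * exp (rate g * t) + norm \<xi> * exp (rate g * t)"
      using yb[OF t, of 0] mult_left_mono[OF e1[OF t], of "norm \<xi>"] by (intro add_mono) (simp_all add: Y_def)
    finally show ?thesis by (simp add: mult_ac)
  qed
  ultimately show ?thesis by blast
qed

end

end

section \<open>The solution process\<close>

text \<open>The graph is described by coordinates: \<open>R \<xi> \<eta>\<close> says that
  \<open>Y\<close> maps each coordinate of \<open>\<xi>\<close> to that of \<open>\<eta>\<close>.
  Uniqueness of \<open>\<eta>\<close> is then evident and gives linearity of the extension.\<close>

lemma alg_ampliation:
  fixes Y :: "'b::chilbert_space => 'b"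
  assumes Y: "clinear_on D Y"
  shows alg_ampliation_linear: "clinear_on (alg_tensor (UNIV :: 'a::chilbert_space set) D) (alg_ampliation D Y)"
    and alg_ampliation_tensor: "\<zeta> \<in> D ==> alg_ampliation D Y (tensor (x :: 'a) \<zeta>) = tensor x (Y \<zeta>)"
proof -
  let ?E = "alg_tensor (UNIV :: 'a set) D"
  have D: "csubspace D" and add: "\<And>x y. x \<in> D ==> y \<in> D ==> Y (x + y) = Y x + Y y"
    and sc: "\<And>c x. x \<in> D ==> Y (c *\<^sub>C x) = c *\<^sub>C Y x" using Y by (auto simp: clinear_on_def)
  have E: "csubspace ?E" unfolding alg_tensor_def by (rule csubspace_cspan)
  define R where "R \<xi> \<eta> \<longleftrightarrow> (\<forall>e\<in>onb. lbra (e :: 'a) \<xi> \<in> D \<and> lbra e \<eta> = Y (lbra e \<xi>))" for \<xi> \<eta>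
  have uniq: "\<eta> = \<eta>'" if "R \<xi> \<eta>" "R \<xi> \<eta>'" for \<xi> \<eta> \<eta>'
    by (rule htensor_eqI) (use that in \<open>auto simp: R_def lbra_onb[symmetric]\<close>)
  have R_add: "R (\<xi> + \<xi>') (\<eta> + \<eta>')" if "R \<xi> \<eta>" "R \<xi>' \<eta>'" for \<xi> \<eta> \<xi>' \<eta>'
    using that by (simp add: R_def bounded_ops_simps(1)[OF lbra_bounded] add csubspaceD(2)[OF D])
  have R_sc: "R (c *\<^sub>C \<xi>) (c *\<^sub>C \<eta>)" if "R \<xi> \<eta>" for \<xi> \<eta> c
    using that by (simp add: R_def bounded_ops_simps(2)[OF lbra_bounded] sc csubspaceD(3)[OF D])
  have R_tensor: "R (tensor x \<zeta>) (tensor x (Y \<zeta>))" if "\<zeta> \<in> D" for x \<zeta>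
    using that by (simp add: R_def lbra_tensor sc csubspaceD(3)[OF D])
  have "?E \<subseteq> {\<xi>. \<exists>\<eta>. R \<xi> \<eta>}"
    unfolding alg_tensor_def
  proof (rule cspan_minimal)
    have "R 0 0" using R_tensor[OF csubspaceD(1)[OF D], of 0] by simp
    then show "csubspace {\<xi>. \<exists>\<eta>. R \<xi> \<eta>}" unfolding csubspace_def using R_add R_sc by blast
  qed (use R_tensor in auto)
  then have R_THE: "R \<xi> (THE \<eta>. R \<xi> \<eta>)" if "\<xi> \<in> ?E" for \<xi> using that uniq by (blast intro: theI')
  define L where "L \<xi> = (THE \<eta>. R \<xi> \<eta>)" for \<xi>
  have L: "L \<xi> = \<eta>" if "\<xi> \<in> ?E" "R \<xi> \<eta>" for \<xi> \<eta> unfolding L_def using uniq[OF R_THE[OF that(1)] that(2)] .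
  have RL: "R \<xi> (L \<xi>)" if "\<xi> \<in> ?E" for \<xi> using R_THE[OF that] by (simp add: L_def)
  have "clinear_on ?E L \<and> (\<forall>x. \<forall>\<zeta>\<in>D. L (tensor x \<zeta>) = tensor x (Y \<zeta>))"
    unfolding clinear_on_def
  proof (intro conjI ballI allI E)
    show "L (x + y) = L x + L y" if "x \<in> ?E" "y \<in> ?E" for x y
      by (rule L[OF csubspaceD(2)[OF E that] R_add[OF RL[OF that(1)] RL[OF that(2)]]])
    show "L (c *\<^sub>C x) = c *\<^sub>C L x" if "x \<in> ?E" for c x by (rule L[OF csubspaceD(3)[OF E that] R_sc[OF RL[OF that]]])
    show "L (tensor x \<zeta>) = tensor x (Y \<zeta>)" if "\<zeta> \<in> D" for x \<zeta>
      by (rule L[OF _ R_tensor[OF that]]) (use that in \<open>auto simp: alg_tensor_def intro: cspan_superset\<close>)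
  qed
  from someI[of "\<lambda>L. clinear_on ?E L \<and> (\<forall>x. \<forall>\<zeta>\<in>D. L (tensor x \<zeta>) = tensor x (Y \<zeta>))", OF this]
  have *: "clinear_on ?E (alg_ampliation D Y) \<and> (\<forall>x::'a. \<forall>\<zeta>\<in>D. alg_ampliation D Y (tensor x \<zeta>) = tensor x (Y \<zeta>))"
    unfolding alg_ampliation_def .
  then show "clinear_on ?E (alg_ampliation D Y)" by (rule conjunct1)
  show "\<zeta> \<in> D ==> alg_ampliation D Y (tensor x \<zeta>) = tensor x (Y \<zeta>)" using conjunct2[OF *] by blast
qed

text \<open>A vector adapted to \<open>f\<close> at time \<open>s\<close> becomes adapted to
  \<open>f'\<close> once its future from \<open>t\<close> on is replaced, since the two functions
  agree before \<open>t\<close>.\<close>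

lemma future_op_change:
  fixes x :: "('h::chilbert_space, 'k::chilbert_space fockspace) htensor"
  assumes s: "0 \<le> s" "s \<le> t" and f: "f \<in> \<S>" and f': "f' \<in> \<S>" and eq: "\<And>r. r < t ==> f' r = f r"
  shows "past_proj s f' (future_op t f' f (past_proj s f x)) = future_op t f' f (past_proj s f x)"
proof -
  have t: "0 \<le> t" using s by simp
  have "past_proj s f' \<circ> future_op t f' f \<circ> past_proj s f = (future_op t f' f \<circ> past_proj s f :: ('h, 'k) fock_op)"
  proof (rule bounded_ops_eq_on_varpiI)
    fix u :: 'h and h :: "real => 'k" assume h: "h \<in> \<S>"
    have sp: "splice t (splice s h f) f' = splice s h f'" "splice s (splice s h f') f' = splice s h f'"
      using s eq by (auto simp: splice_def)
    note st = step_splice[OF h f s(1)] step_splice[OF h f' s(1)]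
    show "(past_proj s f' \<circ> future_op t f' f \<circ> past_proj s f) (tensor u (varpi h)) = (future_op t f' f \<circ> past_proj s f) (tensor u (varpi h))"
      by (simp add: future_op_varpi[OF s(1) f h] future_op_varpi[OF t f' st(1)] future_op_varpi[OF s(1) f' st(2)]
          bounded_ops_simps(2)[OF future_op_bounded[OF t f']] bounded_ops_simps(2)[OF future_op_bounded[OF s(1) f']] sp)
  qed (intro bounded_ops_compose future_op_bounded s t f f')+
  then show ?thesis by (metis comp_apply)
qed

text \<open>Composing the projections of two functions replaces the future of \<open>f\<close> by
  that of \<open>g\<close>, at the price of the overlap of the two futures. It serves the estimate
  for the adjoint process.\<close>

lemma past_proj_past_proj:
  fixes x :: "('h::chilbert_space, 'k::chilbert_space fockspace) htensor"
  assumes s: "0 \<le> s" and f: "f \<in> \<S>" and g: "g \<in> \<S>"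
  shows "past_proj s g (past_proj s f x) = tail s g f *\<^sub>C future_op s (splice s f g) f x"
proof -
  note fg = step_splice[OF f g s]
  have "past_proj s g \<circ> past_proj s f = (\<lambda>x. tail s g f *\<^sub>C (future_op s (splice s f g) f x :: ('h, 'k fockspace) htensor))"
  proof (rule bounded_ops_eq_on_varpiI)
    fix u :: 'h and h :: "real => 'k" assume h: "h \<in> \<S>"
    have sp: "splice s (splice s h f) g = splice s h g" "splice s h (splice s f g) = splice s h g"
      by (auto simp: splice_def)
    show "(past_proj s g \<circ> past_proj s f) (tensor u (varpi h)) = tail s g f *\<^sub>C future_op s (splice s f g) f (tensor u (varpi h))"
      by (simp add: future_op_varpi[OF s f h] future_op_varpi[OF s g step_splice[OF h f s]] future_op_varpi[OF s fg h]
          bounded_ops_simps(2)[OF future_op_bounded[OF s g]] sp scaleC_scaleC mult.commute)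
  qed (intro bounded_ops_compose bounded_ops_scaleC future_op_bounded s f g fg)+
  then show ?thesis by (metis comp_apply)
qed

lemma norm_varpi [simp]: "norm (varpi f) = 1" by (simp add: varpi_def)

lemma past_proj_self: "0 \<le> s ==> g \<in> \<S> ==> past_proj s g (tensor u (varpi g)) = tensor u (varpi g)"
  by (simp add: future_op_varpi)

section \<open>The solution as an adapted process\<close>

context flow
begin

definition sol :: "(real => 'k) => 'h => real => ('h, 'k fockspace) htensor"
  where "sol g u = (SOME y. (\<forall>T. solves T g (tensor u (varpi g)) y) \<and>
    (\<forall>t\<ge>0. norm (y t) \<le> 2 * exp (rate g * t) * norm (tensor u (varpi g))))"

lemma sol:
  assumes g: "g \<in> \<S>"
  shows sol_solves: "solves T g (tensor u (varpi g)) (sol g u)"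
    and sol_bound: "0 \<le> t ==> norm (sol g u t) \<le> 2 * exp (rate g * t) * norm u"
  using someI_ex[OF solution_exists[OF g past_proj_self[OF _ g]], folded sol_def, of u] by (auto simp: norm_tensor)

lemma sol_eqI: "g \<in> \<S> ==> solves T g (tensor u (varpi g)) y ==> t \<in> {0..T} ==> sol g u t = y t"
  by (rule solves_unique[OF _ sol_solves])

lemma sol_linear:
  assumes g: "g \<in> \<S>" and t: "0 \<le> t"
  shows "sol g (u + v) t = sol g u t + sol g v t" "sol g (c *\<^sub>C u) t = c *\<^sub>C sol g u t"
proof -
  have "solves t g (tensor (u + v) (varpi g)) (\<lambda>s. sol g u s + sol g v s)"
    unfolding tensor_add_left by (intro solves_add g sol_solves)
  then show "sol g (u + v) t = sol g u t + sol g v t" by (rule sol_eqI[OF g]) (use t in simp)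
  have "solves t g (tensor (c *\<^sub>C u) (varpi g)) (\<lambda>s. c *\<^sub>C sol g u s)"
    unfolding tensor_scaleC_left by (intro solves_scaleC g sol_solves)
  then show "sol g (c *\<^sub>C u) t = c *\<^sub>C sol g u t" by (rule sol_eqI[OF g]) (use t in simp)
qed

lemma sol_past: "g \<in> \<S> ==> past T g (sol g u)"
  using sol_solves[of g T u] by (simp add: solves_def)

lemma sol_past_proj: "g \<in> \<S> ==> 0 \<le> s ==> past_proj s g (sol g u s) = sol g u s"
  using sol_past[of g s u] by (simp add: past_def)

text \<open>Changing \<open>f\<close> from time \<open>t\<close> on changes only the future factor:
  \<open>future_op t f' f\<close> carries the solution for \<open>f\<close> to a solution for
  \<open>f'\<close>, and solutions are unique. This is the adaptedness of the process.\<close>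

lemma sol_change:
  assumes t: "0 \<le> t" and f: "f \<in> \<S>" and f': "f' \<in> \<S>" and eq: "\<And>r. r < t ==> f' r = f r"
  shows "sol f' u t = future_op t f' f (sol f u t)"
proof -
  have sp: "splice t f f' = f'" using eq by (auto simp: splice_def)
  have "solves t f' (future_op t f' f (tensor u (varpi f))) (\<lambda>s. future_op t f' f (sol f u s))"
  proof (rule solves_intertwine[OF sol_solves[OF f] nabla_compat_future_op[OF t f' f]])
    show "K F s (tensor_op id (future_op t f' f) \<zeta>) = tensor_op id (future_op t f' f) (K F s \<zeta>)" if "0 \<le> s" "s \<le> t" for s \<zeta>
      by (rule K_future_op[OF F_amp that f' f])
    show "past_proj s f' (future_op t f' f (sol f u s)) = future_op t f' f (sol f u s)" if "s \<in> {0..t}" for s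
      using future_op_change[of s t f f' "sol f u s"] that f f' eq sol_past_proj[OF f] by simp
  qed (rule eq)
  then have "solves t f' (tensor u (varpi f')) (\<lambda>s. future_op t f' f (sol f u s))"
    by (simp add: future_op_varpi[OF t f' f] sp)
  from sol_eqI[OF f' this, of t] t show ?thesis by simp
qed

lemma sol_commutant:
  assumes t: "0 \<le> t" and f: "f \<in> \<S>" and a': "a' \<in> commutant A"
  shows "sol f (a' u) t = tensor_op a' id (sol f u t)"
proof -
  have b: "a' \<in> \<B>" using a' by (rule commutantD_bounded)
  have comm: "past_proj s f (tensor_op a' id x) = tensor_op a' id (past_proj s f x)" if s: "0 \<le> s" for s and x :: "('h, 'k fockspace) htensor"
  proof -
    have "past_proj s f \<circ> tensor_op a' id = (tensor_op a' id \<circ> past_proj s f :: ('h, 'k) fock_op)"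
      by (rule bounded_ops_eq_on_varpiI; (intro bounded_ops_compose future_op_bounded s f tensor_op(1) b bounded_ops_id(1))?)
        (simp add: future_op_varpi[OF s f] tensor_op(2)[OF b bounded_ops_id(1)] bounded_ops_simps(2)[OF tensor_op(1)[OF b bounded_ops_id(1)]])
    then show ?thesis by (metis comp_apply)
  qed
  have "solves t f (tensor_op a' id (tensor u (varpi f))) (\<lambda>s. tensor_op a' id (sol f u s))"
    by (rule solves_intertwine[OF sol_solves[OF f] nabla_compat_left[OF b] K_commutant[OF _ a']])
      (simp_all add: comm sol_past_proj[OF f])
  then have "solves t f (tensor (a' u) (varpi f)) (\<lambda>s. tensor_op a' id (sol f u s))"
    by (simp add: tensor_op(2)[OF b bounded_ops_id(1)])
  from sol_eqI[OF f this, of t] t show ?thesis by simp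
qed

text \<open>Clamping the time at 0 keeps the prescription linear in \<open>u\<close> at negative
  times, where \<open>sol\<close> satisfies no equation, so that \<open>linear_extension\<close>
  applies at every \<open>t\<close>.\<close>

definition Y :: "real => ('h, 'k) fock_op"
  where "Y t = (SOME L. clinear_on proc_domain L \<and> (\<forall>u. \<forall>f\<in>\<S>. L (tensor u (varpi f)) = sol f u (max 0 t)))"

lemma Y_linear: "clinear_on proc_domain (Y t)"
  and Y_varpi': "f \<in> \<S> ==> Y t (tensor u (varpi f)) = sol f u (max 0 t)"
proof -
  have "\<exists>L. clinear_on proc_domain L \<and> (\<forall>u. \<forall>f\<in>\<S>. L (tensor u (varpi f)) = sol f u (max 0 t))"
    by (rule linear_extension) (simp_all add: sol_linear)
  note * = someI_ex[OF this, folded Y_def]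
  show "clinear_on proc_domain (Y t)" by (rule conjunct1[OF *])
  show "f \<in> \<S> ==> Y t (tensor u (varpi f)) = sol f u (max 0 t)" using conjunct2[OF *] by blast
qed

lemma Y_varpi: "f \<in> \<S> ==> 0 \<le> t ==> Y t (tensor u (varpi f)) = sol f u t"
  by (simp add: Y_varpi')

definition G :: "(real => ('h, 'k) fock_op) => real => ('h, 'k) hat_space => ('h, 'k) hat_space"
  where "G X t = id_tensor_map A (j t) F \<circ> alg_ampliation proc_domain (X t)"

lemma G_tensor:
  assumes "clinear_on proc_domain (X t)" "0 \<le> t" "\<zeta> \<in> proc_domain"
  shows "G X t (tensor x \<zeta>) = K F t (tensor x (X t \<zeta>))"
  by (simp add: G_def K_eq[OF assms(2)] alg_ampliation_tensor[OF assms(1,3)])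

lemma G_linear:
  assumes "clinear_on proc_domain (X t)" "0 \<le> t" shows "clinear_on (alg_tensor UNIV proc_domain) (G X t)"
  using alg_ampliation_linear[OF assms(1), where 'a = "complex \<times> 'k"] unfolding clinear_on_def G_def K_eq[OF assms(2), symmetric]
  by (simp add: bounded_ops_simps[OF K_bounded[OF F_amp]])

lemma nabla_hat_in: "\<zeta> \<in> proc_domain ==> nabla_hat t (\<zeta> :: ('h, 'k fockspace) htensor) \<in> alg_tensor UNIV proc_domain"
proof -
  assume "\<zeta> \<in> proc_domain"
  then obtain S u where S: "\<zeta> = exp_sum S u" "finite S" "S \<subseteq> \<S>" unfolding proc_domain_eq by blast
  have "tensor (khat (f t)) (tensor (u f) (varpi f)) \<in> alg_tensor UNIV proc_domain" if "f \<in> S" for f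
    unfolding alg_tensor_def[of UNIV proc_domain] by (rule cspan_superset) (use S(3) that tensor_varpi_in in blast)
  moreover have "csubspace (alg_tensor UNIV proc_domain :: ('h, 'k) hat_space set)"
    unfolding alg_tensor_def[of UNIV proc_domain] by (rule csubspace_cspan)
  ultimately show ?thesis
    unfolding S(1) nabla_hat_exp_sum[OF S(2,3)] by (intro csubspace_sum)
qed

lemma G_nabla:
  assumes X: "clinear_on proc_domain (X t)" and t: "0 \<le> t" and S: "finite S" "S \<subseteq> \<S>"
  shows "G X t (nabla_hat t (exp_sum S u)) = (\<Sum>f\<in>S. drive f (\<lambda>s. X s (tensor (u f) (varpi f))) t)"
proof -
  have *: "tensor (khat (f t)) (tensor (u f) (varpi f)) \<in> alg_tensor UNIV proc_domain" if "f \<in> S" for f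
    using nabla_hat_in[OF tensor_varpi_in[of f "u f"], of t] S(2) that by (auto simp: nabla_hat_varpi)
  have "G X t (\<Sum>f\<in>S. tensor (khat (f t)) (tensor (u f) (varpi f))) = (\<Sum>f\<in>S. G X t (tensor (khat (f t)) (tensor (u f) (varpi f))))"
    by (rule clinear_on_sum[OF G_linear[where X = X and t = t, OF X t] S(1) *])
  also have "\<dots> = (\<Sum>f\<in>S. drive f (\<lambda>s. X s (tensor (u f) (varpi f))) t)"
  proof (intro sum.cong refl)
    fix f assume "f \<in> S"
    then have "tensor (u f) (varpi f) \<in> proc_domain" using S(2) tensor_varpi_in by blast
    from G_tensor[where X = X and t = t, OF X t this]
    show "G X t (tensor (khat (f t)) (tensor (u f) (varpi f))) = drive f (\<lambda>s. X s (tensor (u f) (varpi f))) t"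
      by (simp add: drive_def)
  qed
  finally show ?thesis unfolding nabla_hat_exp_sum[OF S] .
qed

end

text \<open>The adjoint acts on the left entry of a matrix element: it truncates \<open>f\<close>
  and leaves the overlap of the futures, which is the factor in the adaptedness relation.\<close>

lemma future_op_adapted:
  fixes f g :: "real => 'k::chilbert_space"
  assumes t: "0 \<le> t" and f: "f \<in> \<S>" and g: "g \<in> \<S>"
  shows "adj (future_op t g (restr {0..<t} g)) (tensor v (varpi f)) = cnj (tail t f g) *\<^sub>C tensor v (varpi (restr {0..<t} f))"
proof -
  have "splice t f (restr {0..<t} g) = restr {0..<t} f"
    using step_neg[OF f] t by (force simp: splice_def restr_def)
  then show ?thesis
    unfolding adj_future_op[OF t g step_restr_below[OF g]] future_op_varpi[OF t step_restr_below[OF g] f]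
    by (simp add: tail_commute[of t f g])
qed

lemma adapted_id: "adapted (\<lambda>t. \<lambda>\<zeta>. \<zeta> :: ('h::chilbert_space, 'k::chilbert_space fockspace) htensor)"
  unfolding adapted_iff by (simp add: cinner_tensor varpi_cinner_split)

lemma adapted_diff:
  assumes X: "adapted X" and X': "adapted X'" shows "adapted (\<lambda>t \<zeta>. X t \<zeta> - X' t \<zeta>)"
  unfolding adapted_iff cinner_diff_right right_diff_distrib
proof (intro allI impI ballI)
  fix t :: real and f g :: "real => 'b" and u v assume "0 \<le> t" "f \<in> \<S>" "g \<in> \<S>"
  then show "cinner (tensor v (varpi f)) (X t (tensor u (varpi g))) - cinner (tensor v (varpi f)) (X' t (tensor u (varpi g))) =
      tail t f g * cinner (tensor v (varpi (restr {0..<t} f))) (X t (tensor u (varpi (restr {0..<t} g)))) -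
      tail t f g * cinner (tensor v (varpi (restr {0..<t} f))) (X' t (tensor u (varpi (restr {0..<t} g))))"
    using X X' unfolding adapted_iff by (intro arg_cong2[of _ _ _ _ "(-)"]) blast+
qed

lemma operator_processI:
  assumes "\<And>t. 0 \<le> t ==> clinear_on proc_domain (X t)" "\<And>\<zeta>. \<zeta> \<in> proc_domain ==> continuous_on {0..} (\<lambda>t. X t \<zeta>)" "adapted X"
  shows "operator_process X"
  unfolding operator_process_def
  using assms by (auto intro!: continuous_imp_measurable_on_sets_lebesgue continuous_on_cinner' continuous_on_const)

lemma clinear_on_diff:
  assumes "clinear_on D S" "clinear_on D T" shows "clinear_on D (\<lambda>x. S x - T x)"
  using assms unfolding clinear_on_def by (auto simp: scaleC_diff_right)

lemma bounded_clinear_on: "T \<in> \<B> ==> csubspace D ==> clinear_on D T"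
  by (simp add: clinear_on_def bounded_ops_simps)

lemma continuous_on_halfline:
  fixes y :: "real => 'a::topological_space"
  assumes "\<And>T. continuous_on {0..T} y" shows "continuous_on {0..} y"
  unfolding continuous_on_def
proof
  fix s :: real assume s: "s \<in> {0..}"
  have "at s within {0..} = at s within {0..s + 1}" by (rule at_within_nhd[of _ "{..<s + 1}"]) auto
  then show "(y \<longlongrightarrow> y s) (at s within {0..})" using assms[of "s + 1"] s by (simp add: continuous_on_def)
qed

lemma locally_integrableI:
  assumes rc: "\<And>s. 0 \<le> s ==> (x \<longlongrightarrow> x s) (at_right s)" and B: "\<And>T. \<exists>B. \<forall>s\<in>{0..T}. norm (x s) \<le> B"
  shows "locally_integrable p x"
  unfolding locally_integrable_def
proof (intro allI impI conjI exI[of _ x])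
  fix T :: real assume T: "T > 0"
  have "(\<lambda>s. s) \<in> borel_measurable (lebesgue_on {0..T})" by (intro measurable_restrict_space1 measurable_completion) simp
  then show "strongly_measurable (lebesgue_on {0..T}) x"
    by (rule strongly_measurable_right_continuous) (use rc in auto)
  obtain C where C: "\<forall>s\<in>{0..T}. norm (x s) \<le> C" using B by blast
  have "(\<integral>\<^sup>+s. ennreal ((norm (x s))^p) \<partial>lebesgue_on {0..T}) \<le> (\<integral>\<^sup>+s. ennreal (C^p) \<partial>lebesgue_on {0..T})"
    by (intro nn_integral_mono ennreal_leI power_mono) (use C in auto)
  also have "\<dots> = ennreal (C^p) * emeasure lborel {0..T}" by (simp add: emeasure_restrict_space)
  also have "\<dots> < \<infinity>" by (simp add: ennreal_mult_less_top emeasure_lborel_Icc_eq)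
  finally show "(\<integral>\<^sup>+s. ennreal ((norm (x s))^p) \<partial>lebesgue_on {0..T}) < \<infinity>" .
qed simp

lemma hat_bra_cinner: "cinner v (hat_bra x \<epsilon> w) = cinner (tensor x (tensor v \<epsilon>)) w"
proof -
  have "hat_ket x \<epsilon> = lket x \<circ> ket \<epsilon>" by (auto simp: hat_ket_def lket_def ket_def)
  then have "hat_ket x \<epsilon> \<in> \<B>" using bounded_ops_compose[OF lket_bounded ket_bounded] by metis
  then show ?thesis unfolding hat_bra_def by (subst adj_cinner(2)) (simp_all add: hat_ket_def)
qed

context flow
begin

lemma Y_exp_sum: "0 \<le> t ==> finite S ==> S \<subseteq> \<S> ==> Y t (exp_sum S u) = (\<Sum>f\<in>S. sol f (u f) t)"
  unfolding exp_sum_def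
  by (subst clinear_on_sum[OF Y_linear]) (auto simp: Y_varpi subset_iff intro!: tensor_varpi_in)

lemma Y_continuous: assumes "\<zeta> \<in> proc_domain" shows "continuous_on {0..} (\<lambda>t. Y t \<zeta>)"
proof -
  obtain S u where S: "\<zeta> = exp_sum S u" "finite S" "S \<subseteq> \<S>" using assms unfolding proc_domain_eq by blast
  have "continuous_on {0..} (sol f (u f))" if "f \<in> S" for f
    by (rule continuous_on_halfline) (use sol_past[of f _ "u f"] S(3) that in \<open>auto simp: past_def\<close>)
  then have "continuous_on {0..} (\<lambda>t. \<Sum>f\<in>S. sol f (u f) t)" by (rule continuous_on_sum)
  then show ?thesis by (rule continuous_on_eq) (simp add: S Y_exp_sum)
qed

lemma sol_adapted:
  assumes "0 \<le> t" "g \<in> \<S>"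
  shows "sol g u t = future_op t g (restr {0..<t} g) (sol (restr {0..<t} g) u t)"
  by (rule sol_change[OF assms(1) step_restr_below[OF assms(2)] assms(2)]) (use step_neg[OF assms(2)] in \<open>auto simp: restr_def\<close>)

lemma Y_adapted: "adapted Y"
  unfolding adapted_iff
proof (intro allI impI ballI)
  fix t :: real and f g :: "real => 'k" and u v :: 'h assume t: "0 \<le> t" and f: "f \<in> \<S>" and g: "g \<in> \<S>"
  show "cinner (tensor v (varpi f)) (Y t (tensor u (varpi g))) =
      tail t f g * cinner (tensor v (varpi (restr {0..<t} f))) (Y t (tensor u (varpi (restr {0..<t} g))))"
    unfolding Y_varpi[OF g t] Y_varpi[OF step_restr_below[OF g] t] sol_adapted[OF t g]
      adj_cinner(1)[OF future_op_bounded[OF t g], symmetric] future_op_adapted[OF t f g] by (simp add: cinner_scaleC_left)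
qed

lemma Y_process: "operator_process Y"
  by (intro operator_processI Y_linear Y_continuous Y_adapted)

text \<open>On a finite exponential sum the integrand is the sum of the integrands
  \<open>drive\<close> of the vector equations, whose properties add up.\<close>

lemma integrand:
  assumes \<zeta>: "\<zeta> \<in> proc_domain"
  shows integrand_right_continuous: "0 \<le> s ==> ((\<lambda>s. G Y s (nabla_hat s \<zeta>)) \<longlongrightarrow> G Y s (nabla_hat s \<zeta>)) (at_right s)"
    and integrand_bounded: "\<exists>B. \<forall>s\<in>{0..T}. norm (G Y s (nabla_hat s \<zeta>)) \<le> B"
    and Y_integral: "0 \<le> t ==> \<zeta>' \<in> proc_domain ==>
      ((\<lambda>s. cinner (nabla_hat s \<zeta>') (G Y s (nabla_hat s \<zeta>))) has_integral cinner \<zeta>' (Y t \<zeta> - \<zeta>)) {0..t}"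
proof -
  obtain S u where S: "\<zeta> = exp_sum S u" "finite S" "S \<subseteq> \<S>" using \<zeta> unfolding proc_domain_eq by blast
  have st: "f \<in> \<S>" if "f \<in> S" for f using S(3) that by blast
  have eq: "G Y s (nabla_hat s \<zeta>) = (\<Sum>f\<in>S. drive f (sol f (u f)) s)" if s: "0 \<le> s" for s
    unfolding S(1) G_nabla[where X = Y and t = s, OF Y_linear s S(2,3)]
    by (intro sum.cong refl) (simp add: drive_def Y_varpi[OF st s])
  show "((\<lambda>s. G Y s (nabla_hat s \<zeta>)) \<longlongrightarrow> G Y s (nabla_hat s \<zeta>)) (at_right s)" if s: "0 \<le> s"
  proof -
    have "((\<lambda>s. \<Sum>f\<in>S. drive f (sol f (u f)) s) \<longlongrightarrow> (\<Sum>f\<in>S. drive f (sol f (u f)) s)) (at_right s)"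
      by (intro tendsto_sum drive_driving(2) sol_past st s)
    then show ?thesis
      unfolding eq[OF s] by (rule Lim_transform_eventually)
        (use s in \<open>auto simp: eq eventually_at_right_field intro!: exI[of _ "s + 1"]\<close>)
  qed
  have "\<forall>f\<in>S. \<exists>B. \<forall>s\<in>{0..T}. norm (drive f (sol f (u f)) s) \<le> B"
    by (intro ballI drive_driving(3) sol_past st)
  then obtain B where "\<forall>f\<in>S. \<forall>s\<in>{0..T}. norm (drive f (sol f (u f)) s) \<le> B f" by (elim exE[OF bchoice])
  then show "\<exists>B. \<forall>s\<in>{0..T}. norm (G Y s (nabla_hat s \<zeta>)) \<le> B"
    by (intro exI[of _ "sum B S"]) (auto simp: eq intro: sum_norm_le)
  show "((\<lambda>s. cinner (nabla_hat s \<zeta>') (G Y s (nabla_hat s \<zeta>))) has_integral cinner \<zeta>' (Y t \<zeta> - \<zeta>)) {0..t}"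
    if t: "0 \<le> t" and \<zeta>': "\<zeta>' \<in> proc_domain"
  proof -
    have "((\<lambda>s. \<Sum>f\<in>S. cinner (nabla_hat s \<zeta>') (drive f (sol f (u f)) s)) has_integral
        (\<Sum>f\<in>S. cinner \<zeta>' (sol f (u f) t - tensor (u f) (varpi f)))) {0..t}"
      by (rule has_integral_sum[OF S(2)]) (use sol_solves[OF st, of _ t] t \<zeta>' in \<open>auto simp: solves_def\<close>)
    then show ?thesis
      unfolding cinner_sum_right[symmetric] sum_subtractf Y_exp_sum[OF t S(2,3), folded S(1), symmetric] exp_sum_def[symmetric] S(1)[symmetric]
      by (rule has_integral_cong[THEN iffD1, rotated]) (simp add: eq)
  qed
qed

text \<open>Local integrability comes from right-continuity and local boundedness of the integrand.
  For adaptedness, the solution for \<open>g\<close> arises from that for the truncated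
  \<open>g\<close> by \<open>future_op\<close>, which commutes with the coefficient.\<close>

lemma Y_integrable: "qs_integrable (\<lambda>t. alg_tensor UNIV proc_domain) (G Y)"
  unfolding qs_integrable_def
proof (intro conjI allI impI ballI)
  show "clinear_on (alg_tensor UNIV proc_domain) (G Y t)" if "0 \<le> t" for t by (rule G_linear[OF Y_linear that])
  show "nabla_hat t \<zeta> \<in> alg_tensor UNIV proc_domain" if "\<zeta> \<in> proc_domain" for t and \<zeta> :: "('h, 'k fockspace) htensor"
    by (rule nabla_hat_in[OF that])
  have loc: "locally_integrable p (\<lambda>s. tensor_op R id (G Y s (nabla_hat s \<zeta>)))"
    if R: "R \<in> \<B>" and \<zeta>: "\<zeta> \<in> proc_domain" for p and R :: "complex \<times> 'k => complex \<times> 'k" and \<zeta>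
  proof (rule locally_integrableI)
    have b: "tensor_op R id \<in> \<B>" by (rule tensor_op(1)[OF R bounded_ops_id(1)])
    show "((\<lambda>s. tensor_op R id (G Y s (nabla_hat s \<zeta>))) \<longlongrightarrow> tensor_op R id (G Y s (nabla_hat s \<zeta>))) (at_right s)" if "0 \<le> s" for s
      by (rule bounded_ops_tendsto[OF b integrand_right_continuous[OF \<zeta> that]])
    fix T :: real
    obtain C where C: "C \<ge> 0" "op_bound (tensor_op R (id :: ('h, 'k) fock_op)) C" by (rule bounded_ops_bound[OF b])
    obtain B where B: "\<forall>s\<in>{0..T}. norm (G Y s (nabla_hat s \<zeta>)) \<le> B" using integrand_bounded[OF \<zeta>] by blast
    have "norm (tensor_op R id (G Y s (nabla_hat s \<zeta>))) \<le> C * B" if "s \<in> {0..T}" for s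
      using C(2) mult_left_mono[OF B[rule_format, OF that] C(1)] unfolding op_bound_def by (meson order_trans)
    then show "\<exists>B. \<forall>s\<in>{0..T}. norm (tensor_op R id (G Y s (nabla_hat s \<zeta>))) \<le> B" by blast
  qed
  have proj: "(\<lambda>(z, c). (z, 0)) \<in> (\<B> :: (complex \<times> 'k => complex \<times> 'k) set)"
    "(\<lambda>(z, c). (0, c)) \<in> (\<B> :: (complex \<times> 'k => complex \<times> 'k) set)"
    by (rule bounded_opsI[where K = 1]; force simp: op_bound_def scaleC_prod_def norm_Pair norm_fst_le norm_snd_le)+
  show "locally_integrable 1 (\<lambda>s. Delta_perp (G Y s (nabla_hat s \<zeta>)))" "locally_integrable 2 (\<lambda>s. Delta (G Y s (nabla_hat s \<zeta>)))"
    if "\<zeta> \<in> proc_domain" for \<zeta>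
    unfolding Delta_perp_def Delta_def by (intro loc proj that)+
  fix t :: real and f g :: "real => 'k" and u :: 'h assume t: "0 \<le> t" and f: "f \<in> \<S>" and g: "g \<in> \<S>"
  let ?g = "restr {0..<t} g"
  note g' = step_restr_below[OF g, of t]
  show "hat_ket (khat (g t)) (varpi ?g) u \<in> alg_tensor UNIV proc_domain"
    unfolding hat_ket_def alg_tensor_def[of UNIV proc_domain] by (rule cspan_superset) (use tensor_varpi_in[OF g'] in blast)
  show "hat_bra (khat (f t)) (varpi f) (G Y t (nabla_hat t (ket (varpi g) u))) =
      cinner (varpi (restr {t..} f)) (varpi (restr {t..} g)) *\<^sub>C
      hat_bra (khat (f t)) (varpi (restr {0..<t} f)) (G Y t (hat_ket (khat (g t)) (varpi ?g) u))"
  proof (rule cinner_eqI)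
    fix v
    note b = future_op_bounded[OF t g, of ?g]
    have "cinner v (hat_bra (khat (f t)) (varpi f) (G Y t (nabla_hat t (ket (varpi g) u)))) =
        cinner (tensor (khat (f t)) (tensor v (varpi f))) (tensor_op id (future_op t g ?g) (K F t (tensor (khat (g t)) (sol ?g u t))))"
      unfolding K_future_op[OF F_amp t order_refl g g', symmetric] tensor_op_id_right(2)[OF b] sol_adapted[OF t g, symmetric]
      by (simp add: hat_bra_cinner ket_def nabla_hat_varpi[OF g] G_tensor[where X = Y and t = t, OF Y_linear t tensor_varpi_in[OF g]] Y_varpi[OF g t])
    also have "\<dots> = tail t f g * cinner (tensor (khat (f t)) (tensor v (varpi (restr {0..<t} f)))) (K F t (tensor (khat (g t)) (sol ?g u t)))"
      unfolding adj_cinner(1)[OF tensor_op_id_right(1)[OF b], symmetric] tensor_op_id_right(3)[OF b]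
        tensor_op_id_right(2)[OF adj_bounded_ops[OF b]] future_op_adapted[OF t f g]
      by (simp add: tensor_scaleC_right cinner_scaleC_left)
    also have "\<dots> = cinner v (tail t f g *\<^sub>C hat_bra (khat (f t)) (varpi (restr {0..<t} f)) (G Y t (hat_ket (khat (g t)) (varpi ?g) u)))"
      by (simp add: hat_bra_cinner cinner_scaleC_right hat_ket_def G_tensor[where X = Y and t = t, OF Y_linear t tensor_varpi_in[OF g']] Y_varpi[OF g' t])
    finally show "cinner v (hat_bra (khat (f t)) (varpi f) (G Y t (nabla_hat t (ket (varpi g) u)))) =
        cinner v (cinner (varpi (restr {t..} f)) (varpi (restr {t..} g)) *\<^sub>C
        hat_bra (khat (f t)) (varpi (restr {0..<t} f)) (G Y t (hat_ket (khat (g t)) (varpi ?g) u)))"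
      unfolding tail_def .
  qed
qed

lemma Y_solution: "strong_solution A j F Y"
proof -
  have "is_qs_integral (G Y) (\<lambda>t \<zeta>. Y t \<zeta> - \<zeta>)"
    unfolding is_qs_integral_def
  proof (intro conjI allI impI ballI operator_processI adapted_diff Y_adapted adapted_id clinear_on_diff Y_linear)
    show "clinear_on proc_domain (\<lambda>\<zeta>. \<zeta> :: ('h, 'k fockspace) htensor)"
      by (rule bounded_clinear_on[OF bounded_ops_id(2) csubspace_proc_domain])
    show "continuous_on {0..} (\<lambda>t. Y t \<zeta> - \<zeta>)" if "\<zeta> \<in> proc_domain" for \<zeta>
      by (intro continuous_on_diff continuous_on_const Y_continuous that)
    then show "continuous_on {0..} (\<lambda>t. Y t \<zeta> - \<zeta>)" if "\<zeta> \<in> proc_domain" for \<zeta> using that .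
    fix t :: real and \<zeta> \<zeta>' :: "('h, 'k fockspace) htensor" assume t: "0 \<le> t" and \<zeta>: "\<zeta>' \<in> proc_domain" "\<zeta> \<in> proc_domain"
    obtain B where B: "\<forall>s\<in>{0..t}. norm (G Y s (nabla_hat s \<zeta>)) \<le> B" using integrand_bounded[OF \<zeta>(2)] by blast
    have "integrable (lebesgue_on {0..t}) (\<lambda>s. cinner (nabla_hat s \<zeta>') (G Y s (nabla_hat s \<zeta>)))"
      by (rule nabla_hat_integrable(1)[OF \<zeta>(1)]) (use integrand_right_continuous[OF \<zeta>(2)] B in auto)
    then have "(\<integral>s. cinner (nabla_hat s \<zeta>') (G Y s (nabla_hat s \<zeta>)) \<partial>lebesgue_on {0..t}) =
        integral {0..t} (\<lambda>s. cinner (nabla_hat s \<zeta>') (G Y s (nabla_hat s \<zeta>)))"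
      by (rule lebesgue_integral_eq_integral) simp
    then show "cinner \<zeta>' (Y t \<zeta> - \<zeta>) = (\<integral>s. cinner (nabla_hat s \<zeta>') (G Y s (nabla_hat s \<zeta>)) \<partial>lebesgue_on {0..t})"
      using integral_unique[OF Y_integral[OF \<zeta>(2) t \<zeta>(1)]] by simp
  qed
  then show ?thesis
    unfolding strong_solution_def Let_def G_def[symmetric, abs_def]
    using Y_process Y_integrable by (intro conjI exI[of _ "\<lambda>t \<zeta>. Y t \<zeta> - \<zeta>"]) auto
qed

text \<open>The adaptedness relation is applied to \<open>f'\<close> and to its splice with
  \<open>f\<close>: their truncations at \<open>s\<close> coincide, so the vector already has the
  future of \<open>f\<close>.\<close>

lemma adapted_past_proj:
  assumes X: "adapted X" and s: "0 \<le> s" and f: "f \<in> \<S>"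
  shows "past_proj s f (X s (tensor u (varpi f))) = (X s (tensor u (varpi f)) :: ('h, 'k fockspace) htensor)"
proof (rule ctotalD[OF ctotal_tensor_varpi], clarify)
  fix v :: 'h and f' :: "real => 'k" assume f': "f' \<in> \<S>"
  have ad: "cinner (tensor v (varpi h)) (X s (tensor u (varpi f))) =
      tail s h f * cinner (tensor v (varpi (restr {0..<s} h))) (X s (tensor u (varpi (restr {0..<s} f))))"
    if "h \<in> \<S>" for h using X s f that unfolding adapted_iff by blast
  show "cinner (tensor v (varpi f')) (past_proj s f (X s (tensor u (varpi f)))) = cinner (tensor v (varpi f')) (X s (tensor u (varpi f)))"
    using adj_cinner(1)[OF future_op_bounded[OF s f], of f "tensor v (varpi f')" "X s (tensor u (varpi f))"]
    unfolding adj_future_op[OF s f f] future_op_varpi[OF s f f'] cinner_scaleC_left ad[OF step_splice[OF f' f s]] ad[OF f']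
    by (simp add: tail_commute[of s f' f])
qed

text \<open>Along an exponential vector, the path of any strong solution is continuous, as the
  integral is, and adapted; hence it solves the vector equation and agrees with \<open>sol\<close>.
  Linearity extends this to the domain.\<close>

lemma Y_unique:
  assumes X: "strong_solution A j F X" and t: "0 \<le> t" and \<zeta>: "\<zeta> \<in> proc_domain"
  shows "X t \<zeta> = Y t \<zeta>"
proof -
  obtain Z where op: "operator_process X" and Z: "is_qs_integral (G X) Z" "\<And>t \<zeta>. 0 \<le> t ==> \<zeta> \<in> proc_domain ==> X t \<zeta> = \<zeta> + Z t \<zeta>"
    using X unfolding strong_solution_def Let_def G_def[symmetric, abs_def] by (elim conjE exE) blast
  have lin: "clinear_on proc_domain (X t)" if "0 \<le> t" for t using op that unfolding operator_process_def by auto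
  have ad: "adapted X" using op unfolding operator_process_def by auto
  have "X t (tensor u (varpi f)) = Y t (tensor u (varpi f))" if f: "f \<in> \<S>" for u f
  proof -
    define y where "y s = X s (tensor u (varpi f))" for s
    note dom = tensor_varpi_in[OF f, of u]
    have past: "past T f y" for T
      unfolding past_def
    proof (intro conjI ballI)
      have "continuous_on {0..T} (\<lambda>s. Z s (tensor u (varpi f)))"
        by (rule continuous_on_subset[of "{0..}"]) (use Z(1) dom in \<open>auto simp: is_qs_integral_def\<close>)
      then have "continuous_on {0..T} (\<lambda>s. tensor u (varpi f) + Z s (tensor u (varpi f)))"
        by (intro continuous_on_add continuous_on_const)
      then show "continuous_on {0..T} y" by (rule continuous_on_eq) (simp add: y_def Z(2)[OF _ dom])
    qed (use adapted_past_proj[OF ad _ f] in \<open>auto simp: y_def\<close>)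
    have "solves t f (tensor u (varpi f)) y"
      unfolding solves_def
    proof (intro conjI ballI past)
      fix r and \<zeta> :: "('h, 'k fockspace) htensor" assume r: "r \<in> {0..t}" and \<zeta>: "\<zeta> \<in> proc_domain"
      have eq: "G X s (nabla_hat s (tensor u (varpi f))) = drive f y s" if "0 \<le> s" for s
        by (simp add: nabla_hat_varpi[OF f] G_tensor[where X = X and t = s, OF lin[OF that] that dom] drive_def y_def)
      obtain B where B: "\<forall>s\<in>{0..r}. norm (drive f y s) \<le> B" using drive_driving(3)[OF f past] by blast
      have int: "integrable (lebesgue_on {0..r}) (\<lambda>s. cinner (nabla_hat s \<zeta>) (drive f y s))"
        "(\<lambda>s. cinner (nabla_hat s \<zeta>) (drive f y s)) integrable_on {0..r}"
        by (rule nabla_hat_integrable[OF \<zeta>]; use drive_driving(2)[OF f past] B in auto)+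
      have "cinner \<zeta> (Z r (tensor u (varpi f))) = (\<integral>s. cinner (nabla_hat s \<zeta>) (G X s (nabla_hat s (tensor u (varpi f)))) \<partial>lebesgue_on {0..r})"
        using Z(1) dom \<zeta> r unfolding is_qs_integral_def by auto
      also have "\<dots> = (\<integral>s. cinner (nabla_hat s \<zeta>) (drive f y s) \<partial>lebesgue_on {0..r})"
        by (rule Bochner_Integration.integral_cong) (auto simp: eq)
      also have "\<dots> = integral {0..r} (\<lambda>s. cinner (nabla_hat s \<zeta>) (drive f y s))"
        by (rule lebesgue_integral_eq_integral[OF int(1)]) simp
      finally have "cinner \<zeta> (y r - tensor u (varpi f)) = integral {0..r} (\<lambda>s. cinner (nabla_hat s \<zeta>) (drive f y s))"
        using Z(2)[OF _ dom, of r] r by (simp add: y_def)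
      then show "((\<lambda>s. cinner (nabla_hat s \<zeta>) (drive f y s)) has_integral cinner \<zeta> (y r - tensor u (varpi f))) {0..r}"
        using int(2) by (simp add: integrable_integral)
    qed
    from sol_eqI[OF f this, of t] show ?thesis using t f by (simp add: y_def Y_varpi)
  qed
  then show ?thesis by (rule proc_domain_linear_eq[OF lin[OF t] Y_linear \<zeta>])
qed

end

section \<open>Membership and estimates\<close>

text \<open>Column version of \<open>uw_tensor_eq\<close>: truncating the second factor to finitely
  many basis vectors gives a finite sum of tensors with entries \<open>bra e \<circ> T\<close>,
  which commute with the commutant of \<open>A\<close> and so lie in \<open>A\<close>.\<close>

lemma tensor_ketI:
  fixes T :: "'h::chilbert_space => ('h, 'b::chilbert_space) htensor"
  assumes A: "von_neumann_algebra A" and T: "T \<in> \<B>"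
    and comm: "\<And>a' u. a' \<in> commutant A ==> T (a' u) = tensor_op a' id (T u)"
  shows "T \<in> uw_tensor_ket A"
proof -
  let ?Q = "\<lambda>J. tensor_op (id :: 'h => 'h) (onb_proj J) :: ('h, 'b) htensor => _"
  have Q: "?Q J \<in> \<B>" "op_bound (?Q J) 1" for J
    using tensor_op(1)[OF bounded_ops_id(1) onb_proj(1)] tensor_op(3)[OF bounded_ops_id(1) onb_proj(1) op_bound_id onb_proj(2)] by auto
  have lim: "((\<lambda>J. ?Q J \<xi>) \<longlongrightarrow> \<xi>) (finite_subsets_at_top onb)" for \<xi>
  proof (rule tendsto_bounded_ops_total[where S = "\<lambda>\<xi>. \<xi>", OF Q bounded_ops_id(2) ctotal_tensor[OF ctotal_UNIV ctotal_onb]])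
    fix b :: "('h, 'b) htensor" assume "b \<in> {tensor b c | b c. b \<in> UNIV \<and> c \<in> onb}"
    then obtain u e where b: "b = tensor u e" "e \<in> onb" by blast
    have "\<forall>\<^sub>F J in finite_subsets_at_top onb. ?Q J b = b"
      using onb_proj_eventually[OF b(2)] by eventually_elim (simp add: b tensor_op onb_proj)
    then show "((\<lambda>J. ?Q J b) \<longlongrightarrow> b) (finite_subsets_at_top onb)" by (rule tendsto_eventually)
  qed
  obtain C where C: "C \<ge> 0" "op_bound T C" using bounded_ops_bound[OF T] by blast
  show ?thesis
    unfolding uw_tensor_ket_def
  proof (rule in_ultraweak_closure[where T = "\<lambda>J. ?Q J \<circ> T" and \<F> = "finite_subsets_at_top onb", OF _ _ C(1) T])
    show "?Q J \<circ> T \<in> \<B>" for J by (intro bounded_ops_compose Q T)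
    show "op_bound (?Q J \<circ> T) C" for J
      using Q(2)[of J] C(2) unfolding op_bound_def by (auto intro: order_trans)
    show "((\<lambda>J. (?Q J \<circ> T) x) \<longlongrightarrow> T x) (finite_subsets_at_top onb)" for x using lim by simp
    show "\<forall>\<^sub>F J in finite_subsets_at_top onb. ?Q J \<circ> T \<in> op_span {(\<lambda>u. tensor (a u) x) | a x. a \<in> A}"
    proof (rule always_eventually, rule allI)
      fix J :: "'b set"
      have bT: "bra e \<circ> T \<in> A" for e
        unfolding vna_commutant(3)[OF A, symmetric]
      proof (subst vna_commutant(3)[OF A], rule commutantI)
        show "bra e \<circ> T \<in> \<B>" by (intro bounded_ops_compose bra_bounded T)
        fix a' x assume a': "a' \<in> commutant A"
        then have b: "a' \<in> \<B>" by (rule commutantD_bounded)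
        have "bra e \<circ> tensor_op a' id = a' \<circ> bra e"
          by (rule bounded_ops_eq_tensorI; (intro bounded_ops_compose bra_bounded b tensor_op(1) bounded_ops_id(1))?)
            (simp add: tensor_op(2)[OF b bounded_ops_id(1)] bra_tensor bounded_ops_simps(2)[OF b])
        then have "bra e (tensor_op a' id (T x)) = a' (bra e (T x))" by (metis comp_apply)
        then show "(bra e \<circ> T) (a' x) = a' ((bra e \<circ> T) x)" by (simp add: comm[OF a'])
      qed
      have "?Q J = (\<lambda>\<xi>. \<Sum>e\<in>J \<inter> onb. tensor (bra e \<xi>) e)"
      proof (rule bounded_ops_eq_tensorI[OF Q(1)])
        have "(\<lambda>\<xi>. \<Sum>e\<in>J \<inter> onb. (ket e \<circ> bra e) \<xi>) \<in> (\<B> :: (('h, 'b) htensor => _) set)"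
          by (intro bounded_ops_sum bounded_ops_compose ket_bounded bra_bounded)
        then show "(\<lambda>\<xi> :: ('h, 'b) htensor. \<Sum>e\<in>J \<inter> onb. tensor (bra e \<xi>) e) \<in> \<B>" by (simp add: ket_def)
      qed (simp add: tensor_op onb_proj onb_proj_def bra_tensor tensor_sum_right tensor_scaleC_left tensor_scaleC_right)
      then have "?Q J \<circ> T = (\<lambda>u. \<Sum>e\<in>J \<inter> onb. tensor ((bra e \<circ> T) u) e)" by (simp only: o_def)
      also have "\<dots> \<in> op_span {(\<lambda>u. tensor (a u) x) | a x. a \<in> A}"
      proof (rule op_span_sum)
        fix e :: 'b
        have "(\<lambda>u. tensor ((bra e \<circ> T) u) e) \<in> {(\<lambda>u. tensor (a u) x) | a x. a \<in> A}" using bT by blast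
        from op_span_scale[OF this, of 1] show "(\<lambda>u. tensor ((bra e \<circ> T) u) e) \<in> op_span {(\<lambda>u. tensor (a u) x) | a x. a \<in> A}" by simp
      qed
      finally show "?Q J \<circ> T \<in> op_span {(\<lambda>u. tensor (a u) x) | a x. a \<in> A}" .
    qed
  qed simp
qed

lemma exp_domain_induct [consumes 1, case_names varpi add scale]:
  assumes "\<epsilon> \<in> exp_domain" "\<And>f. f \<in> \<S> ==> P (varpi f)"
    and "\<And>\<epsilon> \<epsilon>'. \<epsilon> \<in> exp_domain ==> \<epsilon>' \<in> exp_domain ==> P \<epsilon> ==> P \<epsilon>' ==> P (\<epsilon> + \<epsilon>')"
    and "\<And>c \<epsilon>. \<epsilon> \<in> exp_domain ==> P \<epsilon> ==> P (c *\<^sub>C \<epsilon>)"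
  shows "P \<epsilon>"
proof -
  have E: "csubspace (exp_domain :: 'a fockspace set)" unfolding exp_domain_def by (rule csubspace_cspan)
  have v: "varpi f \<in> exp_domain" if "f \<in> \<S>" for f :: "real => 'a"
    unfolding exp_domain_def using that by (intro cspan_superset) auto
  have P0: "P 0" using assms(4)[OF v[OF step_zero] assms(2)[OF step_zero], of 0] by simp
  have "exp_domain \<subseteq> {\<epsilon> \<in> exp_domain. P \<epsilon>}"
    by (subst (1) exp_domain_def, rule cspan_minimal)
      (use assms(2-4) E P0 v in \<open>auto simp: csubspace_def\<close>)
  then show ?thesis using assms(1) by blast
qed

lemma tensor_exp_domain: "\<epsilon> \<in> exp_domain ==> tensor u \<epsilon> \<in> proc_domain"
  unfolding alg_tensor_def by (rule cspan_superset) blast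

lemma clinear_on_simps:
  assumes "clinear_on D T"
  shows "x \<in> D ==> y \<in> D ==> T (x + y) = T x + T y" "x \<in> D ==> T (c *\<^sub>C x) = c *\<^sub>C T x"
  using assms by (auto simp: clinear_on_def)

text \<open>The constant may depend on the exponential vector, since constants add and scale along
  the span; linearity of the bound in \<open>norm u\<close> turns it into one for the operator
  norm.\<close>

lemma holder_halfI:
  fixes X :: "real => ('h::chilbert_space, 'k::chilbert_space) fock_op"
  assumes lin: "\<And>t. 0 \<le> t ==> clinear_on proc_domain (X t)"
    and est: "\<And>f T. f \<in> \<S> ==> 0 < T ==> \<exists>C. \<forall>r t u. 0 \<le> r --> r < t --> t \<le> T -->
      norm (X t (tensor u (varpi f)) - X r (tensor u (varpi f))) \<le> C * norm u * sqrt (t - r)"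
  shows "holder_half X"
  unfolding holder_half_def
proof (intro ballI allI impI)
  fix \<epsilon> :: "'k fockspace" and T :: real assume \<epsilon>: "\<epsilon> \<in> exp_domain" and T: "T > 0"
  define Q where "Q \<epsilon> C \<longleftrightarrow> (\<forall>r t u. 0 \<le> r --> r < t --> t \<le> T -->
    norm (X t (tensor u \<epsilon>) - X r (tensor u \<epsilon>)) \<le> C * norm u * sqrt (t - r))" for \<epsilon> C
  have QD: "norm (X t (tensor u \<epsilon>) - X r (tensor u \<epsilon>)) \<le> C * norm u * sqrt (t - r)"
    if "Q \<epsilon> C" "0 \<le> r" "r < t" "t \<le> T" for \<epsilon> C r t u
    using that unfolding Q_def by blast
  have "\<exists>C. Q \<epsilon> C"
    using \<epsilon>
  proof (induction rule: exp_domain_induct)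
    case (varpi f) then show ?case unfolding Q_def by (rule est[OF _ T])
  next
    case (add \<epsilon> \<epsilon>')
    then obtain C C' where C: "Q \<epsilon> C" "Q \<epsilon>' C'" by blast
    have "Q (\<epsilon> + \<epsilon>') (C + C')"
      unfolding Q_def
    proof (intro allI impI)
      fix r t u assume that: "0 \<le> r" "r < t" "t \<le> T"
      have "X s (tensor u (\<epsilon> + \<epsilon>')) = X s (tensor u \<epsilon>) + X s (tensor u \<epsilon>')" if "0 \<le> s" for s
        unfolding tensor_add_right using add tensor_exp_domain by (intro clinear_on_simps(1)[OF lin[OF that]]) auto
      then have eq: "X t (tensor u (\<epsilon> + \<epsilon>')) - X r (tensor u (\<epsilon> + \<epsilon>')) =
          (X t (tensor u \<epsilon>) - X r (tensor u \<epsilon>)) + (X t (tensor u \<epsilon>') - X r (tensor u \<epsilon>'))"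
        using that by simp
      show "norm (X t (tensor u (\<epsilon> + \<epsilon>')) - X r (tensor u (\<epsilon> + \<epsilon>'))) \<le> (C + C') * norm u * sqrt (t - r)"
        unfolding eq using norm_triangle_le[OF add_mono[OF QD[OF C(1) that, of u] QD[OF C(2) that, of u]]] by (simp add: distrib_right)
    qed
    then show ?case by blast
  next
    case (scale c \<epsilon>)
    then obtain C where C: "Q \<epsilon> C" by blast
    have "Q (c *\<^sub>C \<epsilon>) (cmod c * C)"
      unfolding Q_def
    proof (intro allI impI)
      fix r t u assume that: "0 \<le> r" "r < t" "t \<le> T"
      have "X s (tensor u (c *\<^sub>C \<epsilon>)) = c *\<^sub>C X s (tensor u \<epsilon>)" if "0 \<le> s" for s
        unfolding tensor_scaleC_right using scale tensor_exp_domain by (intro clinear_on_simps(2)[OF lin[OF that]]) auto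
      then have "X t (tensor u (c *\<^sub>C \<epsilon>)) - X r (tensor u (c *\<^sub>C \<epsilon>)) = c *\<^sub>C (X t (tensor u \<epsilon>) - X r (tensor u \<epsilon>))"
        using that by (simp add: scaleC_diff_right)
      then show "norm (X t (tensor u (c *\<^sub>C \<epsilon>)) - X r (tensor u (c *\<^sub>C \<epsilon>))) \<le> (cmod c * C) * norm u * sqrt (t - r)"
        using mult_left_mono[OF QD[OF C that, of u], of "cmod c"] by (simp add: norm_scaleC mult_ac)
    qed
    then show ?case by blast
  qed
  then obtain C where C: "Q \<epsilon> C" by blast
  have "ennreal ((t - r) powr (-1/2)) * opnorm_on UNIV (\<lambda>u. X t (ket \<epsilon> u) - X r (ket \<epsilon> u)) \<le> ennreal \<bar>C\<bar>"
    if rt: "0 \<le> r" "r < t" "t \<le> T" for r t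
  proof -
    have "opnorm_on UNIV (\<lambda>u. X t (ket \<epsilon> u) - X r (ket \<epsilon> u)) \<le> ennreal (\<bar>C\<bar> * sqrt (t - r))"
      unfolding opnorm_on_def ket_def
    proof (rule SUP_least, rule ennreal_leI)
      fix u :: 'h assume "u \<in> {x \<in> UNIV. norm x \<le> 1}"
      then have "C * norm u \<le> \<bar>C\<bar>" using mult_mono[of C "\<bar>C\<bar>" "norm u" 1] by auto
      then have "C * norm u * sqrt (t - r) \<le> \<bar>C\<bar> * sqrt (t - r)" by (rule mult_right_mono) (use rt in simp)
      then show "norm (X t (tensor u \<epsilon>) - X r (tensor u \<epsilon>)) \<le> \<bar>C\<bar> * sqrt (t - r)" using QD[OF C rt, of u] by linarith
    qed
    then have "ennreal ((t - r) powr (-1/2)) * opnorm_on UNIV (\<lambda>u. X t (ket \<epsilon> u) - X r (ket \<epsilon> u)) \<le>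
        ennreal ((t - r) powr (-1/2)) * ennreal (\<bar>C\<bar> * sqrt (t - r))" by (rule mult_left_mono) simp
    also have "\<dots> = ennreal (\<bar>C\<bar> * ((t - r) powr (-1/2) * (t - r) powr (1/2)))"
      using rt by (simp add: ennreal_mult[symmetric] powr_half_sqrt mult_ac)
    also have "(t - r) powr (-1/2) * (t - r) powr (1/2) = 1" using rt by (simp add: powr_add[symmetric])
    finally show ?thesis by simp
  qed
  then show "(SUP (r, t)\<in>{(r, t). 0 \<le> r \<and> r < t \<and> t \<le> T}.
      ennreal ((t - r) powr (-1/2)) * opnorm_on UNIV (\<lambda>u. X t (ket \<epsilon> u) - X r (ket \<epsilon> u))) < \<infinity>"
    by (intro le_less_trans[OF SUP_least, of _ _ "ennreal \<bar>C\<bar>"]) auto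
qed

lemma opnorm_on_bound:
  assumes T: "clinear_on D T" and C: "opnorm_on D T \<le> ennreal C" "0 \<le> C" and x: "x \<in> D"
  shows "norm (T x) \<le> C * norm x"
proof (cases "x = 0")
  case True
  then show ?thesis using clinear_on_simps(2)[OF T x, of 0] by simp
next
  case False
  let ?c = "complex_of_real (1 / norm x)"
  have D: "?c *\<^sub>C x \<in> D" "norm (?c *\<^sub>C x) \<le> 1" using T x False by (auto simp: clinear_on_def csubspace_def norm_scaleC norm_divide)
  then have "ennreal (norm (T (?c *\<^sub>C x))) \<le> opnorm_on D T" unfolding opnorm_on_def by (intro SUP_upper) auto
  then have "norm (T (?c *\<^sub>C x)) \<le> C" using C by (meson ennreal_le_iff order_trans)
  then show ?thesis using False by (simp add: clinear_on_simps(2)[OF T x] norm_scaleC norm_divide field_simps)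
qed

text \<open>Boundedness on the dense domain gives an extension with the same bound; bounded
  extensions are unique, so the bound holds for the one selected by
  \<open>extension\<close>.\<close>

lemma bounded_extension:
  fixes X :: "('h::chilbert_space, 'k::chilbert_space) fock_op"
  assumes X: "clinear_on proc_domain X" and C: "opnorm_on proc_domain X \<le> ennreal C" "0 \<le> C"
  shows "extension X \<in> \<B>" "\<zeta> \<in> proc_domain ==> extension X \<zeta> = X \<zeta>" "op_bound (extension X) C"
proof -
  let ?a = "\<lambda>(u, f). tensor u (varpi f) :: ('h, 'k fockspace) htensor"
  have "\<exists>S\<in>\<B>. (\<forall>i\<in>UNIV \<times> \<S>. S (?a i) = X (?a i)) \<and> op_bound S C"
  proof (rule operator_of_family[OF ctotal_tensor_varpi C(2)])
    fix S :: "('h \<times> (real => 'k)) set" and c assume S: "finite S" "S \<subseteq> UNIV \<times> \<S>"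
    have a: "?a i \<in> proc_domain" if "i \<in> S" for i using S(2) that by (auto intro: tensor_varpi_in)
    then have ca: "c i *\<^sub>C ?a i \<in> proc_domain" if "i \<in> S" for i using that by (intro csubspaceD(3)[OF csubspace_proc_domain])
    have "X (\<Sum>i\<in>S. c i *\<^sub>C ?a i) = (\<Sum>i\<in>S. X (c i *\<^sub>C ?a i))" by (rule clinear_on_sum[OF X S(1) ca])
    also have "\<dots> = (\<Sum>i\<in>S. c i *\<^sub>C X (?a i))" by (rule sum.cong[OF refl clinear_on_simps(2)[OF X a]])
    finally have eq: "X (\<Sum>i\<in>S. c i *\<^sub>C ?a i) = (\<Sum>i\<in>S. c i *\<^sub>C X (?a i))" .
    have "(\<Sum>i\<in>S. c i *\<^sub>C ?a i) \<in> proc_domain" by (rule csubspace_sum[OF csubspace_proc_domain ca])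
    from opnorm_on_bound[OF X C this]
    show "norm (\<Sum>i\<in>S. c i *\<^sub>C X (?a i)) \<le> C * norm (\<Sum>i\<in>S. c i *\<^sub>C ?a i)" unfolding eq .
  qed
  then obtain S where S: "S \<in> \<B>" "\<forall>i\<in>UNIV \<times> \<S>. S (?a i) = X (?a i)" "op_bound S C" by blast
  have SX: "S \<zeta> = X \<zeta>" if "\<zeta> \<in> proc_domain" for \<zeta>
    by (rule proc_domain_linear_eq[OF bounded_clinear_on[OF S(1) csubspace_proc_domain] X that]) (use S(2) in auto)
  have "\<exists>S. S \<in> \<B> \<and> (\<forall>\<zeta>\<in>proc_domain. S \<zeta> = X \<zeta>)" using S(1) SX by blast
  from someI_ex[OF this] have E: "extension X \<in> \<B> \<and> (\<forall>\<zeta>\<in>proc_domain. extension X \<zeta> = X \<zeta>)"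
    unfolding extension_def .
  then show "extension X \<in> \<B>" "\<zeta> \<in> proc_domain ==> extension X \<zeta> = X \<zeta>" by auto
  have "extension X = S"
  proof (rule bounded_ops_eq_on_varpiI)
    fix u :: 'h and f :: "real => 'k" assume "f \<in> \<S>"
    then show "extension X (tensor u (varpi f)) = S (tensor u (varpi f))"
      using E SX[OF tensor_varpi_in[of f u]] tensor_varpi_in[of f u] by simp
  qed (use E S(1) in auto)
  then show "op_bound (extension X) C" using S(3) by simp
qed

section \<open>Membership and Hoelder estimates for the solution and its adjoint\<close>

context flow
begin

text \<open>Boundedness in \<open>u\<close> and commutation with the commutant are the two
  conditions of \<open>tensor_ketI\<close>; both pass from exponential vectors to their linear
  combinations.\<close>

lemma Y_ket: assumes s: "0 \<le> s" and \<epsilon>: "\<epsilon> \<in> exp_domain" shows "Y s \<circ> ket \<epsilon> \<in> uw_tensor_ket A"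
proof (rule tensor_ketI[OF A])
  define good where "good \<epsilon> \<longleftrightarrow> (\<lambda>u. Y s (tensor u \<epsilon>)) \<in> \<B> \<and>
    (\<forall>a'\<in>commutant A. \<forall>u. Y s (tensor (a' u) \<epsilon>) = tensor_op a' id (Y s (tensor u \<epsilon>)))" for \<epsilon>
  have "good \<epsilon>"
    using \<epsilon>
  proof (induction rule: exp_domain_induct)
    case (varpi f)
    have "(\<lambda>u. sol f u s) \<in> \<B>"
      by (rule bounded_opsI[where K = "2 * exp (rate f * s)"]) (simp_all add: sol_linear[OF varpi s] op_bound_def sol_bound[OF varpi s])
    then show ?case unfolding good_def Y_varpi[OF varpi s] using sol_commutant[OF s varpi] by blast
  next
    case (add \<epsilon> \<epsilon>')
    have "Y s (tensor u (\<epsilon> + \<epsilon>')) = Y s (tensor u \<epsilon>) + Y s (tensor u \<epsilon>')" for u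
      unfolding tensor_add_right using add.hyps by (intro clinear_on_simps(1)[OF Y_linear] tensor_exp_domain)
    then show ?case
      using add.IH by (simp add: good_def bounded_ops_add bounded_ops_simps(1)[OF tensor_op(1)[OF commutantD_bounded bounded_ops_id(1)]])
  next
    case (scale c \<epsilon>)
    have "Y s (tensor u (c *\<^sub>C \<epsilon>)) = c *\<^sub>C Y s (tensor u \<epsilon>)" for u
      unfolding tensor_scaleC_right using scale.hyps by (intro clinear_on_simps(2)[OF Y_linear] tensor_exp_domain)
    then show ?case
      using scale.IH by (simp add: good_def bounded_ops_scaleC bounded_ops_simps(2)[OF tensor_op(1)[OF commutantD_bounded bounded_ops_id(1)]])
  qed
  then show "Y s \<circ> ket \<epsilon> \<in> \<B>" "\<And>a' u. a' \<in> commutant A ==> (Y s \<circ> ket \<epsilon>) (a' u) = tensor_op a' id ((Y s \<circ> ket \<epsilon>) u)"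
    by (auto simp: good_def ket_def o_def)
qed

text \<open>The dependence on \<open>u\<close> stays linear in \<open>norm u\<close>, so one
  constant serves all \<open>u\<close>. In the time part \<open>sqrt (t - r)\<close> is bounded by
  \<open>sqrt T\<close>, which leaves a single factor \<open>sqrt (t - r)\<close>.\<close>

lemma increment_bound:
  fixes z :: "'h => real => ('h, 'k fockspace) htensor"
  assumes g: "g \<in> \<S>" and B: "0 \<le> B"
    and P: "\<And>u s. s \<in> {0..T} ==> tensor_op id (past_proj s g) (x u s) = x u s"
    and b: "\<And>u s. s \<in> {0..T} ==> norm (x u s :: ('h, 'k) hat_space) \<le> B * norm u"
    and z: "\<And>u t \<zeta>. t \<in> {0..T} ==> \<zeta> \<in> proc_domain ==>
      ((\<lambda>s. cinner (nabla_hat s \<zeta>) (x u s)) has_integral cinner \<zeta> (z u t - w u)) {0..t}"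
  shows "\<exists>C. \<forall>r t u. 0 \<le> r --> r < t --> t \<le> T --> norm (z u t - z u r) \<le> C * norm u * sqrt (t - r)"
proof (intro exI allI impI)
  fix r t u assume rt: "0 \<le> r" "r < t" "t \<le> T"
  have "norm ((z u t - w u) - (z u r - w u)) \<le> B * norm u * (khat_bound g * sqrt (t - r) + 1) * sqrt (t - r)"
    by (rule integral_continuous(2)[OF g P b z]) (use rt in auto)
  also have "\<dots> \<le> B * norm u * (khat_bound g * sqrt T + 1) * sqrt (t - r)"
    using rt B khat_bound_nonneg[OF g] by (intro mult_right_mono mult_left_mono add_right_mono) auto
  finally show "norm (z u t - z u r) \<le> (B * (khat_bound g * sqrt T + 1)) * norm u * sqrt (t - r)" by (simp add: mult_ac)
qed

lemma Y_holder: "holder_half Y"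
proof (rule holder_halfI[OF Y_linear])
  fix f :: "real => 'k" and T :: real assume f: "f \<in> \<S>" and T: "0 < T"
  let ?B = "\<kappa> * khat_bound f * (2 * exp (rate f * T))"
  have "\<exists>C. \<forall>r t u. 0 \<le> r --> r < t --> t \<le> T --> norm (sol f u t - sol f u r) \<le> C * norm u * sqrt (t - r)"
  proof (rule increment_bound[OF f, where x = "\<lambda>u. drive f (sol f u)" and w = "\<lambda>u. tensor u (varpi f)" and B = ?B])
    show "0 \<le> ?B" using \<kappa>(1) khat_bound_nonneg[OF f] by simp
    fix u s assume s: "s \<in> {0..T}"
    have "norm (sol f u s) \<le> 2 * exp (rate f * s) * norm u" by (rule sol_bound[OF f]) (use s in simp)
    also have "\<dots> \<le> 2 * exp (rate f * T) * norm u" using s rate_pos[OF f] by (intro mult_right_mono) auto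
    finally have "\<kappa> * khat_bound f * norm (sol f u s) \<le> \<kappa> * khat_bound f * (2 * exp (rate f * T) * norm u)"
      by (rule mult_left_mono) (simp add: \<kappa>(1) khat_bound_nonneg[OF f])
    then show "norm (drive f (sol f u) s) \<le> ?B * norm u"
      using drive_bound[OF f, where y = "sol f u" and s = s] by (simp add: mult.assoc)
  qed (use sol_solves[OF f, of T] drive_driving(1)[OF f sol_past[OF f]] in \<open>auto simp: solves_def\<close>)
  then show "\<exists>C. \<forall>r t u. 0 \<le> r --> r < t --> t \<le> T -->
      norm (Y t (tensor u (varpi f)) - Y r (tensor u (varpi f))) \<le> C * norm u * sqrt (t - r)"
    by (simp add: Y_varpi[OF f] less_imp_le cong: imp_cong)
qed

text \<open>The adjoint satisfies the estimate because \<open>\<langle>(Y\<^sub>t\<^sup>* - Y\<^sub>r\<^sup>*) \<eta>, \<zeta>\<rangle>\<close> is the integral of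
  \<open>\<langle>Y\<^sub>s\<^sup>* K\<^sub>s\<^sup>* \<nabla>\<^sub>s \<eta>, \<nabla>\<^sub>s \<zeta>\<rangle>\<close>, whose left entry is bounded and adapted.\<close>

lemma adjoint_holder:
  assumes Z: "\<And>t. 0 \<le> t ==> Z t \<in> \<B>" "\<And>t \<zeta>. 0 \<le> t ==> \<zeta> \<in> proc_domain ==> Z t \<zeta> = Y t \<zeta>"
    and M: "\<And>T. \<exists>M\<ge>0. \<forall>t\<in>{0..T}. op_bound (adj (Z t)) M"
  shows "holder_half (\<lambda>t. adj (Z t))"
proof (rule holder_halfI[OF bounded_clinear_on[OF adj_bounded_ops[OF Z(1)] csubspace_proc_domain]])
  fix g :: "real => 'k" and T :: real assume g: "g \<in> \<S>" and T: "0 < T"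
  obtain M where M: "0 \<le> M" "\<And>t. t \<in> {0..T} ==> op_bound (adj (Z t)) M" using M by blast
  let ?\<eta> = "\<lambda>u. tensor u (varpi g)"
  define x where "x u s = tensor_op id (adj (Z s)) (adj (K F s) (tensor (khat (g s)) (?\<eta> u)))" for u s
  \<comment> \<open>On an exponential vector of \<open>f\<close> both orders give
    \<open>tail s g f\<close> times the solution for the function equal to \<open>f\<close> before
    \<open>s\<close> and to \<open>g\<close> afterwards. So \<open>Z s\<close> commutes with the
    projection, and hence so does its adjoint.\<close>
  have PZ: "past_proj s g (Z s \<xi>) = Z s (past_proj s g \<xi>)" if s: "0 \<le> s" for s \<xi>
  proof -
    have "past_proj s g \<circ> Z s = Z s \<circ> past_proj s g"
    proof (rule bounded_ops_eq_on_varpiI)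
      fix u and f :: "real => 'k" assume f: "f \<in> \<S>"
      note fg = step_splice[OF f g s]
      have "past_proj s g (sol f u s) = tail s g f *\<^sub>C sol (splice s f g) u s"
        using past_proj_past_proj[OF s f g, of "sol f u s"] sol_change[OF s f fg, of u]
        by (simp add: sol_past_proj[OF f s] splice_below)
      then show "(past_proj s g \<circ> Z s) (tensor u (varpi f)) = (Z s \<circ> past_proj s g) (tensor u (varpi f))"
        by (simp add: Z(2)[OF s tensor_varpi_in[OF f]] Z(2)[OF s tensor_varpi_in[OF fg]] Y_varpi[OF f s] Y_varpi[OF fg s]
            future_op_varpi[OF s g f] bounded_ops_simps(2)[OF Z(1)[OF s]])
    qed (intro bounded_ops_compose future_op_bounded Z s g)+
    then show ?thesis by (metis comp_apply)
  qed
  show "\<exists>C. \<forall>r t u. 0 \<le> r --> r < t --> t \<le> T -->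
      norm (adj (Z t) (?\<eta> u) - adj (Z r) (?\<eta> u)) \<le> C * norm u * sqrt (t - r)"
  proof (rule increment_bound[OF g, where x = x and w = ?\<eta> and B = "M * (\<kappa> * khat_bound g)"])
    show "0 \<le> M * (\<kappa> * khat_bound g)" using M(1) \<kappa>(1) khat_bound_nonneg[OF g] by simp
    fix u and s :: real assume "s \<in> {0..T}"
    then have s: "0 \<le> s" "s \<in> {0..T}" by auto
    note aZ = adj_bounded_ops[OF Z(1)[OF s(1)]] and P_b = future_op_bounded[OF s(1) g, of g]
    have "op_bound (tensor_op id (adj (Z s)) :: ('h, 'k) hat_space => _) (1 * M)"
      by (rule tensor_op(3)[OF bounded_ops_id(1) aZ _ M(2)[OF s(2)] _ M(1)]) (simp_all add: op_bound_def)
    moreover have "op_bound (adj (K F s)) \<kappa>"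
      by (rule op_bound_adj[OF K_bounded[OF F_amp] _ \<kappa>(1)]) (simp add: op_bound_def \<kappa>(2))
    ultimately have "norm (x u s) \<le> M * norm (adj (K F s) (tensor (khat (g s)) (?\<eta> u)))"
      "norm (adj (K F s) (tensor (khat (g s)) (?\<eta> u))) \<le> \<kappa> * norm (tensor (khat (g s)) (?\<eta> u))"
      unfolding x_def op_bound_def by simp_all
    then have "norm (x u s) \<le> M * (\<kappa> * norm (tensor (khat (g s)) (?\<eta> u)))"
      using M(1) by (meson mult_left_mono order_trans)
    also have "\<dots> \<le> M * (\<kappa> * (khat_bound g * norm u))"
      unfolding norm_tensor norm_varpi mult_1_right
      by (intro mult_left_mono mult_right_mono khat_bound g \<kappa>(1) M(1) norm_ge_zero)
    finally show "norm (x u s) \<le> M * (\<kappa> * khat_bound g) * norm u" by (simp add: mult.assoc)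
    have PaZ: "past_proj s g (adj (Z s) \<xi>) = adj (Z s) (past_proj s g \<xi>)" for \<xi>
    proof (rule cinner_eqI)
      fix \<zeta> :: "('h, 'k fockspace) htensor"
      note p = adj_cinner(1)[OF P_b, unfolded adj_future_op[OF s(1) g g]]
      show "cinner \<zeta> (past_proj s g (adj (Z s) \<xi>)) = cinner \<zeta> (adj (Z s) (past_proj s g \<xi>))"
        by (simp add: p[symmetric] adj_cinner(2)[OF Z(1)[OF s(1)]] PZ[OF s(1)])
    qed
    have "tensor_op id (past_proj s g) \<circ> tensor_op id (adj (Z s)) =
        (tensor_op id (adj (Z s)) \<circ> tensor_op id (past_proj s g) :: ('h, 'k) hat_space => _)"
      unfolding tensor_op_compose[OF bounded_ops_id(1) P_b bounded_ops_id(1) aZ] tensor_op_compose[OF bounded_ops_id(1) aZ bounded_ops_id(1) P_b]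
      by (rule arg_cong[where f = "tensor_op (id \<circ> id)"]) (auto simp: PaZ)
    then have "tensor_op id (past_proj s g) (x u s) =
        tensor_op id (adj (Z s)) (tensor_op id (past_proj s g) (adj (K F s) (tensor (khat (g s)) (?\<eta> u))))"
      unfolding x_def by (metis comp_apply)
    \<comment> \<open>The adjoint of the coefficient is the coefficient of \<open>adj F\<close>, so
      it commutes with the projection as well.\<close>
    also have "tensor_op id (past_proj s g) (adj (K F s) (tensor (khat (g s)) (?\<eta> u))) = adj (K F s) (tensor (khat (g s)) (?\<eta> u))"
      unfolding K_adj[OF F_amp, symmetric] K_future_op[OF amp_commutant_adj[OF A F_amp] s(1) order_refl g g, symmetric]
        tensor_op_id_right(2)[OF P_b] past_proj_self[OF s(1) g] ..
    finally show "tensor_op id (past_proj s g) (x u s) = x u s" unfolding x_def .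
  next
    fix u t and \<zeta> :: "('h, 'k fockspace) htensor" assume t: "t \<in> {0..T}" and \<zeta>: "\<zeta> \<in> proc_domain"
    note \<eta> = tensor_varpi_in[OF g, of u]
    have "((\<lambda>s. cnj (cinner (nabla_hat s (?\<eta> u)) (G Y s (nabla_hat s \<zeta>)))) has_integral cnj (cinner (?\<eta> u) (Y t \<zeta> - \<zeta>))) {0..t}"
      unfolding has_integral_cnj[unfolded o_def] using Y_integral[OF \<zeta> _ \<eta>, of t] t by simp
    moreover have "cnj (cinner (?\<eta> u) (Y t \<zeta> - \<zeta>)) = cinner \<zeta> (adj (Z t) (?\<eta> u) - ?\<eta> u)"
      using t \<zeta> by (simp add: cinner_commute[symmetric] Z(2)[symmetric] cinner_diff_left cinner_diff_right adj_cinner(2)[OF Z(1)])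
    moreover have "cnj (cinner (nabla_hat s (?\<eta> u)) (G Y s (nabla_hat s \<zeta>))) = cinner (nabla_hat s \<zeta>) (x u s)" if s: "s \<in> {0..t}" for s
    proof -
      have s0: "0 \<le> s" using s by simp
      obtain S v where S: "\<zeta> = exp_sum S v" "finite S" "S \<subseteq> \<S>" using \<zeta> unfolding proc_domain_eq by blast
      have "G Y s (nabla_hat s \<zeta>) = K F s (tensor_op id (Z s) (nabla_hat s \<zeta>))"
        unfolding S(1) G_nabla[where X = Y and t = s, OF Y_linear s0 S(2,3)]
        unfolding nabla_hat_exp_sum[OF S(2,3)] using S(3) by (auto simp: bounded_ops_simps(5)[OF tensor_op_id_right(1)[OF Z(1)[OF s0]]] bounded_ops_simps(5)[OF K_bounded[OF F_amp]]
            tensor_op_id_right(2)[OF Z(1)[OF s0]] drive_def Z(2)[OF s0 tensor_varpi_in] intro!: sum.cong)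
      then have "cinner (nabla_hat s \<zeta>) (x u s) = cinner (G Y s (nabla_hat s \<zeta>)) (nabla_hat s (?\<eta> u))"
        unfolding x_def tensor_op_id_right(3)[OF Z(1)[OF s0], symmetric]
        by (simp add: adj_cinner(2)[OF tensor_op_id_right(1)[OF Z(1)[OF s0]]] adj_cinner(2)[OF K_bounded[OF F_amp]] nabla_hat_varpi[OF g])
      then show ?thesis by (simp add: cinner_commute[symmetric])
    qed
    ultimately show "((\<lambda>s. cinner (nabla_hat s \<zeta>) (x u s)) has_integral cinner \<zeta> (adj (Z t) (?\<eta> u) - ?\<eta> u)) {0..t}"
      using has_integral_cong[of "{0..t}" "\<lambda>s. cnj (cinner (nabla_hat s (?\<eta> u)) (G Y s (nabla_hat s \<zeta>)))" "\<lambda>s. cinner (nabla_hat s \<zeta>) (x u s)"] by simp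
  qed
qed

lemma Y_extension:
  assumes "bounded_process Y" "0 \<le> t"
  shows "extension (Y t) \<in> \<B>" "\<zeta> \<in> proc_domain ==> extension (Y t) \<zeta> = Y t \<zeta>"
proof -
  have "opnorm_on proc_domain (Y t) < \<infinity>" using assms unfolding bounded_process_def by blast
  then have "opnorm_on proc_domain (Y t) \<le> ennreal (enn2real (opnorm_on proc_domain (Y t)))" by simp
  from bounded_extension(1,2)[OF Y_linear this enn2real_nonneg]
  show "extension (Y t) \<in> \<B>" "\<zeta> \<in> proc_domain ==> extension (Y t) \<zeta> = Y t \<zeta>" by auto
qed

text \<open>Either alternative bounds the adjoints locally uniformly: an operator and its adjoint
  have the same bounds, and the adjoint of a coisometry is an isometry.\<close>

lemma Y_adjoint_holder:
  assumes "bounded_process Y \<and> locally_uniform_bounds Y \<or> coisometric_process Y"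
  shows "holder_half (\<lambda>t. adj (extension (Y t)))"
proof -
  have b: "bounded_process Y" using assms by (auto simp: coisometric_process_def)
  note E = Y_extension[OF b]
  have "\<exists>M\<ge>0. \<forall>t\<in>{0..T}. op_bound (adj (extension (Y t))) M" for T
  \<comment> \<open>For negative \<open>T\<close> the index set is empty, while the local bounds are
    stated for nonnegative \<open>T\<close>.\<close>
  proof (cases "T < 0")
    case False
    from assms show ?thesis
    proof
      assume "bounded_process Y \<and> locally_uniform_bounds Y"
      then have lt: "(SUP t\<in>{0..T}. opnorm_on proc_domain (Y t)) < \<infinity>" using False unfolding locally_uniform_bounds_def by simp
      define M where "M = enn2real (SUP t\<in>{0..T}. opnorm_on proc_domain (Y t))"
      have "op_bound (adj (extension (Y t))) M" if t: "t \<in> {0..T}" for t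
      proof -
        have "opnorm_on proc_domain (Y t) \<le> (SUP t\<in>{0..T}. opnorm_on proc_domain (Y t))" by (rule SUP_upper[OF t])
        also have "\<dots> = ennreal M" using lt unfolding M_def by simp
        finally have "op_bound (extension (Y t)) M" by (rule bounded_extension(3)[OF Y_linear]) (simp add: M_def)
        then show ?thesis by (rule op_bound_adj[OF E(1), rotated]) (use t in \<open>auto simp: M_def\<close>)
      qed
      then show ?thesis by (intro exI[of _ M]) (simp add: M_def)
    next
      assume co: "coisometric_process Y"
      have "op_bound (adj (extension (Y t))) 1" if t: "t \<in> {0..T}" for t
      proof -
        have t0: "0 \<le> t" using t by simp
        have "extension (Y t) \<circ> adj (extension (Y t)) = id" using co t0 unfolding coisometric_process_def by blast
        then have "extension (Y t) (adj (extension (Y t)) \<xi>) = \<xi>" for \<xi> by (metis comp_apply id_apply)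
        then have "cinner (adj (extension (Y t)) \<xi>) (adj (extension (Y t)) \<xi>) = cinner \<xi> \<xi>" for \<xi>
          by (simp add: adj_cinner(1)[OF E(1)[OF t0]])
        then show ?thesis by (simp add: op_bound_def norm_cinner)
      qed
      then show ?thesis by (intro exI[of _ 1]) simp
    qed
  qed auto
  then show ?thesis by (intro adjoint_holder E)
qed

end

theorem theorem4p1:
  fixes A :: "('h::chilbert_space \<Rightarrow> 'h) set"
    and j :: "real \<Rightarrow> ('h \<Rightarrow> 'h) \<Rightarrow> ('h, 'k::chilbert_space) fock_op"
    and F :: "(complex \<times> 'k, 'h) htensor \<Rightarrow> (complex \<times> 'k, 'h) htensor"
  assumes "von_neumann_algebra A"
    and "qs_flow A j"
    and "F \<in> uw_tensor bounded_ops A"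
  shows "\<exists>Y. strong_solution A j F Y \<and>
    (\<forall>Y'. strong_solution A j F Y' \<longrightarrow> (\<forall>t\<ge>0. \<forall>\<zeta>\<in>proc_domain. Y' t \<zeta> = Y t \<zeta>)) \<and>
    (\<forall>s\<ge>0. \<forall>\<epsilon>\<in>exp_domain. Y s \<circ> ket \<epsilon> \<in> uw_tensor_ket A) \<and>
    holder_half Y \<and>
    (bounded_process Y \<and> locally_uniform_bounds Y \<and>
       separable_space (euclidean :: 'h topology) \<and> separable_space (euclidean :: 'k topology) \<or>
     coisometric_process Y \<longrightarrow>
       holder_half (\<lambda>t. adj (extension (Y t))))"
proof -
  interpret flow A j F using assms by unfold_locales
  show ?thesis
    using Y_solution Y_unique Y_ket Y_holder Y_adjoint_holder by (intro exI[of _ Y]) blast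
qed

end
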